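(* Let $(M_+,f)$ be a multi-sheeted algebraic domain. Then, for all pairwise distinct points $z,w,a,b\in\mathbb{C}\setminus f(\Gamma)$ for which all the factors below are well-defined finite nonzero numbers, $$ E_\rho(z,w;a,b)=\mathcal{E}_{f,f^*}(z,\bar w;a,\bar b) \cdot\left(\frac{\bar z-\bar w}{S(z)-\bar w}\right)^{\rho(z)} \left(\frac{w-z}{\overline{S(w)}-z}\right)^{\rho(w)} \left(\frac{\bar a-\bar b}{S(a)-\bar b}\right)^{\rho(a)} \left(\frac{b-a}{\overline{S(b)}-a}\right)^{\rho(b)} $$ $$ \cdot\left(\frac{S(z)-\bar b}{\bar z-\bar b}\right)^{\rho(z)} \left(\frac{\overline{S(w)}-a}{w-a}\right)^{\rho(w)} \left(\frac{S(a)-\bar w}{\bar a-\bar w}\right)^{\rho(a)} \left(\frac{\overline{S(b)}-z}{b-z}\right)^{\rho(b)}. $$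
   Context: Multi-sheeted algebraic domain: $M$ is a connected compact Riemann surface with an anticonformal involution $J:M\to M$ ($J\circ J=\mathrm{id}$) with fixed point set $\Gamma$, such that $M\setminus\Gamma$ has exactly two components, $M_+$ (selected) and $M_-=J(M_+)$; thus $M_+$ is a bordered Riemann surface with $\partial M_+=\Gamma$ and $M$ is its double. A multi-sheeted algebraic domain is such a pair $(M_+,f)$ with $f$ a nonconstant meromorphic function on $M$. Put $f^*=\overline{f\circ J}$, again meromorphic on $M$. Let $\mathbb{P}$ be the Riemann sphere. Counting function: for $z\in\mathbb{P}\setminus f(\Gamma)$, $\rho(z)=\mathrm{card}\{\zeta\in M_+:f(\zeta)=z\}$, counted with multiplicities. Extended exponential transform: $$E_\rho(z,w;a,b)=\exp\left[\frac{1}{2\pi \mathrm{i}}\int_{\mathbb{P}}\rho(\zeta)\left(\frac{d\zeta}{\zeta-z}-\frac{d\zeta}{\zeta-a}\right)\wedge\left(\frac{d\bar\zeta}{\bar\zeta-\bar w}-\frac{d\bar\zeta}{\bar\zeta-\bar b}\right)\right].$$ Resultant and extended elimination function: for a meromorphic function $g$ on $M$ and a divisor $D=\sum_k n_k\cdot(p_k)$ put $g(D)=\prod_k g(p_k)^{n_k}$. For meromorphic $F,G$ on $M$ the meromorphic resultant is $\mathcal{R}(F,G)=G((F))$, where $(F)$ is the divisor of $F$ (zeros minus poles), whenever this makes sense. The extended elimination function is $$\mathcal{E}_{f,f^*}(z,\bar w;a,\bar b)=\mathcal{R}\left(\frac{f-z}{f-a},\frac{f^*-\bar w}{f^*-\bar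 b}\right),$$ which is a rational function of $z,\bar w,a,\bar b$. Schwarz function factors: $S=f^*\circ f^{-1}$ is a multi-valued algebraic function. Expressions $(S(z)-\bar w)^{\rho(z)}$ are made single-valued by the definition $$(S(z)-\bar w)^{\rho(z)}=\prod_{j=1}^{\rho(z)}\left(f^*(\zeta_j)-\bar w\right),\qquad f^{-1}(z)\cap M_+=\{\zeta_1,\dots,\zeta_{\rho(z)}\},$$ with points repeated according to multiplicity (empty product $=1$). Similarly for the other arguments, with $(\overline{S(w)}-z)^{\rho(w)}=\overline{(S(w)-\bar z)^{\rho(w)}}$, and powers of quotients are quotients of powers, e.g. $\left(\frac{\bar z-\bar w}{S(z)-\bar w}\right)^{\rho(z)}=\frac{(\bar z-\bar w)^{\rho(z)}}{(S(z)-\bar w)^{\rho(z)}}$. *)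

theory Defs
  imports "HOL-Complex_Analysis.Complex_Analysis"
begin

section \<open>Compact Riemann surfaces\<close>

text \<open>
  A Riemann surface is a Hausdorff topological space, here a whole type of class
  \<open>t2_space\<close>, with a holomorphic atlas: a set of pairs \<open>(U, \<phi>)\<close> of an open set and a
  coordinate map, where the values of \<open>\<phi>\<close> outside \<open>U\<close> are irrelevant.
  For a compact surface second countability is automatic.
\<close>

type_synonym 'a atlas = "('a set \<times> ('a \<Rightarrow> complex)) set"

definition riemann_atlas :: "('a::t2_space) atlas \<Rightarrow> bool" where
  "riemann_atlas \<A> \<longleftrightarrow>
     (\<Union>(U, \<phi>)\<in>\<A>. U) = UNIV \<and>
     (\<forall>(U, \<phi>)\<in>\<A>. open U \<and> open (\<phi> ` U) \<and> homeomorphism U (\<phi> ` U) \<phi> (inv_into U \<phi>)) \<and>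
     (\<forall>(U, \<phi>)\<in>\<A>. \<forall>(V, \<psi>)\<in>\<A>. (\<psi> \<circ> inv_into U \<phi>) holomorphic_on \<phi> ` (U \<inter> V))"

definition compact_riemann_surface :: "('a::t2_space) atlas \<Rightarrow> bool" where
  "compact_riemann_surface \<A> \<longleftrightarrow>
     compact (UNIV :: 'a set) \<and> connected (UNIV :: 'a set) \<and> riemann_atlas \<A>"

definition fixed_points :: "('a \<Rightarrow> 'a) \<Rightarrow> 'a set" where
  "fixed_points J = {p. J p = p}"

definition anticonformal_involution :: "('a::t2_space) atlas \<Rightarrow> ('a \<Rightarrow> 'a) \<Rightarrow> bool" where
  "anticonformal_involution \<A> J \<longleftrightarrow>
     J \<circ> J = id \<and> continuous_on UNIV J \<and>
     (\<forall>(U, \<phi>)\<in>\<A>. \<forall>(V, \<psi>)\<in>\<A>.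
        (cnj \<circ> \<psi> \<circ> J \<circ> inv_into U \<phi>) holomorphic_on \<phi> ` (U \<inter> J -` V))"


section \<open>Meromorphic functions and divisors\<close>

text \<open>
  As for the library's \<open>meromorphic_on\<close>, a meromorphic function is represented by a
  complex-valued function whose values at the points of a discrete set (in particular at
  poles and removable singularities) carry no meaning. Its true value in the Riemann
  sphere is given by \<open>mero_value\<close> below. All later notions refer to a meromorphic function
  only through \<open>mero_value\<close> and \<open>mero_order\<close>, so they do not depend on these arbitrary values,
  and the field operations on meromorphic functions may be taken pointwise.
\<close>

definition meromorphic_function :: "('a::t2_space) atlas \<Rightarrow> ('a \<Rightarrow> complex) \<Rightarrow> bool" where
  "meromorphic_function \<A> g \<longleftrightarrow> (\<forall>(U, \<phi>)\<in>\<A>. (g \<circ> inv_into U \<phi>) meromorphic_on \<phi> ` U)"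

text \<open>The Riemann sphere; \<open>None\<close> is the point at infinity.\<close>

type_synonym riemann_sphere = "complex option"

definition mero_value :: "(('a::t2_space) \<Rightarrow> complex) \<Rightarrow> 'a \<Rightarrow> riemann_sphere" where
  "mero_value g p = (if is_pole g p then None else Some (Lim (at p) g))"

text \<open>The order (positive at zeros, negative at poles) does not depend on the chosen chart.\<close>

definition mero_order :: "('a::t2_space) atlas \<Rightarrow> ('a \<Rightarrow> complex) \<Rightarrow> 'a \<Rightarrow> int" where
  "mero_order \<A> g p =
     (let (U, \<phi>) = (SOME c. c \<in> \<A> \<and> p \<in> fst c) in zorder (g \<circ> inv_into U \<phi>) (\<phi> p))"

definition multiplicity_at :: "('a::t2_space) atlas \<Rightarrow> ('a \<Rightarrow> complex) \<Rightarrow> 'a \<Rightarrow> nat" where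
  "multiplicity_at \<A> g p =
     (case mero_value g p of
        None \<Rightarrow> nat (- mero_order \<A> g p)
      | Some c \<Rightarrow> nat (mero_order \<A> (\<lambda>q. g q - c) p))"

text \<open>Divisors are integer-valued functions of finite support.\<close>

definition divisor_of :: "('a::t2_space) atlas \<Rightarrow> ('a \<Rightarrow> complex) \<Rightarrow> 'a \<Rightarrow> int" where
  "divisor_of \<A> F = (\<lambda>p. mero_order \<A> F p)"

definition eval_divisor :: "(('a::t2_space) \<Rightarrow> complex) \<Rightarrow> ('a \<Rightarrow> int) \<Rightarrow> complex" where
  "eval_divisor g D = (\<Prod>p | D p \<noteq> 0. the (mero_value g p) powi D p)"

definition mero_resultant ::
    "('a::t2_space) atlas \<Rightarrow> ('a \<Rightarrow> complex) \<Rightarrow> ('a \<Rightarrow> complex) \<Rightarrow> complex" where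
  "mero_resultant \<A> F G = eval_divisor G (divisor_of \<A> F)"

text \<open>The resultant makes sense as a finite nonzero number.\<close>

definition resultant_regular ::
    "('a::t2_space) atlas \<Rightarrow> ('a \<Rightarrow> complex) \<Rightarrow> ('a \<Rightarrow> complex) \<Rightarrow> bool" where
  "resultant_regular \<A> F G \<longleftrightarrow>
     (\<forall>p. divisor_of \<A> F p \<noteq> 0 \<longrightarrow> mero_value G p \<noteq> None \<and> mero_value G p \<noteq> Some 0)"

text \<open>The arguments \<open>w'\<close> and \<open>b'\<close> are the already conjugated variables.\<close>

definition ext_elimination ::
    "('a::t2_space) atlas \<Rightarrow> ('a \<Rightarrow> complex) \<Rightarrow> ('a \<Rightarrow> complex) \<Rightarrow>
     complex \<Rightarrow> complex \<Rightarrow> complex \<Rightarrow> complex \<Rightarrow> complex" where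
  "ext_elimination \<A> f g z w' a b' =
     mero_resultant \<A> (\<lambda>p. (f p - z) / (f p - a)) (\<lambda>p. (g p - w') / (g p - b'))"

definition ext_elimination_regular ::
    "('a::t2_space) atlas \<Rightarrow> ('a \<Rightarrow> complex) \<Rightarrow> ('a \<Rightarrow> complex) \<Rightarrow>
     complex \<Rightarrow> complex \<Rightarrow> complex \<Rightarrow> complex \<Rightarrow> bool" where
  "ext_elimination_regular \<A> f g z w' a b' \<longleftrightarrow>
     resultant_regular \<A> (\<lambda>p. (f p - z) / (f p - a)) (\<lambda>p. (g p - w') / (g p - b'))"


section \<open>Multi-sheeted algebraic domains\<close>

definition multi_sheeted_algebraic_domain ::
    "('a::t2_space) atlas \<Rightarrow> ('a \<Rightarrow> 'a) \<Rightarrow> 'a set \<Rightarrow> ('a \<Rightarrow> complex) \<Rightarrow> bool" where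
  "multi_sheeted_algebraic_domain \<A> J Mp f \<longleftrightarrow>
     compact_riemann_surface \<A> \<and>
     anticonformal_involution \<A> J \<and>
     components (UNIV - fixed_points J) = {Mp, J ` Mp} \<and> Mp \<noteq> J ` Mp \<and>
     meromorphic_function \<A> f \<and> \<not> (\<exists>c. \<forall>p. mero_value f p = c)"

definition conj_reflection :: "('a \<Rightarrow> 'a) \<Rightarrow> ('a \<Rightarrow> complex) \<Rightarrow> 'a \<Rightarrow> complex" where
  "conj_reflection J f = (\<lambda>p. cnj (f (J p)))"

definition counting_function ::
    "('a::t2_space) atlas \<Rightarrow> 'a set \<Rightarrow> ('a \<Rightarrow> complex) \<Rightarrow> riemann_sphere \<Rightarrow> nat" where
  "counting_function \<A> Mp f z =
     (\<Sum>\<zeta> | \<zeta> \<in> Mp \<and> mero_value f \<zeta> = z. multiplicity_at \<A> f \<zeta>)"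

text \<open>
  The 2-form is written out with \<open>d\<zeta> \<and> d\<zeta>\<^sup>* = - 2 \<i> dx dy\<close> (where \<open>\<zeta>\<^sup>*\<close> is the conjugate
  of \<open>\<zeta>\<close>). The point at infinity is a null set, as is the curve \<open>f(\<Gamma>)\<close>, so that the values of
  \<open>\<rho>\<close> there do not matter.
\<close>

definition ext_exp_transform ::
    "(riemann_sphere \<Rightarrow> nat) \<Rightarrow> complex \<Rightarrow> complex \<Rightarrow> complex \<Rightarrow> complex \<Rightarrow> complex" where
  "ext_exp_transform \<rho> z w a b =
     exp (1 / (2 * of_real pi * \<i>) *
       (LINT \<zeta>|lebesgue. of_nat (\<rho> (Some \<zeta>)) *
          (1 / (\<zeta> - z) - 1 / (\<zeta> - a)) *
          (1 / (cnj \<zeta> - cnj w) - 1 / (cnj \<zeta> - cnj b)) * (- 2 * \<i>)))"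

text \<open>
  \<open>schwarz_power \<A> J Mp f z c\<close> is \<open>(S(z) - c)\<^bsup>\<rho>(z)\<^esup>\<close> for \<open>S = f\<^sup>* \<circ> f\<^sup>-\<^sup>1\<close>; it is meaningful under
  \<open>schwarz_finite\<close>, i.e. if none of the values of \<open>f\<^sup>*\<close> involved is infinite.
\<close>

definition schwarz_power ::
    "('a::t2_space) atlas \<Rightarrow> ('a \<Rightarrow> 'a) \<Rightarrow> 'a set \<Rightarrow> ('a \<Rightarrow> complex) \<Rightarrow>
     complex \<Rightarrow> complex \<Rightarrow> complex" where
  "schwarz_power \<A> J Mp f z c =
     (\<Prod>\<zeta> | \<zeta> \<in> Mp \<and> mero_value f \<zeta> = Some z.
        (the (mero_value (conj_reflection J f) \<zeta>) - c) ^ multiplicity_at \<A> f \<zeta>)"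

definition schwarz_finite ::
    "('a \<Rightarrow> 'a) \<Rightarrow> ('a::t2_space) set \<Rightarrow> ('a \<Rightarrow> complex) \<Rightarrow> complex \<Rightarrow> bool" where
  "schwarz_finite J Mp f z \<longleftrightarrow>
     (\<forall>\<zeta>\<in>Mp. mero_value f \<zeta> = Some z \<longrightarrow> mero_value (conj_reflection J f) \<zeta> \<noteq> None)"

end

theory Submission
  imports Defs
begin

text \<open>
  The exponent on the left is a difference of Cauchy transforms of the density
  \<open>\<rho> * cnj (d B / B)\<close>, where \<open>B x = (x - w) / (x - b)\<close>, and such a density is the antiholomorphic
  derivative of the logarithm of an algebraic object. Write \<open>B\<^sup>* = (f\<^sup>* - cnj w) / (f\<^sup>* - cnj b)\<close>, which is
  the conjugate of \<open>B \<circ> f \<circ> J\<close>, and let \<open>N \<zeta>\<close> be the product over the fibre of \<open>f\<close> over \<open>\<zeta>\<close> in which a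
  sheet in \<open>M\<^sub>-\<close> contributes the value of \<open>B\<^sup>*\<close>, and all other sheets contribute \<open>cnj (B \<zeta>)\<close>. Off \<open>f(\<Gamma>)\<close> the
  function \<open>N\<close> is locally \<open>cnj B ^ \<rho>\<close> times a holomorphic function, so its logarithmic antiholomorphic
  derivative is the density. On \<open>\<Gamma>\<close> the reflection is the identity, so that \<open>B\<^sup>*\<close> and \<open>cnj B \<circ> f\<close> agree
  there; hence \<open>N\<close> crosses the curve \<open>f(\<Gamma>)\<close> continuously although the exponent \<open>\<rho>\<close> jumps.

  What remains are finitely many zeros and poles. Apart from those of \<open>cnj (B \<zeta>) ^ \<rho>\<close> at \<open>w\<close> and \<open>b\<close>
  they lie at the points \<open>f (J q)\<close> with \<open>q\<close> in
  \<open>M\<^sub>+\<close> over \<open>w\<close> or \<open>b\<close>; dividing by an explicit rational function \<open>Den\<close> that has these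
  zeros and poles, and suitable powers of \<open>\<zeta> - w\<close> and \<open>\<zeta> - b\<close>, leaves the exponential of a continuous function \<open>L\<close> on the plane
  without \<open>w\<close> and \<open>b\<close>, with logarithmic growth at these two points and with a limit \<open>l\<close> at infinity
  (\<open>N_asymptotics\<close>, \<open>log_norm_exists\<close>). The Cauchy--Pompeiu formula for \<open>L\<close> gives
  \<open>\<pi> * (l - L z)\<close> for the Cauchy transform of the density at \<open>z\<close>
  (\<open>cauchy_transform_of_density\<close>), so the transform \<open>E\<close> is \<open>exp (L z) / exp (L a)\<close>. Evaluating \<open>N / Den\<close> at
  \<open>z\<close> and \<open>a\<close> fibre by fibre gives the theorem: the product of \<open>B\<^sup>*\<close> over the whole
  fibres is the elimination function, the sheets in \<open>M\<^sub>+\<close> give the Schwarz powers at \<open>z\<close> and \<open>a\<close>, and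
  \<open>Den\<close> gives those at \<open>w\<close> and \<open>b\<close>.

  Two analytic points need care. The function \<open>L\<close> is only continuous across \<open>f(\<Gamma>)\<close>, about whose regularity
  nothing is assumed: it suffices that almost every horizontal or vertical line
  meets it in finitely many points, since then Green's formula on squares follows from Fubini and
  the one-dimensional fundamental theorem (\<open>green_square\<close>, \<open>cauchy_pompeiu_with_exceptions\<close>). That
  holds because on \<open>\<Gamma>\<close> the real and imaginary part of \<open>f\<close> are values of the meromorphic functions
  \<open>(f + f\<^sup>*) / 2\<close> and \<open>(f - f\<^sup>*) / 2\<i>\<close> (\<open>boundary_image_lines\<close>). Secondly, the first derivatives of
  \<open>L\<close> must be bounded by \<open>A / \<bar>\<zeta> - c\<bar>\<close> near every point \<open>c\<close>, even a branch point on \<open>f(\<Gamma>)\<close>; this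
  comes from the local description of \<open>f\<close> by the map \<open>t \<mapsto> t\<^sup>m\<close> (\<open>fiber_chart_exists\<close>, \<open>N_local_form\<close>).
\<close>

section \<open>Integration in the plane\<close>

text \<open>
  The plane as a product of two lines with an arbitrary base point: this gives access to Fubini's theorem.
\<close>
lemma lborel_complex_eq:
  "distr (lborel \<Otimes>\<^sub>M lborel) borel (\<lambda>(x, y). z + Complex x y) = lborel"
proof -
  have m0: "(\<lambda>(x, y). Complex x y) \<in> borel_measurable (lborel \<Otimes>\<^sub>M lborel)"
    unfolding Complex_eq by measurable
  have "lborel = distr (lborel \<Otimes>\<^sub>M lborel) borel (\<lambda>(x, y). Complex x y)"
  proof (rule lborel_eqI)
    fix l u :: complex
    assume le: "\<And>b. b \<in> Basis \<Longrightarrow> l \<bullet> b \<le> u \<bullet> b"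
    have le': "Re l \<le> Re u" "Im l \<le> Im u"
      using le[of 1] le[of \<i>] by (auto simp: Basis_complex_def inner_complex_def)
    have *: "(\<lambda>(x, y). Complex x y) -` box l u \<inter> space (lborel \<Otimes>\<^sub>M lborel)
        = {Re l<..<Re u} \<times> {Im l<..<Im u}"
      by (auto simp: space_pair_measure in_box_complex_iff)
    show "emeasure (distr (lborel \<Otimes>\<^sub>M lborel) borel (\<lambda>(x, y). Complex x y)) (box l u)
        = ennreal (\<Prod>b\<in>Basis. (u - l) \<bullet> b)"
      using le' m0
      by (subst emeasure_distr)
         (auto simp: * lborel.emeasure_pair_measure_Times Basis_complex_def inner_complex_def
            ennreal_mult)
  qed simp
  hence "distr (distr (lborel \<Otimes>\<^sub>M lborel) borel (\<lambda>(x, y). Complex x y)) borel ((+) z) = lborel"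
    using lborel_distr_plus[of z] by simp
  thus ?thesis
    using m0 by (subst (asm) distr_distr) (auto simp: o_def case_prod_unfold)
qed

lemma measurable_shifted_Complex [measurable]:
  "(\<lambda>(x, y). z + Complex x y) \<in> borel_measurable (lborel \<Otimes>\<^sub>M lborel)"
  unfolding Complex_eq by measurable

lemma integrable_complex_pair_iff:
  fixes g :: "complex \<Rightarrow> 'b :: {banach, second_countable_topology}"
  assumes "g \<in> borel_measurable borel"
  shows "integrable (lborel \<Otimes>\<^sub>M lborel) (\<lambda>(x, y). g (z + Complex x y)) \<longleftrightarrow> integrable lborel g"
  using integrable_distr_eq[OF measurable_shifted_Complex[of z] assms]
  using lborel_complex_eq[of z] by (simp add: case_prod_unfold)

lemma integral_complex_pair:
  fixes g :: "complex \<Rightarrow> 'b :: {banach, second_countable_topology}"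
  assumes "g \<in> borel_measurable borel"
  shows "(\<integral>(x, y). g (z + Complex x y) \<partial>(lborel \<Otimes>\<^sub>M lborel)) = integral\<^sup>L lborel g"
  using integral_distr[OF measurable_shifted_Complex[of z] assms]
  using lborel_complex_eq[of z] by (simp add: case_prod_unfold)

text \<open>
  A function of one real variable that is integrable both at zero and at infinity.
\<close>
definition sqrt_kernel :: "real \<Rightarrow> real" where
  "sqrt_kernel x = 1 / (sqrt \<bar>x\<bar> * (1 + \<bar>x\<bar>))"

lemma sqrt_kernel_measurable [measurable]: "sqrt_kernel \<in> borel_measurable borel"
  unfolding sqrt_kernel_def[abs_def] by measurable

lemma sqrt_kernel_nonneg: "sqrt_kernel x \<ge> 0"
  by (simp add: sqrt_kernel_def)

lemma integrable_sqrt_kernel: "integrable lborel sqrt_kernel"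
proof -
  have deriv: "((\<lambda>x. 2 * arctan (sqrt x)) has_real_derivative sqrt_kernel x) (at x)" if "x > 0" for x
  proof -
    have "((\<lambda>x. 2 * arctan (sqrt x)) has_real_derivative
            2 * (inverse (1 + (sqrt x)^2) * (inverse (sqrt x) / 2))) (at x)"
      using that by (auto intro!: derivative_eq_intros)
    also have "2 * (inverse (1 + (sqrt x)^2) * (inverse (sqrt x) / 2)) = sqrt_kernel x"
      using that by (simp add: sqrt_kernel_def divide_simps)
    finally show ?thesis .
  qed
  have half: "set_integrable lborel (einterval 0 \<infinity>) sqrt_kernel"
  proof (rule interval_integral_FTC_nonneg)
    show "DERIV (\<lambda>x. 2 * arctan (sqrt x)) x :> sqrt_kernel x" if "0 < ereal x" for x
      using deriv that by auto
    show "isCont sqrt_kernel x" if "0 < ereal x" for x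
      using that unfolding sqrt_kernel_def[abs_def] by (auto intro!: continuous_intros)
    show "(((\<lambda>x. 2 * arctan (sqrt (x::real))) \<circ> real_of_ereal) \<longlongrightarrow> 0) (at_right 0)"
      unfolding zero_ereal_def ereal_tendsto_simps
      by (auto intro!: tendsto_eq_intros)
    show "(((\<lambda>x. 2 * arctan (sqrt (x::real))) \<circ> real_of_ereal) \<longlongrightarrow> pi) (at_left \<infinity>)"
      unfolding ereal_tendsto_simps
      by (rule tendsto_eq_intros refl filterlim_compose[OF tendsto_arctan_at_top sqrt_at_top] | simp)+
  qed (auto simp: sqrt_kernel_nonneg)
  hence h1: "integrable lborel (\<lambda>x. indicator {0<..} x * sqrt_kernel x)"
    by (simp add: set_integrable_def einterval_def greaterThan_def zero_ereal_def)
  have h2: "integrable lborel (\<lambda>x. indicator {0<..} (-x) * sqrt_kernel (-x))"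
    using lborel_integrable_real_affine[OF h1, of "-1" 0] by simp
  have "integrable lborel (\<lambda>x. indicator {0<..} x * sqrt_kernel x +
                               indicator {0<..} (-x) * sqrt_kernel (-x))"
    using h1 h2 by (rule Bochner_Integration.integrable_add)
  also have "(\<lambda>x. indicator {0<..} x * sqrt_kernel x + indicator {0<..} (-x) * sqrt_kernel (-x))
      = sqrt_kernel"
    by (rule ext) (auto simp: sqrt_kernel_def indicator_def)
  finally show ?thesis .
qed

text \<open>
  A universal majorant: the singularity of the Cauchy kernel, with decay of order three at infinity.
\<close>
definition cauchy_majorant :: "complex \<Rightarrow> real" where
  "cauchy_majorant x = 1 / (norm x * (1 + norm x)^2)"

lemma cauchy_majorant_measurable [measurable]: "cauchy_majorant \<in> borel_measurable borel"
  unfolding cauchy_majorant_def[abs_def] by measurable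

text \<open>
  Since \<open>\<bar>x\<bar> \<ge> sqrt (\<bar>Re x\<bar> * \<bar>Im x\<bar>)\<close>, the majorant is bounded by a product of two integrable functions of one
  real variable, and polar coordinates are avoided.
\<close>
lemma integrable_cauchy_majorant: "integrable lborel (\<lambda>x. cauchy_majorant (x - c))"
proof -
  have prod: "integrable (lborel \<Otimes>\<^sub>M lborel) (\<lambda>(x, y). sqrt_kernel x * sqrt_kernel y)"
  proof (rule lborel_pair.Fubini_integrable)
    show "integrable lborel (\<lambda>x. \<integral>y. norm (case (x, y) of (x, y) \<Rightarrow> sqrt_kernel x * sqrt_kernel y) \<partial>lborel)"
      using integrable_sqrt_kernel by (simp add: abs_mult sqrt_kernel_nonneg)
  qed (use integrable_sqrt_kernel in auto)
  have bound: "cauchy_majorant (Complex x y) \<le> sqrt_kernel x * sqrt_kernel y"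
    if "x \<noteq> 0" "y \<noteq> 0" for x y
  proof -
    let ?n = "norm (Complex x y)"
    have "\<bar>x\<bar> \<le> ?n" "\<bar>y\<bar> \<le> ?n"
      using abs_Re_le_cmod[of "Complex x y"] abs_Im_le_cmod[of "Complex x y"] by auto
    hence a: "sqrt \<bar>x\<bar> * sqrt \<bar>y\<bar> \<le> ?n" "(1 + \<bar>x\<bar>) * (1 + \<bar>y\<bar>) \<le> (1 + ?n)^2"
      unfolding power2_eq_square
      using mult_mono[of "sqrt \<bar>x\<bar>" "sqrt ?n" "sqrt \<bar>y\<bar>" "sqrt ?n"]
      by (auto intro!: mult_mono)
    have "(sqrt \<bar>x\<bar> * sqrt \<bar>y\<bar>) * ((1 + \<bar>x\<bar>) * (1 + \<bar>y\<bar>)) \<le> ?n * (1 + ?n)^2"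
      by (rule mult_mono[OF a]) auto
    moreover have "(sqrt \<bar>x\<bar> * sqrt \<bar>y\<bar>) * ((1 + \<bar>x\<bar>) * (1 + \<bar>y\<bar>)) > 0"
      using that by (intro mult_pos_pos) auto
    ultimately have "1 / (?n * (1 + ?n)^2) \<le> 1 / ((sqrt \<bar>x\<bar> * sqrt \<bar>y\<bar>) * ((1 + \<bar>x\<bar>) * (1 + \<bar>y\<bar>)))"
      by (intro divide_left_mono mult_pos_pos) auto
    thus ?thesis by (simp add: cauchy_majorant_def sqrt_kernel_def mult_ac)
  qed
  have ae: "AE p in (lborel \<Otimes>\<^sub>M lborel). fst p \<noteq> (0::real) \<and> snd p \<noteq> (0::real)"
  proof -
    have 1: "AE x in lborel. x \<noteq> (0::real)"
      by (rule AE_lborel_singleton)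
    have "AE x in lborel. AE y in lborel. x \<noteq> (0::real) \<and> y \<noteq> (0::real)"
      using 1 by (auto elim!: AE_mp)
    thus ?thesis
    proof (intro lborel_pair.AE_pair_measure)
      show "{p \<in> space (lborel \<Otimes>\<^sub>M lborel). fst p \<noteq> (0::real) \<and> snd p \<noteq> (0::real)}
          \<in> sets (lborel \<Otimes>\<^sub>M lborel)"
        by measurable
    qed auto
  qed
  have cm: "(\<lambda>x. cauchy_majorant (x - c)) \<in> borel_measurable borel" by measurable
  have "integrable (lborel \<Otimes>\<^sub>M lborel) (\<lambda>(x, y). cauchy_majorant (c + Complex x y - c))"
  proof (rule Bochner_Integration.integrable_bound[OF prod])
    show "(\<lambda>(x, y). cauchy_majorant (c + Complex x y - c)) \<in> borel_measurable (lborel \<Otimes>\<^sub>M lborel)"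
      using measurable_compose[OF measurable_shifted_Complex[of c] cm] by (simp add: case_prod_unfold)
    show "AE p in lborel \<Otimes>\<^sub>M lborel. norm (case p of (x, y) \<Rightarrow> cauchy_majorant (c + Complex x y - c))
             \<le> norm (case p of (x, y) \<Rightarrow> sqrt_kernel x * sqrt_kernel y)"
      using ae
    proof eventually_elim
      case (elim p)
      have "cauchy_majorant (Complex (fst p) (snd p)) \<ge> 0" by (simp add: cauchy_majorant_def)
      thus ?case using bound[of "fst p" "snd p"] elim by (auto simp: case_prod_unfold sqrt_kernel_nonneg)
    qed
  qed
  thus ?thesis
    by (subst (asm) integrable_complex_pair_iff[of "\<lambda>x. cauchy_majorant (x - c)" c]) auto
qed

text \<open>
  By compactness of a large closed ball finitely many of the local estimates suffice, so the function is bounded by a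
  finite sum of translates of the majorant. The local bound has the same form at all points,
  so that the singular points need not be listed.
\<close>
lemma integrable_of_local_bounds:
  fixes g :: "complex \<Rightarrow> complex"
  assumes meas: "g \<in> borel_measurable borel"
    and loc: "\<And>c. \<exists>A. \<forall>\<^sub>F x in at c. norm (g x) \<le> A / norm (x - c)"
    and inf: "\<exists>A. \<forall>\<^sub>F x in at_infinity. norm (g x) \<le> A / norm x ^ 3"
  shows "integrable lborel g"
proof -
  have "\<exists>A d. d > 0 \<and> A \<ge> 0 \<and> (\<forall>x\<in>ball c d - {c}. norm (g x) \<le> A * cauchy_majorant (x - c))" for c
  proof -
    obtain A where "\<forall>\<^sub>F x in at c. norm (g x) \<le> A / norm (x - c)" using loc by blast
    then obtain d where d: "d > 0" "\<And>x. x \<noteq> c \<Longrightarrow> dist x c < d \<Longrightarrow> norm (g x) \<le> A / norm (x - c)"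
      unfolding eventually_at by auto
    have "norm (g x) \<le> max A 0 * (1 + d)^2 * cauchy_majorant (x - c)" if "x \<in> ball c d - {c}" for x
    proof -
      have x: "x \<noteq> c" "norm (x - c) < d" using that by (auto simp: dist_norm norm_minus_commute)
      have "norm (g x) \<le> A / norm (x - c)" using d(2)[of x] x by (simp add: dist_norm)
      also have "\<dots> \<le> max A 0 / norm (x - c)" by (intro divide_right_mono) auto
      also have "\<dots> = max A 0 / norm (x - c) * 1" by simp
      also have "\<dots> \<le> max A 0 / norm (x - c) * ((1 + d)^2 / (1 + norm (x - c))^2)"
      proof (intro mult_left_mono)
        have "(1 + norm (x - c))^2 \<le> (1 + d)^2" "(1 + norm (x - c))^2 > 0"
          using x by (intro power_mono zero_less_power add_pos_nonneg; simp)+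
        thus "1 \<le> (1 + d)^2 / (1 + norm (x - c))^2" by (simp only: le_divide_eq_1_pos)
      qed auto
      finally show ?thesis by (simp add: cauchy_majorant_def)
    qed
    thus ?thesis using d(1)
      by (intro exI[of _ "max A 0 * (1 + d)^2"] exI[of _ d]) auto
  qed
  then obtain A d where d: "\<And>c. d c > 0" and A: "\<And>c. A c \<ge> 0"
    and Ad: "\<And>c x. x \<in> ball c (d c) - {c} \<Longrightarrow> norm (g x) \<le> A c * cauchy_majorant (x - c)"
    by metis
  obtain B0 where "\<forall>\<^sub>F x in at_infinity. norm (g x) \<le> B0 / norm x ^ 3" using inf by blast
  then obtain r where r: "\<And>x. norm x \<ge> r \<Longrightarrow> norm (g x) \<le> B0 / norm x ^ 3"
    unfolding eventually_at_infinity by blast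
  define R where "R = max r 1"
  have far: "norm (g x) \<le> 4 * max B0 0 * cauchy_majorant (x - 0)" if "norm x \<ge> R" for x
  proof -
    have x: "norm x \<ge> 1" "norm x \<ge> r" using that by (auto simp: R_def)
    have "norm (g x) \<le> B0 / norm x ^ 3" by (rule r[OF x(2)])
    also have "\<dots> \<le> max B0 0 / norm x ^ 3" by (intro divide_right_mono) auto
    also have "\<dots> = max B0 0 * (1 / (norm x * (norm x)^2))"
      by (simp add: power3_eq_cube power2_eq_square)
    also have "\<dots> \<le> max B0 0 * (4 * (1 / (norm x * (1 + norm x)^2)))"
    proof (rule mult_left_mono)
      have "(1 + norm x)^2 \<le> (2 * norm x)^2" using x by (intro power_mono) auto
      hence "(1 + norm x)^2 \<le> 4 * (norm x)^2" by (simp add: power_mult_distrib)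
      moreover have n: "norm x > 0" "1 + norm x > 0" using x by linarith+
      ultimately have "4 / (norm x * (4 * (norm x)^2)) \<le> 4 / (norm x * (1 + norm x)^2)"
        by (intro divide_left_mono mult_left_mono mult_pos_pos zero_less_power) (use n in auto)
      thus "1 / (norm x * (norm x)^2) \<le> 4 * (1 / (norm x * (1 + norm x)^2))"
        by simp
    qed auto
    finally have "norm (g x) \<le> max B0 0 * (4 * cauchy_majorant x)"
      by (simp only: cauchy_majorant_def)
    thus ?thesis by simp
  qed
  obtain C where C: "finite C" "cball 0 R \<subseteq> (\<Union>c\<in>C. ball c (d c))"
  proof -
    have "x \<in> ball x (d x)" for x using d by simp
    hence "cball 0 R \<subseteq> (\<Union>c\<in>cball 0 R. ball c (d c))" by blast
    moreover have "open (ball c (d c))" if "c \<in> cball 0 R" for c by (rule open_ball)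
    ultimately obtain C where "C \<subseteq> cball 0 R" "finite C" "cball 0 R \<subseteq> (\<Union>c\<in>C. ball c (d c))"
      using compactE_image[OF compact_cball, of "cball 0 R" "\<lambda>c. ball c (d c)"] by metis
    thus ?thesis by (intro that)
  qed
  define maj where "maj = (\<lambda>x. 4 * max B0 0 * cauchy_majorant (x - 0) + (\<Sum>c\<in>C. A c * cauchy_majorant (x - c)))"
  have "integrable lborel maj"
    unfolding maj_def
    by (intro Bochner_Integration.integrable_add Bochner_Integration.integrable_sum
        integrable_mult_right integrable_cauchy_majorant)
  moreover have "AE x in lborel. norm (g x) \<le> norm (maj x)"
  proof -
    have nn: "cauchy_majorant x \<ge> 0" for x by (simp add: cauchy_majorant_def)
    have "norm (g x) \<le> maj x" if "x \<notin> C" for x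
    proof (cases "norm x \<ge> R")
      case True
      have "(\<Sum>c\<in>C. A c * cauchy_majorant (x - c)) \<ge> 0" by (intro sum_nonneg mult_nonneg_nonneg A nn)
      thus ?thesis using far[OF True] by (simp add: maj_def)
    next
      case False
      then obtain c where c: "c \<in> C" "x \<in> ball c (d c)" using C(2) by (force simp: not_le)
      have "norm (g x) \<le> A c * cauchy_majorant (x - c)" using Ad[of x c] c that by auto
      also have "\<dots> \<le> (\<Sum>c\<in>C. A c * cauchy_majorant (x - c))"
        using C(1) c(1) by (intro member_le_sum mult_nonneg_nonneg A nn) auto
      also have "\<dots> \<le> maj x" unfolding maj_def using nn[of "x - 0"] by simp
      finally show ?thesis .
    qed
    hence "norm (g x) \<le> norm (maj x)" if "x \<notin> C" for x using that by fastforce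
    moreover have "AE x in lborel. x \<notin> C"
      using C(1) by (intro AE_not_in finite_imp_null_set_lborel) auto
    ultimately show ?thesis by (auto elim: eventually_mono)
  qed
  ultimately show ?thesis
    using meas by (intro Bochner_Integration.integrable_bound[of lborel maj g]) auto
qed

lemma integral_complex_iterated:
  fixes g :: "complex \<Rightarrow> complex"
  assumes g: "integrable lborel g"
  shows "AE x in lborel. integrable lborel (\<lambda>y. g (z + Complex x y))"
    and "integrable lborel (\<lambda>x. \<integral>y. g (z + Complex x y) \<partial>lborel)"
    and "(\<integral>x. \<integral>y. g (z + Complex x y) \<partial>lborel \<partial>lborel) = integral\<^sup>L lborel g"
    and "AE y in lborel. integrable lborel (\<lambda>x. g (z + Complex x y))"
    and "integrable lborel (\<lambda>y. \<integral>x. g (z + Complex x y) \<partial>lborel)"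
    and "(\<integral>y. \<integral>x. g (z + Complex x y) \<partial>lborel \<partial>lborel) = integral\<^sup>L lborel g"
proof -
  have gm: "g \<in> borel_measurable borel" using g by auto
  have 1: "integrable (lborel \<Otimes>\<^sub>M lborel) (\<lambda>(x, y). g (z + Complex x y))"
    using integrable_complex_pair_iff[OF gm] g by simp
  have 2: "integrable (lborel \<Otimes>\<^sub>M lborel) (\<lambda>(y, x). g (z + Complex x y))"
    using lborel_pair.integrable_product_swap[OF 1] by simp
  have 3: "(\<integral>(y, x). g (z + Complex x y) \<partial>(lborel \<Otimes>\<^sub>M lborel)) = integral\<^sup>L lborel g"
    using lborel_pair.integral_product_swap[OF borel_measurable_integrable[OF 1]]
    by (simp add: integral_complex_pair[OF gm, of z])
  show "AE x in lborel. integrable lborel (\<lambda>y. g (z + Complex x y))"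
    using lborel_pair.AE_integrable_fst'[OF 1] by simp
  show "integrable lborel (\<lambda>x. \<integral>y. g (z + Complex x y) \<partial>lborel)"
    using lborel_pair.integrable_fst'[OF 1] by simp
  show "(\<integral>x. \<integral>y. g (z + Complex x y) \<partial>lborel \<partial>lborel) = integral\<^sup>L lborel g"
    using lborel_pair.integral_fst'[OF 1] integral_complex_pair[OF gm, of z] by simp
  show "AE y in lborel. integrable lborel (\<lambda>x. g (z + Complex x y))"
    using lborel_pair.AE_integrable_fst'[OF 2] by simp
  show "integrable lborel (\<lambda>y. \<integral>x. g (z + Complex x y) \<partial>lborel)"
    using lborel_pair.integrable_fst'[OF 2] by simp
  show "(\<integral>y. \<integral>x. g (z + Complex x y) \<partial>lborel \<partial>lborel) = integral\<^sup>L lborel g"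
    using lborel_pair.integral_fst'[OF 2] 3 by simp
qed

text \<open>
  The restriction to an interval is written into the integrand, since it is met as a section of an integrand
  on the plane.
\<close>
lemma line_integral_FTC:
  fixes p d :: "real \<Rightarrow> complex"
  assumes R: "R \<ge> 0" and p: "continuous_on UNIV p" and S: "finite S"
    and der: "\<And>x. x \<notin> S \<Longrightarrow> (p has_vector_derivative d x) (at x)"
    and int: "integrable lborel (\<lambda>x. if x \<notin> S \<and> \<bar>x\<bar> \<le> R then d x else 0)"
  shows "(\<integral>x. (if x \<notin> S \<and> \<bar>x\<bar> \<le> R then d x else 0) \<partial>lborel) = p R - p (- R)"
proof -
  let ?h = "\<lambda>x. if x \<notin> S \<and> \<bar>x\<bar> \<le> R then d x else 0"
  have "(?h has_integral (p R - p (- R))) {-R..R}"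
  proof (rule fundamental_theorem_of_calculus_interior_strong[OF S])
    show "(p has_vector_derivative ?h x) (at x)" if "x \<in> {-R<..<R} - S" for x
      using der[of x] that by (auto simp: abs_le_iff)
    show "continuous_on {-R..R} p" using p by (rule continuous_on_subset) auto
  qed (use R in auto)
  hence "((\<lambda>x. if x \<in> {-R..R} then ?h x else 0) has_integral (p R - p (- R))) UNIV"
    by (simp only: has_integral_restrict_UNIV)
  also have "(\<lambda>x. if x \<in> {-R..R} then ?h x else 0) = ?h"
    by (rule ext) auto
  finally have "(?h has_integral (p R - p (- R))) UNIV" .
  moreover have "(?h has_integral (integral\<^sup>L lborel ?h)) UNIV"
    by (rule has_integral_integral_lborel[OF int])
  ultimately show ?thesis using has_integral_unique by blast
qed

text \<open>
  Green's formula with Cauchy--Riemann operator \<open>D x 1 + \<i> * D x \<i>\<close>. Each of the two terms is integrated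
  first along the direction in which it differentiates, where the fundamental theorem of calculus applies on all but
  countably many lines. The complement of \<open>\<Omega>\<close> need not be a curve: it only has to meet these lines in finitely many
  points, across which \<open>P\<close> is continuous.
\<close>
lemma green_square:
  fixes P :: "complex \<Rightarrow> complex" and D :: "complex \<Rightarrow> complex \<Rightarrow> complex"
  assumes R: "R \<ge> 0" and Pm [measurable]: "P \<in> borel_measurable borel"
    and der: "\<And>x. x \<in> \<Omega> \<Longrightarrow> (P has_derivative D x) (at x)"
    and X: "countable X" "\<And>s. s \<notin> X \<Longrightarrow> finite {t. z + Complex s t \<notin> \<Omega>}"
           "\<And>s. s \<notin> X \<Longrightarrow> continuous_on UNIV (\<lambda>t. P (z + Complex s t))"
    and Y: "countable Y" "\<And>t. t \<notin> Y \<Longrightarrow> finite {s. z + Complex s t \<notin> \<Omega>}"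
           "\<And>t. t \<notin> Y \<Longrightarrow> continuous_on UNIV (\<lambda>s. P (z + Complex s t))"
  defines "Q \<equiv> {x. \<bar>Re (x - z)\<bar> \<le> R \<and> \<bar>Im (x - z)\<bar> \<le> R}"
  assumes i1: "integrable lborel (\<lambda>x. if x \<in> \<Omega> \<inter> Q then D x 1 else 0)"
    and i2: "integrable lborel (\<lambda>x. if x \<in> \<Omega> \<inter> Q then D x \<i> else 0)"
  defines "B \<equiv> \<lambda>t. if \<bar>t\<bar> \<le> R then P (z + Complex R t) - P (z + Complex (-R) t)
                       + \<i> * (P (z + Complex t R) - P (z + Complex t (-R))) else 0"
  shows "(\<integral>x. (if x \<in> \<Omega> \<inter> Q then D x 1 + \<i> * D x \<i> else 0) \<partial>lborel) = integral\<^sup>L lborel B"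
    and "integrable lborel B"
proof -
  let ?g1 = "\<lambda>x. if x \<in> \<Omega> \<inter> Q then D x 1 else 0" and ?g2 = "\<lambda>x. if x \<in> \<Omega> \<inter> Q then D x \<i> else 0"
  let ?B1 = "\<lambda>t. if \<bar>t\<bar> \<le> R then P (z + Complex R t) - P (z + Complex (-R) t) else 0"
  let ?B2 = "\<lambda>t. if \<bar>t\<bar> \<le> R then P (z + Complex t R) - P (z + Complex t (-R)) else 0"
  have PC [measurable]: "(\<lambda>t. P (z + Complex (h t) (k t))) \<in> borel_measurable borel"
    if [measurable]: "h \<in> borel_measurable borel" "k \<in> borel_measurable borel" for h k :: "real \<Rightarrow> real"
    unfolding Complex_eq by measurable
  have B1m: "?B1 \<in> borel_measurable lborel" and B2m: "?B2 \<in> borel_measurable lborel"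
    by measurable
  have der1: "((\<lambda>s. P (z + Complex s t)) has_vector_derivative D (z + Complex s t) 1) (at s)"
    if "z + Complex s t \<in> \<Omega>" for s t
  proof -
    have "((\<lambda>s. z + Complex s t) has_derivative (\<lambda>h. of_real h)) (at s)"
      unfolding Complex_eq by (auto intro!: derivative_eq_intros)
    from diff_chain_at[OF this, of P] der[OF that]
    have "((\<lambda>s. P (z + Complex s t)) has_derivative (\<lambda>h. D (z + Complex s t) (of_real h))) (at s)"
      by (simp add: o_def)
    moreover have "D (z + Complex s t) (of_real h) = h *\<^sub>R D (z + Complex s t) 1" for h
      using linear_scale[OF has_derivative_linear[OF der[OF that]], of h 1] by (simp add: scaleR_conv_of_real)
    ultimately show ?thesis by (simp add: has_vector_derivative_def)
  qed
  have der2: "((\<lambda>t. P (z + Complex s t)) has_vector_derivative D (z + Complex s t) \<i>) (at t)"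
    if "z + Complex s t \<in> \<Omega>" for s t
  proof -
    have "((\<lambda>t. z + Complex s t) has_derivative (\<lambda>h. \<i> * of_real h)) (at t)"
      unfolding Complex_eq by (auto intro!: derivative_eq_intros)
    from diff_chain_at[OF this, of P] der[OF that]
    have "((\<lambda>t. P (z + Complex s t)) has_derivative (\<lambda>h. D (z + Complex s t) (\<i> * of_real h))) (at t)"
      by (simp add: o_def)
    moreover have "D (z + Complex s t) (\<i> * of_real h) = h *\<^sub>R D (z + Complex s t) \<i>" for h
      using linear_scale[OF has_derivative_linear[OF der[OF that]], of h \<i>] by (simp add: scaleR_conv_of_real mult.commute)
    ultimately show ?thesis by (simp add: has_vector_derivative_def)
  qed
  have ae1: "AE t in lborel. (\<integral>s. ?g1 (z + Complex s t) \<partial>lborel) = ?B1 t"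
  proof -
    have "AE t in lborel. t \<notin> Y"
      using Y(1) by (intro AE_not_in countable_imp_null_set_lborel)
    with integral_complex_iterated(4)[OF i1, of z] show ?thesis
    proof eventually_elim
      case (elim t)
      show ?case
      proof (cases "\<bar>t\<bar> \<le> R")
        case True
        have eq: "(\<lambda>s. ?g1 (z + Complex s t))
            = (\<lambda>s. if s \<notin> {s. z + Complex s t \<notin> \<Omega>} \<and> \<bar>s\<bar> \<le> R then D (z + Complex s t) 1 else 0)"
          using True by (auto simp: Q_def fun_eq_iff)
        have "(\<integral>s. ?g1 (z + Complex s t) \<partial>lborel) = P (z + Complex R t) - P (z + Complex (-R) t)"
          using elim unfolding eq by (intro line_integral_FTC R Y der1) auto
        thus ?thesis using True by simp
      qed (auto simp: Q_def)
    qed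
  qed
  have ae2: "AE s in lborel. (\<integral>t. ?g2 (z + Complex s t) \<partial>lborel) = ?B2 s"
  proof -
    have "AE s in lborel. s \<notin> X"
      using X(1) by (intro AE_not_in countable_imp_null_set_lborel)
    with integral_complex_iterated(1)[OF i2, of z] show ?thesis
    proof eventually_elim
      case (elim s)
      show ?case
      proof (cases "\<bar>s\<bar> \<le> R")
        case True
        have eq: "(\<lambda>t. ?g2 (z + Complex s t))
            = (\<lambda>t. if t \<notin> {t. z + Complex s t \<notin> \<Omega>} \<and> \<bar>t\<bar> \<le> R then D (z + Complex s t) \<i> else 0)"
          using True by (auto simp: Q_def fun_eq_iff)
        have "(\<integral>t. ?g2 (z + Complex s t) \<partial>lborel) = P (z + Complex s R) - P (z + Complex s (-R))"
          using elim unfolding eq by (intro line_integral_FTC R X der2) auto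
        thus ?thesis using True by simp
      qed (auto simp: Q_def)
    qed
  qed
  have I1: "integrable lborel ?B1" "integral\<^sup>L lborel ?g1 = integral\<^sup>L lborel ?B1"
    using integrable_cong_AE_imp[OF integral_complex_iterated(5)[OF i1] B1m ae1]
      integral_cong_AE[OF borel_measurable_integrable[OF integral_complex_iterated(5)[OF i1]] B1m ae1]
      integral_complex_iterated(6)[OF i1, of z] by auto
  have I2: "integrable lborel ?B2" "integral\<^sup>L lborel ?g2 = integral\<^sup>L lborel ?B2"
    using integrable_cong_AE_imp[OF integral_complex_iterated(2)[OF i2] B2m ae2]
      integral_cong_AE[OF borel_measurable_integrable[OF integral_complex_iterated(2)[OF i2]] B2m ae2]
      integral_complex_iterated(3)[OF i2, of z] by auto
  have B: "B = (\<lambda>t. ?B1 t + \<i> * ?B2 t)" by (auto simp: B_def fun_eq_iff)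
  show "integrable lborel B"
    unfolding B using I1 I2 by (intro Bochner_Integration.integrable_add integrable_mult_right) auto
  have "(\<lambda>x. if x \<in> \<Omega> \<inter> Q then D x 1 + \<i> * D x \<i> else 0) = (\<lambda>x. ?g1 x + \<i> * ?g2 x)"
    by auto
  thus "(\<integral>x. (if x \<in> \<Omega> \<inter> Q then D x 1 + \<i> * D x \<i> else 0) \<partial>lborel) = integral\<^sup>L lborel B"
    unfolding B using I1 I2 i1 i2 by (simp add: integral_add integral_mult_right)
qed

section \<open>The Cauchy--Pompeiu formula with an exceptional set\<close>

lemma measurable_continuous_off_finite:
  fixes L :: "complex \<Rightarrow> complex"
  assumes "finite S" "continuous_on (- S) L"
  shows "L \<in> borel_measurable borel"
proof -
  have "open (- S)" using assms(1) by (simp add: finite_imp_closed open_Compl)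
  hence "(\<lambda>x. indicator (- S) x *\<^sub>R L x) \<in> borel_measurable borel"
    using assms(2) by (intro borel_measurable_continuous_on_indicator) auto
  thus ?thesis
    by (rule measurable_discrete_difference[where X = S])
       (use assms(1) in \<open>auto simp: countable_finite\<close>)
qed

text \<open>
  A directional derivative is a limit of a sequence of difference quotients, hence measurable without any
  continuity of the derivative.
\<close>
lemma directional_derivative_LIMSEQ:
  fixes P :: "complex \<Rightarrow> complex"
  assumes der: "(P has_derivative D) (at x)" and h: "h \<noteq> 0"
  shows "(\<lambda>n. of_nat (Suc n) * (P (x + h / of_nat (Suc n)) - P x)) \<longlonglongrightarrow> D h"
proof -
  have lin: "linear D" using der by (rule has_derivative_linear)
  have seq: "(\<lambda>n. x + h / of_nat (Suc n)) \<longlonglongrightarrow> x"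
  proof -
    have "(\<lambda>n. x + h * inverse (of_nat (Suc n))) \<longlonglongrightarrow> x + h * 0"
      by (intro tendsto_intros LIMSEQ_Suc[OF lim_inverse_n])
    thus ?thesis by (simp add: divide_inverse)
  qed
  have "filterlim (\<lambda>n. x + h / of_nat (Suc n)) (at x) sequentially"
    using h by (intro filterlim_atI seq always_eventually) (auto simp del: of_nat_Suc)
  moreover have "((\<lambda>y. norm (P y - P x - D (y - x)) / norm (y - x)) \<longlongrightarrow> 0) (at x)"
    using der unfolding has_derivative_iff_norm by simp
  ultimately have "(\<lambda>n. norm (P (x + h / of_nat (Suc n)) - P x - D (x + h / of_nat (Suc n) - x))
       / norm (x + h / of_nat (Suc n) - x)) \<longlonglongrightarrow> 0"
    by (rule filterlim_compose[rotated])
  hence "(\<lambda>n. norm h * (norm (P (x + h / of_nat (Suc n)) - P x - D (x + h / of_nat (Suc n) - x))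
       / norm (x + h / of_nat (Suc n) - x))) \<longlonglongrightarrow> norm h * 0"
    by (intro tendsto_intros)
  moreover have "norm h * (norm (P (x + h / of_nat (Suc n)) - P x - D (x + h / of_nat (Suc n) - x))
       / norm (x + h / of_nat (Suc n) - x))
     = norm (of_nat (Suc n) * (P (x + h / of_nat (Suc n)) - P x) - D h)" for n
  proof -
    have "D (h / of_nat (Suc n)) = D h / of_nat (Suc n)"
      using linear_scale[OF lin, of "inverse (real (Suc n))" h]
      by (simp add: scaleR_conv_of_real divide_inverse mult.commute)
    hence "of_nat (Suc n) * (P (x + h / of_nat (Suc n)) - P x) - D h
        = of_nat (Suc n) * (P (x + h / of_nat (Suc n)) - P x - D (x + h / of_nat (Suc n) - x))"
      by (simp add: algebra_simps del: of_nat_Suc)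
    also have "norm \<dots> = real (Suc n) * norm (P (x + h / of_nat (Suc n)) - P x - D (x + h / of_nat (Suc n) - x))"
      by (simp add: norm_mult del: of_nat_Suc)
    finally show ?thesis using h by (simp add: norm_divide del: of_nat_Suc)
  qed
  ultimately have "(\<lambda>n. norm (of_nat (Suc n) * (P (x + h / of_nat (Suc n)) - P x) - D h)) \<longlonglongrightarrow> 0"
    by (simp only: mult_zero_right)
  thus ?thesis
    by (rule LIM_zero_cancel[OF tendsto_norm_zero_cancel])
qed

lemma measurable_directional_derivative:
  fixes P :: "complex \<Rightarrow> complex"
  assumes "open \<Omega>" and [measurable]: "P \<in> borel_measurable borel"
    and der: "\<And>x. x \<in> \<Omega> \<Longrightarrow> (P has_derivative D x) (at x)" and h: "h \<noteq> 0"
  shows "(\<lambda>x. if x \<in> \<Omega> then D x h else 0) \<in> borel_measurable borel"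
proof (rule borel_measurable_LIMSEQ_metric)
  have [measurable]: "\<Omega> \<in> sets borel" using assms(1) by simp
  show "(\<lambda>x. if x \<in> \<Omega> then of_nat (Suc n) * (P (x + h / of_nat (Suc n)) - P x) else 0)
      \<in> borel_measurable borel" for n
    by measurable
  show "(\<lambda>n. if x \<in> \<Omega> then of_nat (Suc n) * (P (x + h / of_nat (Suc n)) - P x) else 0)
      \<longlonglongrightarrow> (if x \<in> \<Omega> then D x h else 0)" for x
    using directional_derivative_LIMSEQ[OF der h] by auto
qed

lemma integral_cauchy_kernel_square:
  assumes n: "n > (0::real)"
  shows "has_bochner_integral lborel (\<lambda>t. indicator {-n..n} t *\<^sub>R (n / (n^2 + t^2))) (pi / 2)"
proof -
  have "has_bochner_integral lborel (\<lambda>t. indicator {-n..n} t *\<^sub>R (n / (n^2 + t^2)))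
      (arctan (n / n) - arctan (- n / n))"
  proof (rule has_bochner_integral_FTC_Icc)
    show "((\<lambda>t. arctan (t / n)) has_vector_derivative n / (n\<^sup>2 + t\<^sup>2)) (at t within {-n..n})" for t
    proof -
      have "((\<lambda>t. arctan (t / n)) has_real_derivative inverse (1 + (t / n)^2) * (1 / n)) (at t)"
        using n by (auto intro!: derivative_eq_intros)
      also have "inverse (1 + (t / n)^2) * (1 / n) = n / (n\<^sup>2 + t\<^sup>2)"
      proof -
        have "n^2 + t^2 > 0" using n by (simp add: add_pos_nonneg)
        moreover have "1 + (t/n)^2 = (n^2 + t^2) / n^2" using n by (simp add: power_divide field_simps)
        ultimately show ?thesis using n by (simp add: power2_eq_square)
      qed
      finally show ?thesis
        by (simp add: has_real_derivative_iff_has_vector_derivative has_vector_derivative_at_within)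
    qed
    show "continuous_on {-n..n} (\<lambda>t. n / (n\<^sup>2 + t\<^sup>2))"
    proof (intro continuous_intros ballI)
      show "n^2 + t^2 \<noteq> 0" for t using n by (simp add: add_pos_nonneg less_imp_neq[symmetric])
    qed
  qed (use n in auto)
  thus ?thesis using n by (simp add: arctan_minus arctan_one)
qed

lemma square_corner_norm:
  assumes "\<bar>t\<bar> \<le> n" "n > (0::real)"
  shows "norm (Complex n t) \<ge> n" "norm (Complex (-n) t) \<ge> n" "norm (Complex t n) \<ge> n" "norm (Complex t (-n)) \<ge> n"
  using abs_Re_le_cmod[of "Complex n t"] abs_Re_le_cmod[of "Complex (-n) t"]
    abs_Im_le_cmod[of "Complex t n"] abs_Im_le_cmod[of "Complex t (-n)"] assms by auto

text \<open>
  On the boundary of a square the four values of the Cauchy kernel at the points with the same parameter \<open>t\<close>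
  combine to a real expression, whose integral is an arctangent. This replaces the winding number of the square.
\<close>
lemma boundary_term_cauchy_kernel:
  assumes "n > (0::real)"
  shows "1 / Complex n t - 1 / Complex (-n) t + \<i> * (1 / Complex t n - 1 / Complex t (-n))
    = of_real (4 * (n / (n^2 + t^2)))"
proof -
  define d where "d = n^2 + t^2"
  have inv: "1 / Complex n t = Complex (n / d) (- t / d)" "1 / Complex (-n) t = Complex (- n / d) (- t / d)"
    "1 / Complex t n = Complex (t / d) (- n / d)" "1 / Complex t (-n) = Complex (t / d) (n / d)"
    unfolding d_def divide_inverse[of "1::complex"] by (simp_all add: complex_inverse add.commute)
  show ?thesis
    unfolding inv d_def[symmetric] by (simp add: complex_eq_iff)
qed

text \<open>
  Here \<open>G\<close> and \<open>F\<close> are the holomorphic and antiholomorphic derivatives of \<open>L\<close>. Green's formula is applied to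
  \<open>(L x - L z) / (x - z)\<close> on growing squares around \<open>z\<close>. The integrals over the squares tend to twice the integral in
  question by dominated convergence, and the boundary terms tend to \<open>2 * \<pi> * (l - L z)\<close> because \<open>L\<close> is nearly constant far
  away. No small disc around \<open>z\<close> is removed, since \<open>L\<close> is differentiable at \<open>z\<close>.
\<close>
lemma cauchy_pompeiu_with_exceptions:
  fixes L F G :: "complex \<Rightarrow> complex"
  assumes S: "finite S" "continuous_on (- S) L"
    and \<Omega>: "open \<Omega>" "z \<in> \<Omega>" "z \<notin> S"
    and der: "\<And>x. x \<in> \<Omega> \<Longrightarrow> (L has_derivative (\<lambda>h. G x * h + F x * cnj h)) (at x)"
    and X: "countable X" "\<And>s. s \<notin> X \<Longrightarrow> finite {t. Complex s t \<notin> \<Omega>}"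
    and Y: "countable Y" "\<And>t. t \<notin> Y \<Longrightarrow> finite {s. Complex s t \<notin> \<Omega>}"
    and bound: "\<And>c. \<exists>A. \<forall>\<^sub>F x in at c. x \<in> \<Omega> \<longrightarrow>
                   norm (G x) \<le> A / norm (x - c) \<and> norm (F x) \<le> A / norm (x - c)"
    and boundS: "\<And>c. c \<in> S \<Longrightarrow> \<exists>A. \<forall>\<^sub>F x in at c. norm (L x) \<le> A / norm (x - c)"
    and boundz: "\<exists>A. \<forall>\<^sub>F x in at z. norm (G x) \<le> A \<and> norm (F x) \<le> A"
    and inf: "(L \<longlongrightarrow> l) at_infinity"
    and boundinf: "\<exists>A. \<forall>\<^sub>F x in at_infinity. x \<in> \<Omega> \<longrightarrow> norm (F x) \<le> A / norm x ^ 2"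
  shows "integrable lborel (\<lambda>x. if x \<in> \<Omega> then F x / (x - z) else 0)"
    and "(\<integral>x. (if x \<in> \<Omega> then F x / (x - z) else 0) \<partial>lborel) = pi * (l - L z)"
proof -
  \<comment> \<open>Subtracting \<open>L z\<close> leaves the antiholomorphic derivative unchanged and keeps the difference quotient
     bounded near \<open>z\<close>, so that its derivatives are there of order \<open>1 / \<bar>x - z\<bar>\<close> and hence integrable.\<close>
  define P where "P = (\<lambda>x. (L x - L z) / (x - z))"
  define D where "D = (\<lambda>x h. (G x * h + F x * cnj h - P x * h) / (x - z))"
  define \<Omega>' where "\<Omega>' = \<Omega> - {z}"
  have \<Omega>': "open \<Omega>'" using \<Omega> unfolding \<Omega>'_def by auto
  have derP: "(P has_derivative D x) (at x)" if "x \<in> \<Omega>'" for x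
  proof -
    have x: "x \<in> \<Omega>" "x \<noteq> z" using that by (auto simp: \<Omega>'_def)
    have "((\<lambda>x. (L x - L z) / (x - z)) has_derivative
        (\<lambda>h. ((G x * h + F x * cnj h) * (x - z) - (L x - L z) * h) / ((x - z) * (x - z)))) (at x)"
      using x by (auto intro!: derivative_eq_intros der)
    also have "(\<lambda>h. ((G x * h + F x * cnj h) * (x - z) - (L x - L z) * h) / ((x - z) * (x - z))) = D x"
      using x by (auto simp: D_def P_def fun_eq_iff divide_simps)
    finally show ?thesis by (simp add: P_def)
  qed
  have dbar: "D x 1 + \<i> * D x \<i> = 2 * (F x / (x - z))" for x
    by (simp add: D_def algebra_simps add_divide_distrib diff_divide_distrib)
  have [measurable]: "L \<in> borel_measurable borel"
    by (rule measurable_continuous_off_finite[OF S])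
  have Pm [measurable]: "P \<in> borel_measurable borel"
    unfolding P_def by measurable
  have Dm: "(\<lambda>x. if x \<in> \<Omega>' then D x h else 0) \<in> borel_measurable borel" if "h \<noteq> 0" for h
    by (rule measurable_directional_derivative[OF \<Omega>' Pm derP that])
  have contP: "continuous_on (- (insert z S)) P"
    unfolding P_def using S(2) by (intro continuous_intros continuous_on_subset[OF S(2)]) auto

  have boundL: "\<exists>A. \<forall>\<^sub>F x in at c. norm (L x) \<le> A / norm (x - c)" for c
  proof (cases "c \<in> S")
    case False
    have "open (- S)" using S(1) by (simp add: finite_imp_closed open_Compl)
    hence "isCont L c" using S(2) False by (simp add: continuous_on_eq_continuous_at)
    hence "(L \<longlongrightarrow> L c) (at c)" by (rule isContD)
    hence "((\<lambda>x. norm (L x) * norm (x - c)) \<longlongrightarrow> norm (L c) * norm (c - c)) (at c)"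
      by (intro tendsto_intros)
    hence "\<forall>\<^sub>F x in at c. norm (L x) * norm (x - c) < 1"
      by (rule order_tendstoD) simp
    moreover have "\<forall>\<^sub>F x in at c. x \<noteq> c" by (simp add: eventually_at_filter)
    ultimately have "\<forall>\<^sub>F x in at c. norm (L x) \<le> 1 / norm (x - c)"
      by eventually_elim (auto simp: field_simps)
    thus ?thesis by blast
  qed (use boundS in auto)

  have far: "\<exists>B. \<forall>\<^sub>F x in at c. x \<noteq> z \<and> 1 / norm (x - z) \<le> B \<and> B \<ge> 0" if "c \<noteq> z" for c
  proof -
    have "((\<lambda>x. 1 / norm (x - z)) \<longlongrightarrow> 1 / norm (c - z)) (at c)"
      using that by (intro tendsto_intros) auto
    hence "\<forall>\<^sub>F x in at c. 1 / norm (x - z) < 1 / norm (c - z) + 1"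
      by (rule order_tendstoD) simp
    moreover have "\<forall>\<^sub>F x in at c. x \<noteq> z"
      using that by (intro eventually_neq_at_within)
    ultimately have "\<forall>\<^sub>F x in at c. x \<noteq> z \<and> 1 / norm (x - z) \<le> 1 / norm (c - z) + 1
        \<and> 1 / norm (c - z) + 1 \<ge> 0"
      by eventually_elim auto
    thus ?thesis by blast
  qed

  have boundP_z: "\<exists>A. \<forall>\<^sub>F x in at z. norm (P x) \<le> A"
  proof -
    obtain K where K: "\<And>h. norm (G z * h + F z * cnj h) \<le> norm h * K"
      using has_derivative_bounded_linear[OF der[OF \<Omega>(2)]] bounded_linear.bounded by blast
    have "((\<lambda>y. norm (L y - L z - (G z * (y - z) + F z * cnj (y - z))) / norm (y - z)) \<longlongrightarrow> 0) (at z)"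
      using der[OF \<Omega>(2)] unfolding has_derivative_iff_norm by simp
    hence "\<forall>\<^sub>F y in at z. norm (L y - L z - (G z * (y - z) + F z * cnj (y - z))) / norm (y - z) < 1"
      by (rule order_tendstoD) simp
    moreover have "\<forall>\<^sub>F y in at z. y \<noteq> z" by (simp add: eventually_at_filter)
    ultimately have "\<forall>\<^sub>F y in at z. norm (P y) \<le> K + 1"
    proof eventually_elim
      case (elim y)
      let ?d = "G z * (y - z) + F z * cnj (y - z)"
      have pos: "norm (y - z) > 0" using elim by simp
      have "norm (L y - L z) \<le> norm (L y - L z - ?d) + norm ?d"
        using norm_triangle_ineq[of "L y - L z - ?d" ?d] by simp
      also have "\<dots> \<le> norm (y - z) + norm (y - z) * K"
        using elim pos K[of "y - z"] by (intro add_mono) (auto simp: field_simps)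
      finally show ?case using pos by (simp add: P_def norm_divide field_simps)
    qed
    thus ?thesis by blast
  qed

  have boundD: "\<exists>A. \<forall>\<^sub>F x in at c. x \<in> \<Omega>' \<longrightarrow>
      (norm h = 1 \<longrightarrow> norm (D x h) \<le> A / norm (x - c)) \<and> norm (F x / (x - z)) \<le> A / norm (x - c)" for c h
  proof -
    have tri: "norm (D x h) \<le> (norm (G x) + norm (F x) + norm (P x)) / norm (x - z)"
      if "norm h = 1" for x
    proof -
      have "norm (G x * h + F x * cnj h - P x * h) \<le> norm (G x * h) + norm (F x * cnj h) + norm (P x * h)"
        by (meson norm_triangle_ineq norm_triangle_ineq4 order_trans add_right_mono)
      thus ?thesis using that by (simp add: D_def norm_divide norm_mult divide_right_mono)
    qed
    show ?thesis
    proof (cases "c = z")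
      case True
      obtain A where A: "\<forall>\<^sub>F x in at z. norm (G x) \<le> A \<and> norm (F x) \<le> A" using boundz by blast
      obtain B where B: "\<forall>\<^sub>F x in at z. norm (P x) \<le> B" using boundP_z by blast
      from A B have "\<forall>\<^sub>F x in at z. x \<in> \<Omega>' \<longrightarrow>
        (norm h = 1 \<longrightarrow> norm (D x h) \<le> (2 * A + B) / norm (x - z)) \<and> norm (F x / (x - z)) \<le> (2 * A + B) / norm (x - z)"
      proof eventually_elim
        case (elim x)
        have nn: "0 \<le> A" "0 \<le> B" using elim norm_ge_zero order_trans by metis+
        have "(norm (G x) + norm (F x) + norm (P x)) / norm (x - z) \<le> (2 * A + B) / norm (x - z)"
          using elim by (intro divide_right_mono) auto
        moreover have "norm (F x) / norm (x - z) \<le> (2 * A + B) / norm (x - z)"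
          using elim nn by (intro divide_right_mono) auto
        ultimately show ?case using tri[of x] by (auto simp: norm_divide)
      qed
      thus ?thesis using True by blast
    next
      case False
      obtain B where B: "\<forall>\<^sub>F x in at c. x \<noteq> z \<and> 1 / norm (x - z) \<le> B \<and> B \<ge> 0" using far[OF False] by blast
      obtain A where A: "\<forall>\<^sub>F x in at c. x \<in> \<Omega> \<longrightarrow> norm (G x) \<le> A / norm (x - c) \<and> norm (F x) \<le> A / norm (x - c)"
        using bound by blast
      obtain A' where A': "\<forall>\<^sub>F x in at c. norm (L x) \<le> A' / norm (x - c)" using boundL by blast
      have near: "\<forall>\<^sub>F x in at c. dist x c < 1" unfolding eventually_at by (auto intro: exI[of _ 1])
      have ne: "\<forall>\<^sub>F x in at c. x \<noteq> c" by (simp add: eventually_at_filter)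
      define A3 where "A3 = (A' + norm (L z)) * B"
      from A A' B near ne have "\<forall>\<^sub>F x in at c. x \<in> \<Omega>' \<longrightarrow>
        (norm h = 1 \<longrightarrow> norm (D x h) \<le> ((2 * A + A3) * B) / norm (x - c)) \<and> norm (F x / (x - z)) \<le> ((2 * A + A3) * B) / norm (x - c)"
      proof eventually_elim
        case (elim x)
        show ?case
        proof
          assume "x \<in> \<Omega>'"
          hence x: "x \<in> \<Omega>" by (simp add: \<Omega>'_def)
          have pos: "norm (x - c) > 0" "norm (x - c) < 1" using elim by (auto simp: dist_norm)
          have GF: "norm (G x) \<le> A / norm (x - c)" "norm (F x) \<le> A / norm (x - c)" using elim x by auto
          have "norm (L x - L z) \<le> norm (L x) + norm (L z)" by (rule norm_triangle_ineq4)
          also have "\<dots> \<le> A' / norm (x - c) + norm (L z) / norm (x - c)"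
          proof (rule add_mono)
            show "norm (L z) \<le> norm (L z) / norm (x - c)"
              using pos by (simp add: divide_simps mult_left_le)
          qed (use elim in auto)
          finally have LL: "norm (L x - L z) \<le> (A' + norm (L z)) / norm (x - c)" by (simp add: add_divide_distrib)
          have "norm (P x) = norm (L x - L z) * (1 / norm (x - z))" by (simp add: P_def norm_divide)
          also have "\<dots> \<le> (A' + norm (L z)) / norm (x - c) * B"
            using LL elim order_trans[OF norm_ge_zero LL] by (intro mult_mono) auto
          finally have PB: "norm (P x) \<le> A3 / norm (x - c)" by (simp add: A3_def)
          have sum: "norm (G x) + norm (F x) + norm (P x) \<le> (2 * A + A3) / norm (x - c)"
            using GF PB by (simp add: add_divide_distrib)
          have key: "u * (1 / norm (x - z)) \<le> ((2 * A + A3) * B) / norm (x - c)"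
            if "u \<le> norm (G x) + norm (F x) + norm (P x)" "u \<ge> 0" for u
          proof -
            have "u * (1 / norm (x - z)) \<le> (2 * A + A3) / norm (x - c) * B"
              using that sum elim order_trans[OF that(2) order_trans[OF that(1) sum]]
              by (intro mult_mono order_trans[OF that(1) sum]) auto
            thus ?thesis by simp
          qed
          show "(norm h = 1 \<longrightarrow> norm (D x h) \<le> ((2 * A + A3) * B) / norm (x - c)) \<and>
                norm (F x / (x - z)) \<le> ((2 * A + A3) * B) / norm (x - c)"
            using key[of "norm (G x) + norm (F x) + norm (P x)"] key[of "norm (F x)"] tri[of x]
            by (auto simp: norm_divide)
        qed
      qed
      thus ?thesis by blast
    qed
  qed

  define Q where "Q = (\<lambda>R::real. {x. \<bar>Re (x - z)\<bar> \<le> R \<and> \<bar>Im (x - z)\<bar> \<le> R})"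
  have Qm [measurable]: "Q R \<in> sets borel" for R
    unfolding Q_def by measurable
  have Qfar: "\<forall>\<^sub>F x in at_infinity. x \<notin> Q R" for R
  proof -
    have "x \<notin> Q R" if "norm x \<ge> norm z + 2 * \<bar>R\<bar> + 1" for x
    proof
      assume "x \<in> Q R"
      hence "norm (x - z) \<le> 2 * \<bar>R\<bar>" using cmod_le[of "x - z"] by (auto simp: Q_def)
      moreover have "norm x \<le> norm (x - z) + norm z" using norm_triangle_ineq[of "x - z" z] by simp
      ultimately show False using that by linarith
    qed
    thus ?thesis unfolding eventually_at_infinity by blast
  qed
  have intD: "integrable lborel (\<lambda>x. if x \<in> \<Omega>' \<inter> Q R then D x h else 0)" if h: "norm h = 1" for h R
  proof (rule integrable_of_local_bounds)
    define g where "g = (\<lambda>x. if x \<in> \<Omega>' then D x h else 0)"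
    have "h \<noteq> 0" using h by force
    hence [measurable]: "g \<in> borel_measurable borel" unfolding g_def by (rule Dm)
    have "(\<lambda>x. if x \<in> Q R then g x else 0) \<in> borel_measurable borel"
      by measurable
    also have "(\<lambda>x. if x \<in> Q R then g x else 0)
        = (\<lambda>x. if x \<in> \<Omega>' \<inter> Q R then D x h else 0)" by (auto simp: g_def fun_eq_iff)
    finally show "(\<lambda>x. if x \<in> \<Omega>' \<inter> Q R then D x h else 0) \<in> borel_measurable borel" .
    show "\<exists>A. \<forall>\<^sub>F x in at c. norm (if x \<in> \<Omega>' \<inter> Q R then D x h else 0) \<le> A / norm (x - c)" for c
    proof -
      obtain A where "\<forall>\<^sub>F x in at c. x \<in> \<Omega>' \<longrightarrow> (norm h = 1 \<longrightarrow> norm (D x h) \<le> A / norm (x - c)) \<and> norm (F x / (x - z)) \<le> A / norm (x - c)"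
        using boundD[of h c] by blast
      hence "\<forall>\<^sub>F x in at c. norm (if x \<in> \<Omega>' \<inter> Q R then D x h else 0) \<le> max A 0 / norm (x - c)"
      proof eventually_elim
        case (elim x)
        have "A / norm (x - c) \<le> max A 0 / norm (x - c)" "0 \<le> max A 0 / norm (x - c)"
          by (auto intro!: divide_right_mono)
        thus ?case using elim h by auto
      qed
      thus ?thesis by blast
    qed
    show "\<exists>A. \<forall>\<^sub>F x in at_infinity. norm (if x \<in> \<Omega>' \<inter> Q R then D x h else 0) \<le> A / norm x ^ 3"
      by (intro exI[of _ 0] eventually_mono[OF Qfar[of R]]) auto
  qed

  define f where "f = (\<lambda>x. if x \<in> \<Omega>' then 2 * (F x / (x - z)) else 0)"
  have fm [measurable]: "f \<in> borel_measurable borel"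
  proof -
    have "(\<lambda>x. (if x \<in> \<Omega>' then D x 1 else 0) + \<i> * (if x \<in> \<Omega>' then D x \<i> else 0)) \<in> borel_measurable borel"
      using Dm[of 1] Dm[of \<i>] by (intro borel_measurable_add borel_measurable_times borel_measurable_const) auto
    also have "(\<lambda>x. (if x \<in> \<Omega>' then D x 1 else 0) + \<i> * (if x \<in> \<Omega>' then D x \<i> else 0)) = f"
      by (auto simp: f_def dbar)
    finally show ?thesis .
  qed
  have fint: "integrable lborel f"
  proof (rule integrable_of_local_bounds[OF fm])
    show "\<exists>A. \<forall>\<^sub>F x in at c. norm (f x) \<le> A / norm (x - c)" for c
    proof -
      obtain A where "\<forall>\<^sub>F x in at c. x \<in> \<Omega>' \<longrightarrow> (norm (1::complex) = 1 \<longrightarrow> norm (D x 1) \<le> A / norm (x - c)) \<and> norm (F x / (x - z)) \<le> A / norm (x - c)"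
        using boundD[of 1 c] by blast
      hence "\<forall>\<^sub>F x in at c. norm (f x) \<le> (2 * max A 0) / norm (x - c)"
      proof eventually_elim
        case (elim x)
        have "A / norm (x - c) \<le> max A 0 / norm (x - c)" "0 \<le> max A 0 / norm (x - c)"
          by (auto intro!: divide_right_mono)
        moreover have "norm (f x) = (if x \<in> \<Omega>' then 2 * norm (F x / (x - z)) else 0)"
          by (auto simp: f_def norm_mult norm_divide)
        ultimately show ?case using elim by auto
      qed
      thus ?thesis by blast
    qed
    show "\<exists>A. \<forall>\<^sub>F x in at_infinity. norm (f x) \<le> A / norm x ^ 3"
    proof -
      obtain A where A: "\<forall>\<^sub>F x in at_infinity. x \<in> \<Omega> \<longrightarrow> norm (F x) \<le> A / norm x ^ 2" using boundinf by blast
      have "\<forall>\<^sub>F x in at_infinity. norm (x::complex) \<ge> 2 * norm z + 1"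
        unfolding eventually_at_infinity by blast
      with A have "\<forall>\<^sub>F x in at_infinity. norm (f x) \<le> (4 * max A 0) / norm x ^ 3"
      proof eventually_elim
        case (elim x)
        show ?case
        proof (cases "x \<in> \<Omega>'")
          case True
          have pos: "norm x > 0" using elim(2) norm_ge_zero[of z] by linarith
          have "norm x \<le> norm (x - z) + norm z" using norm_triangle_ineq[of "x - z" z] by simp
          hence ge: "norm (x - z) \<ge> norm x / 2" using elim(2) by linarith
          have "norm (f x) = 2 * norm (F x) / norm (x - z)" using True by (simp add: f_def norm_divide norm_mult)
          also have "\<dots> \<le> 2 * (max A 0 / norm x ^ 2) / (norm x / 2)"
          proof (rule frac_le)
            have "A / norm x ^ 2 \<le> max A 0 / norm x ^ 2" by (intro divide_right_mono) auto
            thus "2 * norm (F x) \<le> 2 * (max A 0 / norm x ^ 2)"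
              using elim(1) True by (auto simp: \<Omega>'_def)
          qed (use ge pos in auto)
          also have "\<dots> = (4 * max A 0) / norm x ^ 3" using pos by (simp add: power2_eq_square power3_eq_cube)
          finally show ?thesis .
        qed (auto simp: f_def)
      qed
      thus ?thesis by blast
    qed
  qed

  define B where "B = (\<lambda>R t. if \<bar>t\<bar> \<le> R then P (z + Complex R t) - P (z + Complex (-R) t)
                       + \<i> * (P (z + Complex t R) - P (z + Complex t (-R))) else 0)"
  define X' where "X' = (\<lambda>s. s - Re z) ` (X \<union> Re ` insert z S)"
  define Y' where "Y' = (\<lambda>s. s - Im z) ` (Y \<union> Im ` insert z S)"
  have zC: "z + Complex s t = Complex (Re z + s) (Im z + t)" for s t by (simp add: complex_eq_iff)
  have green: "(\<integral>x. (if x \<in> \<Omega>' \<inter> Q R then D x 1 + \<i> * D x \<i> else 0) \<partial>lborel) = integral\<^sup>L lborel (B R)"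
              "integrable lborel (B R)" if R: "R \<ge> 0" for R
  proof -
    have cX: "countable X'" "countable Y'"
      unfolding X'_def Y'_def using X(1) Y(1) countable_finite[OF S(1)] by auto
    have fX: "finite {t. z + Complex s t \<notin> \<Omega>'}" if "s \<notin> X'" for s
    proof -
      have s: "Re z + s \<notin> X" "s \<noteq> 0" using that image_eqI[of s "\<lambda>s. s - Re z" "Re z + s"] image_eqI[of s "\<lambda>s. s - Re z" "Re z"]
        unfolding X'_def by auto
      have "{t. z + Complex s t \<notin> \<Omega>'} \<subseteq> (\<lambda>t. t - Im z) ` {t. Complex (Re z + s) t \<notin> \<Omega>}"
      proof
        fix t assume "t \<in> {t. z + Complex s t \<notin> \<Omega>'}"
        hence "Complex (Re z + s) (Im z + t) \<notin> \<Omega>" using s(2) by (auto simp: \<Omega>'_def zC complex_eq_iff)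
        thus "t \<in> (\<lambda>t. t - Im z) ` {t. Complex (Re z + s) t \<notin> \<Omega>}"
          by (intro image_eqI[of _ _ "Im z + t"]) auto
      qed
      thus ?thesis using X(2)[OF s(1)] finite_surj by blast
    qed
    have fY: "finite {s. z + Complex s t \<notin> \<Omega>'}" if "t \<notin> Y'" for t
    proof -
      have s: "Im z + t \<notin> Y" "t \<noteq> 0" using that image_eqI[of t "\<lambda>s. s - Im z" "Im z + t"] image_eqI[of t "\<lambda>s. s - Im z" "Im z"]
        unfolding Y'_def by auto
      have "{s. z + Complex s t \<notin> \<Omega>'} \<subseteq> (\<lambda>s. s - Re z) ` {s. Complex s (Im z + t) \<notin> \<Omega>}"
      proof
        fix r assume "r \<in> {s. z + Complex s t \<notin> \<Omega>'}"
        hence "Complex (Re z + r) (Im z + t) \<notin> \<Omega>" using s(2) by (auto simp: \<Omega>'_def zC complex_eq_iff)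
        thus "r \<in> (\<lambda>s. s - Re z) ` {s. Complex s (Im z + t) \<notin> \<Omega>}"
          by (intro image_eqI[of _ _ "Re z + r"]) auto
      qed
      thus ?thesis using Y(2)[OF s(1)] finite_surj by blast
    qed
    have contX: "continuous_on UNIV (\<lambda>t. P (z + Complex s t))" if "s \<notin> X'" for s
    proof (rule continuous_on_compose2[OF contP])
      show "continuous_on UNIV (\<lambda>t. z + Complex s t)" unfolding Complex_eq by (intro continuous_intros)
      show "range (\<lambda>t. z + Complex s t) \<subseteq> - insert z S"
      proof
        fix y assume "y \<in> range (\<lambda>t. z + Complex s t)"
        hence "Re y = Re z + s" by auto
        hence "s = Re y - Re z" by simp
        thus "y \<in> - insert z S" using that unfolding X'_def by blast
      qed
    qed
    have contY: "continuous_on UNIV (\<lambda>s. P (z + Complex s t))" if "t \<notin> Y'" for t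
    proof (rule continuous_on_compose2[OF contP])
      show "continuous_on UNIV (\<lambda>s. z + Complex s t)" unfolding Complex_eq by (intro continuous_intros)
      show "range (\<lambda>s. z + Complex s t) \<subseteq> - insert z S"
      proof
        fix y assume "y \<in> range (\<lambda>s. z + Complex s t)"
        hence "Im y = Im z + t" by auto
        hence "t = Im y - Im z" by simp
        thus "y \<in> - insert z S" using that unfolding Y'_def by blast
      qed
    qed
    show "(\<integral>x. (if x \<in> \<Omega>' \<inter> Q R then D x 1 + \<i> * D x \<i> else 0) \<partial>lborel) = integral\<^sup>L lborel (B R)"
         "integrable lborel (B R)"
      unfolding Q_def B_def
      by (rule green_square[OF R Pm derP cX(1) fX contX cX(2) fY contY
            intD[of 1 R, unfolded Q_def] intD[of \<i> R, unfolded Q_def]]; simp)+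
  qed

  have lim1: "(\<lambda>n. integral\<^sup>L lborel (B (real (Suc n)))) \<longlonglongrightarrow> integral\<^sup>L lborel f"
  proof -
    have "(\<lambda>n. \<integral>x. (if x \<in> Q (real (Suc n)) then f x else 0) \<partial>lborel) \<longlonglongrightarrow> integral\<^sup>L lborel f"
    proof (rule integral_dominated_convergence[where w = "\<lambda>x. norm (f x)"])
      show "AE x in lborel. (\<lambda>n. if x \<in> Q (real (Suc n)) then f x else 0) \<longlonglongrightarrow> f x"
      proof (rule AE_I2)
        fix x
        obtain N where N: "norm (x - z) \<le> real N" using real_arch_simple by blast
        have "x \<in> Q (real (Suc n))" if "n \<ge> N" for n
        proof -
          have "real N \<le> real n" using that by simp
          thus ?thesis using N abs_Re_le_cmod[of "x - z"] abs_Im_le_cmod[of "x - z"] unfolding Q_def by auto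
        qed
        hence "\<forall>\<^sub>F n in sequentially. (if x \<in> Q (real (Suc n)) then f x else 0) = f x"
          unfolding eventually_sequentially by auto
        thus "(\<lambda>n. if x \<in> Q (real (Suc n)) then f x else 0) \<longlonglongrightarrow> f x"
          by (rule tendsto_eventually)
      qed
    qed (use fint in auto)
    moreover have "(\<integral>x. (if x \<in> Q (real (Suc n)) then f x else 0) \<partial>lborel) = integral\<^sup>L lborel (B (real (Suc n)))" for n
      by (subst green(1)[symmetric]) (auto simp: f_def dbar intro!: Bochner_Integration.integral_cong)
    ultimately show ?thesis by simp
  qed
  have lim2: "(\<lambda>n. integral\<^sup>L lborel (B (real (Suc n)))) \<longlonglongrightarrow> 2 * pi * (l - L z)"
  proof (rule LIMSEQ_I)
    fix e :: real assume e: "e > 0"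
    have "e / 9 > 0" using e by simp
    with inf have "\<forall>\<^sub>F x in at_infinity. dist (L x) l < e / 9" by (rule tendstoD)
    then obtain b where b: "\<And>x. norm x \<ge> b \<Longrightarrow> dist (L x) l < e / 9"
      unfolding eventually_at_infinity by blast
    obtain N where N: "b + norm z \<le> real N" using real_arch_simple by blast
    show "\<exists>no. \<forall>n\<ge>no. norm (integral\<^sup>L lborel (B (real (Suc n))) - 2 * pi * (l - L z)) < e"
    proof (intro exI[of _ N] allI impI)
      fix m assume m: "N \<le> m"
      define n where "n = real (Suc m)"
      have n: "n > 0" "n \<ge> b + norm z" using m N unfolding n_def by (auto simp: of_nat_mono intro: order_trans)
      define K where "K = (\<lambda>t. indicator {-n..n} t *\<^sub>R (n / (n^2 + t^2)))"
      define B' where "B' = (\<lambda>t. (4 * (l - L z)) * of_real (K t))"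
      have K: "has_bochner_integral lborel K (pi / 2)"
        unfolding K_def by (rule integral_cauchy_kernel_square[OF n(1)])
      have KB: "4 * (l - L z) * of_real (pi / 2) = 2 * pi * (l - L z)" by simp
      have iB': "integrable lborel B'" "integral\<^sup>L lborel B' = 2 * pi * (l - L z)"
      proof -
        have "integrable lborel K" "integral\<^sup>L lborel K = pi / 2"
          using K by (auto simp: has_bochner_integral_iff)
        moreover from this have "integral\<^sup>L lborel B' = (4 * (l - L z)) * of_real (integral\<^sup>L lborel K)"
          unfolding B'_def by simp
        ultimately show "integrable lborel B'" "integral\<^sup>L lborel B' = 2 * pi * (l - L z)"
          by (simp add: B'_def, simp only: KB)
      qed
      have near: "norm (P (z + \<zeta>) - (l - L z) * (1 / \<zeta>)) \<le> e / 9 / n" if "norm \<zeta> \<ge> n" for \<zeta>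
      proof -
        have nz: "\<zeta> \<noteq> 0" using that n by auto
        have "norm \<zeta> \<le> norm (z + \<zeta>) + norm z"
          using norm_triangle_ineq4[of "z + \<zeta>" z] by simp
        hence "norm (z + \<zeta>) \<ge> b" using that n by linarith
        from b[OF this] have d: "norm (L (z + \<zeta>) - l) \<le> e / 9" by (simp add: dist_norm)
        have "P (z + \<zeta>) - (l - L z) * (1 / \<zeta>) = (L (z + \<zeta>) - l) / \<zeta>"
          using nz by (simp add: P_def diff_divide_distrib)
        also have "norm \<dots> \<le> e / 9 / n"
          unfolding norm_divide using d that n e by (intro frac_le) auto
        finally show ?thesis .
      qed
      have four: "norm (u1 - u2 + (\<i> * u3 - \<i> * u4)) \<le> (d + d) + (d + d)"
        if "norm u1 \<le> d" "norm u2 \<le> d" "norm u3 \<le> d" "norm u4 \<le> d" for u1 u2 u3 u4 d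
        using that norm_triangle_ineq4[of u1 u2] norm_triangle_ineq4[of "\<i> * u3" "\<i> * u4"]
          norm_triangle_ineq[of "u1 - u2" "\<i> * u3 - \<i> * u4"] by (simp add: norm_mult)
      have BB: "norm (B n t - B' t) \<le> indicator {-n..n} t *\<^sub>R (4 * (e / 9 / n))" for t
      proof (cases "\<bar>t\<bar> \<le> n")
        case True
        note c = square_corner_norm[OF True n(1)]
        have "B' t = (l - L z) * (1 / Complex n t - 1 / Complex (-n) t + \<i> * (1 / Complex t n - 1 / Complex t (-n)))"
          using True unfolding boundary_term_cauchy_kernel[OF n(1)]
          by (simp add: B'_def K_def indicator_def abs_le_iff)
        hence "B n t - B' t = (P (z + Complex n t) - (l - L z) * (1 / Complex n t))
             - (P (z + Complex (-n) t) - (l - L z) * (1 / Complex (-n) t))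
             + (\<i> * (P (z + Complex t n) - (l - L z) * (1 / Complex t n))
             - \<i> * (P (z + Complex t (-n)) - (l - L z) * (1 / Complex t (-n))))"
          using True by (simp add: B_def algebra_simps)
        also have "norm \<dots> \<le> (e/9/n + e/9/n) + (e/9/n + e/9/n)"
          by (intro four near c)
        finally show ?thesis using True by (simp add: indicator_def abs_le_iff)
      next
        case False
        thus ?thesis by (auto simp: B_def B'_def K_def indicator_def abs_le_iff)
      qed
      have iB: "integrable lborel (B n)" using green(2)[of n] n by simp
      have ind: "integrable lborel (\<lambda>t. indicator {-n..n} t *\<^sub>R (4 * (e / 9 / n)))"
                "integral\<^sup>L lborel (\<lambda>t. indicator {-n..n} t *\<^sub>R (4 * (e / 9 / n))) = 8 * e / 9"
        using n by (auto simp: measure_def)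
      have "norm (integral\<^sup>L lborel (B n) - 2 * pi * (l - L z)) = norm (integral\<^sup>L lborel (\<lambda>t. B n t - B' t))"
        using iB iB' by (simp add: Bochner_Integration.integral_diff)
      also have "\<dots> \<le> integral\<^sup>L lborel (\<lambda>t. norm (B n t - B' t))"
        by (rule integral_norm_bound)
      also have "\<dots> \<le> integral\<^sup>L lborel (\<lambda>t. indicator {-n..n} t *\<^sub>R (4 * (e / 9 / n)))"
        using iB iB' ind BB by (intro integral_mono) auto
      also have "\<dots> < e" using ind e by simp
      finally show "norm (integral\<^sup>L lborel (B (real (Suc m))) - 2 * pi * (l - L z)) < e"
        by (simp add: n_def)
    qed
  qed
  have "integral\<^sup>L lborel f = 2 * pi * (l - L z)"
    by (rule LIMSEQ_unique[OF lim1 lim2])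
  moreover have f2: "(\<lambda>x. if x \<in> \<Omega> then F x / (x - z) else 0) = (\<lambda>x. f x / 2)"
    by (auto simp: f_def \<Omega>'_def fun_eq_iff)
  ultimately show "(\<integral>x. (if x \<in> \<Omega> then F x / (x - z) else 0) \<partial>lborel) = pi * (l - L z)"
    by simp
  show "integrable lborel (\<lambda>x. if x \<in> \<Omega> then F x / (x - z) else 0)"
    unfolding f2 using fint by simp
qed

section \<open>Charts, orders and local parameters\<close>

text \<open>
  After division by a power of the coordinate centred at \<open>x\<close> the function \<open>h\<close> is nonvanishing, so it is the \<open>m\<close>-th power of a
  holomorphic function with a simple zero at \<open>x\<close>; the local inverse of the latter is the coordinate.
\<close>
lemma local_power_coordinate:
  fixes h :: "complex \<Rightarrow> complex"
  assumes mero: "h meromorphic_on {x}" and lim: "(h \<longlongrightarrow> 0) (at x)"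
    and nz: "\<forall>\<^sub>F y in at x. h y \<noteq> 0" and S: "open S" "x \<in> S"
  obtains y r where "r > 0" "y holomorphic_on ball 0 r" "inj_on y (ball 0 r)" "y 0 = x"
    "y ` ball 0 r \<subseteq> S" "\<And>t. t \<in> ball 0 r - {0} \<Longrightarrow> h (y t) = t ^ nat (zorder h x)" "zorder h x > 0"
proof -
  define m where "m = nat (zorder h x)"
  have iso: "isolated_singularity_at h x" "not_essential h x" using mero by (auto simp: meromorphic_at_iff)
  have "isolated_zero h x" using lim nz by (simp add: isolated_zero_def)
  hence pos: "zorder h x > 0" using zorder_isolated_zero_pos'[OF _ iso(1)] by simp
  hence m: "m > 0" "zorder h x = int m" by (auto simp: m_def)
  have "\<exists>\<^sub>F y in at x. h y \<noteq> 0" using nz by (simp add: eventually_frequently)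
  from zorder_exist[OF iso this] obtain \<rho> where g0: "zor_poly h x x \<noteq> 0" and \<rho>: "\<rho> > 0"
    "zor_poly h x holomorphic_on cball x \<rho>"
    "\<And>w. w \<in> cball x \<rho> - {x} \<Longrightarrow> h w = zor_poly h x w * (w - x) powi zorder h x \<and> zor_poly h x w \<noteq> 0"
    by blast
  define g where "g = zor_poly h x"
  obtain \<rho>1 where \<rho>1: "\<rho>1 > 0" "ball x \<rho>1 \<subseteq> S" using S openE by blast
  define b where "b = ball x (min \<rho> \<rho>1)"
  have b: "open b" "convex b" "x \<in> b" "b \<subseteq> S" using \<rho>(1) \<rho>1 by (auto simp: b_def)
  have bc: "b \<subseteq> cball x \<rho>" by (auto simp: b_def)
  have gh: "g holomorphic_on b" unfolding g_def by (rule holomorphic_on_subset[OF \<rho>(2) bc])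
  have gn: "g w \<noteq> 0" if "w \<in> b" for w
    using \<rho>(3)[of w] g0 that bc by (cases "w = x") (auto simp: g_def)
  obtain l where l: "l holomorphic_on b" "\<And>w. w \<in> b \<Longrightarrow> exp (l w) = g w"
    using holomorphic_logarithm_exists[OF b(2,1) gh gn b(3)] by blast
  define \<tau> where "\<tau> = (\<lambda>w. (w - x) * exp (l w / of_nat m))"
  have \<tau>h: "\<tau> holomorphic_on b" unfolding \<tau>_def using m by (intro holomorphic_intros l(1)) auto
  have \<tau>pow: "h w = \<tau> w ^ m" if "w \<in> b" "w \<noteq> x" for w
  proof -
    have "h w = g w * (w - x) ^ m"
      using \<rho>(3)[of w] that bc by (auto simp: g_def m(2) power_int_of_nat)
    also have "g w = exp (l w / of_nat m) ^ m"
      using l(2)[OF that(1)] m by (simp add: exp_of_nat_mult[symmetric])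
    finally show ?thesis by (simp add: \<tau>_def power_mult_distrib mult.commute)
  qed
  have "deriv \<tau> x = exp (l x / of_nat m)"
  proof (rule DERIV_imp_deriv)
    have "(l has_field_derivative deriv l x) (at x)" using l(1) b(1,3) by (rule holomorphic_derivI)
    thus "(\<tau> has_field_derivative exp (l x / of_nat m)) (at x)"
      unfolding \<tau>_def using m by (auto intro!: derivative_eq_intros)
  qed
  hence "deriv \<tau> x \<noteq> 0" by simp
  from has_complex_derivative_locally_invertible[OF \<tau>h b(3,1) this]
  obtain \<rho>2 where \<rho>2: "\<rho>2 > 0" "ball x \<rho>2 \<subseteq> b" "open (\<tau> ` ball x \<rho>2)" "inj_on \<tau> (ball x \<rho>2)" by blast
  have \<tau>h2: "\<tau> holomorphic_on ball x \<rho>2" by (rule holomorphic_on_subset[OF \<tau>h \<rho>2(2)])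
  obtain y where y: "y holomorphic_on \<tau> ` ball x \<rho>2" "\<And>w. w \<in> ball x \<rho>2 \<Longrightarrow> y (\<tau> w) = w"
    using holomorphic_has_inverse[OF \<tau>h2 open_ball \<rho>2(4)] by metis
  have "0 \<in> \<tau> ` ball x \<rho>2" using \<rho>2(1) by (intro image_eqI[of _ _ x]) (auto simp: \<tau>_def)
  then obtain r where r: "r > 0" "ball 0 r \<subseteq> \<tau> ` ball x \<rho>2" using \<rho>2(3) openE by blast
  have inv: "\<tau> (y t) = t" "y t \<in> ball x \<rho>2" if "t \<in> ball 0 r" for t
    using r(2) y(2) that by (auto simp: subset_iff image_iff)
  have y0: "y 0 = x"
    using y(2)[of x] \<rho>2(1) by (simp add: \<tau>_def)
  show ?thesis
  proof (rule that)
    show "y holomorphic_on ball 0 r" by (rule holomorphic_on_subset[OF y(1) r(2)])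
    show "inj_on y (ball 0 r)" by (metis inj_onI inv(1))
    show "y ` ball 0 r \<subseteq> S" using inv(2) \<rho>2(2) b(4) by blast
    show "h (y t) = t ^ nat (zorder h x)" if "t \<in> ball 0 r - {0}" for t
    proof -
      have t: "t \<in> ball 0 r" "t \<noteq> 0" using that by auto
      have "y t \<noteq> x" using inv(1)[OF t(1)] t(2) by (auto simp: \<tau>_def)
      thus ?thesis using \<tau>pow[of "y t"] inv[OF t(1)] \<rho>2(2) by (auto simp: m_def)
    qed
  qed (use r y0 pos in auto)
qed

locale riemann_surface =
  fixes \<A> :: "('a::t2_space) atlas"
  assumes atlas: "riemann_atlas \<A>"
begin

text \<open>
  The order of a meromorphic function is defined with a chosen chart at each point; the same choice is made here, so that
  orders can be computed in this chart.
\<close>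
definition chart_dom :: "'a \<Rightarrow> 'a set" where
  "chart_dom p = fst (SOME c. c \<in> \<A> \<and> p \<in> fst c)"

definition coord :: "'a \<Rightarrow> 'a \<Rightarrow> complex" where
  "coord p = snd (SOME c. c \<in> \<A> \<and> p \<in> fst c)"

definition coord_inv :: "'a \<Rightarrow> complex \<Rightarrow> 'a" where
  "coord_inv p = inv_into (chart_dom p) (coord p)"

abbreviation coord_at :: "'a \<Rightarrow> complex" where
  "coord_at p \<equiv> coord p p"

lemma chart_props:
  assumes "(U, \<phi>) \<in> \<A>"
  shows "open U" "open (\<phi> ` U)" "homeomorphism U (\<phi> ` U) \<phi> (inv_into U \<phi>)"
  using atlas assms unfolding riemann_atlas_def by auto

lemma chart_at: "(chart_dom p, coord p) \<in> \<A>" "p \<in> chart_dom p"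
proof -
  have "(\<Union>(U, \<phi>)\<in>\<A>. U) = UNIV" using atlas unfolding riemann_atlas_def by blast
  hence "\<exists>c. c \<in> \<A> \<and> p \<in> fst c" by fastforce
  from someI_ex[OF this] show "(chart_dom p, coord p) \<in> \<A>" "p \<in> chart_dom p"
    unfolding chart_dom_def coord_def by auto
qed

lemma mero_order_eq: "mero_order \<A> g p = zorder (g \<circ> coord_inv p) (coord_at p)"
  unfolding mero_order_def coord_inv_def chart_dom_def coord_def by (simp add: case_prod_unfold Let_def)

lemma chart_open_map:
  assumes c: "(U, \<phi>) \<in> \<A>"
  shows "open S \<Longrightarrow> S \<subseteq> U \<Longrightarrow> open (\<phi> ` S)"
    and "open T \<Longrightarrow> T \<subseteq> \<phi> ` U \<Longrightarrow> open (inv_into U \<phi> ` T)"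
proof -
  note h = chart_props[OF c]
  show "open (\<phi> ` S)" if "open S" "S \<subseteq> U"
  proof -
    have "openin (top_of_set U) S" using that by (simp add: open_openin_trans h(1))
    from homeomorphism_imp_open_map[OF h(3) this] show ?thesis
      using h(2) openin_open_trans by blast
  qed
  show "open (inv_into U \<phi> ` T)" if "open T" "T \<subseteq> \<phi> ` U"
  proof -
    have "openin (top_of_set (\<phi> ` U)) T" using that by (simp add: open_openin_trans h(2))
    from homeomorphism_imp_open_map[OF homeomorphism_symD[OF h(3)] this] show ?thesis
      using h(1) openin_open_trans by blast
  qed
qed

lemma chart_inverse:
  assumes c: "(U, \<phi>) \<in> \<A>"
  shows "x \<in> U \<Longrightarrow> inv_into U \<phi> (\<phi> x) = x" "y \<in> \<phi> ` U \<Longrightarrow> \<phi> (inv_into U \<phi> y) = y"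
    "y \<in> \<phi> ` U \<Longrightarrow> inv_into U \<phi> y \<in> U"
  using chart_props(3)[OF c] unfolding homeomorphism_def by (auto simp: f_inv_into_f inv_into_into)

lemma eventually_at_chart:
  assumes c: "(U, \<phi>) \<in> \<A>" and p: "p \<in> U"
  shows "eventually P (at p) \<longleftrightarrow> eventually (\<lambda>x. P (inv_into U \<phi> x)) (at (\<phi> p))"
proof
  assume "eventually P (at p)"
  then obtain S where S: "open S" "p \<in> S" "\<And>q. q \<in> S \<Longrightarrow> q \<noteq> p \<Longrightarrow> P q"
    unfolding eventually_at_topological by blast
  let ?T = "\<phi> ` (S \<inter> U)"
  have "open ?T" using S(1) chart_props(1)[OF c] by (intro chart_open_map(1)[OF c]) auto
  moreover have "\<phi> p \<in> ?T" using S(2) p by auto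
  moreover have "P (inv_into U \<phi> x)" if "x \<in> ?T" "x \<noteq> \<phi> p" for x
    using that S(3) by (force simp: chart_inverse[OF c])
  ultimately show "eventually (\<lambda>x. P (inv_into U \<phi> x)) (at (\<phi> p))"
    unfolding eventually_at_topological by blast
next
  assume "eventually (\<lambda>x. P (inv_into U \<phi> x)) (at (\<phi> p))"
  then obtain T where T: "open T" "\<phi> p \<in> T" "\<And>x. x \<in> T \<Longrightarrow> x \<noteq> \<phi> p \<Longrightarrow> P (inv_into U \<phi> x)"
    unfolding eventually_at_topological by blast
  let ?S = "inv_into U \<phi> ` (T \<inter> \<phi> ` U)"
  have "open ?S" using T(1) chart_props(2)[OF c] by (intro chart_open_map(2)[OF c]) auto
  moreover have "p \<in> ?S" using T(2) p by (intro image_eqI[of _ _ "\<phi> p"]) (auto simp: chart_inverse[OF c])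
  moreover have "P q" if q: "q \<in> ?S" "q \<noteq> p" for q
  proof -
    obtain x where x: "x \<in> T" "q = inv_into U \<phi> x" using q(1) by blast
    have "x \<noteq> \<phi> p" using q(2) x(2) chart_inverse(1)[OF c p] by auto
    thus ?thesis using T(3) x by blast
  qed
  ultimately show "eventually P (at p)"
    unfolding eventually_at_topological by blast
qed

lemma filtermap_chart:
  assumes c: "(U, \<phi>) \<in> \<A>" and p: "p \<in> U"
  shows "filtermap (inv_into U \<phi>) (at (\<phi> p)) = at p"
  by (rule filter_eqI) (simp add: eventually_filtermap eventually_at_chart[OF c p])

lemma filtermap_coord: "filtermap (coord_inv p) (at (coord_at p)) = at p"
  unfolding coord_inv_def by (rule filtermap_chart[OF chart_at])

lemma filterlim_coord: "filterlim g F (at p) \<longleftrightarrow> filterlim (g \<circ> coord_inv p) F (at (coord_at p))"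
  by (subst filtermap_coord[symmetric]) (simp add: filterlim_def filtermap_filtermap o_def)

lemma eventually_coord: "eventually P (at p) \<longleftrightarrow> eventually (\<lambda>x. P (coord_inv p x)) (at (coord_at p))"
  by (subst filtermap_coord[symmetric]) (simp add: eventually_filtermap)

lemma at_nontrivial: "at (p::'a) \<noteq> bot"
  by (metis filtermap_coord filtermap_bot_iff at_neq_bot)

lemma not_open_singleton [simp]: "\<not> open {p::'a}"
  using at_nontrivial by (simp add: at_eq_bot_iff)

lemma is_pole_coord: "is_pole g p \<longleftrightarrow> is_pole (g \<circ> coord_inv p) (coord_at p)"
  unfolding is_pole_def by (rule filterlim_coord)

lemma mero_value_None_iff: "mero_value g p = None \<longleftrightarrow> is_pole g p"
  by (simp add: mero_value_def)

lemma mero_valueI: "((g :: 'a \<Rightarrow> complex) \<longlongrightarrow> l) (at p) \<Longrightarrow> mero_value g p = Some l"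
  using not_tendsto_and_filterlim_at_infinity[OF at_nontrivial, of g l p] tendsto_Lim[OF at_nontrivial, of g l p]
  by (auto simp: mero_value_def is_pole_def)

lemma mero_value_poleI: "is_pole g p \<Longrightarrow> mero_value g p = None"
  by (simp add: mero_value_def)

lemma meromorphic_chart:
  assumes "meromorphic_function \<A> g" "(U, \<phi>) \<in> \<A>"
  shows "(g \<circ> inv_into U \<phi>) meromorphic_on \<phi> ` U"
  using assms unfolding meromorphic_function_def by auto

lemma meromorphic_coord:
  assumes "meromorphic_function \<A> g"
  shows "(g \<circ> coord_inv p) meromorphic_on coord p ` chart_dom p" "(g \<circ> coord_inv p) meromorphic_on {coord_at p}"
proof -
  show *: "(g \<circ> coord_inv p) meromorphic_on coord p ` chart_dom p"
    unfolding coord_inv_def by (rule meromorphic_chart[OF assms chart_at(1)])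
  show "(g \<circ> coord_inv p) meromorphic_on {coord_at p}"
    by (rule meromorphic_on_subset[OF *]) (use chart_at(2) in auto)
qed

lemma pole_or_limit:
  assumes "meromorphic_function \<A> g"
  shows "is_pole g p \<or> (\<exists>l. (g \<longlongrightarrow> l) (at p))"
  using meromorphic_on_not_essential[OF meromorphic_coord(2)[OF assms, of p]]
  unfolding not_essential_def is_pole_coord[of g p] filterlim_coord[of g _ p] by auto

lemma mero_value_Some_iff:
  assumes "meromorphic_function \<A> g"
  shows "mero_value g p = Some l \<longleftrightarrow> (g \<longlongrightarrow> l) (at p)"
  using pole_or_limit[OF assms, of p] mero_valueI[of g _ p] mero_value_poleI[of g p] by fastforce

lemma eventually_tendsto_value:
  assumes "meromorphic_function \<A> g"
  shows "\<forall>\<^sub>F q in at p. (g \<longlongrightarrow> g q) (at q)"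
proof -
  let ?h = "g \<circ> coord_inv p"
  let ?D = "coord p ` chart_dom p"
  have D: "open ?D" "coord_at p \<in> ?D" using chart_props(2)[OF chart_at(1)] chart_at(2) by auto
  have "isolated_singularity_at ?h (coord_at p)"
    using meromorphic_coord(2)[OF assms, of p] by (simp add: meromorphic_at_iff)
  then obtain r where r: "r > 0" "?h analytic_on ball (coord_at p) r - {coord_at p}"
    by (auto simp: isolated_singularity_at_def)
  have "\<forall>\<^sub>F x in at (coord_at p). x \<in> ball (coord_at p) r \<inter> ?D - {coord_at p}"
    using D r(1) by (intro eventually_at_in_open) auto
  hence "\<forall>\<^sub>F x in at (coord_at p). (g \<longlongrightarrow> g (coord_inv p x)) (at (coord_inv p x))"
  proof eventually_elim
    case (elim x)
    let ?q = "coord_inv p x"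
    have q: "?q \<in> chart_dom p" "coord p ?q = x"
      using elim unfolding coord_inv_def by (auto simp: chart_inverse[OF chart_at(1)])
    have "?h analytic_on {x}" by (rule analytic_on_subset[OF r(2)]) (use elim in auto)
    hence "(?h \<longlongrightarrow> ?h x) (at x)" by (intro isContD analytic_at_imp_isCont)
    hence "filterlim g (nhds (g ?q)) (filtermap (coord_inv p) (at x))"
      by (simp add: filterlim_def filtermap_filtermap o_def)
    also have "filtermap (coord_inv p) (at x) = at ?q"
      using filtermap_chart[OF chart_at(1) q(1)] q(2) by (simp add: coord_inv_def)
    finally show ?case .
  qed
  thus ?thesis by (subst eventually_coord)
qed

lemma eventually_mero_value:
  assumes "meromorphic_function \<A> g"
  shows "\<forall>\<^sub>F q in at p. mero_value g q = Some (g q)"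
  using eventually_tendsto_value[OF assms, of p] by eventually_elim (rule mero_valueI)

lemma meromorphic_function_ops:
  assumes "meromorphic_function \<A> g" "meromorphic_function \<A> h"
  shows "meromorphic_function \<A> (\<lambda>p. c)" "meromorphic_function \<A> (\<lambda>p. g p + h p)"
    "meromorphic_function \<A> (\<lambda>p. g p - h p)" "meromorphic_function \<A> (\<lambda>p. g p * h p)"
    "meromorphic_function \<A> (\<lambda>p. g p / h p)" "meromorphic_function \<A> (\<lambda>p. inverse (g p))"
  using assms unfolding meromorphic_function_def
  by (fastforce simp: o_def intro!: meromorphic_intros)+

lemma eventually_eq_or_neq:
  assumes "meromorphic_function \<A> g"
  shows "(\<forall>\<^sub>F q in at p. g q = c) \<or> (\<forall>\<^sub>F q in at p. g q \<noteq> c)"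
proof -
  have m: "(\<lambda>x. (g \<circ> coord_inv p) x - c) meromorphic_on {coord_at p}"
    using meromorphic_coord(2)[OF assms, of p] by (intro meromorphic_intros)
  show ?thesis
    using not_essential_frequently_0_imp_eventually_0[of "\<lambda>x. (g \<circ> coord_inv p) x - c" "coord_at p"] m
    unfolding eventually_coord[of _ p] meromorphic_at_iff by (auto simp: frequently_def)
qed

text \<open>
  The set of points near which \<open>g = c\<close> is open, and so is the set near which \<open>g \<noteq> c\<close>, by the isolation of
  values in a chart. Together they cover the connected surface.
\<close>
lemma identity_dichotomy:
  assumes "meromorphic_function \<A> g" and conn: "connected (UNIV :: 'a set)"
  shows "(\<forall>p. \<forall>\<^sub>F q in at p. g q = c) \<or> (\<forall>p. \<forall>\<^sub>F q in at p. g q \<noteq> c)"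
proof -
  define E where "E = {p. \<forall>\<^sub>F q in at p. g q = c}"
  have opn: "open {p. \<forall>\<^sub>F q in at p. P (g q)}" for P
  proof (subst open_subopen, safe)
    fix p assume "\<forall>\<^sub>F q in at p. P (g q)"
    then obtain S where S: "open S" "p \<in> S" "\<And>q. q \<in> S \<Longrightarrow> q \<noteq> p \<Longrightarrow> P (g q)"
      unfolding eventually_at_topological by blast
    have "\<forall>\<^sub>F q' in at q. P (g q')" if "q \<in> S" for q
    proof (cases "q = p")
      case False
      have "\<forall>\<^sub>F q' in at q. q' \<in> S - {p}"
        using S(1) that False by (intro eventually_at_in_open') auto
      thus ?thesis by eventually_elim (use S(3) in auto)
    qed (use S in \<open>auto simp: eventually_at_topological\<close>)
    thus "\<exists>T. open T \<and> p \<in> T \<and> T \<subseteq> {p. \<forall>\<^sub>F q in at p. P (g q)}" using S by blast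
  qed
  have "open E" unfolding E_def by (rule opn)
  moreover have "- E = {p. \<forall>\<^sub>F q in at p. g q \<noteq> c}"
  proof (intro set_eqI iffI)
    fix p assume "p \<in> - E"
    thus "p \<in> {p. \<forall>\<^sub>F q in at p. g q \<noteq> c}" using eventually_eq_or_neq[OF assms(1), of c p] by (auto simp: E_def)
  next
    fix p assume p: "p \<in> {p. \<forall>\<^sub>F q in at p. g q \<noteq> c}"
    show "p \<in> - E"
    proof
      assume "p \<in> E"
      hence "\<forall>\<^sub>F q in at p. g q = c" by (simp add: E_def)
      moreover from p have "\<forall>\<^sub>F q in at p. g q \<noteq> c" by simp
      ultimately have "\<forall>\<^sub>F q in at p. False" by eventually_elim simp
      thus False using at_nontrivial by (simp add: trivial_limit_def)
    qed
  qed
  hence "open (- E)" using opn[of "\<lambda>v. v \<noteq> c"] by simp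
  ultimately have "E = {} \<or> E = UNIV"
    using conn unfolding connected_clopen by (auto simp: closed_def)
  thus ?thesis using \<open>- E = _\<close> by (auto simp: E_def)
qed

end

lemma zorder_injective:
  assumes y: "y holomorphic_on S" "open S" "inj_on y S" "a \<in> S"
  shows "zorder (\<lambda>x. y x - y a) a = 1"
proof (rule zorder_zero_eqI)
  show "(\<lambda>x. y x - y a) holomorphic_on S" using y by (intro holomorphic_intros)
  have "deriv (\<lambda>x. y x - y a) a = deriv y a"
    using y by (simp add: holomorphic_on_imp_differentiable_at)
  moreover have "deriv y a \<noteq> 0" by (rule holomorphic_injective_imp_regular[OF y])
  ultimately show "(deriv ^^ nat 1) (\<lambda>x. y x - y a) a \<noteq> 0" by simp
qed (use y in auto)

lemma power_locally_injective:
  fixes t :: complex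
  assumes "t \<noteq> 0" "m > 0" "open S" "t \<in> S"
  obtains r where "r > 0" "ball t r \<subseteq> S" "inj_on (\<lambda>x. x ^ m) (ball t r)"
proof (rule has_complex_derivative_locally_injective[of "\<lambda>x. x ^ m" S t])
  have "((\<lambda>x. x ^ m) has_field_derivative of_nat m * t ^ (m - 1)) (at t)"
    by (auto intro!: derivative_eq_intros)
  hence "deriv (\<lambda>x. x ^ m) t = of_nat m * t ^ (m - 1)" by (rule DERIV_imp_deriv)
  thus "deriv (\<lambda>x. x ^ m) t \<noteq> 0" using assms by simp
qed (use assms that in \<open>auto intro!: holomorphic_intros\<close>)

lemma finite_disjoint_neighbourhoods:
  fixes X :: "'a::t2_space set"
  assumes "finite X"
  shows "\<exists>W. (\<forall>p\<in>X. open (W p) \<and> p \<in> W p) \<and> (\<forall>p\<in>X. \<forall>q\<in>X. p \<noteq> q \<longrightarrow> W p \<inter> W q = {})"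
proof -
  define sep where "sep = (\<lambda>(p::'a) q UV. open (fst UV) \<and> open (snd UV) \<and> p \<in> fst UV \<and> q \<in> snd UV \<and> fst UV \<inter> snd UV = {})"
  define UV where "UV = (\<lambda>p q. SOME UV. sep p q UV)"
  have UV: "sep p q (UV p q)" if pq: "p \<noteq> q" for p q
  proof -
    obtain U V where "open U" "open V" "p \<in> U" "q \<in> V" "U \<inter> V = {}" using hausdorff[OF pq] by auto
    hence "sep p q (U, V)" by (simp add: sep_def)
    thus ?thesis unfolding UV_def by (rule someI)
  qed
  define W where "W = (\<lambda>p. \<Inter>q\<in>X - {p}. fst (UV p q) \<inter> snd (UV q p))"
  have "open (W p) \<and> p \<in> W p" for p
  proof
    have o: "open (fst (UV p q) \<inter> snd (UV q p)) \<and> p \<in> fst (UV p q) \<inter> snd (UV q p)" if "q \<in> X - {p}" for q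
      using UV[of p q] UV[of q p] that by (auto simp: sep_def)
    show "open (W p)" unfolding W_def using assms o by (intro open_INT) auto
    show "p \<in> W p" unfolding W_def using o by blast
  qed
  moreover have "W p \<inter> W q = {}" if "p \<in> X" "q \<in> X" "p \<noteq> q" for p q
  proof -
    have "W p \<subseteq> fst (UV p q)" "W q \<subseteq> snd (UV p q)" unfolding W_def using that by auto
    thus ?thesis using UV[OF that(3)] by (auto simp: sep_def)
  qed
  ultimately show ?thesis by blast
qed

context riemann_surface
begin

lemma mero_order_divide:
  assumes "meromorphic_function \<A> g" "meromorphic_function \<A> h"
    and "\<forall>\<^sub>F q in at p. g q \<noteq> 0" "\<forall>\<^sub>F q in at p. h q \<noteq> 0"
  shows "mero_order \<A> (\<lambda>q. g q / h q) p = mero_order \<A> g p - mero_order \<A> h p"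
proof -
  have "zorder (\<lambda>x. (g \<circ> coord_inv p) x / (h \<circ> coord_inv p) x) (coord_at p)
      = zorder (g \<circ> coord_inv p) (coord_at p) - zorder (h \<circ> coord_inv p) (coord_at p)"
    using assms(3,4) unfolding eventually_coord[of _ p]
    by (intro zorder_divide meromorphic_coord(2) assms(1,2)) (auto intro!: eventually_frequently)
  thus ?thesis by (simp add: mero_order_eq o_def)
qed

lemma mero_order_eq_0:
  assumes "meromorphic_function \<A> g" "(g \<longlongrightarrow> l) (at p)" "l \<noteq> 0"
  shows "mero_order \<A> g p = 0"
proof -
  have lim: "((g \<circ> coord_inv p) \<longlongrightarrow> l) (at (coord_at p))" using assms(2) by (simp add: filterlim_coord)
  have "\<forall>\<^sub>F x in at (coord_at p). (g \<circ> coord_inv p) x \<noteq> 0"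
    using lim assms(3) by (rule tendsto_imp_eventually_ne)
  hence fr: "\<exists>\<^sub>F x in at (coord_at p). (g \<circ> coord_inv p) x \<noteq> 0" by (intro eventually_frequently) auto
  have "\<not> is_pole (g \<circ> coord_inv p) (coord_at p)"
    unfolding is_pole_def using not_tendsto_and_filterlim_at_infinity[OF at_neq_bot lim] by blast
  moreover have "\<not> isolated_zero (g \<circ> coord_inv p) (coord_at p)"
    unfolding isolated_zero_def using tendsto_unique[OF at_neq_bot lim] assms(3) by blast
  ultimately show ?thesis
    unfolding mero_order_eq by (intro not_pole_not_isolated_zero_imp_zorder_eq_0 meromorphic_coord(2) assms(1) fr)
qed

lemma mero_order_pos:
  assumes "meromorphic_function \<A> g" "(g \<longlongrightarrow> 0) (at p)" "\<forall>\<^sub>F q in at p. g q \<noteq> 0"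
  shows "mero_order \<A> g p > 0"
proof -
  have "isolated_zero (g \<circ> coord_inv p) (coord_at p)"
    using assms(2,3) unfolding isolated_zero_def filterlim_coord[of g _ p] eventually_coord[of _ p] by simp
  thus ?thesis unfolding mero_order_eq
    using meromorphic_coord(2)[OF assms(1), of p] zorder_isolated_zero_pos' by (auto simp: meromorphic_at_iff)
qed

lemma mero_order_inverse:
  assumes "meromorphic_function \<A> g" "\<forall>\<^sub>F q in at p. g q \<noteq> 0"
  shows "mero_order \<A> (\<lambda>q. inverse (g q)) p = - mero_order \<A> g p"
proof -
  have "mero_order \<A> (\<lambda>q. 1 / g q) p = mero_order \<A> (\<lambda>q. 1) p - mero_order \<A> g p"
    using assms by (intro mero_order_divide meromorphic_function_ops) auto
  also have "mero_order \<A> (\<lambda>q. 1) p = 0"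
    using assms(1) by (intro mero_order_eq_0[of _ 1] meromorphic_function_ops) auto
  finally show ?thesis by (simp add: divide_inverse)
qed

text \<open>
  A parametrization of a neighbourhood of \<open>p\<close> by a disc through which meromorphic functions and their orders can be
  read off. It is not required to come from a chart of the atlas, so it can be adapted to a given function.
\<close>
definition local_param :: "'a \<Rightarrow> (complex \<Rightarrow> 'a) \<Rightarrow> real \<Rightarrow> bool" where
  "local_param p \<sigma> r \<longleftrightarrow> r > 0 \<and> \<sigma> 0 = p \<and> inj_on \<sigma> (ball 0 r) \<and> continuous_on (ball 0 r) \<sigma> \<and>
     (\<forall>S\<subseteq>ball 0 r. open S \<longrightarrow> open (\<sigma> ` S)) \<and>
     (\<forall>g. meromorphic_function \<A> g \<longrightarrow> (g \<circ> \<sigma>) meromorphic_on ball 0 r) \<and>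
     (\<forall>g. meromorphic_function \<A> g \<longrightarrow> (\<forall>\<^sub>F q in at p. g q \<noteq> 0) \<longrightarrow>
        zorder (g \<circ> \<sigma>) 0 = mero_order \<A> g p)"

lemma local_paramD:
  assumes "local_param p \<sigma> r"
  shows "r > 0" "\<sigma> 0 = p" "inj_on \<sigma> (ball 0 r)" "continuous_on (ball 0 r) \<sigma>"
    "\<And>S. S \<subseteq> ball 0 r \<Longrightarrow> open S \<Longrightarrow> open (\<sigma> ` S)"
    "\<And>g. meromorphic_function \<A> g \<Longrightarrow> (g \<circ> \<sigma>) meromorphic_on ball 0 r"
    "\<And>g. meromorphic_function \<A> g \<Longrightarrow> \<forall>\<^sub>F q in at p. g q \<noteq> 0 \<Longrightarrow> zorder (g \<circ> \<sigma>) 0 = mero_order \<A> g p"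
  using assms unfolding local_param_def by auto

lemma local_param_shrink:
  assumes "local_param p \<sigma> r" "0 < r'" "r' \<le> r"
  shows "local_param p \<sigma> r'"
proof -
  have "ball 0 r' \<subseteq> ball (0::complex) r" using assms(3) by (rule subset_ball)
  with assms show ?thesis unfolding local_param_def
    by (auto intro: inj_on_subset continuous_on_subset meromorphic_on_subset)
qed

lemma filtermap_local_param:
  assumes "local_param p \<sigma> r"
  shows "filtermap \<sigma> (at 0) = at p"
proof (rule filter_eqI)
  fix P
  note lp = local_paramD[OF assms]
  show "eventually P (filtermap \<sigma> (at 0)) \<longleftrightarrow> eventually P (at p)"
  proof
    assume "eventually P (filtermap \<sigma> (at 0))"
    then obtain T where T: "open T" "0 \<in> T" "\<And>t. t \<in> T \<Longrightarrow> t \<noteq> 0 \<Longrightarrow> P (\<sigma> t)"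
      unfolding eventually_filtermap eventually_at_topological by auto
    let ?S = "\<sigma> ` (T \<inter> ball 0 r)"
    have "open ?S" using T(1) by (intro lp(5)) auto
    moreover have "p \<in> ?S" using T(2) lp(1,2) by (intro image_eqI[of _ _ 0]) auto
    moreover have "P q" if "q \<in> ?S" "q \<noteq> p" for q using that T(3) lp(2) by auto
    ultimately show "eventually P (at p)" unfolding eventually_at_topological by blast
  next
    assume "eventually P (at p)"
    then obtain S where S: "open S" "p \<in> S" "\<And>q. q \<in> S \<Longrightarrow> q \<noteq> p \<Longrightarrow> P q"
      unfolding eventually_at_topological by blast
    have "open (ball 0 r \<inter> \<sigma> -` S)" using lp(4) S(1) by (intro continuous_open_preimage) auto
    moreover have "0 \<in> ball 0 r \<inter> \<sigma> -` S" using S(2) lp(1,2) by auto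
    moreover have "P (\<sigma> t)" if "t \<in> ball 0 r \<inter> \<sigma> -` S" "t \<noteq> 0" for t
    proof (rule S(3))
      show "\<sigma> t \<noteq> p" using that inj_onD[OF lp(3), of t 0] lp(1,2) by auto
    qed (use that in auto)
    ultimately show "eventually P (filtermap \<sigma> (at 0))"
      unfolding eventually_filtermap eventually_at_topological by blast
  qed
qed

lemma eventually_local_param:
  assumes "local_param p \<sigma> r"
  shows "eventually P (at p) \<longleftrightarrow> eventually (\<lambda>t. P (\<sigma> t)) (at 0)"
  unfolding filtermap_local_param[OF assms, symmetric] eventually_filtermap ..

lemma filterlim_local_param:
  assumes "local_param p \<sigma> r"
  shows "filterlim g F (at p) \<longleftrightarrow> filterlim (g \<circ> \<sigma>) F (at 0)"
  unfolding filtermap_local_param[OF assms, symmetric] by (simp add: filterlim_def filtermap_filtermap o_def)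

text \<open>
  A function vanishing at \<open>p\<close> becomes exactly a power in a suitable parameter: compose the chosen chart with the power
  coordinate of the function in this chart.
\<close>
lemma local_param_exists:
  assumes u: "meromorphic_function \<A> u" and lim: "(u \<longlongrightarrow> 0) (at p)" and nz: "\<forall>\<^sub>F q in at p. u q \<noteq> 0"
  shows "\<exists>\<sigma> r. local_param p \<sigma> r \<and> (\<forall>t\<in>ball 0 r - {0}. u (\<sigma> t) = t ^ nat (mero_order \<A> u p))"
proof -
  let ?D = "coord p ` chart_dom p"
  have D: "open ?D" "coord_at p \<in> ?D" using chart_props(2)[OF chart_at(1)] chart_at(2) by auto
  have l: "((u \<circ> coord_inv p) \<longlongrightarrow> 0) (at (coord_at p))" using lim by (simp add: filterlim_coord)
  have n: "\<forall>\<^sub>F x in at (coord_at p). (u \<circ> coord_inv p) x \<noteq> 0" using nz by (simp add: eventually_coord)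
  obtain y r where y: "r > 0" "y holomorphic_on ball 0 r" "inj_on y (ball 0 r)" "y 0 = coord_at p"
    "y ` ball 0 r \<subseteq> ?D" "\<And>t. t \<in> ball 0 r - {0} \<Longrightarrow> (u \<circ> coord_inv p) (y t) = t ^ nat (mero_order \<A> u p)"
    using local_power_coordinate[OF meromorphic_coord(2)[OF u] l n D] unfolding mero_order_eq by metis
  define \<sigma> where "\<sigma> = coord_inv p \<circ> y"
  have yc: "continuous_on (ball 0 r) y" using y(2) by (rule holomorphic_on_imp_continuous_on)
  have yana: "y analytic_on ball 0 r" using y(2) by (simp add: analytic_on_open)
  have hom: "homeomorphism (chart_dom p) ?D (coord p) (coord_inv p)"
    unfolding coord_inv_def by (rule chart_props(3)[OF chart_at(1)])
  have invc: "continuous_on ?D (coord_inv p)" using hom unfolding homeomorphism_def by blast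
  have invi: "inj_on (coord_inv p) ?D" unfolding coord_inv_def by (rule inj_on_inv_into) auto
  have "local_param p \<sigma> r"
    unfolding local_param_def
  proof (intro conjI allI impI)
    show "r > 0" by fact
    show "\<sigma> 0 = p" using y(4) chart_at by (simp add: \<sigma>_def coord_inv_def chart_inverse[OF chart_at(1)])
    show "inj_on \<sigma> (ball 0 r)" unfolding \<sigma>_def
      using y(3) inj_on_subset[OF invi y(5)] by (rule comp_inj_on)
    show "continuous_on (ball 0 r) \<sigma>" unfolding \<sigma>_def
      using yc continuous_on_subset[OF invc y(5)] by (rule continuous_on_compose)
    show "open (\<sigma> ` S)" if "S \<subseteq> ball 0 r" "open S" for S
    proof -
      have "open (y ` S)"
        using that y(2,3) by (intro open_mapping_thm3) (auto intro: holomorphic_on_subset inj_on_subset)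
      hence "open (coord_inv p ` (y ` S))"
        unfolding coord_inv_def using y(5) that by (intro chart_open_map(2)[OF chart_at(1)]) auto
      thus ?thesis by (simp add: \<sigma>_def image_comp)
    qed
    show "(g \<circ> \<sigma>) meromorphic_on ball 0 r" if "meromorphic_function \<A> g" for g
      using meromorphic_on_compose[OF meromorphic_coord(1)[OF that, of p] yana y(5)]
      by (simp add: \<sigma>_def o_def)
    show "zorder (g \<circ> \<sigma>) 0 = mero_order \<A> g p"
      if g: "meromorphic_function \<A> g" "\<forall>\<^sub>F q in at p. g q \<noteq> 0" for g
    proof -
      have m: "(g \<circ> coord_inv p) meromorphic_on {y 0}" using meromorphic_coord(2)[OF g(1), of p] y(4) by simp
      have "zorder ((g \<circ> coord_inv p) \<circ> y) 0 = zorder (g \<circ> coord_inv p) (y 0) * zorder (\<lambda>x. y x - y 0) 0"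
      proof (rule zorder_compose')
        show "isolated_singularity_at (g \<circ> coord_inv p) (y 0)" "not_essential (g \<circ> coord_inv p) (y 0)"
          using m by (auto simp: meromorphic_at_iff)
        show "y analytic_on {0}" using yana by (rule analytic_on_subset) (use y(1) in auto)
        show "\<forall>\<^sub>F w in at (y 0). (g \<circ> coord_inv p) w \<noteq> 0"
          using g(2) unfolding y(4) eventually_coord[of _ p] by simp
        have "\<forall>\<^sub>F w in at 0. w \<in> ball 0 r - {0::complex}" using y(1) by (intro eventually_at_in_open) auto
        thus "\<forall>\<^sub>F w in at 0. y w \<noteq> y 0"
          by eventually_elim (use y(1) inj_onD[OF y(3)] in force)
      qed
      also have "zorder (\<lambda>x. y x - y 0) 0 = 1"
        using y(1) by (intro zorder_injective[OF y(2) open_ball y(3)]) auto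
      finally show ?thesis using y(4) unfolding \<sigma>_def mero_order_eq o_assoc by (simp only: mult_1_right)
    qed
  qed
  thus ?thesis using y(6) by (intro exI[of _ \<sigma>] exI[of _ r]) (auto simp: \<sigma>_def)
qed

text \<open>
  In a parameter in which \<open>u\<close> is \<open>t ^ m\<close> with \<open>m \<ge> 2\<close>, small values are taken at several points.
\<close>
lemma mero_order_eq_1_if_injective:
  assumes u: "meromorphic_function \<A> u" and lim: "(u \<longlongrightarrow> 0) (at p)" and nz: "\<forall>\<^sub>F q in at p. u q \<noteq> 0"
    and inj: "open V" "p \<in> V" "inj_on u (V - {p})"
  shows "mero_order \<A> u p = 1"
proof (rule ccontr)
  assume ne: "mero_order \<A> u p \<noteq> 1"
  define m where "m = nat (mero_order \<A> u p)"
  have m: "m \<ge> 2" using mero_order_pos[OF u lim nz] ne by (simp add: m_def)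
  obtain \<sigma> r where \<sigma>: "local_param p \<sigma> r" "\<And>t. t \<in> ball 0 r - {0} \<Longrightarrow> u (\<sigma> t) = t ^ m"
    using local_param_exists[OF u lim nz] unfolding m_def by blast
  note lp = local_paramD[OF \<sigma>(1)]
  have "open (ball 0 r \<inter> \<sigma> -` V)" using lp(4) inj(1) by (intro continuous_open_preimage) auto
  moreover have "0 \<in> ball 0 r \<inter> \<sigma> -` V" using inj(2) lp(1,2) by auto
  ultimately obtain d where d: "d > 0" "ball 0 d \<subseteq> ball 0 r \<inter> \<sigma> -` V" using openE by blast
  have "card {z::complex. z ^ m = 1} = m" using m by (intro card_roots_unity_eq) auto
  moreover have "card {1::complex} = 1" by simp
  ultimately have "\<not> {z::complex. z ^ m = 1} \<subseteq> {1}"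
    using m card_mono[of "{1::complex}" "{z. z ^ m = 1}"] by auto
  then obtain \<omega> :: complex where \<omega>: "\<omega> ^ m = 1" "\<omega> \<noteq> 1" by auto
  have "norm \<omega> ^ m = 1 ^ m" using \<omega>(1) by (metis norm_one norm_power power_one)
  hence n\<omega>: "norm \<omega> = 1" using m by (intro power_eq_imp_eq_base[of "norm \<omega>" m 1]) auto
  define t where "t = complex_of_real (d / 2)"
  have t: "t \<in> ball 0 d" "t * \<omega> \<in> ball 0 d" "t \<noteq> 0" "t * \<omega> \<noteq> 0" "t \<noteq> t * \<omega>"
    using d(1) n\<omega> \<omega>(2) by (auto simp: t_def norm_mult)
  hence tr: "t \<in> ball 0 r - {0}" "t * \<omega> \<in> ball 0 r - {0}" "\<sigma> t \<in> V" "\<sigma> (t * \<omega>) \<in> V" using d(2) by auto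
  have z0: "0 \<in> ball 0 r" "t \<in> ball 0 r" "t * \<omega> \<in> ball 0 r" using lp(1) tr(1,2) by auto
  have "\<sigma> t \<noteq> \<sigma> 0" "\<sigma> (t * \<omega>) \<noteq> \<sigma> 0" and ne2: "\<sigma> t \<noteq> \<sigma> (t * \<omega>)"
    unfolding inj_on_eq_iff[OF lp(3) z0(2,1)] inj_on_eq_iff[OF lp(3) z0(3,1)] inj_on_eq_iff[OF lp(3) z0(2,3)]
    using t(3-5) by blast+
  hence mem: "\<sigma> t \<in> V - {p}" "\<sigma> (t * \<omega>) \<in> V - {p}" using lp(2) tr(3,4) by auto
  have "u (\<sigma> t) = u (\<sigma> (t * \<omega>))" unfolding \<sigma>(2)[OF tr(1)] \<sigma>(2)[OF tr(2)] power_mult_distrib \<omega>(1) by simp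
  thus False using inj_onD[OF inj(3) _ mem] ne2 by blast
qed

end

section \<open>Fibres of a meromorphic function\<close>

text \<open>
  The punctured neighbourhoods of a point of the sphere, traced in the plane; finite points and infinity are then
  treated alike.
\<close>
definition sphere_at :: "riemann_sphere \<Rightarrow> complex filter" where
  "sphere_at x = (case x of None \<Rightarrow> at_infinity | Some c \<Rightarrow> at c)"

definition uniformizer :: "riemann_sphere \<Rightarrow> complex \<Rightarrow> complex" where
  "uniformizer x \<zeta> = (case x of None \<Rightarrow> inverse \<zeta> | Some c \<Rightarrow> \<zeta> - c)"

lemma sphere_at_simps [simp]: "sphere_at None = at_infinity" "sphere_at (Some c) = at c"
  by (simp_all add: sphere_at_def)

lemma uniformizer_simps [simp]: "uniformizer None \<zeta> = inverse \<zeta>" "uniformizer (Some c) \<zeta> = \<zeta> - c"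
  by (simp_all add: uniformizer_def)

lemma uniformizer_inj: "uniformizer x \<zeta> = uniformizer x \<eta> \<longleftrightarrow> \<zeta> = \<eta>"
  by (cases x) auto

lemma eventually_sphere_at_nonzero: "\<forall>\<^sub>F \<zeta> in sphere_at x. uniformizer x \<zeta> \<noteq> 0"
proof (cases x)
  case None
  have "\<forall>\<^sub>F \<zeta> in at_infinity. norm (\<zeta>::complex) \<ge> 1" unfolding eventually_at_infinity by blast
  hence "\<forall>\<^sub>F \<zeta> in at_infinity. \<zeta> \<noteq> (0::complex)" by eventually_elim auto
  thus ?thesis using None by simp
qed (auto simp: eventually_at_filter)

lemma tendsto_uniformizer: "(uniformizer x \<longlongrightarrow> 0) (sphere_at x)"
proof (cases x)
  case None
  thus ?thesis using tendsto_inverse_0 by (simp add: uniformizer_def[abs_def])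
next
  case (Some c)
  have "((\<lambda>\<zeta>. \<zeta> - c) \<longlongrightarrow> c - c) (at c)" by (intro tendsto_intros)
  thus ?thesis using Some by (simp add: uniformizer_def[abs_def])
qed

lemma sphere_at_neq_bot [simp]: "sphere_at x \<noteq> bot"
  using trivial_limit_at_infinity[where 'a = complex] by (cases x) simp_all

locale compact_surface = riemann_surface +
  assumes compact_surface: "compact (UNIV :: 'a set)" and connected_surface: "connected (UNIV :: 'a set)"

locale surface_map = compact_surface \<A> for \<A> :: "('a::t2_space) atlas" +
  fixes f :: "'a \<Rightarrow> complex"
  assumes f_mero: "meromorphic_function \<A> f"
    and f_nonconst: "\<not> (\<exists>c. \<forall>p. mero_value f p = c)"
begin

lemma f_avoids: "\<forall>\<^sub>F q in at p. f q \<noteq> c"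
proof -
  have "\<not> (\<forall>p. \<forall>\<^sub>F q in at p. f q = c)"
  proof
    assume *: "\<forall>p. \<forall>\<^sub>F q in at p. f q = c"
    have "mero_value f p = Some c" for p
      using * by (intro mero_valueI tendsto_eventually) auto
    thus False using f_nonconst by blast
  qed
  thus ?thesis using identity_dichotomy[OF f_mero connected_surface, of c] by blast
qed

definition fiber :: "riemann_sphere \<Rightarrow> 'a set" where
  "fiber x = {p. mero_value f p = x}"

abbreviation ram :: "'a \<Rightarrow> nat" where
  "ram p \<equiv> multiplicity_at \<A> f p"

lemma uniformizer_f_mero: "meromorphic_function \<A> (\<lambda>p. uniformizer x (f p))"
  using f_mero by (cases x) (auto intro!: meromorphic_function_ops)

lemma uniformizer_f_nonzero: "\<forall>\<^sub>F q in at p. uniformizer x (f q) \<noteq> 0"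
  using f_avoids[where c = "case x of None \<Rightarrow> 0 | Some c \<Rightarrow> c"] by (cases x) auto

lemma uniformizer_f_tendsto:
  assumes "p \<in> fiber x"
  shows "((\<lambda>q. uniformizer x (f q)) \<longlongrightarrow> 0) (at p)"
proof (cases x)
  case None
  hence "filterlim f at_infinity (at p)"
    using assms by (simp add: fiber_def mero_value_None_iff is_pole_def)
  thus ?thesis using None by (auto intro: filterlim_compose[OF tendsto_inverse_0])
next
  case (Some c)
  hence "(f \<longlongrightarrow> c) (at p)" using assms mero_value_Some_iff[OF f_mero] by (simp add: fiber_def)
  hence "((\<lambda>q. f q - c) \<longlongrightarrow> c - c) (at p)" by (intro tendsto_intros)
  thus ?thesis using Some by simp
qed

lemma ram_eq:
  assumes "p \<in> fiber x"
  shows "int (ram p) = mero_order \<A> (\<lambda>q. uniformizer x (f q)) p" "ram p > 0"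
proof -
  have pos: "mero_order \<A> (\<lambda>q. uniformizer x (f q)) p > 0"
    by (intro mero_order_pos uniformizer_f_mero uniformizer_f_tendsto[OF assms] uniformizer_f_nonzero)
  have "ram p = nat (mero_order \<A> (\<lambda>q. uniformizer x (f q)) p)"
  proof (cases x)
    case None
    have "mero_order \<A> (\<lambda>q. inverse (f q)) p = - mero_order \<A> f p"
      by (intro mero_order_inverse f_mero f_avoids)
    thus ?thesis using None assms by (simp add: multiplicity_at_def fiber_def)
  qed (use assms in \<open>simp add: multiplicity_at_def fiber_def\<close>)
  with pos show "int (ram p) = mero_order \<A> (\<lambda>q. uniformizer x (f q)) p" "ram p > 0" by auto
qed

lemma finite_fiber: "finite (fiber x)"
proof -
  have "\<exists>V. open V \<and> p \<in> V \<and> V \<inter> fiber x \<subseteq> {p}" for p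
  proof -
    have "\<forall>\<^sub>F q in at p. q \<notin> fiber x"
      using eventually_mero_value[OF f_mero, of p] f_avoids[of "case x of None \<Rightarrow> 0 | Some c \<Rightarrow> c" p]
      by eventually_elim (cases x; auto simp: fiber_def)
    thus ?thesis unfolding eventually_at_topological by blast
  qed
  then obtain V where V: "\<And>p. open (V p)" "\<And>p. p \<in> V p" "\<And>p. V p \<inter> fiber x \<subseteq> {p}" by metis
  have "UNIV \<subseteq> (\<Union>p\<in>UNIV. V p)" using V(2) by blast
  from compactE_image[OF compact_surface _ this] V(1) obtain C where C: "finite C" "UNIV \<subseteq> (\<Union>p\<in>C. V p)"
    by metis
  have "fiber x \<subseteq> C" using C(2) V(3) by blast
  thus ?thesis using C(1) finite_subset by blast
qed

text \<open>
  Near a point outside the fibre over \<open>x\<close> the values of \<open>f\<close> stay away from \<open>x\<close>. With compactness this confines the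
  fibres over nearby points to given neighbourhoods of the fibre over \<open>x\<close>.
\<close>
lemma fiber_avoids_neighbourhood:
  assumes "q \<notin> fiber x"
  shows "\<exists>V. open V \<and> q \<in> V \<and> (\<forall>\<^sub>F \<zeta> in sphere_at x. \<forall>q'\<in>V. mero_value f q' \<noteq> Some \<zeta>)"
proof -
  \<comment> \<open>It suffices to separate the values near \<open>q\<close> from \<open>x\<close> by some set \<open>Z\<close>.\<close>
  have reduce: ?thesis
    if Z: "\<forall>\<^sub>F \<zeta> in sphere_at x. \<zeta> \<notin> Z" "\<forall>\<^sub>F q' in at q. f q' \<in> Z" "\<And>\<zeta>. mero_value f q = Some \<zeta> \<Longrightarrow> \<zeta> \<in> Z" for Z
  proof -
    have "\<forall>\<^sub>F q' in at q. mero_value f q' = Some (f q') \<and> f q' \<in> Z"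
      using eventually_mero_value[OF f_mero, of q] Z(2) by eventually_elim auto
    then obtain V where V: "open V" "q \<in> V" "\<And>q'. q' \<in> V \<Longrightarrow> q' \<noteq> q \<Longrightarrow> mero_value f q' = Some (f q') \<and> f q' \<in> Z"
      unfolding eventually_at_topological by blast
    have "\<forall>\<^sub>F \<zeta> in sphere_at x. \<forall>q'\<in>V. mero_value f q' \<noteq> Some \<zeta>"
      using Z(1) by eventually_elim (use V(3) Z(3) in fastforce)
    thus ?thesis using V by blast
  qed
  show ?thesis
  proof (cases "mero_value f q")
    case None
    then obtain c where c: "x = Some c" using assms by (cases x) (auto simp: fiber_def)
    have "filterlim f at_infinity (at q)" using None by (simp add: mero_value_None_iff is_pole_def)
    hence "\<forall>\<^sub>F q' in at q. norm (f q') \<ge> norm c + 1"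
      using filterlim_at_infinity[of 0 f "at q"] by (simp add: add_nonneg_pos)
    moreover have "\<forall>\<^sub>F \<zeta> in at c. dist \<zeta> c < 1" unfolding eventually_at by (auto intro: exI[of _ 1])
    hence "\<forall>\<^sub>F \<zeta> in sphere_at x. \<zeta> \<notin> {\<zeta>. norm \<zeta> \<ge> norm c + 1}"
      unfolding c sphere_at_simps
    proof eventually_elim
      case (elim \<zeta>)
      thus ?case using norm_triangle_ineq2[of \<zeta> c] by (auto simp: dist_norm)
    qed
    ultimately show ?thesis using None by (intro reduce[of "{\<zeta>. norm \<zeta> \<ge> norm c + 1}"]) auto
  next
    case (Some d)
    hence lim: "(f \<longlongrightarrow> d) (at q)" by (simp add: mero_value_Some_iff[OF f_mero])
    show ?thesis
    proof (cases x)
      case None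
      have "\<forall>\<^sub>F q' in at q. dist (f q') d < 1" using lim by (rule tendstoD) simp
      moreover have "\<forall>\<^sub>F \<zeta> in at_infinity. norm (\<zeta>::complex) \<ge> norm d + 1" unfolding eventually_at_infinity by blast
      hence "\<forall>\<^sub>F \<zeta> in sphere_at x. \<zeta> \<notin> ball d 1"
        unfolding None sphere_at_simps
      proof eventually_elim
        case (elim \<zeta>)
        thus ?case using norm_triangle_ineq2[of \<zeta> d] by (auto simp: dist_norm norm_minus_commute)
      qed
      ultimately show ?thesis using Some by (intro reduce[of "ball d 1"]) (auto simp: dist_commute)
    next
      case x: (Some c)
      have cd: "c \<noteq> d" using x Some assms by (auto simp: fiber_def)
      define e where "e = dist c d / 2"
      have e: "e > 0" using cd by (simp add: e_def)
      have "\<forall>\<^sub>F q' in at q. dist (f q') d < e" using lim e by (rule tendstoD)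
      moreover have "\<forall>\<^sub>F \<zeta> in at c. dist \<zeta> c < e" unfolding eventually_at using e by auto
      hence "\<forall>\<^sub>F \<zeta> in sphere_at x. \<zeta> \<notin> ball d e"
        unfolding x sphere_at_simps
      proof eventually_elim
        case (elim \<zeta>)
        thus ?case using dist_triangle[of c d \<zeta>] by (auto simp: e_def dist_commute)
      qed
      ultimately show ?thesis using Some e by (intro reduce[of "ball d e"]) (auto simp: dist_commute)
    qed
  qed
qed

text \<open>
  Simultaneous parameters at the finitely many points over \<open>x\<close>, in which \<open>f\<close> is a power. The last
  clause says that near \<open>x\<close> the whole fibre is described by the roots of one number: it turns products over fibres into products over roots.
\<close>
definition fiber_chart :: "riemann_sphere \<Rightarrow> ('a \<Rightarrow> complex \<Rightarrow> 'a) \<Rightarrow> real \<Rightarrow> bool" where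
  "fiber_chart x \<sigma> r \<longleftrightarrow> r > 0 \<and> (\<forall>p\<in>fiber x. local_param p (\<sigma> p) r) \<and>
     (\<forall>p\<in>fiber x. \<forall>t\<in>ball 0 r - {0}. uniformizer x (f (\<sigma> p t)) = t ^ ram p) \<and>
     (\<forall>p\<in>fiber x. \<forall>q\<in>fiber x. p \<noteq> q \<longrightarrow> \<sigma> p ` ball 0 r \<inter> \<sigma> q ` ball 0 r = {}) \<and>
     (\<forall>\<^sub>F \<zeta> in sphere_at x. uniformizer x \<zeta> \<noteq> 0 \<and>
       (\<forall>p\<in>fiber x. {t. t ^ ram p = uniformizer x \<zeta>} \<subseteq> ball 0 r - {0}) \<and>
       fiber (Some \<zeta>) = (\<Union>p\<in>fiber x. \<sigma> p ` {t. t ^ ram p = uniformizer x \<zeta>}))"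

lemma fiber_chartD:
  assumes "fiber_chart x \<sigma> r"
  shows "r > 0" "\<And>p. p \<in> fiber x \<Longrightarrow> local_param p (\<sigma> p) r"
    "\<And>p t. p \<in> fiber x \<Longrightarrow> t \<in> ball 0 r - {0} \<Longrightarrow> uniformizer x (f (\<sigma> p t)) = t ^ ram p"
    "\<And>p q. p \<in> fiber x \<Longrightarrow> q \<in> fiber x \<Longrightarrow> p \<noteq> q \<Longrightarrow> \<sigma> p ` ball 0 r \<inter> \<sigma> q ` ball 0 r = {}"
    "\<forall>\<^sub>F \<zeta> in sphere_at x. uniformizer x \<zeta> \<noteq> 0 \<and>
       (\<forall>p\<in>fiber x. {t. t ^ ram p = uniformizer x \<zeta>} \<subseteq> ball 0 r - {0}) \<and>
       fiber (Some \<zeta>) = (\<Union>p\<in>fiber x. \<sigma> p ` {t. t ^ ram p = uniformizer x \<zeta>})"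
  using assms unfolding fiber_chart_def by blast+

text \<open>
  Power parameters with disjoint ranges exist because the surface is Hausdorff. That they eventually exhaust the
  fibre follows from compactness: the rest of the surface is covered by finitely many neighbourhoods
  that do not meet fibres over points near \<open>x\<close>.
\<close>
lemma fiber_chart_exists: "\<exists>\<sigma> r. fiber_chart x \<sigma> r"
proof -
  obtain W where W: "\<And>p. p \<in> fiber x \<Longrightarrow> open (W p) \<and> p \<in> W p"
    "\<And>p q. p \<in> fiber x \<Longrightarrow> q \<in> fiber x \<Longrightarrow> p \<noteq> q \<Longrightarrow> W p \<inter> W q = {}"
    using finite_disjoint_neighbourhoods[OF finite_fiber[of x]] by metis
  have "\<exists>\<sigma> r. local_param p \<sigma> r \<and> \<sigma> ` ball 0 r \<subseteq> W p \<and>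
      (\<forall>t\<in>ball 0 r - {0}. uniformizer x (f (\<sigma> t)) = t ^ ram p \<and> (f \<longlongrightarrow> f (\<sigma> t)) (at (\<sigma> t)))"
    if p: "p \<in> fiber x" for p
  proof -
    have "nat (mero_order \<A> (\<lambda>q. uniformizer x (f q)) p) = ram p" using ram_eq(1)[OF p] by simp
    then obtain \<sigma> r where \<sigma>: "local_param p \<sigma> r" "\<And>t. t \<in> ball 0 r - {0} \<Longrightarrow> uniformizer x (f (\<sigma> t)) = t ^ ram p"
      using local_param_exists[OF uniformizer_f_mero uniformizer_f_tendsto[OF p] uniformizer_f_nonzero] by metis
    have "\<forall>\<^sub>F q in at p. q \<in> W p \<and> (f \<longlongrightarrow> f q) (at q)"
      using eventually_tendsto_value[OF f_mero, of p] eventually_at_in_open'[of "W p" p] W(1)[OF p]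
      by (auto elim: eventually_elim2)
    hence "\<forall>\<^sub>F t in at 0. \<sigma> t \<in> W p \<and> (f \<longlongrightarrow> f (\<sigma> t)) (at (\<sigma> t))"
      by (simp add: eventually_local_param[OF \<sigma>(1)])
    then obtain d where d: "d > 0" "\<And>t. t \<noteq> 0 \<Longrightarrow> dist t 0 < d \<Longrightarrow> \<sigma> t \<in> W p \<and> (f \<longlongrightarrow> f (\<sigma> t)) (at (\<sigma> t))"
      unfolding eventually_at by auto
    define r' where "r' = min d r"
    have r': "0 < r'" "r' \<le> r" using d(1) local_paramD(1)[OF \<sigma>(1)] by (auto simp: r'_def)
    have "local_param p \<sigma> r'" by (rule local_param_shrink[OF \<sigma>(1) r'])
    moreover have "\<sigma> t \<in> W p" if "t \<in> ball 0 r'" for t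
      using d(2)[of t] that W(1)[OF p] local_paramD(2)[OF \<sigma>(1)] by (cases "t = 0") (auto simp: r'_def)
    moreover have "uniformizer x (f (\<sigma> t)) = t ^ ram p \<and> (f \<longlongrightarrow> f (\<sigma> t)) (at (\<sigma> t))" if "t \<in> ball 0 r' - {0}" for t
      using d(2)[of t] \<sigma>(2)[of t] that by (auto simp: r'_def)
    ultimately show ?thesis by blast
  qed
  then obtain \<sigma> rr where \<sigma>: "\<And>p. p \<in> fiber x \<Longrightarrow> local_param p (\<sigma> p) (rr p) \<and> \<sigma> p ` ball 0 (rr p) \<subseteq> W p \<and>
      (\<forall>t\<in>ball 0 (rr p) - {0}. uniformizer x (f (\<sigma> p t)) = t ^ ram p \<and> (f \<longlongrightarrow> f (\<sigma> p t)) (at (\<sigma> p t)))"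
    by metis
  define r where "r = Min (insert 1 (rr ` fiber x))"
  have fin: "finite (insert 1 (rr ` fiber x))" using finite_fiber by auto
  have rr: "rr p > 0" if "p \<in> fiber x" for p using \<sigma>[OF that] local_paramD(1) by blast
  have r0: "r > 0" unfolding r_def using fin rr by (subst Min_gr_iff) auto
  have rle: "r \<le> rr p" if "p \<in> fiber x" for p unfolding r_def using fin that by (intro Min_le) auto
  have sub: "ball 0 r \<subseteq> ball (0::complex) (rr p)" if "p \<in> fiber x" for p using rle[OF that] by (rule subset_ball)
  have P1: "local_param p (\<sigma> p) r" if "p \<in> fiber x" for p
    using local_param_shrink[of p "\<sigma> p" "rr p" r] \<sigma>[OF that] r0 rle[OF that] by blast
  have P2: "uniformizer x (f (\<sigma> p t)) = t ^ ram p" "(f \<longlongrightarrow> f (\<sigma> p t)) (at (\<sigma> p t))"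
    if "p \<in> fiber x" "t \<in> ball 0 r - {0}" for p t
    using \<sigma>[OF that(1)] sub[OF that(1)] that(2) by blast+
  have P3: "\<sigma> p ` ball 0 r \<inter> \<sigma> q ` ball 0 r = {}" if "p \<in> fiber x" "q \<in> fiber x" "p \<noteq> q" for p q
  proof -
    have "\<sigma> p ` ball 0 r \<subseteq> W p" "\<sigma> q ` ball 0 r \<subseteq> W q"
      using \<sigma>[OF that(1)] sub[OF that(1)] \<sigma>[OF that(2)] sub[OF that(2)] by blast+
    thus ?thesis using W(2)[OF that] by blast
  qed
  define C where "C = - (\<Union>p\<in>fiber x. \<sigma> p ` ball 0 r)"
  have "open (\<Union>p\<in>fiber x. \<sigma> p ` ball 0 r)" using P1 by (intro open_UN ballI local_paramD(5)[OF P1]) auto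
  hence "closed C" unfolding C_def by (rule closed_Compl)
  hence "compact (UNIV \<inter> C)" using compact_surface by (intro compact_Int_closed)
  hence compC: "compact C" by simp
  have notin: "q \<notin> fiber x" if "q \<in> C" for q
  proof
    assume q: "q \<in> fiber x"
    have "q \<in> \<sigma> q ` ball 0 r" using local_paramD(2)[OF P1[OF q]] r0 by (intro image_eqI[of _ _ 0]) auto
    thus False using that q by (auto simp: C_def)
  qed
  have "\<forall>q\<in>C. \<exists>V. open V \<and> q \<in> V \<and> (\<forall>\<^sub>F \<zeta> in sphere_at x. \<forall>q'\<in>V. mero_value f q' \<noteq> Some \<zeta>)"
    by (intro ballI fiber_avoids_neighbourhood notin)
  from bchoice[OF this] obtain V where V: "\<And>q. q \<in> C \<Longrightarrow> open (V q)" "\<And>q. q \<in> C \<Longrightarrow> q \<in> V q"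
    "\<And>q. q \<in> C \<Longrightarrow> \<forall>\<^sub>F \<zeta> in sphere_at x. \<forall>q'\<in>V q. mero_value f q' \<noteq> Some \<zeta>" by blast
  have "C \<subseteq> (\<Union>q\<in>C. V q)" using V(2) by blast
  from compactE_image[OF compC V(1) this] obtain C' where C': "C' \<subseteq> C" "finite C'" "C \<subseteq> (\<Union>q\<in>C'. V q)" by metis
  have "\<forall>\<^sub>F \<zeta> in sphere_at x. \<forall>q\<in>C'. \<forall>q'\<in>V q. mero_value f q' \<noteq> Some \<zeta>"
    using C'(1,2) V(3) by (intro eventually_ball_finite) auto
  hence evC: "\<forall>\<^sub>F \<zeta> in sphere_at x. \<forall>q\<in>C. mero_value f q \<noteq> Some \<zeta>"
    by eventually_elim (use C'(3) in blast)
  have evr: "\<forall>\<^sub>F \<zeta> in sphere_at x. \<forall>p\<in>fiber x. norm (uniformizer x \<zeta>) < r ^ ram p"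
  proof (intro eventually_ball_finite finite_fiber ballI)
    fix p
    have "\<forall>\<^sub>F \<zeta> in sphere_at x. dist (uniformizer x \<zeta>) 0 < r ^ ram p"
      using tendsto_uniformizer r0 by (intro tendstoD) auto
    thus "\<forall>\<^sub>F \<zeta> in sphere_at x. norm (uniformizer x \<zeta>) < r ^ ram p" by simp
  qed
  have P4: "\<forall>\<^sub>F \<zeta> in sphere_at x. uniformizer x \<zeta> \<noteq> 0 \<and>
       (\<forall>p\<in>fiber x. {t. t ^ ram p = uniformizer x \<zeta>} \<subseteq> ball 0 r - {0}) \<and>
       fiber (Some \<zeta>) = (\<Union>p\<in>fiber x. \<sigma> p ` {t. t ^ ram p = uniformizer x \<zeta>})"
    using evC evr eventually_sphere_at_nonzero[of x]
  proof eventually_elim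
    case (elim \<zeta>)
    have roots: "t \<in> ball 0 r - {0}" if "p \<in> fiber x" "t ^ ram p = uniformizer x \<zeta>" for p t
    proof -
      have "norm t ^ ram p < r ^ ram p" using elim(2) that by (metis norm_power)
      hence "norm t < r" using r0 by (auto dest!: power_less_imp_less_base)
      moreover have "t \<noteq> 0" using that elim(3) ram_eq(2)[OF that(1)] by (auto simp: zero_power)
      ultimately show ?thesis by simp
    qed
    have "fiber (Some \<zeta>) = (\<Union>p\<in>fiber x. \<sigma> p ` {t. t ^ ram p = uniformizer x \<zeta>})"
    proof (intro equalityI subsetI)
      fix q assume q: "q \<in> fiber (Some \<zeta>)"
      hence "q \<notin> C" using elim(1) by (auto simp: fiber_def)
      then obtain p t where p: "p \<in> fiber x" "t \<in> ball 0 r" "q = \<sigma> p t" by (auto simp: C_def)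
      have "t \<noteq> 0"
      proof
        assume "t = 0"
        hence "q = p" using p local_paramD(2)[OF P1[OF p(1)]] by simp
        hence "x = Some \<zeta>" using q p(1) by (auto simp: fiber_def)
        thus False using elim(3) by simp
      qed
      hence t: "t \<in> ball 0 r - {0}" using p(2) by simp
      have "mero_value f q = Some (f q)" using P2(2)[OF p(1) t] p(3) by (simp add: mero_valueI)
      hence "f (\<sigma> p t) = \<zeta>" using q p(3) by (simp add: fiber_def)
      hence "t ^ ram p = uniformizer x \<zeta>" using P2(1)[OF p(1) t] by simp
      thus "q \<in> (\<Union>p\<in>fiber x. \<sigma> p ` {t. t ^ ram p = uniformizer x \<zeta>})" using p by blast
    next
      fix q assume "q \<in> (\<Union>p\<in>fiber x. \<sigma> p ` {t. t ^ ram p = uniformizer x \<zeta>})"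
      then obtain p t where p: "p \<in> fiber x" "t ^ ram p = uniformizer x \<zeta>" "q = \<sigma> p t" by auto
      have t: "t \<in> ball 0 r - {0}" by (rule roots[OF p(1,2)])
      have "uniformizer x (f q) = uniformizer x \<zeta>" using P2(1)[OF p(1) t] p by simp
      hence "f q = \<zeta>" by (simp add: uniformizer_inj)
      thus "q \<in> fiber (Some \<zeta>)" using P2(2)[OF p(1) t] p(3) by (simp add: fiber_def mero_valueI)
    qed
    thus ?case using roots elim(3) by blast
  qed
  have "fiber_chart x \<sigma> r" unfolding fiber_chart_def using r0 P1 P2(1) P3 P4 by blast
  thus ?thesis by blast
qed

text \<open>
  Away from the centre of the parameter, \<open>t ^ m\<close> is locally injective.
\<close>
lemma ram_eq_1_nearby:
  "\<forall>\<^sub>F \<zeta> in sphere_at x. \<forall>q\<in>fiber (Some \<zeta>). ram q = 1"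
proof -
  obtain \<sigma> r where fc: "fiber_chart x \<sigma> r" using fiber_chart_exists by blast
  note P1 = fiber_chartD(2)[OF fc] and P2 = fiber_chartD(3)[OF fc] and P4 = fiber_chartD(5)[OF fc]
  from P4 show ?thesis
  proof eventually_elim
    case (elim \<zeta>)
    show ?case
    proof
      fix q assume q: "q \<in> fiber (Some \<zeta>)"
      then obtain p t where p: "p \<in> fiber x" "t ^ ram p = uniformizer x \<zeta>" "q = \<sigma> p t" using elim by blast
      hence t: "t \<in> ball 0 r - {0}" using elim by blast
      note lp = local_paramD[OF P1[OF p(1)]]
      obtain d where d: "d > 0" "ball t d \<subseteq> ball 0 r - {0}" "inj_on (\<lambda>x. x ^ ram p) (ball t d)"
        using power_locally_injective[of t "ram p" "ball 0 r - {0}"] t ram_eq(2)[OF p(1)] by auto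
      define V where "V = \<sigma> p ` ball t d"
      have V: "open V" "q \<in> V" using d(1,2) p(3) unfolding V_def by (auto intro!: lp(5))
      have "inj_on (\<lambda>q'. uniformizer (Some \<zeta>) (f q')) (V - {q})"
      proof (rule inj_onI)
        fix q1 q2 assume q12: "q1 \<in> V - {q}" "q2 \<in> V - {q}" and eq: "uniformizer (Some \<zeta>) (f q1) = uniformizer (Some \<zeta>) (f q2)"
        then obtain t1 t2 where t12: "t1 \<in> ball t d" "q1 = \<sigma> p t1" "t2 \<in> ball t d" "q2 = \<sigma> p t2" by (auto simp: V_def)
        have "f q1 = f q2" using eq by simp
        moreover have "t1 \<in> ball 0 r - {0}" "t2 \<in> ball 0 r - {0}" using d(2) t12(1,3) by blast+
        ultimately have "t1 ^ ram p = t2 ^ ram p"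
          using P2[OF p(1), of t1] P2[OF p(1), of t2] t12(2,4) by simp
        thus "q1 = q2" using inj_onD[OF d(3) _ t12(1,3)] t12 by simp
      qed
      hence "mero_order \<A> (\<lambda>q'. uniformizer (Some \<zeta>) (f q')) q = 1"
        by (intro mero_order_eq_1_if_injective[OF uniformizer_f_mero uniformizer_f_tendsto[OF q] uniformizer_f_nonzero V])
      thus "ram q = 1" using ram_eq(1)[OF q] by simp
    qed
  qed
qed

end

section \<open>Products over roots\<close>

definition nth_root_of :: "nat \<Rightarrow> complex \<Rightarrow> complex" where
  "nth_root_of m s = root m (norm s) * cis (Arg s / m)"

lemma bij_nth_roots:
  assumes "s \<noteq> 0" "m > 0"
  shows "bij_betw (\<lambda>\<omega>. nth_root_of m s * \<omega>) {\<omega>. \<omega> ^ m = 1} {t. t ^ m = s}"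
  unfolding nth_root_of_def using bij_betw_nth_root_unity[OF assms] by simp

lemma nth_root_of_power: 
  assumes "m > 0"
  shows "nth_root_of m s ^ m = s"
proof (cases "s = 0")
  case False
  have "nth_root_of m s * 1 \<in> {t. t ^ m = s}"
    by (rule bspec[OF bij_betwE[OF bij_nth_roots[OF False assms]]]) simp
  thus ?thesis by simp
qed (use assms in \<open>simp add: nth_root_of_def zero_power\<close>)

lemma eventually_roots:
  assumes "\<forall>\<^sub>F t in at 0. P t" "m > 0"
  shows "\<forall>\<^sub>F s in at (0::complex). \<forall>t. t ^ m = s \<longrightarrow> P t"
proof -
  obtain d where d: "d > 0" "\<And>t::complex. t \<noteq> 0 \<Longrightarrow> dist t 0 < d \<Longrightarrow> P t"
    using assms(1) unfolding eventually_at by auto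
  show ?thesis unfolding eventually_at
  proof (intro exI[of _ "d ^ m"] conjI ballI impI allI)
    show "d ^ m > 0" using d(1) by simp
    fix s t :: complex assume s: "s \<noteq> 0 \<and> dist s 0 < d ^ m" and t: "t ^ m = s"
    have "norm t ^ m < d ^ m" using s t by (simp flip: norm_power)
    hence "norm t < d" using d(1) by (auto dest!: power_less_imp_less_base)
    moreover have "t \<noteq> 0" using s t assms(2) by (auto simp: zero_power)
    ultimately show "P t" using d(2)[of t] by simp
  qed
qed

text \<open>
  All \<open>m\<close> roots of \<open>s\<close> tend to zero with \<open>s\<close>, and each factor then tends to \<open>l\<close>.
\<close>
lemma tendsto_prod_roots:
  fixes \<phi> :: "complex \<Rightarrow> complex"
  assumes lim: "(\<phi> \<longlongrightarrow> l) (at 0)" and m: "m > 0"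
  shows "((\<lambda>s. \<Prod>t | t ^ m = s. \<phi> t) \<longlongrightarrow> l ^ m) (at 0)"
proof -
  have fin: "finite {\<omega>::complex. \<omega> ^ m = 1}" using m by (rule finite_nth_roots)
  have root0: "((\<lambda>s. nth_root_of m s * \<omega>) \<longlongrightarrow> 0) (at 0)" for \<omega>
  proof (rule tendsto_norm_zero_cancel)
    have "((\<lambda>s::complex. root m (norm s) * norm \<omega>) \<longlongrightarrow> root m (norm (0::complex)) * norm \<omega>) (at 0)"
      by (intro tendsto_intros)
    thus "((\<lambda>s. norm (nth_root_of m s * \<omega>)) \<longlongrightarrow> 0) (at 0)"
      using m by (simp add: nth_root_of_def norm_mult abs_of_nonneg)
  qed
  have "((\<lambda>s. \<Prod>\<omega> | \<omega> ^ m = 1. \<phi> (nth_root_of m s * \<omega>)) \<longlongrightarrow> (\<Prod>\<omega> | (\<omega>::complex) ^ m = 1. l)) (at 0)"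
  proof (intro tendsto_prod)
    fix \<omega> :: complex assume "\<omega> \<in> {\<omega>. \<omega> ^ m = 1}"
    hence w: "\<omega> \<noteq> 0" using m by (auto simp: zero_power)
    have ne: "\<forall>\<^sub>F s in at 0. nth_root_of m s * \<omega> \<noteq> 0"
    proof -
      have "\<forall>\<^sub>F s::complex in at 0. s \<noteq> 0" by (simp add: eventually_at_filter)
      thus ?thesis by eventually_elim (use w m nth_root_of_power[OF m] in \<open>auto simp: nth_root_of_def\<close>)
    qed
    have "filterlim (\<lambda>s. nth_root_of m s * \<omega>) (at 0) (at 0)"
      using root0 ne by (rule filterlim_atI)
    thus "((\<lambda>s. \<phi> (nth_root_of m s * \<omega>)) \<longlongrightarrow> l) (at 0)" by (rule filterlim_compose[OF lim])
  qed
  also have "(\<Prod>\<omega> | (\<omega>::complex) ^ m = 1. l) = l ^ m" using m by (simp add: card_roots_unity_eq)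
  finally show ?thesis
  proof (rule Lim_transform_eventually)
    have "\<forall>\<^sub>F s::complex in at 0. s \<noteq> 0" by (simp add: eventually_at_filter)
    thus "\<forall>\<^sub>F s in at 0. (\<Prod>\<omega> | \<omega> ^ m = 1. \<phi> (nth_root_of m s * \<omega>)) = (\<Prod>t | t ^ m = s. \<phi> t)"
      by eventually_elim (rule prod.reindex_bij_betw[OF bij_nth_roots[OF _ m]])
  qed
qed

text \<open>
  The product of the roots of \<open>s\<close> is \<open>s\<close> up to a constant of modulus one, so a zero of order \<open>k\<close> upstairs contributes
  a zero of order \<open>k\<close> downstairs, whatever the ramification.
\<close>
lemma prod_roots_power_int:
  fixes k :: int
  assumes m: "m > 0"
  obtains W :: complex where "W \<noteq> 0" "\<And>s. s \<noteq> 0 \<Longrightarrow> (\<Prod>t | t ^ m = s. t powi k) = W * s powi k" "k = 0 \<Longrightarrow> W = 1"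
proof
  let ?W = "(\<Prod>\<omega>::complex | \<omega> ^ m = 1. \<omega> powi k)"
  have fin: "finite {\<omega>::complex. \<omega> ^ m = 1}" using m by (rule finite_nth_roots)
  show "?W \<noteq> 0" using fin m by (auto simp: power_int_eq_0_iff zero_power)
  show "?W = 1" if "k = 0" using that by simp
  show "(\<Prod>t | t ^ m = s. t powi k) = ?W * s powi k" if s: "s \<noteq> 0" for s :: complex
  proof -
    have "(\<Prod>t | t ^ m = s. t powi k) = (\<Prod>\<omega>::complex | \<omega> ^ m = 1. (nth_root_of m s * \<omega>) powi k)"
      by (rule prod.reindex_bij_betw[OF bij_nth_roots[OF s m], symmetric])
    also have "\<dots> = (\<Prod>\<omega>::complex | \<omega> ^ m = 1. nth_root_of m s powi k) * ?W"
      by (simp add: power_int_mult_distrib prod.distrib)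
    also have "(\<Prod>\<omega>::complex | \<omega> ^ m = 1. nth_root_of m s powi k) = (nth_root_of m s powi k) ^ m"
      using m by (simp add: card_roots_unity_eq)
    also have "\<dots> = (nth_root_of m s ^ m) powi k"
      by (simp add: power_int_power' power_int_power mult.commute)
    finally show ?thesis using nth_root_of_power[OF m, of s] by (simp add: mult.commute)
  qed
qed

section \<open>The double and its reflection\<close>

lemma filtermap_cnj_at: "filtermap cnj (at a) = at (cnj a)"
proof -
  have "filterlim cnj (at (cnj b)) (at b)" for b
    unfolding filterlim_at by (auto intro!: tendsto_intros simp: eventually_at_filter)
  from this[of a] this[of "cnj a"] show ?thesis
    by (intro antisym) (auto simp: filterlim_def filtermap_filtermap dest: filtermap_mono[of _ _ cnj])
qed

lemma cnj_meromorphic_at: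
  assumes "g meromorphic_on {cnj a}"
  shows "(\<lambda>x. cnj (g (cnj x))) meromorphic_on {a}"
proof -
  have cnj_at: "filtermap cnj (at a) = at (cnj a)" for a by (rule filtermap_cnj_at)
  from assms have iso: "isolated_singularity_at g (cnj a)" and ne: "not_essential g (cnj a)"
    by (auto simp: meromorphic_at_iff)
  obtain r where r: "r > 0" "g analytic_on ball (cnj a) r - {cnj a}"
    using iso by (auto simp: isolated_singularity_at_def)
  have op: "open (ball a r - {a})" by auto
  have "cnj ` (ball a r - {a}) \<subseteq> ball (cnj a) r - {cnj a}"
    by (auto simp: dist_norm simp flip: complex_cnj_diff)
  hence "g holomorphic_on cnj ` (ball a r - {a})"
    using analytic_imp_holomorphic[OF r(2)] holomorphic_on_subset by blast
  hence "cnj \<circ> g \<circ> cnj holomorphic_on (ball a r - {a})"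
    using op by (rule holomorphic_on_compose_cnj_cnj)
  hence "(\<lambda>x. cnj (g (cnj x))) analytic_on ball a r - {a}"
    using op by (simp add: analytic_on_open o_def)
  hence "isolated_singularity_at (\<lambda>x. cnj (g (cnj x))) a"
    using r(1) by (auto simp: isolated_singularity_at_def)
  moreover have "not_essential (\<lambda>x. cnj (g (cnj x))) a"
  proof (cases "is_pole g (cnj a)")
    case True
    hence "filterlim g at_infinity (filtermap cnj (at a))" by (simp add: is_pole_def cnj_at)
    hence "filterlim (\<lambda>x. g (cnj x)) at_infinity (at a)" by (simp add: filterlim_def filtermap_filtermap)
    hence "is_pole (\<lambda>x. cnj (g (cnj x))) a"
      by (simp add: is_pole_def filterlim_at_infinity_conv_norm_at_top)
    thus ?thesis by (simp add: not_essential_def)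
  next
    case False
    then obtain l where "(g \<longlongrightarrow> l) (at (cnj a))" using ne by (auto simp: not_essential_def)
    hence "filterlim g (nhds l) (filtermap cnj (at a))" by (simp add: cnj_at)
    hence "((\<lambda>x. g (cnj x)) \<longlongrightarrow> l) (at a)" by (simp add: filterlim_def filtermap_filtermap)
    hence "((\<lambda>x. cnj (g (cnj x))) \<longlongrightarrow> cnj l) (at a)" by (rule tendsto_cnj)
    thus ?thesis by (auto simp: not_essential_def)
  qed
  ultimately show ?thesis by (simp add: meromorphic_at_iff)
qed

locale algebraic_domain =
  fixes \<A> :: "('a::t2_space) atlas" and J :: "'a \<Rightarrow> 'a" and Mp :: "'a set" and f :: "'a \<Rightarrow> complex"
  assumes dom: "multi_sheeted_algebraic_domain \<A> J Mp f"

sublocale algebraic_domain \<subseteq> surface_map \<A> f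
  using dom by unfold_locales
    (auto simp: multi_sheeted_algebraic_domain_def compact_riemann_surface_def)

context algebraic_domain
begin

abbreviation Mm :: "'a set" where "Mm \<equiv> J ` Mp"
abbreviation \<Gamma> :: "'a set" where "\<Gamma> \<equiv> fixed_points J"
abbreviation fs :: "'a \<Rightarrow> complex" where "fs \<equiv> conj_reflection J f"

lemma J_J [simp]: "J (J p) = p"
  using dom unfolding multi_sheeted_algebraic_domain_def anticonformal_involution_def
  by (metis comp_apply id_apply)

lemma J_cont: "continuous_on UNIV J"
  using dom unfolding multi_sheeted_algebraic_domain_def anticonformal_involution_def by blast

lemma filtermap_J: "filtermap J (at p) = at (J p)"
proof -
  have le: "filtermap J (at q) \<le> at (J q)" for q
  proof -
    have "filterlim J (at (J q)) (at q)"
    proof (rule filterlim_atI)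
      show "(J \<longlongrightarrow> J q) (at q)" using J_cont by (simp add: continuous_on_def)
      have "J q' \<noteq> J q" if "q' \<noteq> q" for q' using that J_J by metis
      thus "\<forall>\<^sub>F q' in at q. J q' \<noteq> J q" by (simp add: eventually_at_filter)
    qed
    thus ?thesis by (simp add: filterlim_def)
  qed
  have "at (J p) = filtermap J (filtermap J (at (J p)))" by (simp add: filtermap_filtermap)
  also have "\<dots> \<le> filtermap J (at p)" using filtermap_mono[OF le[of "J p"], of J] by simp
  finally show ?thesis using le by (rule antisym[rotated])
qed

lemma filterlim_J: "filterlim (\<lambda>q. g (J q)) F (at p) \<longleftrightarrow> filterlim g F (at (J p))"
  unfolding filtermap_J[symmetric] by (simp add: filterlim_def filtermap_filtermap)

lemma eventually_J: "eventually (\<lambda>q. P (J q)) (at p) \<longleftrightarrow> eventually P (at (J p))"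
  unfolding filtermap_J[symmetric] by (simp add: eventually_filtermap)

lemma conj_reflection_meromorphic:
  assumes "meromorphic_function \<A> g"
  shows "meromorphic_function \<A> (conj_reflection J g)"
  unfolding meromorphic_function_def
proof (safe, subst meromorphic_on_meromorphic_at, safe)
  fix U \<phi> p assume U: "(U, \<phi>) \<in> \<A>" and p: "p \<in> U"
  define V where "V = chart_dom (J p)"
  define \<psi> where "\<psi> = coord (J p)"
  have V: "(V, \<psi>) \<in> \<A>" "J p \<in> V" unfolding V_def \<psi>_def by (rule chart_at)+
  let ?D = "\<phi> ` (U \<inter> J -` V)"
  let ?A = "\<lambda>x. cnj (\<psi> (J (inv_into U \<phi> x)))"
  have opJ: "open (J -` V)" using J_cont continuous_on_open_vimage[of UNIV J] chart_props(1)[OF V(1)] by auto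
  have D: "open ?D" "\<phi> p \<in> ?D"
    using chart_open_map(1)[OF U, of "U \<inter> J -` V"] chart_props(1)[OF U] opJ p V(2) by auto
  have "anticonformal_involution \<A> J" using dom by (simp add: multi_sheeted_algebraic_domain_def)
  hence "(cnj \<circ> \<psi> \<circ> J \<circ> inv_into U \<phi>) holomorphic_on ?D"
    unfolding anticonformal_involution_def using U V(1) by blast
  hence A: "?A analytic_on ?D" using D(1) by (simp add: analytic_on_open o_def)
  have m: "(\<lambda>x. cnj ((g \<circ> inv_into V \<psi>) (cnj x))) meromorphic_on cnj ` (\<psi> ` V)"
  proof (subst meromorphic_on_meromorphic_at, safe)
    fix v assume "v \<in> V"
    hence "(g \<circ> inv_into V \<psi>) meromorphic_on {cnj (cnj (\<psi> v))}"
      by (intro meromorphic_on_subset[OF meromorphic_chart[OF assms V(1)]]) auto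
    thus "(\<lambda>x. cnj ((g \<circ> inv_into V \<psi>) (cnj x))) meromorphic_on {cnj (\<psi> v)}"
      by (rule cnj_meromorphic_at)
  qed
  have AD: "?A ` ?D \<subseteq> cnj ` (\<psi> ` V)" using chart_inverse[OF U] by auto
  have "(\<lambda>x. cnj ((g \<circ> inv_into V \<psi>) (cnj (?A x)))) meromorphic_on ?D"
    by (rule meromorphic_on_compose[OF m A AD])
  also have "?this \<longleftrightarrow> (conj_reflection J g \<circ> inv_into U \<phi>) meromorphic_on ?D"
  proof (rule meromorphic_on_cong[OF _ refl])
    fix x assume x: "x \<in> ?D"
    have "\<forall>\<^sub>F y in at x. y \<in> ?D" using D(1) x by (rule eventually_at_in_open')
    thus "\<forall>\<^sub>F y in at x. cnj ((g \<circ> inv_into V \<psi>) (cnj (?A y))) = (conj_reflection J g \<circ> inv_into U \<phi>) y"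
      by eventually_elim (auto simp: conj_reflection_def chart_inverse[OF U] chart_inverse[OF V(1)])
  qed
  finally show "(conj_reflection J g \<circ> inv_into U \<phi>) meromorphic_on {\<phi> p}"
    by (rule meromorphic_on_subset) (use D in auto)
qed

lemma fs_mero: "meromorphic_function \<A> fs"
  by (rule conj_reflection_meromorphic[OF f_mero])

lemma mero_value_fs: "mero_value fs p = map_option cnj (mero_value f (J p))"
proof (cases "mero_value f (J p)")
  case None
  hence "filterlim (\<lambda>q. f (J q)) at_infinity (at p)"
    by (simp add: filterlim_J mero_value_None_iff is_pole_def)
  hence "is_pole fs p"
    by (simp add: is_pole_def conj_reflection_def filterlim_at_infinity_conv_norm_at_top)
  thus ?thesis using None by (simp add: mero_value_poleI)
next
  case (Some l)
  hence "((\<lambda>q. f (J q)) \<longlongrightarrow> l) (at p)" by (simp add: filterlim_J mero_value_Some_iff[OF f_mero])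
  hence "((\<lambda>q. cnj (f (J q))) \<longlongrightarrow> cnj l) (at p)" by (rule tendsto_cnj)
  thus ?thesis using Some by (simp add: conj_reflection_def mero_valueI)
qed

lemma fs_avoids: "\<forall>\<^sub>F q in at p. fs q \<noteq> c"
proof -
  have "\<forall>\<^sub>F q in at (J p). f q \<noteq> cnj c" by (rule f_avoids)
  hence "\<forall>\<^sub>F q in at p. f (J q) \<noteq> cnj c" by (subst eventually_J)
  thus ?thesis by eventually_elim (auto simp: conj_reflection_def)
qed

text \<open>
  The set of fixed points is closed as the surface is Hausdorff, and the two components of its complement
  are open because there are only finitely many components.
\<close>
lemma domain_partition:
  shows "open Mp" "open Mm" "Mp \<inter> Mm = {}" "Mp \<inter> \<Gamma> = {}" "Mm \<inter> \<Gamma> = {}" "Mp \<union> Mm \<union> \<Gamma> = UNIV"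
proof -
  have comp: "components (UNIV - \<Gamma>) = {Mp, Mm}" "Mp \<noteq> Mm"
    using dom by (auto simp: multi_sheeted_algebraic_domain_def)
  have \<Gamma>: "closed \<Gamma>" unfolding fixed_points_def
    using closed_Collect_eq[of J "\<lambda>p. p"] J_cont by simp
  have un: "Mp \<union> Mm = UNIV - \<Gamma>" using Union_components[of "UNIV - \<Gamma>"] comp(1) by simp
  show dis: "Mp \<inter> Mm = {}" using components_nonoverlap[of Mp "UNIV - \<Gamma>" Mm] comp by auto
  show "Mp \<inter> \<Gamma> = {}" "Mm \<inter> \<Gamma> = {}" "Mp \<union> Mm \<union> \<Gamma> = UNIV" using un by auto
  have op: "open X" if X: "X \<in> {Mp, Mm}" "Y \<in> {Mp, Mm}" "X \<union> Y = UNIV - \<Gamma>" "X \<inter> Y = {}" for X Y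
  proof -
    have "closedin (top_of_set (UNIV - \<Gamma>)) Y" using closedin_component comp(1) X(2) by blast
    then obtain T where T: "closed T" "Y = (UNIV - \<Gamma>) \<inter> T" unfolding closedin_closed by blast
    have "X = - \<Gamma> \<inter> - T" using X T by blast
    thus ?thesis using \<Gamma> T(1) by (auto simp: open_Compl)
  qed
  show "open Mp" "open Mm" using op[of Mp Mm] op[of Mm Mp] un dis by auto
qed

lemma J_Mp_iff: "J p \<in> Mm \<longleftrightarrow> p \<in> Mp" "J p \<in> Mp \<longleftrightarrow> p \<in> Mm"
proof -
  have "inj J" by (metis J_J injI)
  thus *: "J p \<in> Mm \<longleftrightarrow> p \<in> Mp" for p by (rule inj_image_mem_iff)
  show "J p \<in> Mp \<longleftrightarrow> p \<in> Mm" using *[of "J p"] by simp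
qed

end

text \<open>
  A logarithmic derivative has at most simple poles.
\<close>
lemma logderiv_bound_at_singularity:
  fixes g :: "complex \<Rightarrow> complex"
  assumes mero: "g meromorphic_on {a}" and nz: "\<forall>\<^sub>F t in at a. g t \<noteq> 0"
  shows "\<exists>A. \<forall>\<^sub>F t in at a. g analytic_on {t} \<and> g t \<noteq> 0 \<and> norm ((t - a) * (deriv g t / g t)) \<le> A"
proof -
  have iso: "isolated_singularity_at g a" "not_essential g a" using mero by (auto simp: meromorphic_at_iff)
  have "\<exists>\<^sub>F t in at a. g t \<noteq> 0" using nz by (intro eventually_frequently) auto
  from zorder_exist[OF iso this] obtain h k r where h0: "h a \<noteq> 0" and r: "r > 0" "h holomorphic_on cball a r"
    and gh: "\<And>t. t \<in> cball a r - {a} \<Longrightarrow> g t = h t * (t - a) powi k \<and> h t \<noteq> 0" by blast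
  have hb: "h holomorphic_on ball a r" using r(2) by (rule holomorphic_on_subset) auto
  have cont: "isCont (\<lambda>t. (t - a) * (deriv h t / h t)) a"
  proof -
    have "(\<lambda>t. (t - a) * (deriv h t / h t)) holomorphic_on ball a r"
      using gh h0 by (intro holomorphic_intros holomorphic_deriv hb) (auto, metis DiffI insert_iff mem_cball less_imp_le singletonD)
    hence "continuous_on (ball a r) (\<lambda>t. (t - a) * (deriv h t / h t))"
      by (rule holomorphic_on_imp_continuous_on)
    thus ?thesis using r(1) by (simp add: continuous_on_eq_continuous_at)
  qed
  hence "((\<lambda>t. norm ((t - a) * (deriv h t / h t))) \<longlongrightarrow> 0) (at a)"
    using tendsto_norm[OF isContD[OF cont]] by simp
  hence "\<forall>\<^sub>F t in at a. norm ((t - a) * (deriv h t / h t)) < 1" by (rule order_tendstoD) simp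
  moreover have "\<forall>\<^sub>F t in at a. t \<in> ball a r - {a}" using r(1) by (intro eventually_at_in_open) auto
  ultimately have "\<forall>\<^sub>F t in at a. g analytic_on {t} \<and> g t \<noteq> 0 \<and> norm ((t - a) * (deriv g t / g t)) \<le> 1 + norm (of_int k :: complex)"
  proof eventually_elim
    case (elim t)
    have t: "t \<noteq> a" "t \<in> ball a r" "t \<in> cball a r - {a}" using elim by auto
    have op: "open (ball a r - {a})" by auto
    have hol: "(\<lambda>t. h t * (t - a) powi k) holomorphic_on ball a r - {a}"
      by (intro holomorphic_intros holomorphic_on_subset[OF hb]) auto
    have "\<forall>\<^sub>F s in nhds t. s \<in> ball a r - {a}" using elim op by (intro eventually_nhds_in_open) auto
    hence ev: "\<forall>\<^sub>F s in nhds t. h s * (s - a) powi k = g s"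
      by eventually_elim (use gh in auto)
    have "(\<lambda>t. h t * (t - a) powi k) analytic_on {t}"
      using hol op elim by (auto simp: analytic_on_open[symmetric] intro: analytic_on_subset)
    hence an: "g analytic_on {t}" using analytic_at_cong[OF ev refl] by simp
    have "(h has_field_derivative deriv h t) (at t)" using hb t(2) by (intro holomorphic_derivI) auto
    hence "((\<lambda>t. h t * (t - a) powi k) has_field_derivative
        deriv h t * (t - a) powi k + h t * (of_int k * (t - a) powi (k - 1))) (at t)"
      using t(1) by (auto intro!: derivative_eq_intros)
    hence "deriv (\<lambda>t. h t * (t - a) powi k) t = deriv h t * (t - a) powi k + h t * (of_int k * (t - a) powi (k - 1))"
      by (rule DERIV_imp_deriv)
    also have "deriv (\<lambda>t. h t * (t - a) powi k) t = deriv g t"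
      using ev by (intro deriv_cong_ev) auto
    finally have dg: "deriv g t = deriv h t * (t - a) powi k + h t * (of_int k * ((t - a) powi k / (t - a)))"
      using t(1) by (simp add: power_int_diff)
    have alg: "d * ((h' * P + H * (K * (P / d))) / (H * P)) = d * (h' / H) + K"
      if "d \<noteq> 0" "P \<noteq> 0" "H \<noteq> 0" for d h' P H K :: complex
      using that by (simp add: field_simps)
    have "(t - a) * (deriv g t / g t) = (t - a) * (deriv h t / h t) + of_int k"
      unfolding dg using gh[OF t(3)] t(1) alg[of "t - a" "(t - a) powi k" "h t" "deriv h t" "of_int k"]
      by (simp add: power_int_eq_0_iff)
    moreover have "norm ((t - a) * (deriv h t / h t) + of_int k) \<le> norm ((t - a) * (deriv h t / h t)) + norm (of_int k :: complex)"
      by (rule norm_triangle_ineq)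
    ultimately show ?case using elim an gh[OF t(3)] t(1) by (auto simp: power_int_eq_0_iff)
  qed
  thus ?thesis by blast
qed

context riemann_surface
begin

text \<open>
  The order is characterized by the number of nearby solutions of \<open>u q = s\<close>. This description mentions no charts, so
  it can be transported by the anticonformal map \<open>J\<close>.
\<close>
lemma local_count:
  assumes u: "meromorphic_function \<A> u" "(u \<longlongrightarrow> 0) (at p)" "\<forall>\<^sub>F q in at p. u q \<noteq> 0"
  shows "\<exists>V0. open V0 \<and> p \<in> V0 \<and> (\<forall>V. open V \<longrightarrow> p \<in> V \<longrightarrow> V \<subseteq> V0 \<longrightarrow>
           (\<forall>\<^sub>F s in at 0. card {q \<in> V - {p}. u q = s} = nat (mero_order \<A> u p)))"
proof -
  define m where "m = nat (mero_order \<A> u p)"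
  have m: "m > 0" using mero_order_pos[OF u] by (simp add: m_def)
  obtain \<sigma> r where \<sigma>: "local_param p \<sigma> r" "\<And>t. t \<in> ball 0 r - {0} \<Longrightarrow> u (\<sigma> t) = t ^ m"
    using local_param_exists[OF u] unfolding m_def by blast
  note lp = local_paramD[OF \<sigma>(1)]
  show ?thesis
  proof (intro exI[of _ "\<sigma> ` ball 0 r"] conjI allI impI)
    show "open (\<sigma> ` ball 0 r)" by (intro lp(5)) auto
    show "p \<in> \<sigma> ` ball 0 r" using lp(1,2) by (intro image_eqI[of _ _ 0]) auto
    fix V assume V: "open V" "p \<in> V" "V \<subseteq> \<sigma> ` ball 0 r"
    have "open (ball 0 r \<inter> \<sigma> -` V)" using lp(4) V(1) by (intro continuous_open_preimage) auto
    moreover have "0 \<in> ball 0 r \<inter> \<sigma> -` V" using V(2) lp(1,2) by auto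
    ultimately have "\<forall>\<^sub>F t in at 0. t \<in> ball 0 r \<inter> \<sigma> -` V" by (rule eventually_at_in_open')
    hence "\<forall>\<^sub>F s in at 0. \<forall>t. t ^ m = s \<longrightarrow> t \<in> ball 0 r \<inter> \<sigma> -` V" using m by (rule eventually_roots)
    moreover have "\<forall>\<^sub>F s in at (0::complex). s \<noteq> 0" by (simp add: eventually_at_filter)
    ultimately show "\<forall>\<^sub>F s in at 0. card {q \<in> V - {p}. u q = s} = nat (mero_order \<A> u p)"
    proof eventually_elim
      case (elim s)
      have "{q \<in> V - {p}. u q = s} = \<sigma> ` {t. t ^ m = s}"
      proof (intro equalityI subsetI)
        fix q assume q: "q \<in> {q \<in> V - {p}. u q = s}"
        then obtain t where t: "t \<in> ball 0 r" "q = \<sigma> t" using V(3) by auto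
        have "t \<noteq> 0" using q t(2) lp(2) by auto
        thus "q \<in> \<sigma> ` {t. t ^ m = s}" using \<sigma>(2)[of t] t q by auto
      next
        fix q assume "q \<in> \<sigma> ` {t. t ^ m = s}"
        then obtain t where t: "t ^ m = s" "q = \<sigma> t" by auto
        have tb: "t \<in> ball 0 r" "\<sigma> t \<in> V" using elim(1) t(1) by auto
        have "t \<noteq> 0" using t(1) elim(2) m by (auto simp: zero_power)
        moreover have "\<sigma> t \<noteq> \<sigma> 0" using \<open>t \<noteq> 0\<close> tb lp(1) inj_onD[OF lp(3), of t 0] by auto
        ultimately show "q \<in> {q \<in> V - {p}. u q = s}" using t tb \<sigma>(2)[of t] lp(2) by auto
      qed
      moreover have "inj_on \<sigma> {t. t ^ m = s}" using elim(1) by (intro inj_on_subset[OF lp(3)]) auto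
      ultimately have "card {q \<in> V - {p}. u q = s} = card {t. t ^ m = s}" by (simp add: card_image)
      also have "\<dots> = m" using elim(2) m by (rule card_nth_roots)
      finally show ?case by (simp add: m_def)
    qed
  qed
qed

end

context algebraic_domain
begin

text \<open>
  Both orders count the nearby solutions of an equation, and \<open>J\<close> is a bijection between these solutions; no comparison of
  charts is necessary.
\<close>
lemma mero_order_conj_reflection:
  assumes u: "meromorphic_function \<A> u" "(u \<longlongrightarrow> 0) (at (J p))" "\<forall>\<^sub>F q in at (J p). u q \<noteq> 0"
  shows "mero_order \<A> (conj_reflection J u) p = mero_order \<A> u (J p)"
proof -
  let ?v = "conj_reflection J u"
  have "((\<lambda>q. u (J q)) \<longlongrightarrow> 0) (at p)" using u(2) by (simp add: filterlim_J)
  hence "((\<lambda>q. cnj (u (J q))) \<longlongrightarrow> cnj 0) (at p)" by (rule tendsto_cnj)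
  hence v2: "(?v \<longlongrightarrow> 0) (at p)" by (simp add: conj_reflection_def)
  have "\<forall>\<^sub>F q in at p. u (J q) \<noteq> 0" using u(3) by (subst eventually_J)
  hence v3: "\<forall>\<^sub>F q in at p. ?v q \<noteq> 0" by (simp add: conj_reflection_def)
  note v = conj_reflection_meromorphic[OF u(1)] v2 v3
  obtain V0 where V0: "open V0" "p \<in> V0" "\<And>V. open V \<Longrightarrow> p \<in> V \<Longrightarrow> V \<subseteq> V0 \<Longrightarrow>
           (\<forall>\<^sub>F s in at 0. card {q \<in> V - {p}. ?v q = s} = nat (mero_order \<A> ?v p))"
    using local_count[OF v] by blast
  obtain V1 where V1: "open V1" "J p \<in> V1" "\<And>V. open V \<Longrightarrow> J p \<in> V \<Longrightarrow> V \<subseteq> V1 \<Longrightarrow>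
           (\<forall>\<^sub>F s in at 0. card {q \<in> V - {J p}. u q = s} = nat (mero_order \<A> u (J p)))"
    using local_count[OF u] by blast
  have opJ: "open (J -` S)" if "open S" for S using J_cont continuous_on_open_vimage[of UNIV J] that by auto
  have Jim: "J ` S = J -` S" for S by (auto simp: image_iff) (metis J_J)
  define V where "V = V0 \<inter> J -` V1"
  have V: "open V" "p \<in> V" "V \<subseteq> V0" using V0 V1 opJ by (auto simp: V_def)
  have JV: "open (J ` V)" "J p \<in> J ` V" "J ` V \<subseteq> V1" using V opJ by (auto simp: Jim) (auto simp: V_def)
  have e1: "\<forall>\<^sub>F s in at 0. card {q \<in> V - {p}. ?v q = s} = nat (mero_order \<A> ?v p)" by (rule V0(3)[OF V])
  have "\<forall>\<^sub>F s in at (cnj 0). card {q \<in> J ` V - {J p}. u q = s} = nat (mero_order \<A> u (J p))"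
    using V1(3)[OF JV] by simp
  hence e2: "\<forall>\<^sub>F s in at 0. card {q \<in> J ` V - {J p}. u q = cnj s} = nat (mero_order \<A> u (J p))"
    unfolding filtermap_cnj_at[symmetric] by (simp add: eventually_filtermap)
  have inj: "inj J" by (metis J_J injI)
  have "card {q \<in> V - {p}. ?v q = s} = card {q \<in> J ` V - {J p}. u q = cnj s}" for s
  proof -
    have "J ` {q \<in> V - {p}. ?v q = s} = {q \<in> J ` V - {J p}. u q = cnj s}"
      by (auto simp: conj_reflection_def inj_eq[OF inj])
    thus ?thesis using card_image[OF inj_on_subset[OF inj subset_UNIV], of "{q \<in> V - {p}. ?v q = s}"] by simp
  qed
  note ceq = this
  from e1 e2 have "\<forall>\<^sub>F s in at (0::complex). nat (mero_order \<A> ?v p) = nat (mero_order \<A> u (J p))"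
  proof eventually_elim
    case (elim s)
    thus ?case using ceq[of s] by simp
  qed
  hence "nat (mero_order \<A> ?v p) = nat (mero_order \<A> u (J p))" by (simp add: eventually_const)
  thus ?thesis using mero_order_pos[OF v] mero_order_pos[OF u] by simp
qed

end

locale two_point_domain = algebraic_domain +
  fixes w b :: complex
  assumes w_neq_b: "w \<noteq> b"
begin

definition B :: "complex \<Rightarrow> complex" where "B \<zeta> = (\<zeta> - w) / (\<zeta> - b)"

text \<open>
  The cross quotient \<open>B\<^sup>*\<close> of the reflected function, with the reflected points.
\<close>
definition Bst :: "'a \<Rightarrow> complex" where "Bst q = (fs q - cnj w) / (fs q - cnj b)"

lemma Bst_eq: "Bst q = cnj (B (f (J q)))"
  by (simp add: Bst_def B_def conj_reflection_def)

lemma Bst_mero: "meromorphic_function \<A> Bst"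
  unfolding Bst_def[abs_def] using fs_mero
  by (intro meromorphic_function_ops(5) meromorphic_function_ops(3) meromorphic_function_ops(1)[OF fs_mero fs_mero])

lemma Bst_nonzero: "\<forall>\<^sub>F q in at p. Bst q \<noteq> 0"
  using fs_avoids[of "cnj w" p] fs_avoids[of "cnj b" p] by eventually_elim (simp add: Bst_def)

text \<open>
  The continuous extension of \<open>B\<close> to the sphere, outside its pole.
\<close>
definition B_value :: "riemann_sphere \<Rightarrow> complex" where
  "B_value x = (case x of None \<Rightarrow> 1 | Some c \<Rightarrow> B c)"

lemma B_value_nonzero: "x \<noteq> Some w \<Longrightarrow> x \<noteq> Some b \<Longrightarrow> B_value x \<noteq> 0"
  by (cases x) (auto simp: B_value_def B_def)

lemma B_tendsto:
  assumes "x \<noteq> Some b"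
  shows "(B \<longlongrightarrow> B_value x) (sphere_at x)"
proof (cases x)
  case None
  have "filterlim (\<lambda>\<zeta>::complex. \<zeta> + (- b)) at_infinity at_infinity"
    by (rule tendsto_add_filterlim_at_infinity'[OF filterlim_ident tendsto_const])
  hence "((\<lambda>\<zeta>. inverse (\<zeta> + (- b))) \<longlongrightarrow> 0) at_infinity"
    by (rule filterlim_compose[OF tendsto_inverse_0])
  hence "((\<lambda>\<zeta>. inverse (\<zeta> - b)) \<longlongrightarrow> 0) at_infinity" by simp
  hence "((\<lambda>\<zeta>. 1 + (b - w) * inverse (\<zeta> - b)) \<longlongrightarrow> 1 + (b - w) * 0) at_infinity"
    by (intro tendsto_intros)
  moreover have "\<forall>\<^sub>F \<zeta> in at_infinity. 1 + (b - w) * inverse (\<zeta> - b) = B \<zeta>"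
  proof -
    have "\<forall>\<^sub>F \<zeta> in at_infinity. norm (\<zeta>::complex) \<ge> norm b + 1" unfolding eventually_at_infinity by blast
    thus ?thesis
    proof eventually_elim
      case (elim \<zeta>)
      hence "\<zeta> \<noteq> b" by auto
      thus ?case by (simp add: B_def field_simps)
    qed
  qed
  ultimately have "(B \<longlongrightarrow> 1 + (b - w) * 0) at_infinity" by (rule Lim_transform_eventually)
  thus ?thesis using None by (simp add: B_value_def)
next
  case (Some c)
  hence "c \<noteq> b" using assms by auto
  hence "((\<lambda>\<zeta>. (\<zeta> - w) / (\<zeta> - b)) \<longlongrightarrow> (c - w) / (c - b)) (at c)" by (intro tendsto_intros) auto
  thus ?thesis using Some by (simp add: B_value_def B_def[abs_def])
qed

lemma f_filterlim_sphere: 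
  assumes "p \<in> fiber x"
  shows "filterlim f (sphere_at x) (at p)"
proof (cases x)
  case None
  thus ?thesis using assms by (simp add: fiber_def mero_value_None_iff is_pole_def)
next
  case (Some c)
  hence "(f \<longlongrightarrow> c) (at p)" using assms mero_value_Some_iff[OF f_mero] by (simp add: fiber_def)
  thus ?thesis using Some f_avoids by (auto intro: filterlim_atI)
qed

lemma Bst_tendsto:
  assumes "J p \<in> fiber x" "x \<noteq> Some b"
  shows "(Bst \<longlongrightarrow> cnj (B_value x)) (at p)"
proof -
  have "((\<lambda>q. B (f q)) \<longlongrightarrow> B_value x) (at (J p))"
    by (rule filterlim_compose[OF B_tendsto[OF assms(2)] f_filterlim_sphere[OF assms(1)]])
  hence "((\<lambda>q. B (f (J q))) \<longlongrightarrow> B_value x) (at p)"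
    using filterlim_J[of "\<lambda>q. B (f q)" "nhds (B_value x)" p] by simp
  hence "((\<lambda>q. cnj (B (f (J q)))) \<longlongrightarrow> cnj (B_value x)) (at p)" by (rule tendsto_cnj)
  thus ?thesis by (simp add: Bst_eq[abs_def])
qed

definition ord_Bst :: "'a \<Rightarrow> int" where "ord_Bst p = mero_order \<A> Bst p"

text \<open>
  The zeros and poles of \<open>B\<^sup>*\<close> are the reflections of the points over \<open>w\<close> and \<open>b\<close>, with the same multiplicities.
\<close>
lemma ord_Bst:
  shows "J p \<in> fiber (Some w) \<Longrightarrow> ord_Bst p = int (ram (J p))"
    and "J p \<in> fiber (Some b) \<Longrightarrow> ord_Bst p = - int (ram (J p))"
    and "J p \<notin> fiber (Some w) \<Longrightarrow> J p \<notin> fiber (Some b) \<Longrightarrow> ord_Bst p = 0"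
proof -
  have const: "meromorphic_function \<A> (\<lambda>q. fs q - c)" for c
    using fs_mero by (intro meromorphic_function_ops(3) meromorphic_function_ops(1)[OF fs_mero fs_mero])
  have nz: "\<forall>\<^sub>F q in at p. fs q - c \<noteq> 0" for c using fs_avoids[of c p] by simp
  have div: "ord_Bst p = mero_order \<A> (\<lambda>q. fs q - cnj w) p - mero_order \<A> (\<lambda>q. fs q - cnj b) p"
    unfolding ord_Bst_def Bst_def[abs_def] by (intro mero_order_divide const nz)
  have refl: "mero_order \<A> (\<lambda>q. fs q - cnj c) p = int (ram (J p))" if "J p \<in> fiber (Some c)" for c
  proof -
    have "mero_order \<A> (\<lambda>q. fs q - cnj c) p
        = mero_order \<A> (conj_reflection J (\<lambda>q. uniformizer (Some c) (f q))) p"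
      by (simp add: conj_reflection_def)
    also have "\<dots> = mero_order \<A> (\<lambda>q. uniformizer (Some c) (f q)) (J p)"
      by (intro mero_order_conj_reflection uniformizer_f_mero uniformizer_f_tendsto uniformizer_f_nonzero that)
    also have "\<dots> = int (ram (J p))" using ram_eq(1)[OF that] by simp
    finally show ?thesis .
  qed
  have zero: "mero_order \<A> (\<lambda>q. fs q - cnj c) p = 0" if "J p \<in> fiber (Some d)" "c \<noteq> d" for c d
  proof -
    have "mero_value fs p = Some (cnj d)" using that(1) by (simp add: mero_value_fs fiber_def)
    hence "(fs \<longlongrightarrow> cnj d) (at p)" by (simp add: mero_value_Some_iff[OF fs_mero])
    hence "((\<lambda>q. fs q - cnj c) \<longlongrightarrow> cnj d - cnj c) (at p)" by (intro tendsto_intros)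
    thus ?thesis using that(2) by (intro mero_order_eq_0[where l = "cnj d - cnj c"] const) auto
  qed
  show "ord_Bst p = int (ram (J p))" if "J p \<in> fiber (Some w)"
    using div refl[OF that] zero[OF that, of b] w_neq_b by simp
  show "ord_Bst p = - int (ram (J p))" if "J p \<in> fiber (Some b)"
    using div refl[OF that] zero[OF that, of w] w_neq_b by simp
  show "ord_Bst p = 0" if "J p \<notin> fiber (Some w)" "J p \<notin> fiber (Some b)"
  proof -
    define x where "x = mero_value f (J p)"
    have x: "J p \<in> fiber x" "x \<noteq> Some w" "x \<noteq> Some b" using that by (auto simp: x_def fiber_def)
    show ?thesis unfolding ord_Bst_def
      using mero_order_eq_0[OF Bst_mero Bst_tendsto[OF x(1,3)]] B_value_nonzero[OF x(2,3)] by simp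
  qed
qed

end

section \<open>The norm of the cross quotient\<close>

lemma eventually_at_imp_eventually_nhds:
  fixes c :: "'a :: t1_space"
  assumes "\<forall>\<^sub>F x in at c. P x"
  shows "\<forall>\<^sub>F x in at c. \<forall>\<^sub>F y in nhds x. P y"
proof -
  obtain S where S: "open S" "c \<in> S" "\<And>x. x \<in> S \<Longrightarrow> x \<noteq> c \<Longrightarrow> P x"
    using assms unfolding eventually_at_topological by blast
  have "open (S - {c})" using S(1) by auto
  hence "\<forall>\<^sub>F y in nhds x. P y" if "x \<in> S - {c}" for x
    using that S(3) unfolding eventually_nhds by blast
  thus ?thesis unfolding eventually_at_topological using S by blast
qed

context surface_map
begin

lemma
  assumes fc: "fiber_chart x \<sigma> r" and R: "\<And>p. p \<in> fiber x \<Longrightarrow> R p \<subseteq> ball 0 r \<and> finite (R p)"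
  shows fiber_chart_prod: "(\<Prod>q\<in>(\<Union>p\<in>fiber x. \<sigma> p ` R p). \<phi> q) = (\<Prod>p\<in>fiber x. \<Prod>t\<in>R p. (\<phi> (\<sigma> p t) :: complex))"
    and fiber_chart_sum: "(\<Sum>q\<in>(\<Union>p\<in>fiber x. \<sigma> p ` R p). \<psi> q) = (\<Sum>p\<in>fiber x. \<Sum>t\<in>R p. (\<psi> (\<sigma> p t) :: nat))"
proof -
  have inj: "inj_on (\<sigma> p) (R p)" if "p \<in> fiber x" for p
    using local_paramD(3)[OF fiber_chartD(2)[OF fc that]] R[OF that] by (auto intro: inj_on_subset)
  have fin: "\<forall>p\<in>fiber x. finite (\<sigma> p ` R p)" using R by auto
  have dis: "\<forall>p\<in>fiber x. \<forall>q\<in>fiber x. p \<noteq> q \<longrightarrow> \<sigma> p ` R p \<inter> \<sigma> q ` R q = {}"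
  proof (intro ballI impI)
    fix p q assume pq: "p \<in> fiber x" "q \<in> fiber x" "p \<noteq> q"
    have "\<sigma> p ` R p \<subseteq> \<sigma> p ` ball 0 r" "\<sigma> q ` R q \<subseteq> \<sigma> q ` ball 0 r" using R pq by blast+
    thus "\<sigma> p ` R p \<inter> \<sigma> q ` R q = {}" using fiber_chartD(4)[OF fc pq] by blast
  qed
  show "(\<Prod>q\<in>(\<Union>p\<in>fiber x. \<sigma> p ` R p). \<phi> q) = (\<Prod>p\<in>fiber x. \<Prod>t\<in>R p. \<phi> (\<sigma> p t))"
    by (subst prod.UNION_disjoint[OF finite_fiber fin dis]) (simp add: prod.reindex inj)
  show "(\<Sum>q\<in>(\<Union>p\<in>fiber x. \<sigma> p ` R p). \<psi> q) = (\<Sum>p\<in>fiber x. \<Sum>t\<in>R p. \<psi> (\<sigma> p t))"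
    by (subst sum.UNION_disjoint[OF finite_fiber fin dis]) (simp add: sum.reindex inj)
qed

lemma filterlim_uniformizer: "filterlim (uniformizer x) (at 0) (sphere_at x)"
  using tendsto_uniformizer eventually_sphere_at_nonzero by (rule filterlim_atI)

lemma eventually_fiber_chart:
  assumes fc: "fiber_chart x \<sigma> r" and p: "p \<in> fiber x" and P: "\<forall>\<^sub>F t in at 0. P t"
  shows "\<forall>\<^sub>F \<zeta> in sphere_at x. \<forall>t. t ^ ram p = uniformizer x \<zeta> \<longrightarrow> P t"
  using eventually_compose_filterlim[OF eventually_roots[OF P ram_eq(2)[OF p]] filterlim_uniformizer] by simp

lemma eventually_fiber_chart':
  assumes fc: "fiber_chart x \<sigma> r" and p: "p \<in> fiber x" and P: "\<forall>\<^sub>F q in at p. P q"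
  shows "\<forall>\<^sub>F \<zeta> in sphere_at x. \<forall>t. t ^ ram p = uniformizer x \<zeta> \<longrightarrow> P (\<sigma> p t)"
  using P unfolding eventually_local_param[OF fiber_chartD(2)[OF fc p]]
  by (rule eventually_fiber_chart[OF fc p])

lemma roots_props:
  assumes "p \<in> fiber x" "uniformizer x \<zeta> \<noteq> 0"
  shows "finite {t. t ^ ram p = uniformizer x \<zeta>}" "card {t. t ^ ram p = uniformizer x \<zeta>} = ram p"
  using ram_eq(2)[OF assms(1)] assms(2) by (auto intro: finite_nth_roots card_nth_roots)

lemma counting_function_eq: "counting_function \<A> Mp f x = (\<Sum>p\<in>fiber x \<inter> Mp. ram p)"
  unfolding counting_function_def fiber_def by (rule sum.cong) auto

lemma counting_function_nearby:
  "\<forall>\<^sub>F \<zeta> in sphere_at x. counting_function \<A> S f (Some \<zeta>) = card (fiber (Some \<zeta>) \<inter> S)"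
  using ram_eq_1_nearby[of x] by eventually_elim (simp add: counting_function_eq)

text \<open>
  Near \<open>x\<close> the number of sheets is at most the number of roots in a fibre chart.
\<close>
lemma counting_function_bounded:
  "\<exists>n. \<forall>\<^sub>F \<zeta> in sphere_at x. counting_function \<A> S f (Some \<zeta>) \<le> n"
proof -
  obtain \<sigma> r where fc: "fiber_chart x \<sigma> r" using fiber_chart_exists by blast
  have "\<forall>\<^sub>F \<zeta> in sphere_at x. counting_function \<A> S f (Some \<zeta>) \<le> (\<Sum>p\<in>fiber x. ram p)"
    using counting_function_nearby[of S x] fiber_chartD(5)[OF fc]
  proof eventually_elim
    case (elim \<zeta>)
    have "counting_function \<A> S f (Some \<zeta>) \<le> card (fiber (Some \<zeta>))"
      using elim(1) by (simp add: card_mono finite_fiber)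
    also have "\<dots> \<le> (\<Sum>p\<in>fiber x. card (\<sigma> p ` {t. t ^ ram p = uniformizer x \<zeta>}))"
      using elim(2) by (auto intro: card_UN_le[OF finite_fiber])
    also have "\<dots> \<le> (\<Sum>p\<in>fiber x. ram p)"
    proof (rule sum_mono)
      fix p assume p: "p \<in> fiber x"
      have u: "uniformizer x \<zeta> \<noteq> 0" using elim(2) by blast
      show "card (\<sigma> p ` {t. t ^ ram p = uniformizer x \<zeta>}) \<le> ram p"
        using card_image_le[OF roots_props(1)[OF p u], of "\<sigma> p"] roots_props(2)[OF p u] by simp
    qed
    finally show ?case .
  qed
  thus ?thesis by blast
qed

end

context two_point_domain
begin

text \<open>
  The norm of the cross quotient \<open>B\<^sup>*\<close> with respect to \<open>f\<close>, except that on the sheets in \<open>M\<^sub>+\<close> and on the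
  boundary its value is replaced by \<open>cnj (B \<zeta>)\<close>. Ramification is disregarded, as \<open>N\<close> is only used near points, not at them: over
  all but isolated points the sheets are distinct.
\<close>
definition N :: "complex \<Rightarrow> complex" where
  "N \<zeta> = (\<Prod>q\<in>fiber (Some \<zeta>). if q \<in> Mm then Bst q else cnj (B \<zeta>))"

lemma Bst_roots_asymptotics:
  assumes fc: "fiber_chart x \<sigma> r" and p: "p \<in> fiber x"
  shows "\<exists>c. c \<noteq> 0 \<and>
     ((\<lambda>\<zeta>. (\<Prod>t | t ^ ram p = uniformizer x \<zeta>. Bst (\<sigma> p t)) / uniformizer x \<zeta> powi ord_Bst p) \<longlongrightarrow> c) (sphere_at x)
     \<and> (\<forall>l. l \<noteq> 0 \<longrightarrow> (Bst \<longlongrightarrow> l) (at p) \<longrightarrow> c = l ^ ram p)"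
proof -
  define m where "m = ram p"
  define k where "k = ord_Bst p"
  define g where "g = Bst \<circ> \<sigma> p"
  note lp = local_paramD[OF fiber_chartD(2)[OF fc p]]
  have m: "m > 0" using ram_eq(2)[OF p] by (simp add: m_def)
  have mero: "g meromorphic_on {0}"
    unfolding g_def by (rule meromorphic_on_subset[OF lp(6)[OF Bst_mero]]) (use lp(1) in auto)
  have nz: "\<forall>\<^sub>F t in at 0. g t \<noteq> 0"
    using Bst_nonzero[of p] unfolding eventually_local_param[OF fiber_chartD(2)[OF fc p]] g_def by simp
  have k: "zorder g 0 = k"
    unfolding g_def k_def ord_Bst_def by (rule lp(7)[OF Bst_mero Bst_nonzero])
  have iso: "isolated_singularity_at g 0" "not_essential g 0" using mero by (auto simp: meromorphic_at_iff)
  have "\<exists>\<^sub>F t in at 0. g t \<noteq> 0" using nz by (intro eventually_frequently) auto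
  from zorder_exist[OF iso this] obtain h \<rho> where h0: "h 0 \<noteq> 0" and \<rho>: "\<rho> > 0" "h holomorphic_on cball 0 \<rho>"
    and gh: "\<And>t. t \<in> cball 0 \<rho> - {0} \<Longrightarrow> g t = h t * t powi k \<and> h t \<noteq> 0" unfolding k by auto
  have "continuous_on (ball 0 \<rho>) h" using \<rho>(2)
    by (intro holomorphic_on_imp_continuous_on) (auto intro: holomorphic_on_subset)
  hence "isCont h 0" using \<rho>(1) by (simp add: continuous_on_eq_continuous_at)
  hence hlim: "(h \<longlongrightarrow> h 0) (at 0)" by (rule isContD)
  obtain W :: complex where W: "W \<noteq> 0" "\<And>s. s \<noteq> 0 \<Longrightarrow> (\<Prod>t | t ^ m = s. t powi k) = W * s powi k" "k = 0 \<Longrightarrow> W = 1"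
    using prod_roots_power_int[OF m] by blast
  have evb: "\<forall>\<^sub>F t in at 0. t \<in> cball 0 \<rho> - {0::complex}"
  proof -
    have "\<forall>\<^sub>F t in at 0. t \<in> ball 0 \<rho> - {0::complex}" using \<rho>(1) by (intro eventually_at_in_open) auto
    thus ?thesis by eventually_elim auto
  qed
  have ev0: "\<forall>\<^sub>F s in at 0. s \<noteq> (0::complex)" by (simp add: eventually_at_filter)
  have "((\<lambda>s. W * (\<Prod>t | t ^ m = s. h t)) \<longlongrightarrow> W * h 0 ^ m) (at 0)"
    by (intro tendsto_intros tendsto_prod_roots[OF hlim m])
  moreover have "\<forall>\<^sub>F s in at 0. W * (\<Prod>t | t ^ m = s. h t) = (\<Prod>t | t ^ m = s. g t) / s powi k"
    using eventually_roots[OF evb m] ev0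
  proof eventually_elim
    case (elim s)
    have "(\<Prod>t | t ^ m = s. g t) = (\<Prod>t | t ^ m = s. h t * t powi k)"
      using gh elim(1) by (intro prod.cong) auto
    also have "\<dots> = (\<Prod>t | t ^ m = s. h t) * (W * s powi k)" using W(2)[OF elim(2)] by (simp add: prod.distrib)
    finally show ?case using elim(2) by (simp add: power_int_eq_0_iff)
  qed
  ultimately have "((\<lambda>s. (\<Prod>t | t ^ m = s. g t) / s powi k) \<longlongrightarrow> W * h 0 ^ m) (at 0)"
    by (rule Lim_transform_eventually)
  hence "((\<lambda>\<zeta>. (\<Prod>t | t ^ m = uniformizer x \<zeta>. g t) / uniformizer x \<zeta> powi k) \<longlongrightarrow> W * h 0 ^ m) (sphere_at x)"
    by (rule filterlim_compose[OF _ filterlim_uniformizer])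
  moreover have "W * h 0 ^ m = l ^ m" if l: "l \<noteq> 0" "(Bst \<longlongrightarrow> l) (at p)" for l
  proof -
    have k0: "k = 0" unfolding k_def ord_Bst_def using mero_order_eq_0[OF Bst_mero l(2,1)] .
    have "(g \<longlongrightarrow> l) (at 0)" using l(2) unfolding filterlim_local_param[OF fiber_chartD(2)[OF fc p]] g_def .
    moreover have "(g \<longlongrightarrow> h 0) (at 0)"
    proof (rule Lim_transform_eventually[OF hlim])
      show "\<forall>\<^sub>F t in at 0. h t = g t" using evb by eventually_elim (use gh k0 in auto)
    qed
    ultimately have "l = h 0" using tendsto_unique[OF at_neq_bot] by blast
    thus ?thesis using W(3)[OF k0] by simp
  qed
  ultimately show ?thesis using W(1) h0 unfolding m_def k_def g_def by (intro exI[of _ "W * h 0 ^ ram p"]) auto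
qed

text \<open>
  A sheet through a point of \<open>\<Gamma>\<close> may change sides arbitrarily often near this point. This is harmless: \<open>B\<^sup>*\<close> is the
  conjugate of \<open>B \<circ> f \<circ> J\<close> and \<open>J\<close> fixes the point, so both alternatives have the same limit.
\<close>
lemma boundary_roots_limit:
  assumes fc: "fiber_chart x \<sigma> r" and p: "p \<in> fiber x" "p \<in> \<Gamma>" and x: "x \<noteq> Some b"
  shows "((\<lambda>\<zeta>. \<Prod>t | t ^ ram p = uniformizer x \<zeta>. if \<sigma> p t \<in> Mm then Bst (\<sigma> p t) else cnj (B \<zeta>))
            \<longlongrightarrow> cnj (B_value x) ^ ram p) (sphere_at x)"
proof -
  define \<phi> where "\<phi> = (\<lambda>q. if q \<in> Mm then Bst q else cnj (B (f q)))"
  have Jp: "J p = p" using p(2) by (simp add: fixed_points_def)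
  have l1: "(Bst \<longlongrightarrow> cnj (B_value x)) (at p)" using Bst_tendsto[of p x] Jp p(1) x by simp
  have l2: "((\<lambda>q. cnj (B (f q))) \<longlongrightarrow> cnj (B_value x)) (at p)"
    by (intro tendsto_cnj filterlim_compose[OF B_tendsto[OF x] f_filterlim_sphere[OF p(1)]])
  have "(\<phi> \<longlongrightarrow> cnj (B_value x)) (at p)"
  proof (rule tendstoI)
    fix e :: real assume "e > 0"
    from tendstoD[OF l1 this] tendstoD[OF l2 this]
    show "\<forall>\<^sub>F q in at p. dist (\<phi> q) (cnj (B_value x)) < e" by eventually_elim (simp add: \<phi>_def)
  qed
  hence "((\<phi> \<circ> \<sigma> p) \<longlongrightarrow> cnj (B_value x)) (at 0)"
    by (simp add: filterlim_local_param[OF fiber_chartD(2)[OF fc p(1)]])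
  from tendsto_prod_roots[OF this ram_eq(2)[OF p(1)]]
  have "((\<lambda>\<zeta>. \<Prod>t | t ^ ram p = uniformizer x \<zeta>. (\<phi> \<circ> \<sigma> p) t) \<longlongrightarrow> cnj (B_value x) ^ ram p) (sphere_at x)"
    by (rule filterlim_compose[OF _ filterlim_uniformizer])
  moreover have "\<forall>\<^sub>F \<zeta> in sphere_at x. (\<Prod>t | t ^ ram p = uniformizer x \<zeta>. (\<phi> \<circ> \<sigma> p) t)
      = (\<Prod>t | t ^ ram p = uniformizer x \<zeta>. if \<sigma> p t \<in> Mm then Bst (\<sigma> p t) else cnj (B \<zeta>))"
    using fiber_chartD(5)[OF fc]
  proof eventually_elim
    case (elim \<zeta>)
    have "f (\<sigma> p t) = \<zeta>" if "t ^ ram p = uniformizer x \<zeta>" for t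
    proof -
      have "t \<in> ball 0 r - {0}" using elim p(1) that by blast
      hence "uniformizer x (f (\<sigma> p t)) = uniformizer x \<zeta>" using fiber_chartD(3)[OF fc p(1)] that by simp
      thus ?thesis by (simp only: uniformizer_inj)
    qed
    thus ?case by (intro prod.cong) (auto simp: \<phi>_def)
  qed
  ultimately show ?thesis by (rule Lim_transform_eventually)
qed

text \<open>
  In a fibre chart \<open>N\<close> is a product over the points \<open>p\<close> over \<open>x\<close> of products over roots. A point in \<open>M\<^sub>+\<close> contributes a
  power of \<open>cnj B\<close>, a point in \<open>M\<^sub>-\<close> a power of the uniformizer given by the order of \<open>B\<^sup>*\<close>, and a point of \<open>\<Gamma>\<close> has a
  nonzero limit; for the last one \<open>x\<close> must be neither \<open>w\<close> nor \<open>b\<close>.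
\<close>
lemma N_asymptotics:
  assumes x: "x \<noteq> Some w \<and> x \<noteq> Some b \<or> fiber x \<inter> \<Gamma> = {}"
  obtains c where "\<And>p. p \<in> fiber x \<Longrightarrow> c p \<noteq> 0" "\<And>p. p \<in> fiber x \<inter> Mp \<Longrightarrow> c p = 1"
    "\<And>p l. p \<in> fiber x \<inter> Mm \<Longrightarrow> l \<noteq> 0 \<Longrightarrow> (Bst \<longlongrightarrow> l) (at p) \<Longrightarrow> c p = l ^ ram p"
    "((\<lambda>\<zeta>. N \<zeta> / (cnj (B \<zeta>) ^ counting_function \<A> Mp f x *
         (\<Prod>p\<in>fiber x \<inter> Mm. uniformizer x \<zeta> powi ord_Bst p))) \<longlongrightarrow> (\<Prod>p\<in>fiber x. c p)) (sphere_at x)"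
proof -
  obtain \<sigma> r where fc: "fiber_chart x \<sigma> r" using fiber_chart_exists by blast
  define \<nu> where "\<nu> = (\<lambda>p \<zeta>. if p \<in> Mp then cnj (B \<zeta>) ^ ram p else if p \<in> Mm then uniformizer x \<zeta> powi ord_Bst p else 1)"
  define F where "F = (\<lambda>p \<zeta>. \<Prod>t | t ^ ram p = uniformizer x \<zeta>. if \<sigma> p t \<in> Mm then Bst (\<sigma> p t) else cnj (B \<zeta>))"
  have Bnz: "\<forall>\<^sub>F \<zeta> in sphere_at x. B \<zeta> \<noteq> 0"
  proof -
    have "\<forall>\<^sub>F \<zeta> in sphere_at x. \<zeta> \<noteq> d" for d
    proof (cases x)
      case None
      have "\<forall>\<^sub>F \<zeta> in at_infinity. norm (\<zeta>::complex) \<ge> norm d + 1" unfolding eventually_at_infinity by blast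
      thus ?thesis using None by (auto elim!: eventually_mono)
    next
      case (Some c)
      show ?thesis unfolding Some sphere_at_simps
        by (cases "c = d") (auto simp: eventually_at_filter intro: t1_space_nhds eventually_mono)
    qed
    from this[of w] this[of b] show ?thesis by eventually_elim (simp add: B_def)
  qed
  have "\<exists>c. c \<noteq> 0 \<and> (p \<in> Mp \<longrightarrow> c = 1) \<and> (p \<in> Mm \<longrightarrow> (\<forall>l. l \<noteq> 0 \<longrightarrow> (Bst \<longlongrightarrow> l) (at p) \<longrightarrow> c = l ^ ram p))
      \<and> ((\<lambda>\<zeta>. F p \<zeta> / \<nu> p \<zeta>) \<longlongrightarrow> c) (sphere_at x)" if p: "p \<in> fiber x" for p
  proof -
    consider "p \<in> Mp" | "p \<in> Mm" | "p \<in> \<Gamma>" using domain_partition(6) by blast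
    thus ?thesis
    proof cases
      case 1
      have nm: "p \<notin> Mm" using 1 domain_partition(3) by blast
      have "\<forall>\<^sub>F q in at p. q \<in> Mp" using domain_partition(1) 1 by (rule eventually_at_in_open')
      from eventually_fiber_chart'[OF fc p this] fiber_chartD(5)[OF fc] Bnz
      have "\<forall>\<^sub>F \<zeta> in sphere_at x. 1 = F p \<zeta> / \<nu> p \<zeta>"
      proof eventually_elim
        case (elim \<zeta>)
        have "F p \<zeta> = (\<Prod>t | t ^ ram p = uniformizer x \<zeta>. cnj (B \<zeta>))"
          unfolding F_def using elim(1) domain_partition(3) by (intro prod.cong) auto
        also have "\<dots> = cnj (B \<zeta>) ^ ram p" using roots_props[OF p] elim(2) by simp
        finally show ?case using 1 elim(3) by (simp add: \<nu>_def)
      qed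
      from Lim_transform_eventually[OF tendsto_const this] show ?thesis using 1 nm by (intro exI[of _ 1]) auto
    next
      case 2
      have nm: "p \<notin> Mp" using 2 domain_partition(3) by blast
      have "\<forall>\<^sub>F q in at p. q \<in> Mm" using domain_partition(2) 2 by (rule eventually_at_in_open')
      from eventually_fiber_chart'[OF fc p this]
      have ev: "\<forall>\<^sub>F \<zeta> in sphere_at x. (\<Prod>t | t ^ ram p = uniformizer x \<zeta>. Bst (\<sigma> p t)) / uniformizer x \<zeta> powi ord_Bst p = F p \<zeta> / \<nu> p \<zeta>"
      proof eventually_elim
        case (elim \<zeta>)
        have "F p \<zeta> = (\<Prod>t | t ^ ram p = uniformizer x \<zeta>. Bst (\<sigma> p t))"
          unfolding F_def using elim by (intro prod.cong) auto
        thus ?case using 2 nm by (simp add: \<nu>_def)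
      qed
      obtain c where c: "c \<noteq> 0"
        "((\<lambda>\<zeta>. (\<Prod>t | t ^ ram p = uniformizer x \<zeta>. Bst (\<sigma> p t)) / uniformizer x \<zeta> powi ord_Bst p) \<longlongrightarrow> c) (sphere_at x)"
        "\<And>l. l \<noteq> 0 \<Longrightarrow> (Bst \<longlongrightarrow> l) (at p) \<Longrightarrow> c = l ^ ram p"
        using Bst_roots_asymptotics[OF fc p] by blast
      show ?thesis using nm c(1,3) Lim_transform_eventually[OF c(2) ev] by (intro exI[of _ c]) auto
    next
      case 3
      have nm: "p \<notin> Mp" "p \<notin> Mm" using 3 domain_partition by blast+
      have xx: "x \<noteq> Some w" "x \<noteq> Some b" using x p 3 by blast+
      have "((\<lambda>\<zeta>. F p \<zeta> / \<nu> p \<zeta>) \<longlongrightarrow> cnj (B_value x) ^ ram p) (sphere_at x)"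
        using boundary_roots_limit[OF fc p 3 xx(2)] nm by (simp add: F_def \<nu>_def)
      thus ?thesis using nm B_value_nonzero[OF xx] by (intro exI[of _ "cnj (B_value x) ^ ram p"]) auto
    qed
  qed
  then obtain c where c: "\<And>p. p \<in> fiber x \<Longrightarrow> c p \<noteq> 0 \<and> (p \<in> Mp \<longrightarrow> c p = 1) \<and>
       (p \<in> Mm \<longrightarrow> (\<forall>l. l \<noteq> 0 \<longrightarrow> (Bst \<longlongrightarrow> l) (at p) \<longrightarrow> c p = l ^ ram p))
      \<and> ((\<lambda>\<zeta>. F p \<zeta> / \<nu> p \<zeta>) \<longlongrightarrow> c p) (sphere_at x)" by metis
  have "((\<lambda>\<zeta>. \<Prod>p\<in>fiber x. F p \<zeta> / \<nu> p \<zeta>) \<longlongrightarrow> (\<Prod>p\<in>fiber x. c p)) (sphere_at x)"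
    using c by (intro tendsto_prod) auto
  moreover have "\<forall>\<^sub>F \<zeta> in sphere_at x. (\<Prod>p\<in>fiber x. F p \<zeta> / \<nu> p \<zeta>) = N \<zeta> / (cnj (B \<zeta>) ^ counting_function \<A> Mp f x *
         (\<Prod>p\<in>fiber x \<inter> Mm. uniformizer x \<zeta> powi ord_Bst p))"
    using fiber_chartD(5)[OF fc]
  proof eventually_elim
    case (elim \<zeta>)
    have "N \<zeta> = (\<Prod>p\<in>fiber x. F p \<zeta>)"
      unfolding N_def F_def using elim roots_props(1)[of _ x \<zeta>]
        fiber_chart_prod[OF fc, of "\<lambda>p. {t. t ^ ram p = uniformizer x \<zeta>}" "\<lambda>q. if q \<in> Mm then Bst q else cnj (B \<zeta>)"]
      by auto
    moreover have "(\<Prod>p\<in>fiber x. \<nu> p \<zeta>) = cnj (B \<zeta>) ^ counting_function \<A> Mp f x *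
         (\<Prod>p\<in>fiber x \<inter> Mm. uniformizer x \<zeta> powi ord_Bst p)"
    proof -
      have "\<nu> p \<zeta> = (if p \<in> Mp then cnj (B \<zeta>) ^ ram p else 1) * (if p \<in> Mm then uniformizer x \<zeta> powi ord_Bst p else 1)" for p
        using domain_partition(3) by (auto simp: \<nu>_def)
      thus ?thesis
        by (simp add: prod.distrib counting_function_eq power_sum prod.inter_restrict[OF finite_fiber, symmetric])
    qed
    ultimately show ?case by (simp add: prod_dividef)
  qed
  ultimately have "((\<lambda>\<zeta>. N \<zeta> / (cnj (B \<zeta>) ^ counting_function \<A> Mp f x *
         (\<Prod>p\<in>fiber x \<inter> Mm. uniformizer x \<zeta> powi ord_Bst p))) \<longlongrightarrow> (\<Prod>p\<in>fiber x. c p)) (sphere_at x)"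
    by (rule Lim_transform_eventually)
  thus ?thesis using c that[of c] by auto
qed

end

text \<open>
  A holomorphic \<open>m\<close>-th root of \<open>(\<zeta> - c) / (\<xi> - c)\<close> near \<open>\<xi>\<close>. Multiplying by it continues all \<open>m\<close>-th roots
  of \<open>\<xi> - c\<close> to those of \<open>\<zeta> - c\<close>, so that single sheets near a branch point become holomorphic functions of \<open>\<zeta>\<close>.
\<close>
definition relative_root :: "nat \<Rightarrow> complex \<Rightarrow> complex \<Rightarrow> complex \<Rightarrow> complex" where
  "relative_root m c \<xi> \<zeta> = exp (Ln ((\<zeta> - c) / (\<xi> - c)) / of_nat m)"

lemma relative_root_props:
  assumes "\<xi> \<noteq> c" "\<zeta> \<in> ball \<xi> (dist \<xi> c)" "m > 0"
  shows "relative_root m c \<xi> \<zeta> ^ m = (\<zeta> - c) / (\<xi> - c)"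
    and "relative_root m c \<xi> \<zeta> \<noteq> 0"
    and "relative_root m c \<xi> field_differentiable at \<zeta>"
proof -
  have "norm ((\<zeta> - c) / (\<xi> - c) - 1) < 1"
  proof -
    have "(\<zeta> - c) / (\<xi> - c) - 1 = (\<zeta> - \<xi>) / (\<xi> - c)" using assms(1) by (simp add: field_simps)
    thus ?thesis using assms(1,2) by (simp add: norm_divide dist_norm norm_minus_commute)
  qed
  hence "\<bar>Re ((\<zeta> - c) / (\<xi> - c) - 1)\<bar> < 1" using abs_Re_le_cmod le_less_trans by blast
  hence re: "Re ((\<zeta> - c) / (\<xi> - c)) > 0" by simp
  hence nz: "(\<zeta> - c) / (\<xi> - c) \<noteq> 0" by (metis less_irrefl zero_complex.simps(1))
  show "relative_root m c \<xi> \<zeta> ^ m = (\<zeta> - c) / (\<xi> - c)"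
    using assms(3) nz by (simp add: relative_root_def exp_of_nat_mult[symmetric])
  show "relative_root m c \<xi> \<zeta> \<noteq> 0" by (simp add: relative_root_def)
  have "(\<zeta> - c) / (\<xi> - c) \<notin> \<real>\<^sub>\<le>\<^sub>0" using re by (auto simp: complex_nonpos_Reals_iff)
  thus "relative_root m c \<xi> field_differentiable at \<zeta>"
    unfolding relative_root_def[abs_def] using assms(1,3) nz
    by (auto simp: field_differentiable_def intro!: exI derivative_eq_intros)
qed

lemma relative_root_deriv:
  assumes "\<xi> \<noteq> c" "m > 0"
  shows "relative_root m c \<xi> \<xi> = 1"
    and "(relative_root m c \<xi> has_field_derivative 1 / (of_nat m * (\<xi> - c))) (at \<xi>)"
proof -
  show "relative_root m c \<xi> \<xi> = 1" using assms by (simp add: relative_root_def)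
  have "(\<xi> - c) / (\<xi> - c) \<notin> \<real>\<^sub>\<le>\<^sub>0" using assms by simp
  hence "(relative_root m c \<xi> has_field_derivative
      exp (Ln ((\<xi> - c) / (\<xi> - c)) / of_nat m) * (inverse ((\<xi> - c) / (\<xi> - c)) * (1 / (\<xi> - c)) / of_nat m)) (at \<xi>)"
    unfolding relative_root_def[abs_def] using assms
    by (intro DERIV_chain2[OF DERIV_exp] DERIV_cdivide DERIV_chain2[OF has_field_derivative_Ln])
       (auto intro!: derivative_eq_intros)
  thus "(relative_root m c \<xi> has_field_derivative 1 / (of_nat m * (\<xi> - c))) (at \<xi>)"
    using assms by (simp add: mult.commute)
qed

lemma roots_relative:
  assumes "\<xi> \<noteq> c" "\<zeta> \<in> ball \<xi> (dist \<xi> c)" "m > 0"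
  shows "{t. t ^ m = \<zeta> - c} = (\<lambda>t. relative_root m c \<xi> \<zeta> * t) ` {t. t ^ m = \<xi> - c}"
proof (intro equalityI subsetI)
  note rp = relative_root_props[OF assms]
  fix t assume "t \<in> {t. t ^ m = \<zeta> - c}"
  hence t: "t ^ m = \<zeta> - c" by simp
  have "\<zeta> \<noteq> c" using assms(2) by auto
  hence "(t / relative_root m c \<xi> \<zeta>) ^ m = \<xi> - c" using t rp(1) assms(1) by (simp add: power_divide)
  thus "t \<in> (\<lambda>t. relative_root m c \<xi> \<zeta> * t) ` {t. t ^ m = \<xi> - c}"
    using rp(2) by (intro image_eqI[of _ _ "t / relative_root m c \<xi> \<zeta>"]) auto
next
  note rp = relative_root_props[OF assms]
  fix t assume "t \<in> (\<lambda>t. relative_root m c \<xi> \<zeta> * t) ` {t. t ^ m = \<xi> - c}"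
  thus "t \<in> {t. t ^ m = \<zeta> - c}" using rp(1) assms(1) by (auto simp: power_mult_distrib)
qed

context two_point_domain
begin

definition local_norm_form :: "complex \<Rightarrow> real \<Rightarrow> nat \<Rightarrow> (complex \<Rightarrow> complex) \<Rightarrow> bool" where
  "local_norm_form \<xi> e k H \<longleftrightarrow> e > 0 \<and> H holomorphic_on ball \<xi> e \<and>
     (\<forall>\<zeta>\<in>ball \<xi> e. H \<zeta> \<noteq> 0 \<and> N \<zeta> = cnj (B \<zeta>) ^ k * H \<zeta> \<and> counting_function \<A> Mp f (Some \<zeta>) = k)"

text \<open>
  At a point \<open>\<xi>\<close> off the boundary image every sheet stays in its half of the surface, so the sheets in \<open>M\<^sub>+\<close> contribute
  \<open>cnj B ^ k\<close> and those in \<open>M\<^sub>-\<close> the holomorphic factor \<open>H\<close>. The bound must be uniform in \<open>\<xi>\<close> as \<open>\<xi>\<close> approaches an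
  arbitrary \<open>c\<close>, possibly a branch point: one sheet contributes
  \<open>t * g'(t) / (m * g(t) * (\<xi> - c))\<close> with \<open>t ^ m = \<xi> - c\<close> and \<open>g\<close> the cross quotient in the parameter \<open>t\<close>, and \<open>t * g'(t) / g(t)\<close> is bounded.
\<close>
lemma N_local_form:
  "\<exists>A. \<forall>\<^sub>F \<xi> in at c. fiber (Some \<xi>) \<inter> \<Gamma> = {} \<longrightarrow>
      (\<exists>e k H. local_norm_form \<xi> e k H \<and> norm (deriv H \<xi> / H \<xi>) \<le> A / norm (\<xi> - c))"
proof -
  define x where "x = Some c"
  obtain \<sigma> r where fc: "fiber_chart x \<sigma> r" using fiber_chart_exists by blast
  define g where "g = (\<lambda>p. Bst \<circ> \<sigma> p)"
  define R where "R = (\<lambda>p \<zeta>. {t. t ^ ram p = \<zeta> - c})"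
  have lp: "local_param p (\<sigma> p) r" if "p \<in> fiber x" for p by (rule fiber_chartD(2)[OF fc that])
  have m: "ram p > 0" if "p \<in> fiber x" for p using ram_eq(2)[OF that] .
  have "\<exists>A. \<forall>\<^sub>F t in at 0. g p analytic_on {t} \<and> g p t \<noteq> 0 \<and> norm ((t - 0) * (deriv (g p) t / g p t)) \<le> A"
    if p: "p \<in> fiber x" for p
  proof (rule logderiv_bound_at_singularity)
    show "g p meromorphic_on {0}" unfolding g_def
      using local_paramD(6)[OF lp[OF p] Bst_mero] by (rule meromorphic_on_subset) (use fiber_chartD(1)[OF fc] in auto)
    show "\<forall>\<^sub>F t in at 0. g p t \<noteq> 0"
      using Bst_nonzero[of p] unfolding eventually_local_param[OF lp[OF p]] g_def by simp
  qed
  hence "\<forall>p\<in>fiber x. \<exists>A. \<forall>\<^sub>F t in at 0. g p analytic_on {t} \<and> g p t \<noteq> 0 \<and> norm (t * (deriv (g p) t / g p t)) \<le> A"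
    by (simp only: diff_0_right) blast
  from bchoice[OF this] obtain A where A: "\<And>p. p \<in> fiber x \<Longrightarrow>
     \<forall>\<^sub>F t in at 0. g p analytic_on {t} \<and> g p t \<noteq> 0 \<and> norm (t * (deriv (g p) t / g p t)) \<le> A p"
    by blast
  define AA where "AA = (\<Sum>p\<in>fiber x. real (ram p) * \<bar>A p\<bar>)"
  define good where "good = (\<lambda>\<zeta>. \<zeta> \<noteq> c \<and> (\<forall>p\<in>fiber x. R p \<zeta> \<subseteq> ball 0 r - {0}) \<and>
      fiber (Some \<zeta>) = (\<Union>p\<in>fiber x. \<sigma> p ` R p \<zeta>) \<and>
      counting_function \<A> Mp f (Some \<zeta>) = card (fiber (Some \<zeta>) \<inter> Mp) \<and>
      (\<forall>p\<in>fiber x. \<forall>t. t \<in> R p \<zeta> \<longrightarrow> g p analytic_on {t} \<and> g p t \<noteq> 0 \<and> norm (t * (deriv (g p) t / g p t)) \<le> A p))"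
  have "\<forall>\<^sub>F \<zeta> in at c. \<forall>p\<in>fiber x. \<forall>t. t \<in> R p \<zeta> \<longrightarrow> g p analytic_on {t} \<and> g p t \<noteq> 0 \<and> norm (t * (deriv (g p) t / g p t)) \<le> A p"
    using eventually_fiber_chart[OF fc _ A] by (intro eventually_ball_finite finite_fiber ballI) (simp add: x_def R_def)
  moreover have "\<forall>\<^sub>F \<zeta> in at c. \<zeta> \<noteq> c" by (simp add: eventually_at_filter)
  moreover have "\<forall>\<^sub>F \<zeta> in at c. (\<forall>p\<in>fiber x. R p \<zeta> \<subseteq> ball 0 r - {0}) \<and> fiber (Some \<zeta>) = (\<Union>p\<in>fiber x. \<sigma> p ` R p \<zeta>)"
    using fiber_chartD(5)[OF fc] unfolding x_def R_def by (auto elim!: eventually_mono)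
  moreover have "\<forall>\<^sub>F \<zeta> in at c. counting_function \<A> Mp f (Some \<zeta>) = card (fiber (Some \<zeta>) \<inter> Mp)"
    using counting_function_nearby[of Mp x] by (simp add: x_def)
  ultimately have "\<forall>\<^sub>F \<zeta> in at c. good \<zeta>"
    unfolding good_def by eventually_elim blast
  hence "\<forall>\<^sub>F \<xi> in at c. good \<xi> \<and> (\<forall>\<^sub>F \<zeta> in nhds \<xi>. good \<zeta>)"
    by (intro eventually_conj eventually_at_imp_eventually_nhds)
  hence "\<forall>\<^sub>F \<xi> in at c. fiber (Some \<xi>) \<inter> \<Gamma> = {} \<longrightarrow>
      (\<exists>e k H. local_norm_form \<xi> e k H \<and> norm (deriv H \<xi> / H \<xi>) \<le> AA / norm (\<xi> - c))"
  proof (eventually_elim, intro impI)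
    case (elim \<xi>)
    assume off: "fiber (Some \<xi>) \<inter> \<Gamma> = {}"
    from elim have g\<xi>: "good \<xi>" and gn: "\<forall>\<^sub>F \<zeta> in nhds \<xi>. good \<zeta>" by auto
    have \<xi>c: "\<xi> \<noteq> c" using g\<xi> by (simp add: good_def)
    define \<rho> where "\<rho> = (\<lambda>p. relative_root (ram p) c \<xi>)"
    \<comment> \<open>The index set of the sheets near \<open>\<xi>\<close>; the sheet \<open>(p, t)\<close> passes over \<open>\<zeta>\<close> through \<open>\<sigma> p (\<rho> p \<zeta> * t)\<close>.\<close>
    define I where "I = Sigma (fiber x) (\<lambda>p. R p \<xi>)"
    have finR: "finite (R p \<zeta>)" if "p \<in> fiber x" for p \<zeta> unfolding R_def using m[OF that] by (rule finite_nth_roots)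
    have finI: "finite I" unfolding I_def by (intro finite_SigmaI finite_fiber finR)
    have region: "\<sigma> p t \<in> Mp \<or> \<sigma> p t \<in> Mm" if "(p, t) \<in> I" for p t
    proof -
      have "\<sigma> p t \<in> fiber (Some \<xi>)" using g\<xi> that unfolding good_def I_def by auto
      thus ?thesis using off domain_partition(6) by blast
    qed
    have tball: "t \<in> ball 0 r - {0}" if "(p, t) \<in> I" for p t
      using g\<xi> that unfolding good_def I_def by blast
    have cont: "isCont (\<lambda>\<zeta>. \<sigma> p (\<rho> p \<zeta> * t)) \<xi>" if "(p, t) \<in> I" for p t
    proof -
      have p: "p \<in> fiber x" using that by (simp add: I_def)
      have "isCont (\<rho> p) \<xi>" unfolding \<rho>_def
        by (intro field_differentiable_imp_continuous_at relative_root_props(3) m p \<xi>c) (use \<xi>c in auto)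
      hence c1: "isCont (\<lambda>\<zeta>. \<rho> p \<zeta> * t) \<xi>" by (intro continuous_intros)
      have "isCont (\<sigma> p) t"
        using local_paramD(4)[OF lp[OF p]] tball[OF that] by (simp add: continuous_on_eq_continuous_at)
      moreover have "\<rho> p \<xi> * t = t" unfolding \<rho>_def using relative_root_deriv(1)[OF \<xi>c m[OF p]] by simp
      ultimately have "isCont (\<sigma> p) (\<rho> p \<xi> * t)" by (simp only:)
      with c1 show ?thesis by (rule isCont_o2)
    qed
    have \<rho>1: "\<rho> p \<xi> * t = t" if "(p, t) \<in> I" for p t
      unfolding \<rho>_def using that relative_root_deriv(1)[OF \<xi>c m] by (simp add: I_def)
    have "\<forall>\<^sub>F \<zeta> in nhds \<xi>. \<forall>(p, t)\<in>I. (\<sigma> p (\<rho> p \<zeta> * t) \<in> Mp \<longleftrightarrow> \<sigma> p t \<in> Mp) \<and> (\<sigma> p (\<rho> p \<zeta> * t) \<in> Mm \<longleftrightarrow> \<sigma> p t \<in> Mm)"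
    proof (intro eventually_ball_finite finI ballI, safe)
      fix p t assume pt: "(p, t) \<in> I"
      have lim: "((\<lambda>\<zeta>. \<sigma> p (\<rho> p \<zeta> * t)) \<longlongrightarrow> \<sigma> p t) (nhds \<xi>)"
        using iffD1[OF tendsto_at_iff_tendsto_nhds isContD[OF cont[OF pt]]] unfolding \<rho>1[OF pt] .
      show "\<forall>\<^sub>F \<zeta> in nhds \<xi>. (\<sigma> p (\<rho> p \<zeta> * t) \<in> Mp \<longleftrightarrow> \<sigma> p t \<in> Mp) \<and> (\<sigma> p (\<rho> p \<zeta> * t) \<in> Mm \<longleftrightarrow> \<sigma> p t \<in> Mm)"
      proof (cases "\<sigma> p t \<in> Mp")
        case True
        have "\<forall>\<^sub>F \<zeta> in nhds \<xi>. \<sigma> p (\<rho> p \<zeta> * t) \<in> Mp" using lim domain_partition(1) True by (rule topological_tendstoD)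
        thus ?thesis by eventually_elim (use True domain_partition(3) in blast)
      next
        case False
        hence mm: "\<sigma> p t \<in> Mm" using region[OF pt] by blast
        have "\<forall>\<^sub>F \<zeta> in nhds \<xi>. \<sigma> p (\<rho> p \<zeta> * t) \<in> Mm" using lim domain_partition(2) mm by (rule topological_tendstoD)
        thus ?thesis by eventually_elim (use mm domain_partition(3) in blast)
      qed
    qed
    with gn have "\<forall>\<^sub>F \<zeta> in nhds \<xi>. good \<zeta> \<and> (\<forall>(p, t)\<in>I. (\<sigma> p (\<rho> p \<zeta> * t) \<in> Mp \<longleftrightarrow> \<sigma> p t \<in> Mp) \<and> (\<sigma> p (\<rho> p \<zeta> * t) \<in> Mm \<longleftrightarrow> \<sigma> p t \<in> Mm))"
      by (rule eventually_conj)
    then obtain e0 where e0: "e0 > 0" "\<And>\<zeta>. dist \<zeta> \<xi> < e0 \<Longrightarrow> good \<zeta> \<and>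
        (\<forall>(p, t)\<in>I. (\<sigma> p (\<rho> p \<zeta> * t) \<in> Mp \<longleftrightarrow> \<sigma> p t \<in> Mp) \<and> (\<sigma> p (\<rho> p \<zeta> * t) \<in> Mm \<longleftrightarrow> \<sigma> p t \<in> Mm))"
      unfolding eventually_nhds_metric by blast
    \<comment> \<open>Within distance \<open>dist \<xi> c\<close> the relative root is defined by the principal logarithm.\<close>
    define e where "e = min e0 (dist \<xi> c)"
    have e: "e > 0" using e0(1) \<xi>c by (simp add: e_def)
    have good: "good \<zeta>" and near: "\<zeta> \<in> ball \<xi> (dist \<xi> c)"
      and reg: "\<And>p t. (p, t) \<in> I \<Longrightarrow> (\<sigma> p (\<rho> p \<zeta> * t) \<in> Mp \<longleftrightarrow> \<sigma> p t \<in> Mp) \<and> (\<sigma> p (\<rho> p \<zeta> * t) \<in> Mm \<longleftrightarrow> \<sigma> p t \<in> Mm)"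
      if "\<zeta> \<in> ball \<xi> e" for \<zeta>
      using e0(2)[of \<zeta>] that by (auto simp: e_def dist_commute)
    have Rrel: "R p \<zeta> = (\<lambda>t. \<rho> p \<zeta> * t) ` R p \<xi>" if "p \<in> fiber x" "\<zeta> \<in> ball \<xi> e" for p \<zeta>
      unfolding R_def \<rho>_def by (rule roots_relative[OF \<xi>c near[OF that(2)] m[OF that(1)]])
    have \<rho>nz: "\<rho> p \<zeta> \<noteq> 0" if "p \<in> fiber x" "\<zeta> \<in> ball \<xi> e" for p \<zeta>
      unfolding \<rho>_def by (rule relative_root_props(2)[OF \<xi>c near[OF that(2)] m[OF that(1)]])
    have an: "g p analytic_on {\<rho> p \<zeta> * t}" "g p (\<rho> p \<zeta> * t) \<noteq> 0" if "(p, t) \<in> I" "\<zeta> \<in> ball \<xi> e" for p t \<zeta>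
    proof -
      have p: "p \<in> fiber x" "t \<in> R p \<xi>" using that(1) by (auto simp: I_def)
      hence "\<rho> p \<zeta> * t \<in> R p \<zeta>" using Rrel[OF p(1) that(2)] by blast
      thus "g p analytic_on {\<rho> p \<zeta> * t}" "g p (\<rho> p \<zeta> * t) \<noteq> 0" using good[OF that(2)] p(1) unfolding good_def by blast+
    qed
    define I' where "I' = {(p, t)\<in>I. \<sigma> p t \<in> Mm}"
    have I': "finite I'" "I' \<subseteq> I" using finI by (auto simp: I'_def intro: finite_subset)
    define H where "H = (\<lambda>\<zeta>. \<Prod>i\<in>I'. g (fst i) (\<rho> (fst i) \<zeta> * snd i))"
    define k where "k = card {(p, t)\<in>I. \<sigma> p t \<in> Mp}"
    have factor_diff: "(\<lambda>\<zeta>. g p (\<rho> p \<zeta> * t)) field_differentiable at \<zeta>" if "(p, t) \<in> I" "\<zeta> \<in> ball \<xi> e" for p t \<zeta>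
    proof -
      have p: "p \<in> fiber x" using that(1) by (simp add: I_def)
      have "(\<lambda>\<zeta>. \<rho> p \<zeta> * t) field_differentiable at \<zeta>" unfolding \<rho>_def
        by (intro derivative_intros relative_root_props(3)[OF \<xi>c near[OF that(2)] m[OF p]])
      moreover have "g p field_differentiable at (\<rho> p \<zeta> * t)"
        using an(1)[OF that] by (rule analytic_on_imp_differentiable_at) simp
      ultimately show ?thesis using field_differentiable_compose[of "\<lambda>\<zeta>. \<rho> p \<zeta> * t" \<zeta> "g p"] by (simp add: o_def)
    qed
    have Hhol: "H holomorphic_on ball \<xi> e"
      unfolding H_def
    proof (intro holomorphic_on_prod)
      fix i assume i: "i \<in> I'"
      obtain p t where pt: "i = (p, t)" by (cases i)
      have "(p, t) \<in> I" using i pt I'(2) by blast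
      from factor_diff[OF this] show "(\<lambda>\<zeta>. g (fst i) (\<rho> (fst i) \<zeta> * snd i)) holomorphic_on ball \<xi> e"
        unfolding pt by (auto simp: holomorphic_on_def field_differentiable_at_within)
    qed
    have Hnz: "H \<zeta> \<noteq> 0" if "\<zeta> \<in> ball \<xi> e" for \<zeta>
      unfolding H_def using I' an(2)[OF _ that] by (auto simp: prod_zero_iff)
    have reindex: "(\<Prod>t\<in>R p \<zeta>. \<phi> t) = (\<Prod>t\<in>R p \<xi>. (\<phi> (\<rho> p \<zeta> * t) :: complex))"
      "(\<Sum>t\<in>R p \<zeta>. \<psi> t) = (\<Sum>t\<in>R p \<xi>. (\<psi> (\<rho> p \<zeta> * t) :: nat))"
      if "p \<in> fiber x" "\<zeta> \<in> ball \<xi> e" for p \<zeta> \<phi> \<psi>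
    proof -
      have inj: "inj_on (\<lambda>t. \<rho> p \<zeta> * t) (R p \<xi>)" using \<rho>nz[OF that] by (simp add: inj_on_def)
      show "(\<Prod>t\<in>R p \<zeta>. \<phi> t) = (\<Prod>t\<in>R p \<xi>. \<phi> (\<rho> p \<zeta> * t))"
        "(\<Sum>t\<in>R p \<zeta>. \<psi> t) = (\<Sum>t\<in>R p \<xi>. \<psi> (\<rho> p \<zeta> * t))"
        unfolding Rrel[OF that] by (simp_all add: prod.reindex[OF inj] sum.reindex[OF inj])
    qed
    have cnt: "counting_function \<A> Mp f (Some \<zeta>) = k" if \<zeta>: "\<zeta> \<in> ball \<xi> e" for \<zeta>
    proof -
      have gd: "good \<zeta>" by (rule good[OF \<zeta>])
      have "counting_function \<A> Mp f (Some \<zeta>) = card (fiber (Some \<zeta>) \<inter> Mp)"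
        using gd unfolding good_def by blast
      also have "\<dots> = (\<Sum>q\<in>fiber (Some \<zeta>). if q \<in> Mp then 1 else 0)"
        unfolding card_eq_sum by (rule sum.inter_restrict[OF finite_fiber])
      also have "fiber (Some \<zeta>) = (\<Union>p\<in>fiber x. \<sigma> p ` R p \<zeta>)" using gd unfolding good_def by blast
      also have "(\<Sum>q\<in>(\<Union>p\<in>fiber x. \<sigma> p ` R p \<zeta>). if q \<in> Mp then 1 else 0)
          = (\<Sum>p\<in>fiber x. \<Sum>t\<in>R p \<zeta>. if \<sigma> p t \<in> Mp then 1 else (0::nat))"
        using gd finR unfolding good_def by (intro fiber_chart_sum[OF fc]) blast
      also have "\<dots> = (\<Sum>p\<in>fiber x. \<Sum>t\<in>R p \<xi>. if \<sigma> p (\<rho> p \<zeta> * t) \<in> Mp then 1 else (0::nat))"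
        by (intro sum.cong refl reindex(2) \<zeta>)
      also have "\<dots> = (\<Sum>(p, t)\<in>I. if \<sigma> p (\<rho> p \<zeta> * t) \<in> Mp then 1 else (0::nat))"
        unfolding I_def by (intro sum.Sigma finite_fiber ballI finR)
      also have "\<dots> = (\<Sum>i\<in>I. if \<sigma> (fst i) (snd i) \<in> Mp then 1 else (0::nat))"
        using reg[OF \<zeta>] by (intro sum.cong) auto
      also have "\<dots> = k" unfolding k_def
        by (simp add: sum.inter_filter[OF finI, symmetric] case_prod_unfold)
      finally show ?thesis .
    qed
    have Nform: "N \<zeta> = cnj (B \<zeta>) ^ k * H \<zeta>" if \<zeta>: "\<zeta> \<in> ball \<xi> e" for \<zeta>
    proof -
      have gd: "good \<zeta>" by (rule good[OF \<zeta>])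
      have fib: "fiber (Some \<zeta>) = (\<Union>p\<in>fiber x. \<sigma> p ` R p \<zeta>)" using gd unfolding good_def by blast
      have Rsub: "R p \<zeta> \<subseteq> ball 0 r \<and> finite (R p \<zeta>)" if "p \<in> fiber x" for p
        using gd finR[OF that] that unfolding good_def by blast
      have "N \<zeta> = (\<Prod>p\<in>fiber x. \<Prod>t\<in>R p \<zeta>. if \<sigma> p t \<in> Mm then Bst (\<sigma> p t) else cnj (B \<zeta>))"
        unfolding N_def fib by (rule fiber_chart_prod[OF fc Rsub])
      also have "\<dots> = (\<Prod>p\<in>fiber x. \<Prod>t\<in>R p \<xi>. if \<sigma> p (\<rho> p \<zeta> * t) \<in> Mm then Bst (\<sigma> p (\<rho> p \<zeta> * t)) else cnj (B \<zeta>))"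
        by (intro prod.cong refl reindex(1) \<zeta>)
      also have "\<dots> = (\<Prod>(p, t)\<in>I. if \<sigma> p (\<rho> p \<zeta> * t) \<in> Mm then Bst (\<sigma> p (\<rho> p \<zeta> * t)) else cnj (B \<zeta>))"
        unfolding I_def by (intro prod.Sigma finite_fiber ballI finR)
      also have "\<dots> = (\<Prod>i\<in>I. (if \<sigma> (fst i) (snd i) \<in> Mp then cnj (B \<zeta>) else 1) *
            (if \<sigma> (fst i) (snd i) \<in> Mm then g (fst i) (\<rho> (fst i) \<zeta> * snd i) else 1))"
      proof (rule prod.cong[OF refl])
        fix i assume i: "i \<in> I"
        obtain p t where pt: "i = (p, t)" by (cases i)
        hence ptI: "(p, t) \<in> I" using i by simp
        have "\<sigma> p t \<in> Mp \<and> \<sigma> p t \<notin> Mm \<or> \<sigma> p t \<notin> Mp \<and> \<sigma> p t \<in> Mm"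
          using region[OF ptI] domain_partition(3) by blast
        thus "(case i of (p, t) \<Rightarrow> if \<sigma> p (\<rho> p \<zeta> * t) \<in> Mm then Bst (\<sigma> p (\<rho> p \<zeta> * t)) else cnj (B \<zeta>)) =
            (if \<sigma> (fst i) (snd i) \<in> Mp then cnj (B \<zeta>) else 1) *
            (if \<sigma> (fst i) (snd i) \<in> Mm then g (fst i) (\<rho> (fst i) \<zeta> * snd i) else 1)"
          using reg[OF \<zeta> ptI] unfolding pt g_def by auto
      qed
      also have "\<dots> = cnj (B \<zeta>) ^ k * H \<zeta>"
        unfolding k_def H_def I'_def
        by (simp add: prod.distrib prod.inter_filter[OF finI, symmetric] case_prod_unfold)
      finally show ?thesis .
    qed
    have "(H has_field_derivative H \<xi> * (\<Sum>i\<in>I'. (deriv (g (fst i)) (snd i) * (snd i / (of_nat (ram (fst i)) * (\<xi> - c)))) / g (fst i) (snd i))) (at \<xi>)"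
    proof -
      have "(H has_field_derivative (\<Prod>i\<in>I'. g (fst i) (\<rho> (fst i) \<xi> * snd i)) *
         (\<Sum>i\<in>I'. (deriv (g (fst i)) (snd i) * (snd i / (of_nat (ram (fst i)) * (\<xi> - c)))) / g (fst i) (\<rho> (fst i) \<xi> * snd i))) (at \<xi>)"
        unfolding H_def
      proof (rule has_field_derivative_prod')
        fix i assume i: "i \<in> I'"
        obtain p t where pt: "i = (p, t)" by (cases i)
        have ptI: "(p, t) \<in> I" and p: "p \<in> fiber x" using i pt I'(2) by (auto simp: I_def)
        have \<xi>e: "\<xi> \<in> ball \<xi> e" using e by simp
        show "g (fst i) (\<rho> (fst i) \<xi> * snd i) \<noteq> 0" using an(2)[OF ptI \<xi>e] pt by simp
        have "g p analytic_on {t}" using an(1)[OF ptI \<xi>e] \<rho>1[OF ptI] by simp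
        hence d1: "(g p has_field_derivative deriv (g p) t) (at (\<rho> p \<xi> * t))"
          using \<rho>1[OF ptI] by (auto intro: analytic_derivI)
        have d2: "((\<lambda>\<zeta>. \<rho> p \<zeta> * t) has_field_derivative 1 / (of_nat (ram p) * (\<xi> - c)) * t) (at \<xi>)"
          unfolding \<rho>_def by (intro DERIV_cmult_right relative_root_deriv(2) \<xi>c m p)
        from DERIV_chain2[OF d1 d2]
        show "((\<lambda>\<zeta>. g (fst i) (\<rho> (fst i) \<zeta> * snd i)) has_field_derivative
            deriv (g (fst i)) (snd i) * (snd i / (of_nat (ram (fst i)) * (\<xi> - c)))) (at \<xi>)"
          by (simp add: pt)
      qed
      moreover have "g (fst i) (\<rho> (fst i) \<xi> * snd i) = g (fst i) (snd i)" if "i \<in> I'" for i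
      proof -
        have "(fst i, snd i) \<in> I" using I'(2) that by auto
        from \<rho>1[OF this] show ?thesis by (simp only:)
      qed
      ultimately show ?thesis by (simp add: H_def)
    qed
    hence "deriv H \<xi> = H \<xi> * (\<Sum>i\<in>I'. (deriv (g (fst i)) (snd i) * (snd i / (of_nat (ram (fst i)) * (\<xi> - c)))) / g (fst i) (snd i))"
      by (rule DERIV_imp_deriv)
    hence "deriv H \<xi> / H \<xi> = (\<Sum>i\<in>I'. (deriv (g (fst i)) (snd i) * (snd i / (of_nat (ram (fst i)) * (\<xi> - c)))) / g (fst i) (snd i))"
      using Hnz[of \<xi>] e by simp
    also have "norm \<dots> \<le> (\<Sum>i\<in>I'. \<bar>A (fst i)\<bar> / norm (\<xi> - c))"
    proof (rule sum_norm_le)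
      fix i assume i: "i \<in> I'"
      obtain p t where pt: "i = (p, t)" by (cases i)
      have p: "p \<in> fiber x" "t \<in> R p \<xi>" using i pt I'(2) by (auto simp: I_def)
      have bd: "norm (t * (deriv (g p) t / g p t)) \<le> A p" using g\<xi> p unfolding good_def by blast
      have "(deriv (g p) t * (t / (of_nat (ram p) * (\<xi> - c)))) / g p t
          = (t * (deriv (g p) t / g p t)) / (of_nat (ram p) * (\<xi> - c))" by (simp add: mult_ac)
      also have "norm \<dots> = norm (t * (deriv (g p) t / g p t)) / (real (ram p) * norm (\<xi> - c))"
        by (simp only: norm_divide norm_mult norm_of_nat)
      also have "\<dots> \<le> \<bar>A p\<bar> / (1 * norm (\<xi> - c))"
      proof (rule frac_le)
        show "1 * norm (\<xi> - c) \<le> real (ram p) * norm (\<xi> - c)" using m[OF p(1)] by (intro mult_right_mono) auto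
      qed (use bd \<xi>c in auto)
      finally show "norm ((deriv (g (fst i)) (snd i) * (snd i / (of_nat (ram (fst i)) * (\<xi> - c)))) / g (fst i) (snd i)) \<le> \<bar>A (fst i)\<bar> / norm (\<xi> - c)"
        by (simp add: pt)
    qed
    also have "\<dots> \<le> (\<Sum>i\<in>I. \<bar>A (fst i)\<bar> / norm (\<xi> - c))"
      using finI I'(2) by (intro sum_mono2) auto
    also have "\<dots> = (\<Sum>p\<in>fiber x. \<Sum>t\<in>R p \<xi>. \<bar>A p\<bar> / norm (\<xi> - c))"
      unfolding I_def by (subst sum.Sigma) (use finite_fiber finR in \<open>auto simp: case_prod_unfold\<close>)
    also have "\<dots> = (\<Sum>p\<in>fiber x. real (ram p) * (\<bar>A p\<bar> / norm (\<xi> - c)))"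
    proof (rule sum.cong[OF refl])
      fix p assume p: "p \<in> fiber x"
      have "card (R p \<xi>) = ram p" unfolding R_def using m[OF p] \<xi>c by (intro card_nth_roots) auto
      thus "(\<Sum>t\<in>R p \<xi>. \<bar>A p\<bar> / norm (\<xi> - c)) = real (ram p) * (\<bar>A p\<bar> / norm (\<xi> - c))" by simp
    qed
    also have "\<dots> = AA / norm (\<xi> - c)" unfolding AA_def by (simp add: sum_divide_distrib)
    finally have "norm (deriv H \<xi> / H \<xi>) \<le> AA / norm (\<xi> - c)" .
    moreover have "local_norm_form \<xi> e k H"
      unfolding local_norm_form_def using e Hhol Hnz Nform cnt by blast
    ultimately show "\<exists>e k H. local_norm_form \<xi> e k H \<and> norm (deriv H \<xi> / H \<xi>) \<le> AA / norm (\<xi> - c)" by blast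
  qed
  thus ?thesis by blast
qed

end

section \<open>The image of the boundary curve\<close>

context surface_map
begin

text \<open>
  The points with a given value are isolated, and the surface is compact.
\<close>
lemma finite_value_set:
  assumes g: "meromorphic_function \<A> g" and avoid: "\<And>p. \<forall>\<^sub>F q in at p. g q \<noteq> c"
  shows "finite {p. mero_value g p = Some c}"
proof -
  have "\<exists>V. open V \<and> p \<in> V \<and> V \<inter> {p. mero_value g p = Some c} \<subseteq> {p}" for p
  proof -
    have "\<forall>\<^sub>F q in at p. mero_value g q \<noteq> Some c"
      using eventually_mero_value[OF g, of p] avoid[of p] by eventually_elim auto
    thus ?thesis unfolding eventually_at_topological by blast
  qed
  then obtain V where V: "\<And>p. open (V p)" "\<And>p. p \<in> V p" "\<And>p. V p \<inter> {p. mero_value g p = Some c} \<subseteq> {p}" by metis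
  have "UNIV \<subseteq> (\<Union>p\<in>UNIV. V p)" using V(2) by blast
  from compactE_image[OF compact_surface _ this] V(1) obtain C where C: "finite C" "UNIV \<subseteq> (\<Union>p\<in>C. V p)"
    by metis
  have "{p. mero_value g p = Some c} \<subseteq> C" using C(2) V(3) by blast
  thus ?thesis using C(1) finite_subset by blast
qed

lemma constant_value_unique:
  assumes "\<forall>p. \<forall>\<^sub>F q in at (p::'a). g q = c" "\<forall>p. \<forall>\<^sub>F q in at (p::'a). g q = (d::complex)"
  shows "c = d"
proof -
  have "\<forall>\<^sub>F q in at (undefined::'a). c = d"
    using spec[OF assms(1), of undefined] spec[OF assms(2), of undefined] by eventually_elim simp
  thus ?thesis using at_nontrivial by (simp add: eventually_const)
qed

end

context algebraic_domain
begin

definition boundary_image :: "complex set" where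
  "boundary_image = {\<zeta>. fiber (Some \<zeta>) \<inter> \<Gamma> \<noteq> {}}"

text \<open>
  A boundary value on the line \<open>\<alpha> = s\<close> comes from a point at which the meromorphic function \<open>g\<close> has the
  value \<open>s\<close>. There are finitely many of these, unless \<open>g\<close> is the constant \<open>s\<close>.
\<close>
lemma boundary_image_lines:
  fixes g :: "'a \<Rightarrow> complex" and \<alpha> :: "complex \<Rightarrow> real"
  assumes g: "meromorphic_function \<A> g"
    and val: "\<And>p v. p \<in> \<Gamma> \<Longrightarrow> mero_value f p = Some v \<Longrightarrow> mero_value g p = Some (of_real (\<alpha> v))"
  shows "\<exists>E. countable E \<and> (\<forall>s. s \<notin> E \<longrightarrow> finite {\<zeta> \<in> boundary_image. \<alpha> \<zeta> = s})"
proof -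
  \<comment> \<open>If \<open>g\<close> is constant, its value is the single exception; otherwise \<open>E\<close> is empty.\<close>
  define E where "E = {s. \<forall>p. \<forall>\<^sub>F q in at p. g q = complex_of_real s}"
  have "s = t" if "s \<in> E" "t \<in> E" for s t
    using constant_value_unique[of g "of_real s" "of_real t"] that by (auto simp: E_def)
  hence "E \<subseteq> {SOME s. s \<in> E}" by (metis singletonI someI subsetI)
  hence "countable E" by (rule countable_subset) simp
  moreover have "finite {\<zeta> \<in> boundary_image. \<alpha> \<zeta> = s}" if "s \<notin> E" for s
  proof -
    have "\<And>p. \<forall>\<^sub>F q in at p. g q \<noteq> of_real s"
      using identity_dichotomy[OF g connected_surface, of "of_real s"] that by (auto simp: E_def)
    hence fin: "finite {p. mero_value g p = Some (of_real s)}" by (rule finite_value_set[OF g])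
    have "{\<zeta> \<in> boundary_image. \<alpha> \<zeta> = s} \<subseteq> (\<lambda>p. the (mero_value f p)) ` {p. mero_value g p = Some (of_real s)}"
    proof
      fix \<zeta> assume z: "\<zeta> \<in> {\<zeta> \<in> boundary_image. \<alpha> \<zeta> = s}"
      then obtain p where p: "p \<in> \<Gamma>" "mero_value f p = Some \<zeta>" by (auto simp: boundary_image_def fiber_def)
      have "mero_value g p = Some (of_real s)" using val[OF p] z by simp
      thus "\<zeta> \<in> (\<lambda>p. the (mero_value f p)) ` {p. mero_value g p = Some (of_real s)}"
        using p(2) by (intro image_eqI[of _ _ p]) auto
    qed
    thus ?thesis using fin finite_surj by blast
  qed
  ultimately show ?thesis by blast
qed

text \<open>
  On \<open>\<Gamma>\<close> the function \<open>f\<^sup>*\<close> has the conjugate value of \<open>f\<close>.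
\<close>
lemma boundary_values:
  assumes "p \<in> \<Gamma>" "mero_value f p = Some v"
  shows "mero_value (\<lambda>q. (f q + fs q) / 2) p = Some (of_real (Re v))"
    and "mero_value (\<lambda>q. (f q - fs q) / (2 * \<i>)) p = Some (of_real (Im v))"
proof -
  have "J p = p" using assms(1) by (simp add: fixed_points_def)
  hence "mero_value fs p = Some (cnj v)" using assms(2) by (simp add: mero_value_fs)
  hence l: "(f \<longlongrightarrow> v) (at p)" "(fs \<longlongrightarrow> cnj v) (at p)"
    using assms(2) by (simp_all add: mero_value_Some_iff[OF f_mero] mero_value_Some_iff[OF fs_mero])
  have "((\<lambda>q. (f q + fs q) / 2) \<longlongrightarrow> (v + cnj v) / 2) (at p)"
    "((\<lambda>q. (f q - fs q) / (2 * \<i>)) \<longlongrightarrow> (v - cnj v) / (2 * \<i>)) (at p)"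
    using l by (intro tendsto_intros; simp)+
  moreover have "(v + cnj v) / 2 = of_real (Re v)" "(v - cnj v) / (2 * \<i>) = of_real (Im v)"
    by (auto simp: complex_eq_iff complex_add_cnj complex_diff_cnj)
  ultimately show "mero_value (\<lambda>q. (f q + fs q) / 2) p = Some (of_real (Re v))"
    "mero_value (\<lambda>q. (f q - fs q) / (2 * \<i>)) p = Some (of_real (Im v))"
    using mero_valueI by metis+
qed

lemma boundary_image_vertical:
  "\<exists>E. countable E \<and> (\<forall>s. s \<notin> E \<longrightarrow> finite {t. Complex s t \<in> boundary_image})"
proof -
  have c: "meromorphic_function \<A> (\<lambda>q. c)" for c by (rule meromorphic_function_ops(1)[OF f_mero f_mero])
  have "meromorphic_function \<A> (\<lambda>q. (f q + fs q) / 2)"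
    by (intro meromorphic_function_ops(5) meromorphic_function_ops(2) c f_mero fs_mero)
  hence "\<exists>E. countable E \<and> (\<forall>s. s \<notin> E \<longrightarrow> finite {\<zeta> \<in> boundary_image. Re \<zeta> = s})"
    by (rule boundary_image_lines) (rule boundary_values(1))
  then obtain E where E: "countable E"
    "\<And>s. s \<notin> E \<Longrightarrow> finite {\<zeta> \<in> boundary_image. Re \<zeta> = s}" by blast
  have "finite {t. Complex s t \<in> boundary_image}" if "s \<notin> E" for s
  proof (rule finite_surj[OF E(2)[OF that]])
    show "{t. Complex s t \<in> boundary_image} \<subseteq> Im ` {\<zeta> \<in> boundary_image. Re \<zeta> = s}"
    proof
      fix t assume "t \<in> {t. Complex s t \<in> boundary_image}"
      thus "t \<in> Im ` {\<zeta> \<in> boundary_image. Re \<zeta> = s}" by (intro image_eqI[of _ _ "Complex s t"]) auto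
    qed
  qed
  thus ?thesis using E(1) by blast
qed

lemma boundary_image_horizontal:
  "\<exists>E. countable E \<and> (\<forall>t. t \<notin> E \<longrightarrow> finite {s. Complex s t \<in> boundary_image})"
proof -
  have c: "meromorphic_function \<A> (\<lambda>q. c)" for c by (rule meromorphic_function_ops(1)[OF f_mero f_mero])
  have "meromorphic_function \<A> (\<lambda>q. (f q - fs q) / (2 * \<i>))"
    by (intro meromorphic_function_ops(5) meromorphic_function_ops(3) c f_mero fs_mero)
  hence "\<exists>E. countable E \<and> (\<forall>s. s \<notin> E \<longrightarrow> finite {\<zeta> \<in> boundary_image. Im \<zeta> = s})"
    by (rule boundary_image_lines) (rule boundary_values(2))
  then obtain E where E: "countable E"
    "\<And>s. s \<notin> E \<Longrightarrow> finite {\<zeta> \<in> boundary_image. Im \<zeta> = s}" by blast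
  have "finite {s. Complex s t \<in> boundary_image}" if "t \<notin> E" for t
  proof (rule finite_surj[OF E(2)[OF that]])
    show "{s. Complex s t \<in> boundary_image} \<subseteq> Re ` {\<zeta> \<in> boundary_image. Im \<zeta> = t}"
    proof
      fix s assume "s \<in> {s. Complex s t \<in> boundary_image}"
      thus "s \<in> Re ` {\<zeta> \<in> boundary_image. Im \<zeta> = t}" by (intro image_eqI[of _ _ "Complex s t"]) auto
    qed
  qed
  thus ?thesis using E(1) by blast
qed

lemma off_boundary_nearby:
  assumes off: "fiber x \<inter> \<Gamma> = {}"
  shows "\<forall>\<^sub>F \<zeta> in sphere_at x. fiber (Some \<zeta>) \<inter> \<Gamma> = {} \<and>
           counting_function \<A> Mp f (Some \<zeta>) = counting_function \<A> Mp f x"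
proof -
  obtain \<sigma> r where fc: "fiber_chart x \<sigma> r" using fiber_chart_exists by blast
  have side: "\<forall>\<^sub>F q in at p. (q \<in> Mp \<longleftrightarrow> p \<in> Mp) \<and> q \<notin> \<Gamma>" if p: "p \<in> fiber x" for p
  proof (cases "p \<in> Mp")
    case True
    have "\<forall>\<^sub>F q in at p. q \<in> Mp" using domain_partition(1) True by (rule eventually_at_in_open')
    thus ?thesis by eventually_elim (use True domain_partition(4) in blast)
  next
    case False
    hence mm: "p \<in> Mm" using p off domain_partition(6) by blast
    have "\<forall>\<^sub>F q in at p. q \<in> Mm" using domain_partition(2) mm by (rule eventually_at_in_open')
    thus ?thesis by eventually_elim (use False domain_partition(3,5) in blast)
  qed
  have "\<forall>\<^sub>F \<zeta> in sphere_at x. \<forall>p\<in>fiber x. \<forall>t. t ^ ram p = uniformizer x \<zeta> \<longrightarrow>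
      (\<sigma> p t \<in> Mp \<longleftrightarrow> p \<in> Mp) \<and> \<sigma> p t \<notin> \<Gamma>"
    by (intro eventually_ball_finite finite_fiber ballI eventually_fiber_chart'[OF fc _ side])
  with fiber_chartD(5)[OF fc] counting_function_nearby[of Mp x] show ?thesis
  proof eventually_elim
    case (elim \<zeta>)
    define R where "R = (\<lambda>p. {t. t ^ ram p = uniformizer x \<zeta>})"
    have fib: "fiber (Some \<zeta>) = (\<Union>p\<in>fiber x. \<sigma> p ` R p)" using elim unfolding R_def by blast
    have u: "uniformizer x \<zeta> \<noteq> 0" using elim by blast
    have fR: "finite (R p)" "card (R p) = ram p" if "p \<in> fiber x" for p
      unfolding R_def by (rule roots_props[OF that u])+
    have sub: "R p \<subseteq> ball 0 r \<and> finite (R p)" if "p \<in> fiber x" for p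
      using elim fR(1)[OF that] that unfolding R_def by blast
    have off': "fiber (Some \<zeta>) \<inter> \<Gamma> = {}" unfolding fib using elim(3) unfolding R_def by blast
    have "counting_function \<A> Mp f (Some \<zeta>) = card (fiber (Some \<zeta>) \<inter> Mp)" using elim by blast
    also have "\<dots> = (\<Sum>q\<in>fiber (Some \<zeta>). if q \<in> Mp then 1 else 0)"
      unfolding card_eq_sum by (rule sum.inter_restrict[OF finite_fiber])
    also have "\<dots> = (\<Sum>p\<in>fiber x. \<Sum>t\<in>R p. if \<sigma> p t \<in> Mp then 1 else (0::nat))"
      unfolding fib by (rule fiber_chart_sum[OF fc sub])
    also have "\<dots> = (\<Sum>p\<in>fiber x. \<Sum>t\<in>R p. if p \<in> Mp then 1 else (0::nat))"
      using elim(3) unfolding R_def by (intro sum.cong refl) auto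
    also have "\<dots> = (\<Sum>p\<in>fiber x. if p \<in> Mp then ram p else 0)"
      using fR(2) by (intro sum.cong refl) auto
    also have "\<dots> = counting_function \<A> Mp f x"
      unfolding counting_function_eq by (rule sum.inter_restrict[OF finite_fiber, symmetric])
    finally show ?case using off' by blast
  qed
qed

end

section \<open>The norm near a point off the boundary image\<close>

context two_point_domain
begin

text \<open>
  The centre itself is excluded from the representation of \<open>N\<close>: it may be a branch point, where \<open>N\<close> as a
  product over a fibre without multiplicities has the wrong value.
\<close>
definition regular_norm_form :: "complex \<Rightarrow> real \<Rightarrow> nat \<Rightarrow> (complex \<Rightarrow> complex) \<Rightarrow> bool" where
  "regular_norm_form \<xi> e k H \<longleftrightarrow> e > 0 \<and> H holomorphic_on ball \<xi> e \<and>
     (\<forall>\<zeta>\<in>ball \<xi> e. H \<zeta> \<noteq> 0) \<and>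
     (\<forall>\<zeta>\<in>ball \<xi> e - {\<xi>}. N \<zeta> = cnj (B \<zeta>) ^ k * H \<zeta> \<and> counting_function \<A> Mp f (Some \<zeta>) = k)"

text \<open>
  The quotient of \<open>N\<close> by \<open>cnj B ^ k\<close> is holomorphic and has a finite nonzero limit at \<open>z\<close>, so the singularity is
  removable; the value at \<open>z\<close> is the product over the fibre with multiplicities.
\<close>
lemma N_regular_form:
  assumes off: "fiber (Some z) \<inter> \<Gamma> = {}" and z: "z \<noteq> w" "z \<noteq> b"
    and ord0: "\<And>p. p \<in> fiber (Some z) \<inter> Mm \<Longrightarrow> J p \<notin> fiber (Some w) \<and> J p \<notin> fiber (Some b)"
  obtains e H where "regular_norm_form z e (counting_function \<A> Mp f (Some z)) H"
    "H z = (\<Prod>p\<in>fiber (Some z) \<inter> Mm. cnj (B_value (mero_value f (J p))) ^ ram p)"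
proof -
  define k where "k = counting_function \<A> Mp f (Some z)"
  define x where "x = Some z"
  define C where "C = (\<Prod>p\<in>fiber x \<inter> Mm. cnj (B_value (mero_value f (J p))) ^ ram p)"
  obtain c where c: "\<And>p. p \<in> fiber x \<Longrightarrow> c p \<noteq> 0" "\<And>p. p \<in> fiber x \<inter> Mp \<Longrightarrow> c p = 1"
    "\<And>p l. p \<in> fiber x \<inter> Mm \<Longrightarrow> l \<noteq> 0 \<Longrightarrow> (Bst \<longlongrightarrow> l) (at p) \<Longrightarrow> c p = l ^ ram p"
    "((\<lambda>\<zeta>. N \<zeta> / (cnj (B \<zeta>) ^ counting_function \<A> Mp f x *
         (\<Prod>p\<in>fiber x \<inter> Mm. uniformizer x \<zeta> powi ord_Bst p))) \<longlongrightarrow> (\<Prod>p\<in>fiber x. c p)) (sphere_at x)"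
    using N_asymptotics[of x] off unfolding x_def by blast
  have val: "cnj (B_value (mero_value f (J p))) \<noteq> 0 \<and> c p = cnj (B_value (mero_value f (J p))) ^ ram p \<and> ord_Bst p = 0"
    if p: "p \<in> fiber x \<inter> Mm" for p
  proof -
    have np: "mero_value f (J p) \<noteq> Some w" "mero_value f (J p) \<noteq> Some b"
      using ord0[of p] p by (auto simp: x_def fiber_def)
    have nz: "cnj (B_value (mero_value f (J p))) \<noteq> 0" using B_value_nonzero[OF np] by simp
    have "(Bst \<longlongrightarrow> cnj (B_value (mero_value f (J p)))) (at p)"
      by (rule Bst_tendsto) (use np in \<open>auto simp: fiber_def\<close>)
    thus ?thesis using nz c(3)[OF p nz] ord_Bst(3)[of p] ord0[of p] p by (auto simp: x_def)
  qed
  have split: "fiber x = (fiber x \<inter> Mp) \<union> (fiber x \<inter> Mm)" using off domain_partition(6) unfolding x_def by blast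
  have "(\<Prod>p\<in>fiber x. c p) = (\<Prod>p\<in>fiber x \<inter> Mp. c p) * (\<Prod>p\<in>fiber x \<inter> Mm. c p)"
    by (subst split, rule prod.union_disjoint) (use finite_fiber domain_partition(3) in auto)
  also have "\<dots> = C" using c(2) val unfolding C_def by simp
  finally have C: "(\<Prod>p\<in>fiber x. c p) = C" .
  have Cnz: "C \<noteq> 0" unfolding C[symmetric] using c(1) finite_fiber by (simp add: prod_zero_iff)
  have lim: "((\<lambda>\<zeta>. N \<zeta> / cnj (B \<zeta>) ^ k) \<longlongrightarrow> C) (at z)"
    using c(4) val unfolding C by (simp add: x_def k_def)
  obtain A where A: "\<forall>\<^sub>F \<xi> in at z. fiber (Some \<xi>) \<inter> \<Gamma> = {} \<longrightarrow>
      (\<exists>e k H. local_norm_form \<xi> e k H \<and> norm (deriv H \<xi> / H \<xi>) \<le> A / norm (\<xi> - z))"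
    using N_local_form by blast
  have "\<forall>\<^sub>F \<xi> in at z. \<xi> \<noteq> w \<and> \<xi> \<noteq> b"
    using z by (intro eventually_conj eventually_neq_at_within)
  with A off_boundary_nearby[OF off, unfolded sphere_at_simps]
  have "\<forall>\<^sub>F \<xi> in at z. \<xi> \<noteq> w \<and> \<xi> \<noteq> b \<and> (\<exists>e H. local_norm_form \<xi> e k H)"
  proof eventually_elim
    case (elim \<xi>)
    then obtain e k' H where lf: "local_norm_form \<xi> e k' H" by blast
    hence "k' = k" using elim unfolding local_norm_form_def k_def by force
    thus ?case using elim lf by blast
  qed
  then obtain e where e: "e > 0" "\<And>\<xi>. \<xi> \<noteq> z \<Longrightarrow> dist \<xi> z < e \<Longrightarrow> \<xi> \<noteq> w \<and> \<xi> \<noteq> b \<and> (\<exists>e H. local_norm_form \<xi> e k H)"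
    unfolding eventually_at by blast
  have Bnz: "cnj (B \<xi>) \<noteq> 0" if "\<xi> \<in> ball z e - {z}" for \<xi>
    using e(2)[of \<xi>] that by (auto simp: B_def dist_commute)
  define H where "H = (\<lambda>\<zeta>. if \<zeta> = z then C else N \<zeta> / cnj (B \<zeta>) ^ k)"
  have loc: "\<exists>e' H'. local_norm_form \<xi> e' k H'" if "\<xi> \<in> ball z e - {z}" for \<xi>
    using e(2)[of \<xi>] that by (auto simp: dist_commute)
  have hol: "H holomorphic_on ball z e - {z}"
  proof -
    have "H field_differentiable at \<xi>" if \<xi>: "\<xi> \<in> ball z e - {z}" for \<xi>
    proof -
      obtain e' H' where lf: "local_norm_form \<xi> e' k H'" using loc[OF \<xi>] by blast
      have "H' field_differentiable at \<xi>"
        using lf unfolding local_norm_form_def by (auto intro: holomorphic_on_imp_differentiable_at)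
      moreover have "\<forall>\<^sub>F \<zeta> in nhds \<xi>. H' \<zeta> = H \<zeta>"
      proof -
        have "open (ball \<xi> e' \<inter> (ball z e - {z}))" by auto
        moreover have "\<xi> \<in> ball \<xi> e' \<inter> (ball z e - {z})" using \<xi> lf by (auto simp: local_norm_form_def)
        ultimately have "\<forall>\<^sub>F \<zeta> in nhds \<xi>. \<zeta> \<in> ball \<xi> e' \<inter> (ball z e - {z})" by (rule eventually_nhds_in_open)
        thus ?thesis
        proof eventually_elim
          case (elim \<zeta>)
          thus ?case using lf Bnz[of \<zeta>] unfolding local_norm_form_def H_def by auto
        qed
      qed
      ultimately show ?thesis
        unfolding field_differentiable_def using has_field_derivative_cong_ev[of \<xi> \<xi> UNIV H' H]
        by (metis DERIV_cong_ev)
    qed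
    thus ?thesis by (auto simp: holomorphic_on_def field_differentiable_at_within)
  qed
  have "continuous_on (ball z e) H"
  proof (rule continuous_at_imp_continuous_on, rule ballI)
    fix \<xi> assume \<xi>: "\<xi> \<in> ball z e"
    show "isCont H \<xi>"
    proof (cases "\<xi> = z")
      case True
      have "\<forall>\<^sub>F \<zeta> in at z. N \<zeta> / cnj (B \<zeta>) ^ k = H \<zeta>"
        by (simp add: eventually_at_filter H_def)
      from Lim_transform_eventually[OF lim this] show ?thesis using True by (simp add: isCont_def H_def)
    next
      case False
      have "open (ball z e - {z})" by auto
      thus ?thesis using holomorphic_on_imp_continuous_on[OF hol] \<xi> False by (simp add: continuous_on_eq_continuous_at)
    qed
  qed
  hence hol': "H holomorphic_on ball z e"
    by (rule no_isolated_singularity[OF _ hol open_ball]) simp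
  have Hnz: "H \<zeta> \<noteq> 0" if "\<zeta> \<in> ball z e" for \<zeta>
  proof (cases "\<zeta> = z")
    case False
    hence "\<zeta> \<in> ball z e - {z}" using that by simp
    from loc[OF this] obtain e' H' where "local_norm_form \<zeta> e' k H'" by blast
    hence "N \<zeta> = cnj (B \<zeta>) ^ k * H' \<zeta>" "H' \<zeta> \<noteq> 0" by (auto simp: local_norm_form_def)
    thus ?thesis using False Bnz[of \<zeta>] that by (simp add: H_def)
  qed (simp add: H_def Cnz)
  have "regular_norm_form z e k H"
    unfolding regular_norm_form_def
  proof (intro conjI ballI)
    fix \<zeta> assume \<zeta>: "\<zeta> \<in> ball z e - {z}"
    show "N \<zeta> = cnj (B \<zeta>) ^ k * H \<zeta>" using Bnz[OF \<zeta>] \<zeta> by (simp add: H_def)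
    from loc[OF \<zeta>] show "counting_function \<A> Mp f (Some \<zeta>) = k" by (auto simp: local_norm_form_def)
  qed (use e(1) hol' Hnz in auto)
  moreover have "H z = (\<Prod>p\<in>fiber (Some z) \<inter> Mm. cnj (B_value (mero_value f (J p))) ^ ram p)"
    by (simp add: H_def C_def x_def)
  ultimately show ?thesis using that unfolding k_def by blast
qed

end

section \<open>The logarithm of the norm\<close>

lemma continuous_on_Lim_at:
  fixes g :: "complex \<Rightarrow> complex"
  assumes "\<And>c. \<exists>l. (g \<longlongrightarrow> l) (at c)"
  shows "continuous_on UNIV (\<lambda>c. Lim (at c) g)"
proof (rule continuous_at_imp_continuous_on, rule ballI)
  fix c :: complex
  have lim: "(g \<longlongrightarrow> Lim (at d) g) (at d)" for d
    using assms[of d] tendsto_Lim[OF at_neq_bot, of g _ d] by auto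
  have "((\<lambda>d. Lim (at d) g) \<longlongrightarrow> Lim (at c) g) (at c)"
  proof (rule tendstoI)
    fix e :: real assume e: "e > 0"
    have "\<forall>\<^sub>F x in at c. dist (g x) (Lim (at c) g) < e / 2" using lim e by (intro tendstoD) auto
    hence "\<forall>\<^sub>F d in at c. \<forall>\<^sub>F x in nhds d. dist (g x) (Lim (at c) g) < e / 2"
      by (rule eventually_at_imp_eventually_nhds)
    thus "\<forall>\<^sub>F d in at c. dist (Lim (at d) g) (Lim (at c) g) < e"
    proof eventually_elim
      case (elim d)
      hence "\<forall>\<^sub>F x in at d. dist (g x) (Lim (at c) g) \<le> e / 2"
        unfolding eventually_at_filter by eventually_elim auto
      hence "dist (Lim (at d) g) (Lim (at c) g) \<le> e / 2"
        by (intro tendsto_upperbound[OF tendsto_dist[OF lim tendsto_const]]) auto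
      thus ?case using e by simp
    qed
  qed
  thus "isCont (\<lambda>c. Lim (at c) g) c" by (simp add: isCont_def)
qed

text \<open>
  The difference of \<open>L\<close> and the principal logarithm of \<open>exp (L x) / C\<close> is continuous on the exterior of a
  disc, which is connected, and takes values in a translate of the discrete set \<open>2 * \<pi> * \<i> * \<int>\<close>.
\<close>
lemma log_limit_at_infinity:
  fixes L :: "complex \<Rightarrow> complex"
  assumes cont: "continuous_on {x. norm x > r0} L"
    and lim: "((\<lambda>x. exp (L x)) \<longlongrightarrow> C) at_infinity" and C: "C \<noteq> 0"
  obtains l where "(L \<longlongrightarrow> l) at_infinity"
proof -
  have lim1: "((\<lambda>x. exp (L x) / C) \<longlongrightarrow> 1) at_infinity" using tendsto_divide[OF lim tendsto_const[of C]] C by simp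
  hence "\<forall>\<^sub>F x in at_infinity. dist (exp (L x) / C) 1 < 1" by (rule tendstoD) simp
  then obtain r1 where r1: "\<And>x. norm x \<ge> r1 \<Longrightarrow> dist (exp (L x) / C) 1 < 1"
    unfolding eventually_at_infinity by blast
  define r where "r = max r0 r1"
  define S where "S = - cball (0::complex) r"
  have S: "norm x > r0" "dist (exp (L x) / C) 1 < 1" if "x \<in> S" for x
    using that r1[of x] by (auto simp: S_def r_def)
  have slit: "exp (L x) / C \<notin> \<real>\<^sub>\<le>\<^sub>0" if "x \<in> S" for x
  proof -
    have "\<bar>Re (exp (L x) / C - 1)\<bar> < 1" using S(2)[OF that] abs_Re_le_cmod le_less_trans unfolding dist_norm by blast
    hence "Re (exp (L x) / C) > 0" by simp
    thus ?thesis by (auto simp: complex_nonpos_Reals_iff)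
  qed
  define \<phi> where "\<phi> = (\<lambda>x. L x - Ln (exp (L x) / C) - Ln C)"
  have contS: "continuous_on S L" using cont by (rule continuous_on_subset) (use S(1) in auto)
  have "continuous_on S \<phi>" unfolding \<phi>_def using C slit
    by (intro continuous_intros contS) auto
  moreover have "connected S" unfolding S_def
    by (intro connected_complement_bounded_convex) auto
  moreover have "\<exists>e>0. \<forall>y. y \<in> S \<and> \<phi> y \<noteq> \<phi> x \<longrightarrow> e \<le> norm (\<phi> y - \<phi> x)" if x: "x \<in> S" for x
  proof (intro exI[of _ "2 * pi"] conjI allI impI)
    fix y assume y: "y \<in> S \<and> \<phi> y \<noteq> \<phi> x"
    have e1: "exp (\<phi> v) = 1" for v using C by (simp add: \<phi>_def exp_diff)
    hence "exp (\<phi> y) = exp (\<phi> x)" by simp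
    then obtain n :: int where n: "\<phi> y = \<phi> x + (of_int (2 * n) * pi) * \<i>" using exp_eq by blast
    have "n \<noteq> 0" using n y by auto
    hence "1 \<le> \<bar>real_of_int n\<bar>" by linarith
    moreover have "norm (\<phi> y - \<phi> x) = 2 * pi * \<bar>real_of_int n\<bar>" using n by (simp add: norm_mult abs_mult)
    ultimately show "2 * pi \<le> norm (\<phi> y - \<phi> x)" by simp
  qed simp
  ultimately have "\<phi> constant_on S" by (intro continuous_discrete_range_constant) auto
  then obtain a where a: "\<And>x. x \<in> S \<Longrightarrow> \<phi> x = a" unfolding constant_on_def by blast
  have "((\<lambda>x. a + Ln (exp (L x) / C) + Ln C) \<longlongrightarrow> a + Ln 1 + Ln C) at_infinity"
    by (intro tendsto_intros lim1) simp
  moreover have "\<forall>\<^sub>F x in at_infinity. a + Ln (exp (L x) / C) + Ln C = L x"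
  proof -
    have "a + Ln (exp (L x) / C) + Ln C = L x" if "norm x \<ge> r + 1" for x
      using a[of x] that by (auto simp: \<phi>_def S_def)
    thus ?thesis unfolding eventually_at_infinity by blast
  qed
  ultimately have "(L \<longlongrightarrow> a + Ln 1 + Ln C) at_infinity" by (rule Lim_transform_eventually)
  thus ?thesis by (rule that)
qed

lemma log_bound_near_zero:
  assumes "0 < y" "y < (1::real)"
  shows "\<bar>ln y\<bar> \<le> 1 / y"
proof -
  have "ln (1 / y) \<le> 1 / y - 1" using assms by (intro ln_le_minus_one) auto
  thus ?thesis using assms by (simp add: ln_div)
qed

text \<open>
  The hypotheses on \<open>w\<close> and \<open>b\<close> under which the norm has controlled zeros and poles: no point of \<open>\<Gamma>\<close> lies
  over them, so that \<open>N\<close> has a definite order there, and the points \<open>f (J q)\<close> are finite, so that \<open>Den\<close> is defined.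
\<close>
locale regular_two_point_domain = two_point_domain +
  assumes off_wb: "fiber (Some w) \<inter> \<Gamma> = {}" "fiber (Some b) \<inter> \<Gamma> = {}"
    and finite_reflection: "\<And>q. q \<in> Mp \<Longrightarrow> q \<in> fiber (Some w) \<union> fiber (Some b) \<Longrightarrow> mero_value f (J q) \<noteq> None"
begin

text \<open>
  The point \<open>f (J q)\<close>; for \<open>q\<close> in \<open>M\<^sub>+\<close> over \<open>w\<close> its conjugate is a value of the Schwarz function at \<open>w\<close>.
\<close>
definition refl_val :: "'a \<Rightarrow> complex" where
  "refl_val q = the (mero_value f (J q))"

abbreviation cnt :: "complex \<Rightarrow> nat" where
  "cnt c \<equiv> counting_function \<A> Mp f (Some c)"

text \<open>
  The conjugated Schwarz power at \<open>v\<close> as a polynomial in its argument \<open>\<zeta>\<close>.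
\<close>
definition RR :: "complex \<Rightarrow> complex \<Rightarrow> complex" where
  "RR v \<zeta> = (\<Prod>q\<in>fiber (Some v) \<inter> Mp. (refl_val q - \<zeta>) ^ ram q)"

text \<open>
  The rational function that has the zeros and poles of the \<open>M\<^sub>-\<close>-part of \<open>N\<close>. The extra powers at \<open>w\<close> and
  \<open>b\<close> are chosen so that \<open>N / Den\<close> behaves like an even power of the distance there, positive or negative, and
  its logarithm is single-valued.
\<close>
definition Den :: "complex \<Rightarrow> complex" where
  "Den \<zeta> = (RR w \<zeta> / (w - \<zeta>) ^ cnt w) / (RR b \<zeta> / (b - \<zeta>) ^ cnt b)"

text \<open>
  The norm divided by both its holomorphic and its antiholomorphic zeros and poles. All its singularities are removable and it
  has no zeros, so it has a continuous logarithm on the simply connected plane.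
\<close>
definition N0 :: "complex \<Rightarrow> complex" where
  "N0 \<zeta> = N \<zeta> * (RR b \<zeta> * cnj (b - \<zeta>) ^ cnt b) / (RR w \<zeta> * cnj (w - \<zeta>) ^ cnt w)"

text \<open>
  The zeros and poles of \<open>Den\<close> lie in this set.
\<close>
definition Z :: "complex set" where
  "Z = {w, b} \<union> refl_val ` ((fiber (Some w) \<union> fiber (Some b)) \<inter> Mp)"

lemma finite_Z: "finite Z" unfolding Z_def using finite_fiber by auto

lemma RR_nonzero: "v \<in> {w, b} \<Longrightarrow> \<zeta> \<notin> Z \<Longrightarrow> RR v \<zeta> \<noteq> 0"
  unfolding RR_def Z_def using finite_fiber by (auto simp: prod_zero_iff)

lemma RR_holomorphic: "RR v holomorphic_on S"
  unfolding RR_def[abs_def] by (intro holomorphic_intros)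

text \<open>
  The polynomial \<open>RR v\<close> without its zero at \<open>c\<close>.
\<close>
definition RR_unit :: "complex \<Rightarrow> complex \<Rightarrow> complex \<Rightarrow> complex" where
  "RR_unit v c \<zeta> = (\<Prod>q\<in>fiber (Some v) \<inter> Mp. if refl_val q = c then (-1) ^ ram q else (refl_val q - \<zeta>) ^ ram q)"

text \<open>
  The points in \<open>M\<^sub>-\<close> over \<open>c\<close> whose reflection lies over \<open>v\<close>; they produce the zero of \<open>RR v\<close> at \<open>c\<close>.
\<close>
definition over :: "complex \<Rightarrow> complex \<Rightarrow> 'a set" where
  "over v c = {p \<in> fiber (Some c) \<inter> Mm. J p \<in> fiber (Some v)}"

lemma RR_factor:
  assumes v: "v \<in> {w, b}"
  shows "RR v \<zeta> = RR_unit v c \<zeta> * (\<Prod>p\<in>over v c. (\<zeta> - c) ^ ram (J p))"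
proof -
  define S where "S = fiber (Some v) \<inter> Mp"
  have fin: "finite S" unfolding S_def using finite_fiber by auto
  have "RR v \<zeta> = (\<Prod>q\<in>S. (if refl_val q = c then (-1) ^ ram q else (refl_val q - \<zeta>) ^ ram q) *
        (if refl_val q = c then (\<zeta> - c) ^ ram q else 1))"
    unfolding RR_def S_def by (intro prod.cong refl) (auto simp: power_mult_distrib[symmetric])
  also have "\<dots> = RR_unit v c \<zeta> * (\<Prod>q\<in>S. if refl_val q = c then (\<zeta> - c) ^ ram q else 1)"
    by (simp add: prod.distrib RR_unit_def S_def)
  also have "(\<Prod>q\<in>S. if refl_val q = c then (\<zeta> - c) ^ ram q else 1) = (\<Prod>q\<in>{q\<in>S. refl_val q = c}. (\<zeta> - c) ^ ram q)"
    using fin by (rule prod.inter_filter[symmetric])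
  also have "\<dots> = (\<Prod>p\<in>over v c. (\<zeta> - c) ^ ram (J p))"
  proof (rule prod.reindex_bij_witness[of _ J J])
    fix q assume q: "q \<in> {q\<in>S. refl_val q = c}"
    hence "mero_value f (J q) \<noteq> None" using finite_reflection[of q] v by (auto simp: S_def)
    hence "mero_value f (J q) = Some c" using q by (auto simp: refl_val_def)
    thus "J q \<in> over v c" using q by (auto simp: over_def S_def fiber_def J_Mp_iff)
  next
    fix p assume "p \<in> over v c"
    thus "J p \<in> {q\<in>S. refl_val q = c}" by (auto simp: over_def S_def fiber_def refl_val_def J_Mp_iff)
  qed auto
  finally show ?thesis .
qed

lemma RR_unit_nonzero: "RR_unit v c c \<noteq> 0"
  unfolding RR_unit_def using finite_fiber by (auto simp: prod_zero_iff)

lemma RR_unit_tendsto: "(RR_unit v c \<longlongrightarrow> RR_unit v c d) (at d)"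
  unfolding RR_unit_def[abs_def] by (intro tendsto_prod) (auto intro!: tendsto_intros)

lemma ord_product:
  assumes "\<zeta> \<noteq> c"
  shows "(\<Prod>p\<in>fiber (Some c) \<inter> Mm. (\<zeta> - c) powi ord_Bst p)
       = (\<Prod>p\<in>over w c. (\<zeta> - c) ^ ram (J p)) / (\<Prod>p\<in>over b c. (\<zeta> - c) ^ ram (J p))"
proof -
  define S where "S = fiber (Some c) \<inter> Mm"
  have fin: "finite S" unfolding S_def using finite_fiber by auto
  have "(\<Prod>p\<in>S. (\<zeta> - c) powi ord_Bst p) = (\<Prod>p\<in>S. (if J p \<in> fiber (Some w) then (\<zeta> - c) ^ ram (J p) else 1) /
        (if J p \<in> fiber (Some b) then (\<zeta> - c) ^ ram (J p) else 1))"
  proof (rule prod.cong[OF refl])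
    fix p
    have "\<not> (J p \<in> fiber (Some w) \<and> J p \<in> fiber (Some b))" using w_neq_b by (auto simp: fiber_def)
    thus "(\<zeta> - c) powi ord_Bst p = (if J p \<in> fiber (Some w) then (\<zeta> - c) ^ ram (J p) else 1) /
        (if J p \<in> fiber (Some b) then (\<zeta> - c) ^ ram (J p) else 1)"
      using ord_Bst[of p] by (auto simp: power_int_minus divide_inverse)
  qed
  also have "\<dots> = (\<Prod>p\<in>over w c. (\<zeta> - c) ^ ram (J p)) / (\<Prod>p\<in>over b c. (\<zeta> - c) ^ ram (J p))"
    unfolding over_def S_def[symmetric] by (simp add: prod_dividef prod.inter_filter[OF fin])
  finally show ?thesis by (simp add: S_def)
qed

lemma eventually_not_finite_at: "finite S \<Longrightarrow> \<forall>\<^sub>F \<zeta> in at (c::complex). \<zeta> \<notin> S"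
  using islimpt_finite[of S c] by (simp add: islimpt_iff_eventually)

text \<open>
  The zeros and poles of \<open>N\<close> at \<open>c\<close> come from points of \<open>M\<^sub>-\<close> whose reflection lies over \<open>w\<close> or \<open>b\<close>. The same
  points cause the zeros of \<open>RR w\<close> and \<open>RR b\<close> at \<open>c\<close>, so that they cancel; at \<open>w\<close> and \<open>b\<close> the power
  of \<open>cnj B\<close> cancels as well.
\<close>
lemma N0_limit: "\<exists>l. l \<noteq> 0 \<and> (N0 \<longlongrightarrow> l) (at c)"
proof -
  define x where "x = Some c"
  have "x \<noteq> Some w \<and> x \<noteq> Some b \<or> fiber x \<inter> \<Gamma> = {}" using off_wb unfolding x_def by blast
  then obtain d where d: "\<And>p. p \<in> fiber x \<Longrightarrow> d p \<noteq> 0"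
    "\<And>p. p \<in> fiber x \<inter> Mp \<Longrightarrow> d p = 1"
    "\<And>p l. p \<in> fiber x \<inter> Mm \<Longrightarrow> l \<noteq> 0 \<Longrightarrow> (Bst \<longlongrightarrow> l) (at p) \<Longrightarrow> d p = l ^ ram p"
    "((\<lambda>\<zeta>. N \<zeta> / (cnj (B \<zeta>) ^ counting_function \<A> Mp f x *
         (\<Prod>p\<in>fiber x \<inter> Mm. uniformizer x \<zeta> powi ord_Bst p))) \<longlongrightarrow> (\<Prod>p\<in>fiber x. d p)) (sphere_at x)"
    using N_asymptotics[of x] by blast
  define C where "C = (\<Prod>p\<in>fiber x. d p)"
  have Cnz: "C \<noteq> 0" unfolding C_def using d(1) finite_fiber by (simp add: prod_zero_iff)
  define P where "P = (\<lambda>\<zeta>. N \<zeta> / (cnj (B \<zeta>) ^ cnt c * (\<Prod>p\<in>fiber (Some c) \<inter> Mm. (\<zeta> - c) powi ord_Bst p)))"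
  have Plim: "(P \<longlongrightarrow> C) (at c)" using d(4) unfolding P_def C_def x_def by simp
  define b2 where "b2 = (\<lambda>\<zeta>. cnj (B \<zeta>) ^ cnt c * cnj (b - \<zeta>) ^ cnt b / cnj (w - \<zeta>) ^ cnt w)"
  have evZ: "\<forall>\<^sub>F \<zeta> in at c. \<zeta> \<notin> {c, w, b}" by (rule eventually_not_finite_at) simp
  have Bq: "cnj (B \<zeta>) = cnj (w - \<zeta>) / cnj (b - \<zeta>)" for \<zeta>
  proof -
    have "B \<zeta> = (w - \<zeta>) / (b - \<zeta>)" unfolding B_def using minus_divide_divide[of "\<zeta> - w" "\<zeta> - b"] by simp
    thus ?thesis by simp
  qed
  have b2lim: "\<exists>m. m \<noteq> 0 \<and> (b2 \<longlongrightarrow> m) (at c)"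
  proof -
    consider "c = w" | "c = b" | "c \<noteq> w" "c \<noteq> b" by blast
    thus ?thesis
    proof cases
      case 1
      have "((\<lambda>\<zeta>. cnj (b - \<zeta>) ^ cnt b / cnj (b - \<zeta>) ^ cnt w) \<longlongrightarrow> cnj (b - c) ^ cnt b / cnj (b - c) ^ cnt w) (at c)"
        using 1 w_neq_b by (intro tendsto_intros) auto
      moreover have "\<forall>\<^sub>F \<zeta> in at c. cnj (b - \<zeta>) ^ cnt b / cnj (b - \<zeta>) ^ cnt w = b2 \<zeta>"
        using evZ by eventually_elim (auto simp: b2_def Bq 1 power_divide)
      ultimately have "(b2 \<longlongrightarrow> cnj (b - c) ^ cnt b / cnj (b - c) ^ cnt w) (at c)" by (rule Lim_transform_eventually)
      thus ?thesis using 1 w_neq_b by (intro exI conjI) auto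
    next
      case 2
      have "((\<lambda>\<zeta>. cnj (w - \<zeta>) ^ cnt b / cnj (w - \<zeta>) ^ cnt w) \<longlongrightarrow> cnj (w - c) ^ cnt b / cnj (w - c) ^ cnt w) (at c)"
        using 2 w_neq_b by (intro tendsto_intros) auto
      moreover have "\<forall>\<^sub>F \<zeta> in at c. cnj (w - \<zeta>) ^ cnt b / cnj (w - \<zeta>) ^ cnt w = b2 \<zeta>"
        using evZ by eventually_elim (auto simp: b2_def Bq 2 power_divide)
      ultimately have "(b2 \<longlongrightarrow> cnj (w - c) ^ cnt b / cnj (w - c) ^ cnt w) (at c)" by (rule Lim_transform_eventually)
      thus ?thesis using 2 w_neq_b by (intro exI conjI) auto
    next
      case 3
      have "(b2 \<longlongrightarrow> (cnj (w - c) / cnj (b - c)) ^ cnt c * cnj (b - c) ^ cnt b / cnj (w - c) ^ cnt w) (at c)"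
        unfolding b2_def Bq using 3 by (intro tendsto_intros) auto
      thus ?thesis using 3 by (intro exI conjI) auto
    qed
  qed
  then obtain m where m: "m \<noteq> 0" "(b2 \<longlongrightarrow> m) (at c)" by blast
  have "((\<lambda>\<zeta>. P \<zeta> * b2 \<zeta> * (RR_unit b c \<zeta> / RR_unit w c \<zeta>)) \<longlongrightarrow> C * m * (RR_unit b c c / RR_unit w c c)) (at c)"
    by (intro tendsto_intros Plim m(2) RR_unit_tendsto RR_unit_nonzero)
  moreover have "\<forall>\<^sub>F \<zeta> in at c. P \<zeta> * b2 \<zeta> * (RR_unit b c \<zeta> / RR_unit w c \<zeta>) = N0 \<zeta>"
    using evZ
  proof eventually_elim
    case (elim \<zeta>)
    define Ew where "Ew = (\<Prod>p\<in>over w c. (\<zeta> - c) ^ ram (J p))"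
    define Eb where "Eb = (\<Prod>p\<in>over b c. (\<zeta> - c) ^ ram (J p))"
    have fin: "finite (over v c)" for v unfolding over_def using finite_fiber by auto
    have nz: "Ew \<noteq> 0" "Eb \<noteq> 0" unfolding Ew_def Eb_def using elim fin by (auto simp: prod_zero_iff)
    have Bnz: "cnj (B \<zeta>) ^ cnt c \<noteq> 0" using elim by (auto simp: B_def)
    have N: "N \<zeta> = P \<zeta> * (cnj (B \<zeta>) ^ cnt c * (Ew / Eb))"
      unfolding P_def using ord_product[of \<zeta> c] elim nz Bnz by (simp add: Ew_def Eb_def)
    have RR: "RR w \<zeta> = RR_unit w c \<zeta> * Ew" "RR b \<zeta> = RR_unit b c \<zeta> * Eb"
      unfolding Ew_def Eb_def by (rule RR_factor; simp)+
    show ?case unfolding N0_def N RR b2_def using nz by (simp add: mult_ac)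
  qed
  ultimately have "(N0 \<longlongrightarrow> C * m * (RR_unit b c c / RR_unit w c c)) (at c)" by (rule Lim_transform_eventually)
  moreover have "C * m * (RR_unit b c c / RR_unit w c c) \<noteq> 0" using Cnz m(1) RR_unit_nonzero by simp
  ultimately show ?thesis by blast
qed

lemma Den_holomorphic:
  assumes "Z \<inter> S = {}"
  shows "Den holomorphic_on S"
proof -
  have "RR w \<zeta> \<noteq> 0 \<and> RR b \<zeta> \<noteq> 0 \<and> (w - \<zeta>) ^ cnt w \<noteq> 0 \<and> (b - \<zeta>) ^ cnt b \<noteq> 0" if "\<zeta> \<in> S" for \<zeta>
  proof -
    have z: "\<zeta> \<notin> Z" using that assms by blast
    hence "w - \<zeta> \<noteq> 0" "b - \<zeta> \<noteq> 0" by (auto simp: Z_def)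
    thus ?thesis using RR_nonzero[OF _ z] by simp
  qed
  thus ?thesis unfolding Den_def[abs_def] by (intro holomorphic_intros RR_holomorphic) auto
qed

lemma Den_nonzero: "\<zeta> \<notin> Z \<Longrightarrow> Den \<zeta> \<noteq> 0"
  unfolding Den_def using RR_nonzero[of w \<zeta>] RR_nonzero[of b \<zeta>] by (auto simp: Z_def)

lemma Den_tendsto_infinity: "(Den \<longlongrightarrow> 1) at_infinity"
proof -
  have q1: "((\<lambda>\<zeta>. (a - \<zeta>) / (v - \<zeta>)) \<longlongrightarrow> 1) at_infinity" for a v :: complex
  proof -
    have "filterlim (\<lambda>\<zeta>::complex. \<zeta> + (- v)) at_infinity at_infinity"
      by (rule tendsto_add_filterlim_at_infinity'[OF filterlim_ident tendsto_const])
    hence "((\<lambda>\<zeta>. inverse (\<zeta> + (- v))) \<longlongrightarrow> 0) at_infinity"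
      by (rule filterlim_compose[OF tendsto_inverse_0])
    hence "((\<lambda>\<zeta>. 1 - (a - v) * inverse (\<zeta> + (- v))) \<longlongrightarrow> 1 - (a - v) * 0) at_infinity"
      by (intro tendsto_intros)
    moreover have "\<forall>\<^sub>F \<zeta> in at_infinity. 1 - (a - v) * inverse (\<zeta> + (- v)) = (a - \<zeta>) / (v - \<zeta>)"
    proof -
      have "1 - (a - v) * inverse (\<zeta> + (- v)) = (a - \<zeta>) / (v - \<zeta>)" if "norm \<zeta> \<ge> norm v + 1" for \<zeta>
      proof -
        have "\<zeta> \<noteq> v" using that by auto
        thus ?thesis by (simp add: divide_simps) (simp add: algebra_simps)
      qed
      thus ?thesis unfolding eventually_at_infinity by blast
    qed
    ultimately have "((\<lambda>\<zeta>. (a - \<zeta>) / (v - \<zeta>)) \<longlongrightarrow> 1 - (a - v) * 0) at_infinity" by (rule Lim_transform_eventually)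
    thus ?thesis by simp
  qed
  have "((\<lambda>\<zeta>. RR v \<zeta> / (v - \<zeta>) ^ cnt v) \<longlongrightarrow> 1) at_infinity" for v
  proof -
    have "RR v \<zeta> / (v - \<zeta>) ^ cnt v = (\<Prod>q\<in>fiber (Some v) \<inter> Mp. ((refl_val q - \<zeta>) / (v - \<zeta>)) ^ ram q)" for \<zeta>
      unfolding RR_def counting_function_eq power_sum by (simp add: prod_dividef power_divide)
    moreover have "((\<lambda>\<zeta>. \<Prod>q\<in>fiber (Some v) \<inter> Mp. ((refl_val q - \<zeta>) / (v - \<zeta>)) ^ ram q) \<longlongrightarrow>
        (\<Prod>q\<in>fiber (Some v) \<inter> Mp. 1 ^ ram q)) at_infinity"
      by (intro tendsto_prod tendsto_power q1)
    ultimately show ?thesis by simp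
  qed
  from tendsto_divide[OF this[of w] this[of b]] show ?thesis by (simp add: Den_def[abs_def])
qed

lemma N_tendsto_infinity: "\<exists>C. C \<noteq> 0 \<and> (N \<longlongrightarrow> C) at_infinity"
proof -
  obtain d where d: "\<And>p. p \<in> fiber None \<Longrightarrow> d p \<noteq> 0"
    "\<And>p. p \<in> fiber None \<inter> Mp \<Longrightarrow> d p = 1"
    "\<And>p l. p \<in> fiber None \<inter> Mm \<Longrightarrow> l \<noteq> 0 \<Longrightarrow> (Bst \<longlongrightarrow> l) (at p) \<Longrightarrow> d p = l ^ ram p"
    "((\<lambda>\<zeta>. N \<zeta> / (cnj (B \<zeta>) ^ counting_function \<A> Mp f None *
         (\<Prod>p\<in>fiber None \<inter> Mm. uniformizer None \<zeta> powi ord_Bst p))) \<longlongrightarrow> (\<Prod>p\<in>fiber None. d p)) (sphere_at None)"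
    using N_asymptotics[of None] by blast
  have ord: "ord_Bst p = 0" if "p \<in> fiber None \<inter> Mm" for p
  proof (rule ord_Bst(3))
    have "J p \<in> Mp" "mero_value f (J (J p)) = None" using that by (auto simp: J_Mp_iff fiber_def)
    thus "J p \<notin> fiber (Some w)" "J p \<notin> fiber (Some b)" using finite_reflection[of "J p"] by blast+
  qed
  have Bl: "((\<lambda>\<zeta>. cnj (B \<zeta>) ^ counting_function \<A> Mp f None) \<longlongrightarrow> cnj 1 ^ counting_function \<A> Mp f None) at_infinity"
    using B_tendsto[of None] by (intro tendsto_intros) (simp add: B_value_def)
  have "((\<lambda>\<zeta>. N \<zeta> / cnj (B \<zeta>) ^ counting_function \<A> Mp f None) \<longlongrightarrow> (\<Prod>p\<in>fiber None. d p)) at_infinity"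
    using d(4) ord by simp
  from tendsto_mult[OF this Bl]
  have "((\<lambda>\<zeta>. N \<zeta> / cnj (B \<zeta>) ^ counting_function \<A> Mp f None * cnj (B \<zeta>) ^ counting_function \<A> Mp f None)
      \<longlongrightarrow> (\<Prod>p\<in>fiber None. d p)) at_infinity" by simp
  moreover have "\<forall>\<^sub>F \<zeta> in at_infinity. N \<zeta> / cnj (B \<zeta>) ^ counting_function \<A> Mp f None * cnj (B \<zeta>) ^ counting_function \<A> Mp f None = N \<zeta>"
  proof -
    have "((\<lambda>\<zeta>. B \<zeta>) \<longlongrightarrow> 1) at_infinity" using B_tendsto[of None] by (simp add: B_value_def)
    hence "\<forall>\<^sub>F \<zeta> in at_infinity. B \<zeta> \<noteq> 0" by (rule tendsto_imp_eventually_ne) simp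
    thus ?thesis by eventually_elim simp
  qed
  ultimately have "(N \<longlongrightarrow> (\<Prod>p\<in>fiber None. d p)) at_infinity" by (rule Lim_transform_eventually)
  moreover have "(\<Prod>p\<in>fiber None. d p) \<noteq> 0" using d(1) finite_fiber by (simp add: prod_zero_iff)
  ultimately show ?thesis by blast
qed

text \<open>
  The function \<open>L\<close> is the sum of a continuous logarithm of \<open>N0\<close> and real logarithms of distances to \<open>w\<close> and \<open>b\<close>. It is
  the logarithm of \<open>N / Den\<close>, which has a finite nonzero limit at infinity since \<open>N\<close> has one and \<open>Den\<close> tends to one.
\<close>
lemma log_norm_exists:
  obtains L l where "continuous_on (- {w, b}) L" "(L \<longlongrightarrow> l) at_infinity"
    "\<And>c. c \<in> {w, b} \<Longrightarrow> \<exists>A. \<forall>\<^sub>F \<zeta> in at c. norm (L \<zeta>) \<le> A / norm (\<zeta> - c)"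
    "\<And>\<xi> e k H \<zeta>. regular_norm_form \<xi> e k H \<Longrightarrow> \<zeta> \<in> ball \<xi> e - Z \<Longrightarrow> exp (L \<zeta>) = cnj (B \<zeta>) ^ k * H \<zeta> / Den \<zeta>"
proof -
  define NN where "NN = (\<lambda>c. Lim (at c) N0)"
  have NNlim: "(N0 \<longlongrightarrow> NN c) (at c)" "NN c \<noteq> 0" for c
    using N0_limit[of c] tendsto_Lim[OF at_neq_bot, of N0 _ c] unfolding NN_def by auto
  have "continuous_on UNIV NN" unfolding NN_def using N0_limit by (intro continuous_on_Lim_at) blast
  then obtain l0 where l0: "continuous_on UNIV l0" "\<And>\<zeta>. NN \<zeta> = exp (l0 \<zeta>)"
    using continuous_logarithm_on_contractible[OF _ contractible_UNIV, of NN] NNlim(2) by auto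
  \<comment> \<open>Passing from \<open>N0\<close> to \<open>N / Den\<close> multiplies by \<open>\<bar>w - \<zeta>\<bar>\<^bsup>2n\<^esup> / \<bar>b - \<zeta>\<bar>\<^bsup>2m\<^esup>\<close>, which is positive and has an
     elementary real logarithm.\<close>
  define L where "L = (\<lambda>\<zeta>. l0 \<zeta> + of_real (2 * cnt w * ln (norm (w - \<zeta>)) - 2 * cnt b * ln (norm (b - \<zeta>))))"
  have contL: "continuous_on (- {w, b}) L" unfolding L_def
    by (intro continuous_intros continuous_on_subset[OF l0(1)]) auto
  define Q where "Q = (\<lambda>\<zeta>. N \<zeta> / Den \<zeta>)"
  have expln: "exp (of_real (2 * real n * ln (norm v))) = (cnj v * v) ^ n" if "v \<noteq> 0" for n and v :: complex
  proof -
    have "exp (2 * real n * ln (norm v)) = ((norm v)^2) ^ n"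
      using that exp_of_nat_mult[of "2 * n" "ln (norm v)"] by (simp add: power_mult)
    hence "exp (complex_of_real (2 * real n * ln (norm v))) = complex_of_real (((norm v)^2) ^ n)"
      by (simp only: exp_of_real)
    also have "\<dots> = (v * cnj v) ^ n" by (simp only: of_real_power[symmetric] complex_norm_square[symmetric])
    finally show ?thesis by (simp add: mult.commute)
  qed
  have expL: "exp (L \<zeta>) = NN \<zeta> * ((cnj (w - \<zeta>) * (w - \<zeta>)) ^ cnt w / (cnj (b - \<zeta>) * (b - \<zeta>)) ^ cnt b)"
    if "\<zeta> \<notin> {w, b}" for \<zeta>
  proof -
    have nz: "w - \<zeta> \<noteq> 0" "b - \<zeta> \<noteq> 0" using that by auto
    show ?thesis
      unfolding L_def of_real_diff exp_add exp_diff l0(2)[symmetric]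
      by (simp only: expln[OF nz(1)] expln[OF nz(2)] of_nat_mult of_nat_numeral)
  qed
  have QN0: "Q \<zeta> = N0 \<zeta> * ((cnj (w - \<zeta>) * (w - \<zeta>)) ^ cnt w / (cnj (b - \<zeta>) * (b - \<zeta>)) ^ cnt b)"
    if "\<zeta> \<notin> Z" for \<zeta>
  proof -
    have alg: "n / ((r1 / u1) / (r2 / u2)) = n * (r2 * v2) / (r1 * v1) * ((v1 * u1) / (v2 * u2))"
      if "v1 \<noteq> 0" "v2 \<noteq> 0" "u1 \<noteq> 0" "u2 \<noteq> 0" "r1 \<noteq> 0" "r2 \<noteq> 0" for n r1 r2 u1 u2 v1 v2 :: complex
      using that by (simp add: field_simps)
    have "cnj (w - \<zeta>) \<noteq> 0" "cnj (b - \<zeta>) \<noteq> 0" "w - \<zeta> \<noteq> 0" "b - \<zeta> \<noteq> 0" using that by (auto simp: Z_def)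
    thus ?thesis unfolding Q_def Den_def N0_def power_mult_distrib
      using RR_nonzero[OF _ that] by (intro alg power_not_zero) auto
  qed
  have Qlim: "(Q \<longlongrightarrow> exp (L \<zeta>)) (at \<zeta>)" if "\<zeta> \<notin> {w, b}" for \<zeta>
  proof -
    have "((\<lambda>\<eta>. N0 \<eta> * ((cnj (w - \<eta>) * (w - \<eta>)) ^ cnt w / (cnj (b - \<eta>) * (b - \<eta>)) ^ cnt b))
        \<longlongrightarrow> NN \<zeta> * ((cnj (w - \<zeta>) * (w - \<zeta>)) ^ cnt w / (cnj (b - \<zeta>) * (b - \<zeta>)) ^ cnt b)) (at \<zeta>)"
      using that by (intro tendsto_intros NNlim(1)) auto
    moreover have "\<forall>\<^sub>F \<eta> in at \<zeta>. N0 \<eta> * ((cnj (w - \<eta>) * (w - \<eta>)) ^ cnt w / (cnj (b - \<eta>) * (b - \<eta>)) ^ cnt b) = Q \<eta>"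
      using eventually_not_finite_at[OF finite_Z, of \<zeta>] by eventually_elim (rule QN0[symmetric])
    ultimately show ?thesis unfolding expL[OF that] by (rule Lim_transform_eventually)
  qed
  obtain C where C: "C \<noteq> 0" "(N \<longlongrightarrow> C) at_infinity" using N_tendsto_infinity by blast
  have Qinf: "(Q \<longlongrightarrow> C) at_infinity"
    using tendsto_divide[OF C(2) Den_tendsto_infinity] by (simp add: Q_def[abs_def])
  have "((\<lambda>\<zeta>. exp (L \<zeta>)) \<longlongrightarrow> C) at_infinity"
  proof (rule tendstoI)
    fix e :: real assume e: "e > 0"
    have "\<forall>\<^sub>F \<zeta> in at_infinity. dist (Q \<zeta>) C < e / 2" using Qinf e by (intro tendstoD) auto
    then obtain r where r: "\<And>\<zeta>. norm \<zeta> \<ge> r \<Longrightarrow> dist (Q \<zeta>) C < e / 2" unfolding eventually_at_infinity by blast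
    have "dist (exp (L \<zeta>)) C < e" if z: "norm \<zeta> \<ge> max r (max (norm w) (norm b)) + 1" for \<zeta>
    proof -
      have nz: "\<zeta> \<notin> {w, b}" using z by auto
      have "open {\<eta>::complex. norm \<eta> > r}" by (intro open_Collect_less continuous_intros)
      hence "\<forall>\<^sub>F \<eta> in at \<zeta>. \<eta> \<in> {\<eta>. norm \<eta> > r}" using z by (intro eventually_at_in_open') auto
      hence "\<forall>\<^sub>F \<eta> in at \<zeta>. dist (Q \<eta>) C \<le> e / 2" by eventually_elim (use r in \<open>auto intro: less_imp_le\<close>)
      hence "dist (exp (L \<zeta>)) C \<le> e / 2"
        by (intro tendsto_upperbound[OF tendsto_dist[OF Qlim[OF nz] tendsto_const]]) auto
      thus ?thesis using e by simp
    qed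
    thus "\<forall>\<^sub>F \<zeta> in at_infinity. dist (exp (L \<zeta>)) C < e" unfolding eventually_at_infinity by blast
  qed
  moreover have "continuous_on {\<zeta>. norm \<zeta> > max (norm w) (norm b)} L"
    using contL by (rule continuous_on_subset) auto
  ultimately obtain l where l: "(L \<longlongrightarrow> l) at_infinity" using log_limit_at_infinity[OF _ _ C(1)] by blast
  have bounds: "\<exists>A. \<forall>\<^sub>F \<zeta> in at c. norm (L \<zeta>) \<le> A / norm (\<zeta> - c)" if "c \<in> {w, b}" for c
  proof -
    define d where "d = (if c = w then b else w)"
    have cd: "d \<noteq> c" "{c, d} = {w, b}" using that w_neq_b by (auto simp: d_def)
    define n where "n = (if c = w then 2 * real (cnt w) else - 2 * real (cnt b))"
    define m where "m = (if c = w then - 2 * real (cnt b) else 2 * real (cnt w))"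
    have Leq: "L \<zeta> = (l0 \<zeta> + of_real (m * ln (norm (d - \<zeta>)))) + of_real (n * ln (norm (c - \<zeta>)))" for \<zeta>
      using that w_neq_b by (auto simp: L_def n_def m_def d_def)
    have "isCont l0 c" using l0(1) by (simp add: continuous_on_eq_continuous_at)
    hence "(l0 \<longlongrightarrow> l0 c) (at c)" by (rule isContD)
    hence lim: "((\<lambda>\<zeta>. norm (l0 \<zeta> + of_real (m * ln (norm (d - \<zeta>))))) \<longlongrightarrow> norm (l0 c + of_real (m * ln (norm (d - c))))) (at c)"
      using cd(1) by (intro tendsto_intros) auto
    define M where "M = norm (l0 c + of_real (m * ln (norm (d - c)))) + 1"
    have "\<forall>\<^sub>F \<zeta> in at c. norm (l0 \<zeta> + of_real (m * ln (norm (d - \<zeta>)))) < M"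
      using lim by (rule order_tendstoD) (simp add: M_def)
    moreover have "\<forall>\<^sub>F \<zeta> in at c. \<zeta> \<noteq> c \<and> dist \<zeta> c < 1" unfolding eventually_at by (auto intro: exI[of _ 1])
    ultimately have "\<forall>\<^sub>F \<zeta> in at c. norm (L \<zeta>) \<le> (M + \<bar>n\<bar>) / norm (\<zeta> - c)"
    proof eventually_elim
      case (elim \<zeta>)
      have y: "0 < norm (\<zeta> - c)" "norm (\<zeta> - c) < 1" using elim by (auto simp: dist_norm)
      have M0: "M \<ge> 0" by (simp add: M_def add_nonneg_nonneg)
      have "norm (L \<zeta>) \<le> norm (l0 \<zeta> + of_real (m * ln (norm (d - \<zeta>)))) + norm (of_real (n * ln (norm (c - \<zeta>))) :: complex)"
        unfolding Leq by (rule norm_triangle_ineq)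
      also have "norm (of_real (n * ln (norm (c - \<zeta>))) :: complex) = \<bar>n\<bar> * \<bar>ln (norm (\<zeta> - c))\<bar>"
        by (simp only: norm_of_real abs_mult norm_minus_commute[of c \<zeta>])
      also have "norm (l0 \<zeta> + of_real (m * ln (norm (d - \<zeta>)))) + \<bar>n\<bar> * \<bar>ln (norm (\<zeta> - c))\<bar>
          \<le> M / norm (\<zeta> - c) + \<bar>n\<bar> * (1 / norm (\<zeta> - c))"
      proof (intro add_mono mult_left_mono log_bound_near_zero y)
        have "M \<le> M / norm (\<zeta> - c)" using y M0 by (simp add: le_divide_eq mult_left_le)
        thus "norm (l0 \<zeta> + of_real (m * ln (norm (d - \<zeta>)))) \<le> M / norm (\<zeta> - c)" using elim by linarith
      qed auto
      finally show ?case by (simp add: add_divide_distrib)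
    qed
    thus ?thesis by blast
  qed
  have form: "exp (L \<zeta>) = cnj (B \<zeta>) ^ k * H \<zeta> / Den \<zeta>"
    if rf: "regular_norm_form \<xi> e k H" and \<zeta>: "\<zeta> \<in> ball \<xi> e - Z" for \<xi> e k H \<zeta>
  proof -
    have wb: "\<zeta> \<notin> {w, b}" using \<zeta> by (auto simp: Z_def)
    have H: "isCont H \<zeta>"
      using rf \<zeta> unfolding regular_norm_form_def
      by (auto intro!: field_differentiable_imp_continuous_at holomorphic_on_imp_differentiable_at)
    have opZ: "open (- Z)" using finite_Z by (simp add: finite_imp_closed open_Compl)
    have D: "isCont Den \<zeta>"
      using Den_holomorphic[of "- Z"] \<zeta> opZ
      by (auto intro!: field_differentiable_imp_continuous_at holomorphic_on_imp_differentiable_at[of Den "- Z"])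
    have Bc: "isCont B \<zeta>" unfolding B_def[abs_def] using wb by (intro continuous_intros) auto
    have "isCont (\<lambda>\<eta>. cnj (B \<eta>) ^ k * H \<eta> / Den \<eta>) \<zeta>"
      using Den_nonzero[of \<zeta>] \<zeta> by (intro continuous_intros H D Bc isCont_o2[OF Bc]) auto
    hence l1: "((\<lambda>\<eta>. cnj (B \<eta>) ^ k * H \<eta> / Den \<eta>) \<longlongrightarrow> cnj (B \<zeta>) ^ k * H \<zeta> / Den \<zeta>) (at \<zeta>)" by (rule isContD)
    have "\<forall>\<^sub>F \<eta> in at \<zeta>. \<eta> \<notin> {\<xi>}" by (rule eventually_not_finite_at) simp
    moreover have "\<forall>\<^sub>F \<eta> in at \<zeta>. \<eta> \<in> ball \<xi> e" using \<zeta> by (intro eventually_at_in_open') auto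
    ultimately have "\<forall>\<^sub>F \<eta> in at \<zeta>. cnj (B \<eta>) ^ k * H \<eta> / Den \<eta> = Q \<eta>"
      by eventually_elim (use rf in \<open>auto simp: Q_def regular_norm_form_def\<close>)
    with l1 have "(Q \<longlongrightarrow> cnj (B \<zeta>) ^ k * H \<zeta> / Den \<zeta>) (at \<zeta>)" by (rule Lim_transform_eventually)
    thus ?thesis using tendsto_unique[OF at_neq_bot Qlim[OF wb]] by blast
  qed
  show ?thesis by (rule that[OF contL l]; (rule bounds | rule form); assumption)
qed

end

section \<open>The Cauchy transform of the density\<close>

text \<open>
  Fubini: almost every section is finite.
\<close>
lemma null_set_of_lines:
  assumes A: "A \<in> sets borel" and X: "countable X" "\<And>s. s \<notin> X \<Longrightarrow> finite {t. Complex s t \<in> A}"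
  shows "A \<in> null_sets lborel"
proof -
  let ?T = "\<lambda>(s, t). 0 + Complex s t"
  have m: "?T \<in> borel_measurable (lborel \<Otimes>\<^sub>M lborel)" by (rule measurable_shifted_Complex)
  have V: "?T -` A \<inter> space (lborel \<Otimes>\<^sub>M lborel) \<in> sets (lborel \<Otimes>\<^sub>M lborel)"
    using m A by (rule measurable_sets)
  have "emeasure lborel A = emeasure (distr (lborel \<Otimes>\<^sub>M lborel) borel ?T) A"
    by (simp only: lborel_complex_eq)
  also have "\<dots> = emeasure (lborel \<Otimes>\<^sub>M lborel) (?T -` A \<inter> space (lborel \<Otimes>\<^sub>M lborel))"
    using m A by (rule emeasure_distr)
  also have "\<dots> = (\<integral>\<^sup>+s. emeasure lborel (Pair s -` (?T -` A \<inter> space (lborel \<Otimes>\<^sub>M lborel))) \<partial>lborel)"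
    by (rule lborel.emeasure_pair_measure_alt[OF V])
  also have "\<dots> = (\<integral>\<^sup>+(s::real). 0 \<partial>lborel)"
  proof (rule nn_integral_cong_AE)
    have "AE s in lborel. s \<notin> X" using X(1) by (intro AE_not_in countable_imp_null_set_lborel)
    thus "AE s in lborel. emeasure lborel (Pair s -` (?T -` A \<inter> space (lborel \<Otimes>\<^sub>M lborel))) = (0::ennreal)"
    proof eventually_elim
      case (elim s)
      have "Pair s -` (?T -` A \<inter> space (lborel \<Otimes>\<^sub>M lborel)) = {t. Complex s t \<in> A}"
        by (auto simp: space_pair_measure)
      thus ?case using X(2)[OF elim] by (simp add: emeasure_lborel_countable countable_finite)
    qed
  qed
  finally show ?thesis using A by (auto simp: null_sets_def)
qed

text \<open>
  Continuity of \<open>L\<close> makes \<open>L - L \<xi>\<close> near \<open>\<xi>\<close> the principal logarithm of \<open>q / q \<xi>\<close>.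
\<close>
lemma log_has_derivative:
  fixes L q :: "complex \<Rightarrow> complex"
  assumes cont: "isCont L \<xi>" and ev: "\<forall>\<^sub>F \<zeta> in nhds \<xi>. exp (L \<zeta>) = q \<zeta>"
    and q: "(q has_derivative q') (at \<xi>)"
  shows "(L has_derivative (\<lambda>h. q' h / q \<xi>)) (at \<xi>)"
proof -
  have q0: "q \<xi> = exp (L \<xi>)" using eventually_nhds_x_imp_x[OF ev] by simp
  have "((\<lambda>\<zeta>. q \<zeta> / q \<xi>) has_derivative (\<lambda>h. q' h / q \<xi>)) (at \<xi>)"
    using bounded_linear.has_derivative[OF bounded_linear_divide q] .
  moreover have "(Ln has_derivative (\<lambda>h. h)) (at (q \<xi> / q \<xi>))"
  proof -
    have "(Ln has_field_derivative inverse 1) (at 1)" by (rule has_field_derivative_Ln) simp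
    moreover have "(*) (1::complex) = (\<lambda>h. h)" by auto
    ultimately show ?thesis using q0 by (simp add: has_field_derivative_def)
  qed
  ultimately have "((\<lambda>\<zeta>. Ln (q \<zeta> / q \<xi>)) has_derivative (\<lambda>h. q' h / q \<xi>)) (at \<xi>)"
    using diff_chain_at[of "\<lambda>\<zeta>. q \<zeta> / q \<xi>" "\<lambda>h. q' h / q \<xi>" \<xi> Ln "\<lambda>h. h"] by (simp add: o_def)
  hence d: "((\<lambda>\<zeta>. L \<xi> + Ln (q \<zeta> / q \<xi>)) has_derivative (\<lambda>h. q' h / q \<xi>)) (at \<xi>)"
    by (auto intro!: derivative_eq_intros)
  have "\<forall>\<^sub>F \<zeta> in nhds \<xi>. dist (L \<zeta>) (L \<xi>) < pi"
    using iffD1[OF tendsto_at_iff_tendsto_nhds isContD[OF cont]] by (intro tendstoD) auto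
  with ev have "\<forall>\<^sub>F \<zeta> in nhds \<xi>. L \<xi> + Ln (q \<zeta> / q \<xi>) = L \<zeta>"
  proof eventually_elim
    case (elim \<zeta>)
    have "\<bar>Im (L \<zeta> - L \<xi>)\<bar> < pi" using elim(2) abs_Im_le_cmod[of "L \<zeta> - L \<xi>"] by (simp add: dist_norm)
    hence "Ln (exp (L \<zeta> - L \<xi>)) = L \<zeta> - L \<xi>" by (intro Ln_exp) auto
    thus ?case using elim(1) q0 by (simp add: exp_diff)
  qed
  from eventually_nhds_x_imp_x[OF this] this d show ?thesis
    by (intro has_derivative_transform_eventually[OF d]) (auto simp: eventually_at_filter elim: eventually_mono)
qed

lemma kernel_bound_near:
  fixes v c :: complex
  shows "\<exists>A. \<forall>\<^sub>F \<zeta> in at c. 1 / norm (\<zeta> - v) \<le> A / norm (\<zeta> - c)"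
    and "c \<noteq> v \<Longrightarrow> \<exists>A. \<forall>\<^sub>F \<zeta> in at c. 1 / norm (\<zeta> - v) \<le> A"
proof -
  show *: "\<exists>A. \<forall>\<^sub>F \<zeta> in at c. 1 / norm (\<zeta> - v) \<le> A" if "c \<noteq> v"
  proof -
    have "((\<lambda>\<zeta>. 1 / norm (\<zeta> - v)) \<longlongrightarrow> 1 / norm (c - v)) (at c)" using that by (intro tendsto_intros) auto
    hence "\<forall>\<^sub>F \<zeta> in at c. 1 / norm (\<zeta> - v) < 1 / norm (c - v) + 1" by (rule order_tendstoD) simp
    hence "\<forall>\<^sub>F \<zeta> in at c. 1 / norm (\<zeta> - v) \<le> 1 / norm (c - v) + 1" by eventually_elim simp
    thus ?thesis by blast
  qed
  show "\<exists>A. \<forall>\<^sub>F \<zeta> in at c. 1 / norm (\<zeta> - v) \<le> A / norm (\<zeta> - c)"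
  proof (cases "c = v")
    case False
    obtain A where A: "\<forall>\<^sub>F \<zeta> in at c. 1 / norm (\<zeta> - v) \<le> A" using *[OF False] by blast
    have "\<forall>\<^sub>F \<zeta> in at c. \<zeta> \<noteq> c \<and> dist \<zeta> c < 1" unfolding eventually_at by (auto intro: exI[of _ 1])
    with A have "\<forall>\<^sub>F \<zeta> in at c. 1 / norm (\<zeta> - v) \<le> A / norm (\<zeta> - c)"
    proof eventually_elim
      case (elim \<zeta>)
      have "0 \<le> A" using elim(1) by (rule order_trans[rotated]) simp
      hence "A \<le> A / norm (\<zeta> - c)" using elim(2) by (simp add: dist_norm le_divide_eq mult_left_le)
      thus ?case using elim(1) by linarith
    qed
    thus ?thesis by blast
  qed (auto intro: exI[of _ 1])
qed

context regular_two_point_domain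
begin

text \<open>
  The density of the Cauchy transform: the counting function times the conjugate of \<open>B' / B\<close>.
\<close>
definition F :: "complex \<Rightarrow> complex" where
  "F \<zeta> = of_nat (cnt \<zeta>) * (1 / (cnj \<zeta> - cnj w) - 1 / (cnj \<zeta> - cnj b))"

text \<open>
  The set where \<open>L\<close> is known to be differentiable. Its complement is the boundary image together with isolated points;
  a branch point belongs to it if it lies neither on the boundary image nor in \<open>Z\<close>, as \<open>z\<close> may be one.
\<close>
definition \<Omega> :: "complex set" where
  "\<Omega> = {\<xi>. \<xi> \<notin> Z \<and> \<xi> \<notin> boundary_image \<and> (\<exists>e H. regular_norm_form \<xi> e (cnt \<xi>) H)}"

lemma regular_norm_form_moves:
  assumes rf: "regular_norm_form \<xi> e k H" and \<zeta>: "\<zeta> \<in> ball \<xi> e" "\<zeta> \<noteq> \<xi>"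
  shows "\<exists>e'. regular_norm_form \<zeta> e' k H \<and> cnt \<zeta> = k"
proof -
  have "open (ball \<xi> e - {\<xi>})" by auto
  then obtain e' where e': "e' > 0" "ball \<zeta> e' \<subseteq> ball \<xi> e - {\<xi>}" using \<zeta> openE by blast
  have "H holomorphic_on ball \<zeta> e'"
    using rf e'(2) unfolding regular_norm_form_def by (blast intro: holomorphic_on_subset)
  moreover have "\<zeta> \<in> ball \<xi> e - {\<xi>}" using \<zeta> by simp
  ultimately show ?thesis using rf e' unfolding regular_norm_form_def by blast
qed

lemma eventually_off_boundary:
  assumes "\<xi> \<notin> boundary_image"
  shows "\<forall>\<^sub>F \<zeta> in at \<xi>. \<zeta> \<notin> boundary_image"
proof -
  have "fiber (Some \<xi>) \<inter> \<Gamma> = {}" using assms by (simp add: boundary_image_def)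
  from off_boundary_nearby[OF this] show ?thesis
    unfolding sphere_at_simps by eventually_elim (simp add: boundary_image_def)
qed

lemma open_\<Omega>: "open \<Omega>"
proof (subst open_subopen, rule ballI)
  fix \<xi> assume \<xi>: "\<xi> \<in> \<Omega>"
  then obtain e H where rf: "regular_norm_form \<xi> e (cnt \<xi>) H" by (auto simp: \<Omega>_def)
  have "e > 0" using rf by (simp add: regular_norm_form_def)
  hence "\<forall>\<^sub>F \<zeta> in at \<xi>. \<zeta> \<in> ball \<xi> e - {\<xi>}" by (intro eventually_at_in_open) auto
  moreover have "\<forall>\<^sub>F \<zeta> in at \<xi>. \<zeta> \<notin> boundary_image" using \<xi> by (intro eventually_off_boundary) (simp add: \<Omega>_def)
  ultimately have "\<forall>\<^sub>F \<zeta> in at \<xi>. \<zeta> \<in> \<Omega>"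
    using eventually_not_finite_at[OF finite_Z, of \<xi>]
  proof eventually_elim
    case (elim \<zeta>)
    hence "\<zeta> \<in> ball \<xi> e" "\<zeta> \<noteq> \<xi>" by auto
    from regular_norm_form_moves[OF rf this] show ?case using elim unfolding \<Omega>_def by auto
  qed
  then obtain T where T: "open T" "\<xi> \<in> T" "\<forall>\<zeta>\<in>T. \<zeta> \<noteq> \<xi> \<longrightarrow> \<zeta> \<in> \<Omega>"
    unfolding eventually_at_topological by auto
  have "\<zeta> \<in> \<Omega>" if "\<zeta> \<in> T" for \<zeta> using T(3) that \<xi> by (cases "\<zeta> = \<xi>") auto
  thus "\<exists>T. open T \<and> \<xi> \<in> T \<and> T \<subseteq> \<Omega>" using T(1,2) by (intro exI[of _ T]) auto
qed

lemma eventually_in_\<Omega>: "\<forall>\<^sub>F \<xi> in at c. \<xi> \<in> \<Omega> \<or> \<xi> \<in> boundary_image"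
proof -
  obtain A where "\<forall>\<^sub>F \<xi> in at c. fiber (Some \<xi>) \<inter> \<Gamma> = {} \<longrightarrow>
      (\<exists>e k H. local_norm_form \<xi> e k H \<and> norm (deriv H \<xi> / H \<xi>) \<le> A / norm (\<xi> - c))"
    using N_local_form by blast
  with eventually_not_finite_at[OF finite_Z, of c] show ?thesis
  proof eventually_elim
    case (elim \<xi>)
    show ?case
    proof (cases "\<xi> \<in> boundary_image")
      case False
      then obtain e k H where lf: "local_norm_form \<xi> e k H" using elim(2) by (auto simp: boundary_image_def)
      hence "cnt \<xi> = k" by (auto simp: local_norm_form_def)
      hence "regular_norm_form \<xi> e (cnt \<xi>) H" using lf unfolding local_norm_form_def regular_norm_form_def by auto
      thus ?thesis using elim(1) False by (auto simp: \<Omega>_def)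
    qed simp
  qed
qed

lemma \<Omega>_lines:
  shows "\<exists>X. countable X \<and> (\<forall>s. s \<notin> X \<longrightarrow> finite {t. Complex s t \<notin> \<Omega>})"
    and "\<exists>Y. countable Y \<and> (\<forall>t. t \<notin> Y \<longrightarrow> finite {s. Complex s t \<notin> \<Omega>})"
proof -
  define D where "D = - (\<Omega> \<union> boundary_image)"
  have "D sparse_in UNIV"
    unfolding sparse_in_eventually_iff[OF open_UNIV] D_def using eventually_in_\<Omega> by simp
  from sparse_imp_countable[OF open_UNIV this] have D: "countable D" by simp
  obtain X where X: "countable X" "\<And>s. s \<notin> X \<Longrightarrow> finite {t. Complex s t \<in> boundary_image}"
    using boundary_image_vertical by blast
  have "finite {t. Complex s t \<notin> \<Omega>}" if s: "s \<notin> X \<union> Re ` D" for s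
  proof (rule finite_subset)
    show "{t. Complex s t \<notin> \<Omega>} \<subseteq> {t. Complex s t \<in> boundary_image}"
    proof
      fix t assume "t \<in> {t. Complex s t \<notin> \<Omega>}"
      moreover have "Complex s t \<notin> D" using s image_eqI[of s Re "Complex s t" D] by auto
      ultimately show "t \<in> {t. Complex s t \<in> boundary_image}" by (auto simp: D_def)
    qed
  qed (use X(2) s in auto)
  thus "\<exists>X. countable X \<and> (\<forall>s. s \<notin> X \<longrightarrow> finite {t. Complex s t \<notin> \<Omega>})"
    using X(1) D by (intro exI[of _ "X \<union> Re ` D"]) auto
  obtain Y where Y: "countable Y" "\<And>t. t \<notin> Y \<Longrightarrow> finite {s. Complex s t \<in> boundary_image}"
    using boundary_image_horizontal by blast
  have "finite {s. Complex s t \<notin> \<Omega>}" if t: "t \<notin> Y \<union> Im ` D" for t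
  proof (rule finite_subset)
    show "{s. Complex s t \<notin> \<Omega>} \<subseteq> {s. Complex s t \<in> boundary_image}"
    proof
      fix s assume "s \<in> {s. Complex s t \<notin> \<Omega>}"
      moreover have "Complex s t \<notin> D" using t image_eqI[of t Im "Complex s t" D] by auto
      ultimately show "s \<in> {s. Complex s t \<in> boundary_image}" by (auto simp: D_def)
    qed
  qed (use Y(2) t in auto)
  thus "\<exists>Y. countable Y \<and> (\<forall>t. t \<notin> Y \<longrightarrow> finite {s. Complex s t \<notin> \<Omega>})"
    using Y(1) D by (intro exI[of _ "Y \<union> Im ` D"]) auto
qed

lemma null_compl_\<Omega>: "- \<Omega> \<in> null_sets lborel"
proof -
  obtain X where "countable X" "\<And>s. s \<notin> X \<Longrightarrow> finite {t. Complex s t \<notin> \<Omega>}" using \<Omega>_lines(1) by blast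
  thus ?thesis using open_\<Omega> by (intro null_set_of_lines[of _ X]) auto
qed

lemma F_norm: "norm (F \<zeta>) \<le> real (cnt \<zeta>) * (1 / norm (\<zeta> - w) + 1 / norm (\<zeta> - b))"
proof -
  have n: "norm (1 / (cnj \<zeta> - cnj v)) = 1 / norm (\<zeta> - v)" for v
  proof -
    have "cnj \<zeta> - cnj v = cnj (\<zeta> - v)" by simp
    thus ?thesis by (simp only: norm_divide norm_one complex_mod_cnj)
  qed
  have "norm (1 / (cnj \<zeta> - cnj w) - 1 / (cnj \<zeta> - cnj b)) \<le> 1 / norm (\<zeta> - w) + 1 / norm (\<zeta> - b)"
    using norm_triangle_ineq4[of "1 / (cnj \<zeta> - cnj w)" "1 / (cnj \<zeta> - cnj b)"] unfolding n .
  thus ?thesis unfolding F_def norm_mult norm_of_nat by (rule mult_left_mono) simp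
qed

lemma F_bounds:
  shows "\<exists>A. \<forall>\<^sub>F \<zeta> in at c. norm (F \<zeta>) \<le> A / norm (\<zeta> - c)"
    and "c \<noteq> w \<Longrightarrow> c \<noteq> b \<Longrightarrow> \<exists>A. \<forall>\<^sub>F \<zeta> in at c. norm (F \<zeta>) \<le> A"
    and "\<exists>A. \<forall>\<^sub>F \<zeta> in at_infinity. norm (F \<zeta>) \<le> A / norm \<zeta> ^ 2"
proof -
  obtain n where n: "\<forall>\<^sub>F \<zeta> in at c. cnt \<zeta> \<le> n" using counting_function_bounded[of Mp "Some c"] by auto
  have le: "norm (F \<zeta>) \<le> real n * (a1 + a2)"
    if "cnt \<zeta> \<le> n" "1 / norm (\<zeta> - w) \<le> a1" "1 / norm (\<zeta> - b) \<le> a2" for \<zeta> a1 a2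
  proof (rule order_trans[OF F_norm], rule mult_mono)
    show "1 / norm (\<zeta> - w) + 1 / norm (\<zeta> - b) \<le> a1 + a2" using that(2,3) by (rule add_mono)
  qed (use that(1) in simp_all)
  obtain A1 where A1: "\<forall>\<^sub>F \<zeta> in at c. 1 / norm (\<zeta> - w) \<le> A1 / norm (\<zeta> - c)" using kernel_bound_near(1) by blast
  obtain A2 where A2: "\<forall>\<^sub>F \<zeta> in at c. 1 / norm (\<zeta> - b) \<le> A2 / norm (\<zeta> - c)" using kernel_bound_near(1) by blast
  from n A1 A2 have "\<forall>\<^sub>F \<zeta> in at c. norm (F \<zeta>) \<le> (real n * (A1 + A2)) / norm (\<zeta> - c)"
  proof eventually_elim
    case (elim \<zeta>)
    have "real n * (A1 / norm (\<zeta> - c) + A2 / norm (\<zeta> - c)) = (real n * (A1 + A2)) / norm (\<zeta> - c)"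
      by (simp add: add_divide_distrib distrib_left)
    with le[OF elim] show ?case by simp
  qed
  thus "\<exists>A. \<forall>\<^sub>F \<zeta> in at c. norm (F \<zeta>) \<le> A / norm (\<zeta> - c)" by blast
  show "\<exists>A. \<forall>\<^sub>F \<zeta> in at c. norm (F \<zeta>) \<le> A" if c: "c \<noteq> w" "c \<noteq> b"
  proof -
    obtain A1 where A1: "\<forall>\<^sub>F \<zeta> in at c. 1 / norm (\<zeta> - w) \<le> A1" using kernel_bound_near(2)[OF c(1)] by blast
    obtain A2 where A2: "\<forall>\<^sub>F \<zeta> in at c. 1 / norm (\<zeta> - b) \<le> A2" using kernel_bound_near(2)[OF c(2)] by blast
    from n A1 A2 have "\<forall>\<^sub>F \<zeta> in at c. norm (F \<zeta>) \<le> real n * (A1 + A2)" by eventually_elim (rule le)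
    thus ?thesis by blast
  qed
  obtain m where m: "\<forall>\<^sub>F \<zeta> in at_infinity. cnt \<zeta> \<le> m" using counting_function_bounded[of Mp None] by auto
  have "\<forall>\<^sub>F \<zeta> in at_infinity. norm (\<zeta>::complex) \<ge> 2 * (norm w + norm b) + 1" unfolding eventually_at_infinity by blast
  with m have "\<forall>\<^sub>F \<zeta> in at_infinity. norm (F \<zeta>) \<le> (4 * real m * norm (w - b)) / norm \<zeta> ^ 2"
  proof eventually_elim
    case (elim \<zeta>)
    have half: "norm (\<zeta> - v) \<ge> norm \<zeta> / 2" if "v \<in> {w, b}" for v
    proof -
      have "norm \<zeta> - norm v \<le> norm (\<zeta> - v)" by (rule norm_triangle_ineq2)
      moreover have "norm v \<le> norm w + norm b" using that by auto
      ultimately have "norm \<zeta> - (norm w + norm b) \<le> norm (\<zeta> - v)" by linarith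
      moreover have "norm w + norm b \<le> (norm \<zeta> - 1) / 2" using elim(2) by simp
      ultimately show ?thesis by (simp add: field_simps)
    qed
    have "0 < 2 * (norm w + norm b) + 1" by (simp add: add_nonneg_pos)
    hence pos: "norm \<zeta> > 0" using elim(2) by (rule less_le_trans)
    have ne: "\<zeta> \<noteq> w" "\<zeta> \<noteq> b" using half[of w] half[of b] pos by auto
    have "1 / (cnj \<zeta> - cnj w) - 1 / (cnj \<zeta> - cnj b) = cnj ((w - b) / ((\<zeta> - w) * (\<zeta> - b)))"
      using ne by (simp add: field_simps)
    hence "norm (F \<zeta>) = real (cnt \<zeta>) * (norm (w - b) / (norm (\<zeta> - w) * norm (\<zeta> - b)))"
      unfolding F_def by (simp only: norm_mult norm_of_nat complex_mod_cnj norm_divide)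
    also have "\<dots> \<le> real m * (norm (w - b) / ((norm \<zeta> / 2) * (norm \<zeta> / 2)))"
      using elim(1) half[of w] half[of b] pos by (intro mult_mono frac_le mult_mono) auto
    also have "\<dots> = (4 * real m * norm (w - b)) / norm \<zeta> ^ 2" by (simp add: power2_eq_square)
    finally show ?case .
  qed
  thus "\<exists>A. \<forall>\<^sub>F \<zeta> in at_infinity. norm (F \<zeta>) \<le> A / norm \<zeta> ^ 2" by blast
qed

lemma Den_logderiv_bound: "\<exists>A. \<forall>\<^sub>F \<zeta> in at c. norm (deriv Den \<zeta> / Den \<zeta>) \<le> A / norm (\<zeta> - c)"
proof -
  have "RR v meromorphic_on {c}" for v
    using RR_holomorphic[of v UNIV] by (intro analytic_on_imp_meromorphic_on) (auto simp: analytic_on_holomorphic intro: exI[of _ UNIV])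
  hence mero: "Den meromorphic_on {c}" unfolding Den_def[abs_def] by (intro meromorphic_intros)
  have "\<forall>\<^sub>F \<zeta> in at c. Den \<zeta> \<noteq> 0"
    using eventually_not_finite_at[OF finite_Z, of c] by eventually_elim (rule Den_nonzero)
  from logderiv_bound_at_singularity[OF mero this] obtain A where
    "\<forall>\<^sub>F t in at c. Den analytic_on {t} \<and> Den t \<noteq> 0 \<and> norm ((t - c) * (deriv Den t / Den t)) \<le> A" by blast
  moreover have "\<forall>\<^sub>F t in at c. t \<noteq> c" by (simp add: eventually_at_filter)
  ultimately have "\<forall>\<^sub>F t in at c. norm (deriv Den t / Den t) \<le> A / norm (t - c)"
  proof eventually_elim
    case (elim t)
    have "norm (t - c) * norm (deriv Den t / Den t) \<le> A" using elim(1) by (simp only: norm_mult)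
    thus ?case using elim(2) by (simp add: le_divide_eq mult.commute)
  qed
  thus ?thesis by blast
qed

text \<open>
  Only \<open>cnj B ^ k\<close> is not holomorphic in the local form of \<open>exp L\<close>, so the antiholomorphic derivative of \<open>L\<close> is the density \<open>F\<close>.
\<close>
lemma norm_form_derivative:
  assumes L: "continuous_on (- {w, b}) L"
    and form: "\<And>\<xi> e k H \<zeta>. regular_norm_form \<xi> e k H \<Longrightarrow> \<zeta> \<in> ball \<xi> e - Z \<Longrightarrow> exp (L \<zeta>) = cnj (B \<zeta>) ^ k * H \<zeta> / Den \<zeta>"
    and rf: "regular_norm_form \<xi> e k H" and \<xi>: "\<xi> \<notin> Z" "cnt \<xi> = k"
  shows "(L has_derivative (\<lambda>h. (deriv H \<xi> / H \<xi> - deriv Den \<xi> / Den \<xi>) * h + F \<xi> * cnj h)) (at \<xi>)"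
proof -
  have opZ: "open (- Z)" using finite_Z by (simp add: finite_imp_closed open_Compl)
  have e: "e > 0" and H0: "H \<xi> \<noteq> 0" using rf by (auto simp: regular_norm_form_def)
  have wb: "\<xi> \<noteq> w" "\<xi> \<noteq> b" using \<xi>(1) by (auto simp: Z_def)
  have D0: "Den \<xi> \<noteq> 0" by (rule Den_nonzero[OF \<xi>(1)])
  have "open (- {w, b})" by (simp add: finite_imp_closed open_Compl)
  hence cont: "isCont L \<xi>" using L wb by (simp add: continuous_on_eq_continuous_at)
  have "open (ball \<xi> e - Z)" using finite_Z by (simp add: finite_imp_closed open_Diff)
  hence "\<forall>\<^sub>F \<zeta> in nhds \<xi>. \<zeta> \<in> ball \<xi> e - Z" using e \<xi>(1) by (intro eventually_nhds_in_open) auto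
  hence ev: "\<forall>\<^sub>F \<zeta> in nhds \<xi>. exp (L \<zeta>) = cnj (B \<zeta>) ^ k * (H \<zeta> / Den \<zeta>)"
    by eventually_elim (simp add: form[OF rf])
  have dH: "(H has_field_derivative deriv H \<xi>) (at \<xi>)"
    using rf e by (intro holomorphic_derivI[of H "ball \<xi> e"]) (auto simp: regular_norm_form_def)
  have dD: "(Den has_field_derivative deriv Den \<xi>) (at \<xi>)"
    using Den_holomorphic[of "- Z"] opZ \<xi>(1) by (intro holomorphic_derivI[of Den "- Z"]) auto
  define H2' where "H2' = (deriv H \<xi> * Den \<xi> - H \<xi> * deriv Den \<xi>) / (Den \<xi> * Den \<xi>)"
  have "((\<lambda>\<zeta>. H \<zeta> / Den \<zeta>) has_field_derivative H2') (at \<xi>)" unfolding H2'_def by (rule DERIV_divide[OF dH dD D0])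
  hence d2: "((\<lambda>\<zeta>. H \<zeta> / Den \<zeta>) has_derivative (\<lambda>h. H2' * h)) (at \<xi>)" by (simp add: has_field_derivative_def)
  define B' where "B' = ((\<xi> - b) - (\<xi> - w)) / ((\<xi> - b) * (\<xi> - b))"
  have "(B has_field_derivative B') (at \<xi>)" unfolding B_def[abs_def] B'_def
    using wb by (auto intro!: derivative_eq_intros)
  hence "(B has_derivative (\<lambda>h. B' * h)) (at \<xi>)" by (simp add: has_field_derivative_def)
  from bounded_linear.has_derivative[OF bounded_linear_cnj this]
  have "((\<lambda>\<zeta>. cnj (B \<zeta>)) has_derivative (\<lambda>h. cnj (B' * h))) (at \<xi>)" .
  from has_derivative_power[OF this, of k]
  have d1: "((\<lambda>\<zeta>. cnj (B \<zeta>) ^ k) has_derivative (\<lambda>h. of_nat k * cnj (B' * h) * cnj (B \<xi>) ^ (k - 1))) (at \<xi>)" .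
  from has_derivative_mult[OF d1 d2]
  have "((\<lambda>\<zeta>. cnj (B \<zeta>) ^ k * (H \<zeta> / Den \<zeta>)) has_derivative
     (\<lambda>h. cnj (B \<xi>) ^ k * (H2' * h) + of_nat k * cnj (B' * h) * cnj (B \<xi>) ^ (k - 1) * (H \<xi> / Den \<xi>))) (at \<xi>)" .
  from log_has_derivative[OF cont ev this]
  have "(L has_derivative (\<lambda>h. (cnj (B \<xi>) ^ k * (H2' * h) + of_nat k * cnj (B' * h) * cnj (B \<xi>) ^ (k - 1) * (H \<xi> / Den \<xi>))
      / (cnj (B \<xi>) ^ k * (H \<xi> / Den \<xi>)))) (at \<xi>)" .
  moreover have "(cnj (B \<xi>) ^ k * (H2' * h) + of_nat k * cnj (B' * h) * cnj (B \<xi>) ^ (k - 1) * (H \<xi> / Den \<xi>))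
      / (cnj (B \<xi>) ^ k * (H \<xi> / Den \<xi>)) = (deriv H \<xi> / H \<xi> - deriv Den \<xi> / Den \<xi>) * h + F \<xi> * cnj h" for h
  proof -
    have B0: "cnj (B \<xi>) \<noteq> 0" using wb by (simp add: B_def)
    have pk: "of_nat k * cnj (B \<xi>) ^ (k - 1) = of_nat k * (cnj (B \<xi>) ^ k / cnj (B \<xi>))"
      using B0 by (cases k) auto
    have quot: "cnj B' / cnj (B \<xi>) = 1 / (cnj \<xi> - cnj w) - 1 / (cnj \<xi> - cnj b)"
    proof -
      have "B' / B \<xi> = 1 / (\<xi> - w) - 1 / (\<xi> - b)" unfolding B'_def B_def using wb by (simp add: divide_simps)
      from arg_cong[OF this, of cnj] show ?thesis by simp
    qed
    have alg: "(p * (x * h) + n * (y * ch) * (p / Bc) * g) / (p * g) = x / g * h + n * (y / Bc) * ch"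
      if "p \<noteq> 0" "g \<noteq> 0" "Bc \<noteq> 0" for p x h n y ch Bc g :: complex
      using that by (simp add: field_simps)
    have "(cnj (B \<xi>) ^ k * (H2' * h) + of_nat k * cnj (B' * h) * cnj (B \<xi>) ^ (k - 1) * (H \<xi> / Den \<xi>))
        = (cnj (B \<xi>) ^ k * (H2' * h) + of_nat k * (cnj B' * cnj h) * (cnj (B \<xi>) ^ k / cnj (B \<xi>)) * (H \<xi> / Den \<xi>))"
      using arg_cong[OF pk, of "\<lambda>u. u * (cnj B' * cnj h) * (H \<xi> / Den \<xi>)"] by (simp add: mult_ac)
    hence "(cnj (B \<xi>) ^ k * (H2' * h) + of_nat k * cnj (B' * h) * cnj (B \<xi>) ^ (k - 1) * (H \<xi> / Den \<xi>))
      / (cnj (B \<xi>) ^ k * (H \<xi> / Den \<xi>)) = H2' / (H \<xi> / Den \<xi>) * h + of_nat k * (cnj B' / cnj (B \<xi>)) * cnj h"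
      using alg[of "cnj (B \<xi>) ^ k" "H \<xi> / Den \<xi>" "cnj (B \<xi>)" H2' h "of_nat k" "cnj B'" "cnj h"] B0 H0 D0 by simp
    also have "H2' / (H \<xi> / Den \<xi>) = deriv H \<xi> / H \<xi> - deriv Den \<xi> / Den \<xi>"
      unfolding H2'_def using H0 D0 by (simp add: field_simps)
    also have "of_nat k * (cnj B' / cnj (B \<xi>)) = F \<xi>" unfolding F_def quot \<xi>(2) ..
    finally show ?thesis .
  qed
  ultimately show ?thesis by (simp only:)
qed

text \<open>
  The Cauchy--Pompeiu formula for the logarithm of \<open>N / Den\<close>. The value of \<open>exp L\<close> is that of the
  local form of \<open>N\<close> at \<open>z\<close>, in which the fibre is counted with multiplicities.
\<close>
lemma cauchy_transform_of_density:
  obtains L :: "complex \<Rightarrow> complex" and l :: complex where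
    "\<And>z. fiber (Some z) \<inter> \<Gamma> = {} \<Longrightarrow> z \<notin> Z \<Longrightarrow> integrable lborel (\<lambda>x. if x \<in> \<Omega> then F x / (x - z) else 0)"
    "\<And>z. fiber (Some z) \<inter> \<Gamma> = {} \<Longrightarrow> z \<notin> Z \<Longrightarrow> (\<integral>x. (if x \<in> \<Omega> then F x / (x - z) else 0) \<partial>lborel) = pi * (l - L z)"
    "\<And>z. fiber (Some z) \<inter> \<Gamma> = {} \<Longrightarrow> z \<notin> Z \<Longrightarrow>
       exp (L z) = cnj (B z) ^ cnt z * (\<Prod>p\<in>fiber (Some z) \<inter> Mm. cnj (B_value (mero_value f (J p))) ^ ram p) / Den z"
proof -
  obtain L l where L: "continuous_on (- {w, b}) L" "(L \<longlongrightarrow> l) at_infinity"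
    "\<And>c. c \<in> {w, b} \<Longrightarrow> \<exists>A. \<forall>\<^sub>F \<zeta> in at c. norm (L \<zeta>) \<le> A / norm (\<zeta> - c)"
    "\<And>\<xi> e k H \<zeta>. regular_norm_form \<xi> e k H \<Longrightarrow> \<zeta> \<in> ball \<xi> e - Z \<Longrightarrow> exp (L \<zeta>) = cnj (B \<zeta>) ^ k * H \<zeta> / Den \<zeta>"
    using log_norm_exists by blast
  define G where "G = (\<lambda>\<xi>. (frechet_derivative L (at \<xi>) 1 - \<i> * frechet_derivative L (at \<xi>) \<i>) / 2)"
  have nd: "(L has_derivative (\<lambda>h. (deriv H \<xi> / H \<xi> - deriv Den \<xi> / Den \<xi>) * h + F \<xi> * cnj h)) (at \<xi>)"
    if rf: "regular_norm_form \<xi> e k H" and xi: "\<xi> \<notin> Z" "cnt \<xi> = k" for \<xi> e k H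
    by (rule norm_form_derivative[OF L(1) _ rf xi]) (rule L(4))
  have G_eq: "G \<xi> = deriv H \<xi> / H \<xi> - deriv Den \<xi> / Den \<xi>"
    if "regular_norm_form \<xi> e k H" "\<xi> \<notin> Z" "cnt \<xi> = k" for \<xi> e k H
  proof -
    have "frechet_derivative L (at \<xi>) = (\<lambda>h. (deriv H \<xi> / H \<xi> - deriv Den \<xi> / Den \<xi>) * h + F \<xi> * cnj h)"
      by (rule frechet_derivative_at[OF nd[OF that], symmetric])
    moreover have "((d * 1 + c * cnj 1) - \<i> * (d * \<i> + c * cnj \<i>)) / 2 = d" for c d :: complex
      by (simp add: algebra_simps)
    ultimately show ?thesis by (simp only: G_def)
  qed
  have der: "(L has_derivative (\<lambda>h. G \<xi> * h + F \<xi> * cnj h)) (at \<xi>)" if "\<xi> \<in> \<Omega>" for \<xi>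
  proof -
    have "\<xi> \<notin> Z \<and> \<xi> \<notin> boundary_image \<and> (\<exists>e H. regular_norm_form \<xi> e (cnt \<xi>) H)"
      using that unfolding \<Omega>_def by (rule CollectD)
    then obtain e H where rf: "regular_norm_form \<xi> e (cnt \<xi>) H" "\<xi> \<notin> Z" by (elim conjE exE)
    show ?thesis unfolding G_eq[OF rf refl] by (rule nd[OF rf refl])
  qed
  have bound: "\<exists>A. \<forall>\<^sub>F \<xi> in at c. \<xi> \<in> \<Omega> \<longrightarrow> norm (G \<xi>) \<le> A / norm (\<xi> - c) \<and> norm (F \<xi>) \<le> A / norm (\<xi> - c)" for c
  proof -
    obtain A1 where A1: "\<forall>\<^sub>F \<xi> in at c. fiber (Some \<xi>) \<inter> \<Gamma> = {} \<longrightarrow>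
      (\<exists>e k H. local_norm_form \<xi> e k H \<and> norm (deriv H \<xi> / H \<xi>) \<le> A1 / norm (\<xi> - c))"
      using N_local_form by blast
    obtain A2 where A2: "\<forall>\<^sub>F \<zeta> in at c. norm (deriv Den \<zeta> / Den \<zeta>) \<le> A2 / norm (\<zeta> - c)" using Den_logderiv_bound by blast
    obtain A3 where A3: "\<forall>\<^sub>F \<zeta> in at c. norm (F \<zeta>) \<le> A3 / norm (\<zeta> - c)" using F_bounds(1) by blast
    define A where "A = \<bar>A1\<bar> + \<bar>A2\<bar> + \<bar>A3\<bar>"
    from A1 A2 A3 have "\<forall>\<^sub>F \<xi> in at c. \<xi> \<in> \<Omega> \<longrightarrow> norm (G \<xi>) \<le> A / norm (\<xi> - c) \<and> norm (F \<xi>) \<le> A / norm (\<xi> - c)"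
    proof (eventually_elim, intro impI)
      case (elim \<xi>)
      assume "\<xi> \<in> \<Omega>"
      hence \<xi>: "\<xi> \<notin> Z" "fiber (Some \<xi>) \<inter> \<Gamma> = {}" unfolding \<Omega>_def boundary_image_def by blast+
      then obtain e k H where lf: "local_norm_form \<xi> e k H" "norm (deriv H \<xi> / H \<xi>) \<le> A1 / norm (\<xi> - c)"
        using elim(1) by blast
      have rf: "regular_norm_form \<xi> e k H" "cnt \<xi> = k"
        using lf(1) unfolding local_norm_form_def regular_norm_form_def by auto
      have le: "u / norm (\<xi> - c) \<le> U / norm (\<xi> - c)" if "u \<le> U" for u U using that by (intro divide_right_mono) auto
      have "norm (G \<xi>) \<le> norm (deriv H \<xi> / H \<xi>) + norm (deriv Den \<xi> / Den \<xi>)"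
        unfolding G_eq[OF rf(1) \<xi>(1) rf(2)] by (rule norm_triangle_ineq4)
      also have "\<dots> \<le> (A1 + A2) / norm (\<xi> - c)" using lf(2) elim(2) by (simp add: add_divide_distrib)
      also have "\<dots> \<le> A / norm (\<xi> - c)" by (rule le) (simp add: A_def)
      finally have "norm (G \<xi>) \<le> A / norm (\<xi> - c)" .
      moreover have "norm (F \<xi>) \<le> A / norm (\<xi> - c)"
        by (rule order_trans[OF elim(3) le]) (simp add: A_def)
      ultimately show "norm (G \<xi>) \<le> A / norm (\<xi> - c) \<and> norm (F \<xi>) \<le> A / norm (\<xi> - c)" by blast
    qed
    thus ?thesis by blast
  qed
  obtain X where X: "countable X" "\<And>s. s \<notin> X \<Longrightarrow> finite {t. Complex s t \<notin> \<Omega>}" using \<Omega>_lines(1) by blast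
  obtain Y where Y: "countable Y" "\<And>t. t \<notin> Y \<Longrightarrow> finite {s. Complex s t \<notin> \<Omega>}" using \<Omega>_lines(2) by blast
  have main: "integrable lborel (\<lambda>x. if x \<in> \<Omega> then F x / (x - z) else 0) \<and>
      (\<integral>x. (if x \<in> \<Omega> then F x / (x - z) else 0) \<partial>lborel) = pi * (l - L z) \<and>
      exp (L z) = cnj (B z) ^ cnt z * (\<Prod>p\<in>fiber (Some z) \<inter> Mm. cnj (B_value (mero_value f (J p))) ^ ram p) / Den z"
    if off: "fiber (Some z) \<inter> \<Gamma> = {}" and zZ: "z \<notin> Z" for z
  proof -
    have zwb: "z \<noteq> w" "z \<noteq> b" using zZ by (auto simp: Z_def)
    have ord0: "J p \<notin> fiber (Some w) \<and> J p \<notin> fiber (Some b)" if p: "p \<in> fiber (Some z) \<inter> Mm" for p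
    proof -
      have "J p \<in> Mp" using p by (simp add: J_Mp_iff)
      moreover have "refl_val (J p) = z" using p by (simp add: refl_val_def fiber_def)
      ultimately show ?thesis using zZ unfolding Z_def by blast
    qed
    obtain e H where rf: "regular_norm_form z e (cnt z) H"
      "H z = (\<Prod>p\<in>fiber (Some z) \<inter> Mm. cnj (B_value (mero_value f (J p))) ^ ram p)"
      using N_regular_form[OF off zwb ord0] by blast
    have e: "e > 0" using rf(1) by (simp add: regular_norm_form_def)
    have z\<Omega>: "z \<in> \<Omega>" unfolding \<Omega>_def boundary_image_def using zZ off rf(1) by blast
    have boundG: "\<exists>A. \<forall>\<^sub>F x in at z. norm (G x) \<le> A"
    proof -
      have opU: "open (ball z e - Z)" using finite_Z by (simp add: finite_imp_closed open_Diff)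
      have zU: "z \<in> ball z e - Z" using e zZ by simp
      have hH: "H holomorphic_on ball z e - Z" using rf(1) unfolding regular_norm_form_def
        by (auto intro: holomorphic_on_subset)
      have hD: "Den holomorphic_on ball z e - Z" by (rule Den_holomorphic) auto
      have "(\<lambda>x. deriv H x / H x - deriv Den x / Den x) holomorphic_on ball z e - Z"
        using rf(1) Den_nonzero opU hH hD unfolding regular_norm_form_def
        by (intro holomorphic_intros holomorphic_deriv) auto
      hence "isCont (\<lambda>x. deriv H x / H x - deriv Den x / Den x) z"
        using opU zU holomorphic_on_imp_continuous_on continuous_on_eq_continuous_at by blast
      hence "((\<lambda>x. norm (deriv H x / H x - deriv Den x / Den x)) \<longlongrightarrow> norm (deriv H z / H z - deriv Den z / Den z)) (at z)"
        by (intro tendsto_norm isContD)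
      hence "\<forall>\<^sub>F x in at z. norm (deriv H x / H x - deriv Den x / Den x) < norm (deriv H z / H z - deriv Den z / Den z) + 1"
        by (rule order_tendstoD) simp
      moreover have "\<forall>\<^sub>F x in at z. x \<in> (ball z e - Z) - {z}" using opU zU by (rule eventually_at_in_open)
      ultimately have "\<forall>\<^sub>F x in at z. norm (G x) \<le> norm (deriv H z / H z - deriv Den z / Den z) + 1"
      proof eventually_elim
        case (elim x)
        have x: "x \<in> ball z e" "x \<noteq> z" "x \<notin> Z" using elim(2) by auto
        obtain e' where "regular_norm_form x e' (cnt z) H" "cnt x = cnt z"
          using regular_norm_form_moves[OF rf(1) x(1,2)] by blast
        thus ?case using G_eq x(3) elim(1) by simp
      qed
      thus ?thesis by blast
    qed
    obtain A1 where A1: "\<forall>\<^sub>F x in at z. norm (G x) \<le> A1" using boundG by blast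
    obtain A2 where A2: "\<forall>\<^sub>F x in at z. norm (F x) \<le> A2" using F_bounds(2)[OF zwb] by blast
    from A1 A2 have "\<forall>\<^sub>F x in at z. norm (G x) \<le> max A1 A2 \<and> norm (F x) \<le> max A1 A2" by eventually_elim auto
    hence boundz: "\<exists>A. \<forall>\<^sub>F x in at z. norm (G x) \<le> A \<and> norm (F x) \<le> A" by blast
    obtain A3 where "\<forall>\<^sub>F x in at_infinity. norm (F x) \<le> A3 / norm x ^ 2" using F_bounds(3) by blast
    hence boundinf: "\<exists>A. \<forall>\<^sub>F x in at_infinity. x \<in> \<Omega> \<longrightarrow> norm (F x) \<le> A / norm x ^ 2"
      by (intro exI[of _ A3]) (auto elim: eventually_mono)
    have zS: "z \<notin> {w, b}" using zwb by simp
    have fS: "finite {w, b}" by simp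
    note cp = cauchy_pompeiu_with_exceptions[where S = "{w, b}" and L = L and \<Omega> = \<Omega> and z = z and G = G and F = F and X = X and Y = Y and l = l, OF fS L(1) open_\<Omega> z\<Omega> zS der X Y bound L(3) boundz L(2) boundinf]
    have "exp (L z) = cnj (B z) ^ cnt z * H z / Den z" by (rule L(4)[OF rf(1)]) (use e zZ in auto)
    hence "exp (L z) = cnj (B z) ^ cnt z * (\<Prod>p\<in>fiber (Some z) \<inter> Mm. cnj (B_value (mero_value f (J p))) ^ ram p) / Den z"
      unfolding rf(2) .
    thus ?thesis by (intro conjI cp)
  qed
  show ?thesis
  proof (rule that[where L = L and l = l])
    fix z assume "fiber (Some z) \<inter> \<Gamma> = {}" "z \<notin> Z"
    note m = main[OF this]
    show "integrable lborel (\<lambda>x. if x \<in> \<Omega> then F x / (x - z) else 0)" by (rule m[THEN conjunct1])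
    show "(\<integral>x. (if x \<in> \<Omega> then F x / (x - z) else 0) \<partial>lborel) = pi * (l - L z)"
      by (rule m[THEN conjunct2, THEN conjunct1])
    show "exp (L z) = cnj (B z) ^ cnt z * (\<Prod>p\<in>fiber (Some z) \<inter> Mm. cnj (B_value (mero_value f (J p))) ^ ram p) / Den z"
      by (rule m[THEN conjunct2, THEN conjunct2])
  qed
qed

end

section \<open>The exponential transform\<close>

text \<open>
  Only \<open>h\<close> is known to be Borel measurable: nothing is known about the measurability of \<open>g\<close> outside \<open>S\<close>. Completeness of Lebesgue measure makes \<open>g\<close> measurable.
\<close>
lemma integral_lebesgue_eq_lborel_off_null_set:
  fixes g h :: "complex \<Rightarrow> complex"
  assumes N: "- S \<in> null_sets lborel" and S: "open S"
    and h: "h \<in> borel_measurable borel" and eq: "\<And>x. x \<in> S \<Longrightarrow> g x = h x"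
  shows "integral\<^sup>L lebesgue g = integral\<^sup>L lborel h"
proof -
  have N': "- S \<in> null_sets lebesgue" using N by (rule null_sets_completionI)
  have hm: "h \<in> borel_measurable lebesgue" using h by (simp add: measurable_completion)
  have gm: "g \<in> borel_measurable lebesgue"
  proof (rule measurableI)
    fix A :: "complex set" assume A: "A \<in> sets borel"
    have "g -` A \<inter> - S \<in> null_sets lebesgue"
      using N' by (rule null_sets_completion_subset[rotated]) auto
    moreover have "h -` A \<inter> S \<in> sets lebesgue"
      using measurable_sets[OF hm A] S by auto
    ultimately have "(h -` A \<inter> S) \<union> (g -` A \<inter> - S) \<in> sets lebesgue" by blast
    also have "(h -` A \<inter> S) \<union> (g -` A \<inter> - S) = g -` A \<inter> space lebesgue" using eq by auto
    finally show "g -` A \<inter> space lebesgue \<in> sets lebesgue" .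
  qed simp
  have "integral\<^sup>L lebesgue g = integral\<^sup>L lebesgue h"
  proof (rule integral_cong_AE[OF gm hm])
    show "AE x in lebesgue. g x = h x" using AE_not_in[OF N'] by eventually_elim (auto simp: eq)
  qed
  also have "\<dots> = integral\<^sup>L lborel h" using h by (intro integral_completion) simp
  finally show ?thesis .
qed

context two_point_domain
begin

text \<open>
  The divisor of the cross quotient is the fibre over \<open>w\<close> minus the fibre over \<open>b\<close>, with multiplicities.
\<close>
lemma order_cross_quotient:
  shows "p \<in> fiber (Some w) \<Longrightarrow> mero_order \<A> (\<lambda>q. (f q - w) / (f q - b)) p = int (ram p)"
    and "p \<in> fiber (Some b) \<Longrightarrow> mero_order \<A> (\<lambda>q. (f q - w) / (f q - b)) p = - int (ram p)"
    and "p \<notin> fiber (Some w) \<Longrightarrow> p \<notin> fiber (Some b) \<Longrightarrow> mero_order \<A> (\<lambda>q. (f q - w) / (f q - b)) p = 0"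
proof -
  have const: "meromorphic_function \<A> (\<lambda>q. f q - c)" for c
    using f_mero by (intro meromorphic_function_ops(3) meromorphic_function_ops(1)[OF f_mero f_mero])
  have nz: "\<forall>\<^sub>F q in at p. f q - c \<noteq> 0" for c using f_avoids[of c p] by simp
  have div: "mero_order \<A> (\<lambda>q. (f q - w) / (f q - b)) p = mero_order \<A> (\<lambda>q. f q - w) p - mero_order \<A> (\<lambda>q. f q - b) p"
    by (intro mero_order_divide const nz)
  have zero: "mero_order \<A> (\<lambda>q. f q - c) p = 0" if "p \<in> fiber (Some d)" "c \<noteq> d" for c d
  proof -
    have "(f \<longlongrightarrow> d) (at p)" using that(1) mero_value_Some_iff[OF f_mero] by (simp add: fiber_def)
    hence "((\<lambda>q. f q - c) \<longlongrightarrow> d - c) (at p)" by (intro tendsto_intros)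
    thus ?thesis using that(2) by (intro mero_order_eq_0[where l = "d - c"] const) auto
  qed
  show "mero_order \<A> (\<lambda>q. (f q - w) / (f q - b)) p = int (ram p)" if "p \<in> fiber (Some w)"
    using div ram_eq(1)[OF that] zero[OF that, of b] w_neq_b by simp
  show "mero_order \<A> (\<lambda>q. (f q - w) / (f q - b)) p = - int (ram p)" if "p \<in> fiber (Some b)"
    using div ram_eq(1)[OF that] zero[OF that, of w] w_neq_b by simp
  show "mero_order \<A> (\<lambda>q. (f q - w) / (f q - b)) p = 0" if "p \<notin> fiber (Some w)" "p \<notin> fiber (Some b)"
  proof -
    define x where "x = mero_value f p"
    have x: "p \<in> fiber x" "x \<noteq> Some w" "x \<noteq> Some b" using that by (auto simp: x_def fiber_def)
    have "((\<lambda>q. B (f q)) \<longlongrightarrow> B_value x) (at p)"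
      by (rule filterlim_compose[OF B_tendsto[OF x(3)] f_filterlim_sphere[OF x(1)]])
    hence "((\<lambda>q. (f q - w) / (f q - b)) \<longlongrightarrow> B_value x) (at p)" by (simp add: B_def)
    thus ?thesis using B_value_nonzero[OF x(2,3)]
      by (intro mero_order_eq_0[where l = "B_value x"] meromorphic_function_ops(5) const)
  qed
qed

end

theorem theorem2:
  fixes \<A> :: "('a::t2_space) atlas" and J :: "'a \<Rightarrow> 'a" and Mp :: "'a set"
    and f :: "'a \<Rightarrow> complex" and z w a b :: complex
  assumes dom: "multi_sheeted_algebraic_domain \<A> J Mp f"
    and dist: "distinct [z, w, a, b]"
    and off_boundary: "Some ` {z, w, a, b} \<inter> mero_value f ` fixed_points J = {}"
    and elimination: "ext_elimination_regular \<A> f (conj_reflection J f) z (cnj w) a (cnj b)"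
    and schwarz_fin: "\<forall>u\<in>{z, w, a, b}. schwarz_finite J Mp f u"
    and schwarz_nz:
      "\<forall>u\<in>{z, a}. \<forall>v\<in>{w, b}. schwarz_power \<A> J Mp f u (cnj v) \<noteq> 0 \<and>
                                 schwarz_power \<A> J Mp f v (cnj u) \<noteq> 0"
  shows
    "ext_exp_transform (counting_function \<A> Mp f) z w a b =
       ext_elimination \<A> f (conj_reflection J f) z (cnj w) a (cnj b)
     * ((cnj z - cnj w) ^ counting_function \<A> Mp f (Some z) / schwarz_power \<A> J Mp f z (cnj w))
     * ((w - z) ^ counting_function \<A> Mp f (Some w) / cnj (schwarz_power \<A> J Mp f w (cnj z)))
     * ((cnj a - cnj b) ^ counting_function \<A> Mp f (Some a) / schwarz_power \<A> J Mp f a (cnj b))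
     * ((b - a) ^ counting_function \<A> Mp f (Some b) / cnj (schwarz_power \<A> J Mp f b (cnj a)))
     * (schwarz_power \<A> J Mp f z (cnj b) / (cnj z - cnj b) ^ counting_function \<A> Mp f (Some z))
     * (cnj (schwarz_power \<A> J Mp f w (cnj a)) / (w - a) ^ counting_function \<A> Mp f (Some w))
     * (schwarz_power \<A> J Mp f a (cnj w) / (cnj a - cnj w) ^ counting_function \<A> Mp f (Some a))
     * (cnj (schwarz_power \<A> J Mp f b (cnj z)) / (b - z) ^ counting_function \<A> Mp f (Some b))"
proof -
  interpret AD: algebraic_domain \<A> J Mp f by unfold_locales (rule dom)
  have ne: "z \<noteq> w" "z \<noteq> b" "a \<noteq> w" "a \<noteq> b" "z \<noteq> a" "w \<noteq> b" using dist by auto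
  interpret W: two_point_domain \<A> J Mp f w b by unfold_locales (rule ne(6))
  interpret ZA: two_point_domain \<A> J Mp f z a by unfold_locales (rule ne(5))
  have off: "AD.fiber (Some u) \<inter> fixed_points J = {}" if "u \<in> {z, w, a, b}" for u
    using off_boundary that unfolding AD.fiber_def by force
  have fin: "mero_value f (J q) \<noteq> None" if "u \<in> {z, w, a, b}" "q \<in> Mp" "q \<in> AD.fiber (Some u)" for u q
    using schwarz_fin that unfolding schwarz_finite_def AD.fiber_def AD.mero_value_fs by auto
  interpret R: regular_two_point_domain \<A> J Mp f w b
  proof unfold_locales
    show "AD.fiber (Some w) \<inter> fixed_points J = {}" "AD.fiber (Some b) \<inter> fixed_points J = {}"
      by (rule off, simp)+
    show "mero_value f (J q) \<noteq> None" if "q \<in> Mp" "q \<in> AD.fiber (Some w) \<union> AD.fiber (Some b)" for q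
      using fin[of w q] fin[of b q] that by auto
  qed
  define n where "n = (\<lambda>c. counting_function \<A> Mp f (Some c))"
  define SP where "SP = (\<lambda>u v. schwarz_power \<A> J Mp f u (cnj v))"
  define PM where "PM = (\<lambda>u. \<Prod>p\<in>AD.fiber (Some u) \<inter> J ` Mp. cnj (W.B_value (mero_value f (J p))) ^ AD.ram p)"
  have SPnz: "SP u v \<noteq> 0" "SP v u \<noteq> 0" if "u \<in> {z, a}" "v \<in> {w, b}" for u v
    using schwarz_nz that unfolding SP_def by blast+

  define F where "F = (\<lambda>p. (f p - z) / (f p - a))"
  have D: "divisor_of \<A> F p = (if p \<in> AD.fiber (Some z) then int (AD.ram p)
      else if p \<in> AD.fiber (Some a) then - int (AD.ram p) else 0)" for p
    unfolding divisor_of_def F_def using ZA.order_cross_quotient[of p] by simp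
  have Dsupp: "{p. divisor_of \<A> F p \<noteq> 0} = AD.fiber (Some z) \<union> AD.fiber (Some a)"
    using AD.ram_eq(2) by (auto simp: D)
  \<comment> \<open>Regularity of the elimination function: no zero or pole of \<open>f\<^sup>*\<close>'s cross quotient lies over \<open>z\<close> or \<open>a\<close>.\<close>
  have no_w_b: "J p \<notin> AD.fiber (Some w) \<and> J p \<notin> AD.fiber (Some b)"
    if p: "p \<in> AD.fiber (Some z) \<union> AD.fiber (Some a)" for p
  proof -
    have "divisor_of \<A> F p \<noteq> 0" using p Dsupp by blast
    hence v: "mero_value W.Bst p \<noteq> None" "mero_value W.Bst p \<noteq> Some 0"
      using elimination unfolding ext_elimination_regular_def resultant_regular_def F_def W.Bst_def[abs_def] by blast+
    then obtain l where "mero_value W.Bst p = Some l" "l \<noteq> 0" by auto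
    hence "W.ord_Bst p = 0" unfolding W.ord_Bst_def
      by (intro AD.mero_order_eq_0[OF W.Bst_mero]) (auto simp: AD.mero_value_Some_iff[OF W.Bst_mero])
    thus ?thesis using W.ord_Bst(1)[of p] W.ord_Bst(2)[of p] AD.ram_eq(2)[of "J p"] by force
  qed
  have Bval: "the (mero_value W.Bst p) = cnj (W.B_value (mero_value f (J p)))"
    and Bval_nz: "cnj (W.B_value (mero_value f (J p))) \<noteq> 0"
    if p: "p \<in> AD.fiber (Some z) \<union> AD.fiber (Some a)" for p
  proof -
    have x: "mero_value f (J p) \<noteq> Some w" "mero_value f (J p) \<noteq> Some b"
      using no_w_b[OF p] by (auto simp: AD.fiber_def)
    have "(W.Bst \<longlongrightarrow> cnj (W.B_value (mero_value f (J p)))) (at p)"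
      using x by (intro W.Bst_tendsto) (auto simp: AD.fiber_def)
    thus "the (mero_value W.Bst p) = cnj (W.B_value (mero_value f (J p)))" by (simp add: AD.mero_valueI)
    show "cnj (W.B_value (mero_value f (J p))) \<noteq> 0" using W.B_value_nonzero[OF x] by simp
  qed
  have notZ: "u \<notin> R.Z" if u: "u \<in> {z, a}" for u
  proof
    assume "u \<in> R.Z"
    moreover have "u \<notin> {w, b}" using u ne by auto
    ultimately obtain q where q: "q \<in> AD.fiber (Some w) \<union> AD.fiber (Some b)" "q \<in> Mp" "u = R.refl_val q"
      unfolding R.Z_def by blast
    have "mero_value f (J q) \<noteq> None" using fin[of w q] fin[of b q] q by auto
    hence "J q \<in> AD.fiber (Some u)" using q(3) by (auto simp: R.refl_val_def AD.fiber_def)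
    hence "J q \<in> AD.fiber (Some z) \<union> AD.fiber (Some a)" using u by auto
    from no_w_b[OF this] show False using q(1) by simp
  qed
  have PMnz: "PM u \<noteq> 0" if "u \<in> {z, a}" for u
  proof -
    have "cnj (W.B_value (mero_value f (J p))) \<noteq> 0" if "p \<in> AD.fiber (Some u) \<inter> J ` Mp" for p
      using \<open>u \<in> {z, a}\<close> that by (intro Bval_nz) auto
    thus ?thesis unfolding PM_def using AD.finite_fiber by (auto simp: prod_zero_iff)
  qed

  \<comment> \<open>Only the sheets in \<open>M\<^sub>+\<close> produce Schwarz powers; the factor \<open>PM u\<close> of the sheets in \<open>M\<^sub>-\<close>
     is the same as in the value of \<open>exp (L u)\<close> and cancels at the end.\<close>
  have norm_fiber: "(\<Prod>p\<in>AD.fiber (Some u). the (mero_value W.Bst p) ^ AD.ram p) = SP u w / SP u b * PM u"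
    if u: "u \<in> {z, a}" for u
  proof -
    have uu: "AD.fiber (Some u) \<subseteq> AD.fiber (Some z) \<union> AD.fiber (Some a)" using u by auto
    have split: "AD.fiber (Some u) = (AD.fiber (Some u) \<inter> Mp) \<union> (AD.fiber (Some u) \<inter> J ` Mp)"
      using off[of u] u AD.domain_partition(6) by blast
    have "(\<Prod>p\<in>AD.fiber (Some u). the (mero_value W.Bst p) ^ AD.ram p)
        = (\<Prod>p\<in>AD.fiber (Some u) \<inter> Mp. the (mero_value W.Bst p) ^ AD.ram p)
        * (\<Prod>p\<in>AD.fiber (Some u) \<inter> J ` Mp. the (mero_value W.Bst p) ^ AD.ram p)"
      by (subst split, rule prod.union_disjoint) (use AD.finite_fiber AD.domain_partition(3) in auto)
    also have "(\<Prod>p\<in>AD.fiber (Some u) \<inter> J ` Mp. the (mero_value W.Bst p) ^ AD.ram p) = PM u"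
      unfolding PM_def using Bval uu by (intro prod.cong) auto
    also have "(\<Prod>p\<in>AD.fiber (Some u) \<inter> Mp. the (mero_value W.Bst p) ^ AD.ram p)
        = (\<Prod>p\<in>AD.fiber (Some u) \<inter> Mp. (the (mero_value (conj_reflection J f) p) - cnj w) ^ AD.ram p /
             (the (mero_value (conj_reflection J f) p) - cnj b) ^ AD.ram p)"
    proof (rule prod.cong[OF refl])
      fix p assume p: "p \<in> AD.fiber (Some u) \<inter> Mp"
      obtain v where v: "mero_value f (J p) = Some v" using fin[of u p] u p by auto
      have "the (mero_value W.Bst p) = (cnj v - cnj w) / (cnj v - cnj b)"
        using Bval[of p] p uu v by (auto simp: W.B_value_def W.B_def)
      thus "the (mero_value W.Bst p) ^ AD.ram p = (the (mero_value (conj_reflection J f) p) - cnj w) ^ AD.ram p /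
             (the (mero_value (conj_reflection J f) p) - cnj b) ^ AD.ram p"
        by (simp add: AD.mero_value_fs v power_divide)
    qed
    also have "\<dots> = SP u w / SP u b"
    proof -
      have "{\<zeta>. \<zeta> \<in> Mp \<and> mero_value f \<zeta> = Some u} = AD.fiber (Some u) \<inter> Mp" by (auto simp: AD.fiber_def)
      thus ?thesis unfolding SP_def schwarz_power_def by (simp add: prod_dividef)
    qed
    finally show ?thesis .
  qed
  have elim: "ext_elimination \<A> f (conj_reflection J f) z (cnj w) a (cnj b) = (SP z w / SP z b * PM z) / (SP a w / SP a b * PM a)"
  proof -
    have "ext_elimination \<A> f (conj_reflection J f) z (cnj w) a (cnj b)
        = (\<Prod>p\<in>AD.fiber (Some z) \<union> AD.fiber (Some a). the (mero_value W.Bst p) powi divisor_of \<A> F p)"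
      unfolding ext_elimination_def mero_resultant_def eval_divisor_def F_def[symmetric] Dsupp W.Bst_def[abs_def] ..
    also have "\<dots> = (\<Prod>p\<in>AD.fiber (Some z). the (mero_value W.Bst p) powi divisor_of \<A> F p)
        * (\<Prod>p\<in>AD.fiber (Some a). the (mero_value W.Bst p) powi divisor_of \<A> F p)"
      by (rule prod.union_disjoint) (use AD.finite_fiber ne in \<open>auto simp: AD.fiber_def\<close>)
    also have "(\<Prod>p\<in>AD.fiber (Some z). the (mero_value W.Bst p) powi divisor_of \<A> F p)
        = (\<Prod>p\<in>AD.fiber (Some z). the (mero_value W.Bst p) ^ AD.ram p)"
      by (intro prod.cong) (auto simp: D)
    also have "(\<Prod>p\<in>AD.fiber (Some a). the (mero_value W.Bst p) powi divisor_of \<A> F p)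
        = (\<Prod>p\<in>AD.fiber (Some a). inverse (the (mero_value W.Bst p) ^ AD.ram p))"
    proof (rule prod.cong[OF refl])
      fix p assume p: "p \<in> AD.fiber (Some a)"
      hence "p \<notin> AD.fiber (Some z)" using ne by (auto simp: AD.fiber_def)
      thus "the (mero_value W.Bst p) powi divisor_of \<A> F p = inverse (the (mero_value W.Bst p) ^ AD.ram p)"
        using p by (simp add: D power_int_minus)
    qed
    also have "\<dots> = inverse (\<Prod>p\<in>AD.fiber (Some a). the (mero_value W.Bst p) ^ AD.ram p)"
      by (rule prod_inversef[unfolded o_def])
    finally show ?thesis using norm_fiber[of z] norm_fiber[of a] by (simp add: divide_inverse)
  qed

  \<comment> \<open>The two kernels in the transform share the antiholomorphic factor, so its exponent is the difference
     at \<open>z\<close> and \<open>a\<close> of one Cauchy transform; the unknown constant \<open>l\<close> drops out.\<close>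
  obtain L :: "complex \<Rightarrow> complex" and l :: complex where L:
    "\<And>u. AD.fiber (Some u) \<inter> fixed_points J = {} \<Longrightarrow> u \<notin> R.Z \<Longrightarrow>
       integrable lborel (\<lambda>x. if x \<in> R.\<Omega> then R.F x / (x - u) else 0)"
    "\<And>u. AD.fiber (Some u) \<inter> fixed_points J = {} \<Longrightarrow> u \<notin> R.Z \<Longrightarrow>
       (\<integral>x. (if x \<in> R.\<Omega> then R.F x / (x - u) else 0) \<partial>lborel) = pi * (l - L u)"
    "\<And>u. AD.fiber (Some u) \<inter> fixed_points J = {} \<Longrightarrow> u \<notin> R.Z \<Longrightarrow>
       exp (L u) = cnj (W.B u) ^ counting_function \<A> Mp f (Some u) *
         (\<Prod>p\<in>AD.fiber (Some u) \<inter> J ` Mp. cnj (W.B_value (mero_value f (J p))) ^ AD.ram p) / R.Den u"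
  proof (rule R.cauchy_transform_of_density, goal_cases)
    case (1 L l)
    show ?case by (rule 1(1)[of l L], fact 1(2), fact 1(3), fact 1(4))
  qed
  have uz: "AD.fiber (Some z) \<inter> fixed_points J = {}" "z \<notin> R.Z" and ua: "AD.fiber (Some a) \<inter> fixed_points J = {}" "a \<notin> R.Z"
    using off[of z] off[of a] notZ[of z] notZ[of a] by auto
  define hz where "hz = (\<lambda>x. if x \<in> R.\<Omega> then R.F x / (x - z) else 0)"
  define ha where "ha = (\<lambda>x. if x \<in> R.\<Omega> then R.F x / (x - a) else 0)"
  have iz: "integrable lborel hz" "integral\<^sup>L lborel hz = pi * (l - L z)"
    and ia: "integrable lborel ha" "integral\<^sup>L lborel ha = pi * (l - L a)"
    unfolding hz_def ha_def using L(1,2)[OF uz] L(1,2)[OF ua] by blast+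
  have "(LINT \<zeta>|lebesgue. of_nat (counting_function \<A> Mp f (Some \<zeta>)) *
          (1 / (\<zeta> - z) - 1 / (\<zeta> - a)) * (1 / (cnj \<zeta> - cnj w) - 1 / (cnj \<zeta> - cnj b)) * (- 2 * \<i>))
      = (LINT \<zeta>|lborel. (hz \<zeta> - ha \<zeta>) * (- 2 * \<i>))"
  proof (rule integral_lebesgue_eq_lborel_off_null_set[OF R.null_compl_\<Omega> R.open_\<Omega>])
    show "(\<lambda>\<zeta>. (hz \<zeta> - ha \<zeta>) * (- 2 * \<i>)) \<in> borel_measurable borel"
      using borel_measurable_integrable[OF iz(1)] borel_measurable_integrable[OF ia(1)] by simp
  qed (simp add: hz_def ha_def R.F_def algebra_simps diff_divide_distrib)
  also have "\<dots> = (pi * (l - L z) - pi * (l - L a)) * (- 2 * \<i>)"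
    using iz ia by (simp add: Bochner_Integration.integral_diff)
  also have "\<dots> = (2 * of_real pi * \<i>) * (L z - L a)" by (simp add: algebra_simps)
  finally have "ext_exp_transform (counting_function \<A> Mp f) z w a b = exp (1 / (2 * of_real pi * \<i>) * ((2 * of_real pi * \<i>) * (L z - L a)))"
    unfolding ext_exp_transform_def by (simp only:)
  also have "\<dots> = exp (L z) / exp (L a)" by (simp add: exp_diff)
  finally have E: "ext_exp_transform (counting_function \<A> Mp f) z w a b = exp (L z) / exp (L a)" .
  \<comment> \<open>The zeros and poles collected in \<open>Den\<close> are those that give the conjugated Schwarz powers at \<open>w\<close> and \<open>b\<close>.\<close>
  have eL: "exp (L u) = ((cnj u - cnj w) ^ n u / (cnj u - cnj b) ^ n u) * PM u /
      ((cnj (SP w u) / (w - u) ^ n w) / (cnj (SP b u) / (b - u) ^ n b))"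
    if u: "AD.fiber (Some u) \<inter> fixed_points J = {}" "u \<notin> R.Z" for u
  proof -
    have RR: "R.RR v u = cnj (SP v u)" if v: "v \<in> {w, b}" for v
    proof -
      have set: "{\<zeta>. \<zeta> \<in> Mp \<and> mero_value f \<zeta> = Some v} = AD.fiber (Some v) \<inter> Mp" by (auto simp: AD.fiber_def)
      have "cnj (SP v u) = (\<Prod>\<zeta>\<in>AD.fiber (Some v) \<inter> Mp. cnj ((the (mero_value (conj_reflection J f) \<zeta>) - cnj u) ^ AD.ram \<zeta>))"
        unfolding SP_def schwarz_power_def set by (rule cnj_prod)
      also have "\<dots> = R.RR v u" unfolding R.RR_def
      proof (rule prod.cong[OF refl])
        fix q assume q: "q \<in> AD.fiber (Some v) \<inter> Mp"
        obtain y where "mero_value f (J q) = Some y" using fin[of v q] v q by auto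
        thus "cnj ((the (mero_value (conj_reflection J f) q) - cnj u) ^ AD.ram q) = (R.refl_val q - u) ^ AD.ram q"
          by (simp add: AD.mero_value_fs R.refl_val_def)
      qed
      finally show ?thesis by simp
    qed
    have RRw: "R.RR w u = cnj (SP w u)" and RRb: "R.RR b u = cnj (SP b u)" by (rule RR, simp)+
    show ?thesis unfolding L(3)[OF u] R.Den_def RRw RRb PM_def n_def W.B_def by (simp add: power_divide)
  qed
  have alg: "(x1 / x2 * Pz / ((r1 / v1) / (r2 / v2))) / (y1 / y2 * Pa / ((t1 / u1) / (t2 / u2)))
      = (s1 / s2 * Pz) / (s3 / s4 * Pa) * (x1 / s1) * (v1 / r1) * (y2 / s4) * (u2 / t2) * (s2 / x2) * (t1 / u1) * (s3 / y1) * (r2 / v2)"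
    if "x1 \<noteq> 0" "x2 \<noteq> 0" "y1 \<noteq> 0" "y2 \<noteq> 0" "s1 \<noteq> 0" "s2 \<noteq> 0" "s3 \<noteq> 0" "s4 \<noteq> 0" "Pa \<noteq> 0"
      "r1 \<noteq> 0" "r2 \<noteq> 0" "t1 \<noteq> 0" "t2 \<noteq> 0" "v1 \<noteq> 0" "v2 \<noteq> 0" "u1 \<noteq> 0" "u2 \<noteq> 0"
    for x1 x2 Pz r1 v1 r2 v2 y1 y2 Pa t1 u1 t2 u2 s1 s2 s3 s4 :: complex
    using that by (simp add: divide_simps)
  have n_app: "counting_function \<A> Mp f (Some c) = n c" for c by (simp add: n_def)
  have SP_app: "schwarz_power \<A> J Mp f u (cnj v) = SP u v" for u v by (simp add: SP_def)
  show ?thesis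
    unfolding E elim eL[OF uz] eL[OF ua] n_app SP_app
    by (rule alg) (use ne SPnz PMnz in \<open>simp_all\<close>)
qed

end
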